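(* Let $(B_i)_{i\in Q_0}\in\bigoplus_{i\in Q_0}\mathrm{Herm}(V_i)$ be a tuple of Hermitian operators, and let $a_{i,1}\leq\ldots\leq a_{i,d_i}$ be the eigenvalues of $B_i$ (with multiplicity) for each $i\in Q_0$. Then $(B_i)_i$ belongs to the image of $\mu_Q:R_{\mathbf d}(Q)\to\bigoplus_i\mathrm{Herm}(V_i)$ if and only if $$\sum_{i\in Q_0}\sum_{k=1}^{d_i}a_{i,k}=0\quad\text{and}\quad a_{\mathbf K}:=\sum_{i\in Q_0}\sum_{k\in K_i}a_{i,k}\geq 0\ \text{ for all }\mathbf K\in\hat S(\mathbf d).$$
   Context: $Q$ is a finite quiver with vertex set $Q_0$ and finitely many arrows $\alpha:i\to j$ (loops and multiple arrows allowed). $\mathbf d=(d_i)_{i\in Q_0}\in\mathbb N Q_0$ is a dimension vector, and $V_i$ is a complex vector space of dimension $d_i$ equipped with a Hermitian inner product. $R_{\mathbf d}(Q)=\bigoplus_{\alpha:i\to j}\mathrm{Hom}_{\mathbb C}(V_i,V_j)$, and the momentum map $\mu_Q:R_{\mathbf d}(Q)\to\bigoplus_{i\in Q_0}\mathrm{Herm}(V_i)$ is $$\mu_Q((f_\alpha)_\alpha)_i=\sum_{\alpha:j\to i}f_\alpha\circ f_\alpha^*-\sum_{\alpha:i\to j}f_\alpha^*\circ f_\alpha,$$ adjoints taken with respect to the Hermitian forms (a loop at $i$ contributes to both sums). For a tuple $\mathbf K=(K_i)_{i\in Q_0}$ of finite sets, its weight is $|\mathbf K|=(|K_i|)_i\in\mathbb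 NQ_0$; for $\mathbf e\in\mathbb NQ_0$ put $[\mathbf e]=(\{1,\ldots,e_i\})_i$. If $\mathbf K\subset[\mathbf d]$ (i.e. $K_i\subset\{1,\dots,d_i\}$ for all $i$) and $\mathbf L\subset[|\mathbf K|]$, write $K_i=\{k_{i,1}<\ldots<k_{i,|K_i|}\}$ and define the height $\mathrm{ht}(\mathbf K,\mathbf L)=\sum_{i\in Q_0}\sum_{j\in L_i}(k_{i,j}-j)$. The sets $\hat S(\mathbf e)$ (for $\mathbf e\in\mathbb NQ_0$) are defined recursively: a tuple $\mathbf K\subset[\mathbf e]$ belongs to $\hat S(\mathbf e)$ if and only if $$\mathrm{ht}(\mathbf K,\mathbf L)\geq\sum_{\alpha:i\to j}|L_i|\,(e_j-|K_j|)\quad\text{for all }\mathbf L\in\hat S(|\mathbf K|).$$ (For $\mathbf K=[\mathbf e]$ both sides are $0$, so $[\mathbf e]\in\hat S(\mathbf e)$; for $\mathbf K\neq[\mathbf e]$ the recursion refers only to $\hat S$ of strictly smaller dimension vectors, so the definition is well-founded.) *)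

theory Defs
  imports Main "Jordan_Normal_Form.Schur_Decomposition" "Jordan_Normal_Form.Char_Poly"
begin

text \<open>A quiver: vertices are the elements of a finite type 'v; the arrows are the
entries of a list of (source, target) pairs (loops and multiple arrows allowed).
The space V_i is C^(d i) with its standard Hermitian inner product; a representation
assigns to the k-th arrow (i,j) a (d j) x (d i) complex matrix.\<close>

type_synonym 'v quiver = "('v \<times> 'v) list"

definition is_rep :: "'v quiver \<Rightarrow> ('v \<Rightarrow> nat) \<Rightarrow> (nat \<Rightarrow> complex mat) \<Rightarrow> bool" where
  "is_rep Q d f \<longleftrightarrow> (\<forall>k < length Q. f k \<in> carrier_mat (d (snd (Q ! k))) (d (fst (Q ! k))))"

definition hermitian_mat :: "nat \<Rightarrow> complex mat \<Rightarrow> bool" where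
  "hermitian_mat n B \<longleftrightarrow> B \<in> carrier_mat n n \<and> mat_adjoint B = B"

definition momentum :: "'v quiver \<Rightarrow> ('v \<Rightarrow> nat) \<Rightarrow> (nat \<Rightarrow> complex mat) \<Rightarrow> 'v \<Rightarrow> complex mat" where
  "momentum Q d f i = mat (d i) (d i) (\<lambda>(r, c).
      (\<Sum>k \<in> {k. k < length Q \<and> snd (Q ! k) = i}. (f k * mat_adjoint (f k)) $$ (r, c))
    - (\<Sum>k \<in> {k. k < length Q \<and> fst (Q ! k) = i}. (mat_adjoint (f k) * f k) $$ (r, c)))"

definition box :: "('v \<Rightarrow> nat) \<Rightarrow> ('v \<Rightarrow> nat set)" where
  "box e = (\<lambda>i. {1..e i})"

definition weight :: "('v \<Rightarrow> nat set) \<Rightarrow> ('v \<Rightarrow> nat)" where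
  "weight K = (\<lambda>i. card (K i))"

definition sub_box :: "('v \<Rightarrow> nat set) \<Rightarrow> ('v \<Rightarrow> nat) \<Rightarrow> bool" where
  "sub_box K e \<longleftrightarrow> (\<forall>i. K i \<subseteq> {1..e i})"

definition ht :: "('v::finite \<Rightarrow> nat set) \<Rightarrow> ('v \<Rightarrow> nat set) \<Rightarrow> int" where
  "ht K L = (\<Sum>i\<in>UNIV. \<Sum>j\<in>L i. int (sorted_list_of_set (K i) ! (j - 1)) - int j)"

definition arrow_rhs :: "'v quiver \<Rightarrow> ('v \<Rightarrow> nat) \<Rightarrow> ('v \<Rightarrow> nat set) \<Rightarrow> ('v \<Rightarrow> nat set) \<Rightarrow> int" where
  "arrow_rhs Q e K L = (\<Sum>k<length Q. int (card (L (fst (Q ! k)))) * (int (e (snd (Q ! k))) - int (card (K (snd (Q ! k))))))"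

lemma sub_box_card_le:
  assumes "sub_box K e" shows "card (K i) \<le> e i"
  using assms unfolding sub_box_def
  by (metis card_atLeastAtMost card_mono diff_Suc_1 finite_atLeastAtMost)

lemma sub_box_neq_lt:
  fixes K :: "'v::finite \<Rightarrow> nat set"
  assumes "sub_box K e" "K \<noteq> box e"
  shows "(\<Sum>i\<in>UNIV. card (K i)) < (\<Sum>i\<in>UNIV. e i)"
proof -
  obtain i where i: "K i \<noteq> {1..e i}" using assms(2) unfolding box_def by (meson ext)
  have sub: "K i \<subseteq> {1..e i}" using assms(1) unfolding sub_box_def by auto
  have "card (K i) < card {1..e i}"
    using sub i by (meson finite_atLeastAtMost psubsetI psubset_card_mono)
  hence lt: "card (K i) < e i" by simp
  show ?thesis
    by (rule sum_strict_mono_ex1) (use sub_box_card_le[OF assms(1)] lt in auto)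
qed

function in_Shat :: "'v::finite quiver \<Rightarrow> ('v \<Rightarrow> nat) \<Rightarrow> ('v \<Rightarrow> nat set) \<Rightarrow> bool" where
  "in_Shat Q e K =
     (if sub_box K e \<and> K \<noteq> box e then
        (\<forall>L. in_Shat Q (weight K) L \<longrightarrow> ht K L \<ge> arrow_rhs Q e K L)
      else K = box e)"
  by auto
termination
  by (relation "measure (\<lambda>(Q, e, K). \<Sum>i\<in>UNIV. e i)")
     (auto simp: weight_def intro: sub_box_neq_lt)

definition Shat :: "'v::finite quiver \<Rightarrow> ('v \<Rightarrow> nat) \<Rightarrow> ('v \<Rightarrow> nat set) set" where
  "Shat Q e = {K. in_Shat Q e K}"

end

theory Submission
  imports Defs "HOL-Analysis.Analysis" "HOL-Computational_Algebra.Computational_Algebra"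
begin

text \<open>Put a basis vector \<open>(i, k)\<close> for every vertex \<open>i\<close> and every \<open>1 \<le> k \<le> d i\<close>, so that a tuple \<open>\<^bold>K\<close>
  becomes a subset \<open>K\<close> of the set \<open>E\<close> of these indices, and reduce by unitary conjugation to \<open>B = diag a\<close>.

  Necessity. If \<open>K\<close> lies in the recursive set, then every representation has a subrepresentation in
  the Schubert variety of \<open>K\<close>; the trace of \<open>\<mu>(f)\<close> over a subrepresentation is nonnegative, which
  gives \<open>a\<^sub>K \<ge> 0\<close>. The existence of such subrepresentations is Belkale's induction: for a generic
  representation the recursive inequalities force a flagged \<open>Ext\<close> group to vanish, because the image of
  a generic flagged homomorphism would otherwise violate one of them. Tangent vectors are derivations of
  the complex numbers applied to the entries of a representation with algebraically independent entries,
  and the passage from this generic representation to all others uses a place of the complex numbers.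

  Sufficiency. Let \<open>f\<close> minimise \<open>|\<mu>(f) - diag a|\<^sup>2\<close>. Criticality makes \<open>X = \<mu>(f) - diag a\<close> commute
  with \<open>f\<close> and with \<open>diag a\<close>. If \<open>X \<noteq> 0\<close>, the indices \<open>K\<close> of its largest eigenvalue satisfy \<open>a\<^sub>K < 0\<close>, hence
  \<open>K\<close> is not in the recursive set, and the flagged \<open>Ext\<close> group from \<open>f\<close> on \<open>K\<close> to \<open>f\<close> on the
  complement is nonzero. An element of its dual is a direction in which the second variation is
  negative.\<close>

section \<open>Ring homomorphisms from subrings of the complex numbers\<close>

text \<open>Two facts of algebraic geometry carry the necessity half, and both are drawn from the
  field of complex numbers. Generic smoothness: an identity between numbers may be differentiated by
  any derivation, and derivations take arbitrary values on algebraically independent numbers, so an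
  identity at one generic point yields all tangent vectors. Properness of flag varieties: along a
  place a vector can be rescaled to have nonzero residue, so subrepresentations have limits. The
  recursive inequalities compare dimensions: the height is the number of free entries of a flagged
  homomorphism, the arrow sum the number of equations imposed on it. The sufficiency half meets two
  obstacles. For quivers with oriented cycles \<mu> is not proper, so the infimum might not be
  attained; a penalty proportional to the squared norm of f is added, and removed by a bound
  independent of its weight. And the dual Ext class changes \<mu> in first order, which spoils the
  second variation; it is corrected by an infinitesimal unitary rotation, whose generator arises by
  dividing by differences of eigenvalues of diag a.\<close>

text \<open>A homomorphism from a subring of the complex numbers into \<open>'r\<close> is represented by its graph,
  a subring of the product ring that is the graph of a function.\<close>

definition phom :: "(complex \<times> 'r::comm_ring_1) set \<Rightarrow> bool" where
  "phom \<Gamma> \<longleftrightarrow> (1,1) \<in> \<Gamma> \<and> (\<forall>x u y v. (x,u) \<in> \<Gamma> \<longrightarrow> (y,v) \<in> \<Gamma> \<longrightarrow> (x-y,u-v) \<in> \<Gamma> \<and> (x * y,u * v) \<in> \<Gamma>)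
     \<and> (\<forall>u. (0,u) \<in> \<Gamma> \<longrightarrow> u = 0)"

definition hpoly :: "(complex \<times> 'r::comm_ring_1) set \<Rightarrow> (complex poly \<times> 'r poly) set" where
  "hpoly \<Gamma> = {(p,q). \<forall>i. (coeff p i, coeff q i) \<in> \<Gamma>}"

text \<open>The candidate graph of the extension that adjoins \<open>z\<close> and sends it to
  \<open>w\<close>. It is a function exactly when every relation of \<open>z\<close> over the domain
  is carried to a relation of \<open>w\<close>, which is the hypothesis of
  \<open>pext_phom\<close>.\<close>

definition pext :: "(complex \<times> 'r::comm_ring_1) set \<Rightarrow> complex \<Rightarrow> 'r \<Rightarrow> (complex \<times> 'r) set" where
  "pext \<Gamma> z w = (\<lambda>(p,q). (poly p z, poly q w)) ` hpoly \<Gamma>"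

context
  fixes \<Gamma> :: "(complex \<times> 'r::comm_ring_1) set"
  assumes ph: "phom \<Gamma>"
begin

lemma phom_one: "(1,1) \<in> \<Gamma>" using ph by (auto simp: phom_def)
lemma phom_diff: "(x,u) \<in> \<Gamma> \<Longrightarrow> (y,v) \<in> \<Gamma> \<Longrightarrow> (x-y,u-v) \<in> \<Gamma>" using ph by (auto simp: phom_def)
lemma phom_mult: "(x,u) \<in> \<Gamma> \<Longrightarrow> (y,v) \<in> \<Gamma> \<Longrightarrow> (x * y,u * v) \<in> \<Gamma>" using ph by (auto simp: phom_def)
lemma phom_0D: "(0,u) \<in> \<Gamma> \<Longrightarrow> u = 0" using ph by (auto simp: phom_def)
lemma phom_zero: "(0,0) \<in> \<Gamma>" using phom_diff[OF phom_one phom_one] by simp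
lemma phom_uminus: "(x,u) \<in> \<Gamma> \<Longrightarrow> (-x,-u) \<in> \<Gamma>" using phom_diff[OF phom_zero] by fastforce
lemma phom_add: "(x,u) \<in> \<Gamma> \<Longrightarrow> (y,v) \<in> \<Gamma> \<Longrightarrow> (x+y,u+v) \<in> \<Gamma>"
  using phom_diff[OF _ phom_uminus, of x u y v] by simp
lemma phom_unique: "(x,u) \<in> \<Gamma> \<Longrightarrow> (x,v) \<in> \<Gamma> \<Longrightarrow> u = v"
  using phom_diff[of x u x v] phom_0D[of "u - v"] by simp
lemma phom_sum: "(\<And>i. i \<in> A \<Longrightarrow> (x i, u i) \<in> \<Gamma>) \<Longrightarrow> (sum x A, sum u A) \<in> \<Gamma>"
  by (induction A rule: infinite_finite_induct) (auto intro: phom_zero phom_add)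
lemma phom_of_nat: "(of_nat n, of_nat n) \<in> \<Gamma>"
  by (induction n) (auto intro: phom_zero phom_one phom_add)

lemma hpoly_diff: "(p,q) \<in> hpoly \<Gamma> \<Longrightarrow> (p',q') \<in> hpoly \<Gamma> \<Longrightarrow> (p-p',q-q') \<in> hpoly \<Gamma>"
  by (auto simp: hpoly_def intro: phom_diff)
lemma hpoly_mult: "(p,q) \<in> hpoly \<Gamma> \<Longrightarrow> (p',q') \<in> hpoly \<Gamma> \<Longrightarrow> (p * p', q * q') \<in> hpoly \<Gamma>"
  by (auto simp: hpoly_def coeff_mult intro!: phom_sum phom_mult)
lemma hpoly_monom: "(c,e) \<in> \<Gamma> \<Longrightarrow> (monom c n, monom e n) \<in> hpoly \<Gamma>"
  by (auto simp: hpoly_def intro: phom_zero)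
lemma hpoly_smult: "(c,e) \<in> \<Gamma> \<Longrightarrow> (p,q) \<in> hpoly \<Gamma> \<Longrightarrow> (smult c p, smult e q) \<in> hpoly \<Gamma>"
  by (auto simp: hpoly_def intro: phom_mult)
text \<open>The target ring may have zero divisors, so the companion polynomial is assembled from
  its coefficients; the integer factors of a derivative lie in the graph by
  \<open>phom_of_nat\<close>.\<close>

lemma hpoly_pderiv:
  assumes "(p,q) \<in> hpoly \<Gamma>" shows "\<exists>q'. (pderiv p, q') \<in> hpoly \<Gamma>"
proof (intro exI)
  let ?n = "max (degree p) (degree q)"
  define q' where "q' = Poly (map (\<lambda>i. of_nat (Suc i) * coeff q (Suc i)) [0..<?n])"
  have q': "coeff q' i = of_nat (Suc i) * coeff q (Suc i)" for i
    by (auto simp: q'_def nth_default_def coeff_eq_0)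
  have "(coeff (pderiv p) i, coeff q' i) \<in> \<Gamma>" for i
    unfolding coeff_pderiv q' using assms by (intro phom_mult phom_of_nat) (auto simp: hpoly_def)
  then show "(pderiv p, q') \<in> hpoly \<Gamma>" by (auto simp: hpoly_def)
qed
lemma hpoly_0D: "(0,q) \<in> hpoly \<Gamma> \<Longrightarrow> q = 0"
  by (auto simp: hpoly_def poly_eq_iff intro: phom_0D)

lemma pext_mono: "\<Gamma> \<subseteq> pext \<Gamma> z w"
proof
  fix x assume "x \<in> \<Gamma>"
  then have "(monom (fst x) 0, monom (snd x) 0) \<in> hpoly \<Gamma>" by (auto intro: hpoly_monom)
  then show "x \<in> pext \<Gamma> z w" unfolding pext_def by (force simp: poly_monom)
qed

lemma pext_mem: "(z,w) \<in> pext \<Gamma> z w"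
proof -
  have "(monom 1 1, monom 1 1) \<in> hpoly \<Gamma>" by (auto intro: hpoly_monom phom_one)
  then show ?thesis unfolding pext_def by (force simp: poly_monom)
qed

lemma pext_phom:
  assumes "\<And>p q. (p,q) \<in> hpoly \<Gamma> \<Longrightarrow> poly p z = 0 \<Longrightarrow> poly q w = 0"
  shows "phom (pext \<Gamma> z w)"
  unfolding phom_def
proof (intro conjI allI impI)
  show "(1,1) \<in> pext \<Gamma> z w" using pext_mono phom_one by blast
next
  fix x u y v assume "(x,u) \<in> pext \<Gamma> z w" "(y,v) \<in> pext \<Gamma> z w"
  then obtain p q p' q' where pq: "(p,q) \<in> hpoly \<Gamma>" "(p',q') \<in> hpoly \<Gamma>"
    "x = poly p z" "u = poly q w" "y = poly p' z" "v = poly q' w"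
    unfolding pext_def by auto
  from hpoly_diff[OF pq(1,2)] show "(x-y,u-v) \<in> pext \<Gamma> z w"
    unfolding pext_def by (force simp: pq(3-6))
  from hpoly_mult[OF pq(1,2)] show "(x * y,u * v) \<in> pext \<Gamma> z w"
    unfolding pext_def by (force simp: pq(3-6))
next
  fix u assume "(0,u) \<in> pext \<Gamma> z w"
  then show "u = 0" using assms unfolding pext_def by force
qed

text \<open>Pseudo-division: multiplying by the leading coefficient of \<open>p\<close> and
  subtracting a multiple of \<open>p\<close> lowers the degree of \<open>p2\<close>, and the same
  operations are performed on the images. By minimality of \<open>degree p\<close> the process ends
  in 0, so up to the factor \<open>c\<close> every relation of \<open>z\<close> is a multiple of
  \<open>p\<close>, and up to \<open>e\<close> its image is a multiple of \<open>q\<close>. A root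
  of \<open>q\<close> thus satisfies all relations as soon as \<open>e\<close> can be
  cancelled.\<close>

lemma minimal_relation_divides:
  assumes pq: "(p,q) \<in> hpoly \<Gamma>" "p \<noteq> 0"
    and minl: "\<And>p' q'. (p',q') \<in> hpoly \<Gamma> \<Longrightarrow> p' \<noteq> 0 \<Longrightarrow> poly p' z = 0 \<Longrightarrow> degree p \<le> degree p'"
    and root: "poly p z = 0"
    and pq2: "(p2,q2) \<in> hpoly \<Gamma>" "poly p2 z = 0"
  shows "\<exists>c e s s'. c \<noteq> 0 \<and> (c,e) \<in> \<Gamma> \<and> smult c p2 = s * p \<and> smult e q2 = s' * q"
  using pq2
proof (induction "degree p2" arbitrary: p2 q2 rule: less_induct)
  case less
  show ?case
  proof (cases "p2 = 0")
    case True
    then have "q2 = 0" using less.prems hpoly_0D by auto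
    with True show ?thesis
      using phom_one by (intro exI[of _ 1] exI[of _ 1] exI[of _ 0]) auto
  next
    case False
    have deg: "degree p \<le> degree p2" using minl[OF less.prems(1) False less.prems(2)] .
    define n where "n = degree p2 - degree p"
    define e1 e2 where "e1 = coeff q (degree p)" and "e2 = coeff q2 (degree p2)"
    have m1: "(lead_coeff p, e1) \<in> \<Gamma>" and m2: "(lead_coeff p2, e2) \<in> \<Gamma>"
      using pq(1) less.prems(1) by (auto simp: hpoly_def e1_def e2_def)
    define p3 q3 where "p3 = smult (lead_coeff p) p2 - monom (lead_coeff p2) n * p"
      and "q3 = smult e1 q2 - monom e2 n * q"
    have g3: "(p3,q3) \<in> hpoly \<Gamma>" unfolding p3_def q3_def
      by (intro hpoly_diff hpoly_smult hpoly_mult hpoly_monom m1 m2 pq(1) less.prems(1))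
    have r3: "poly p3 z = 0" using root less.prems(2) by (simp add: p3_def)
    have "\<exists>c e s s'. c \<noteq> 0 \<and> (c,e) \<in> \<Gamma> \<and> smult c p3 = s * p \<and> smult e q3 = s' * q"
    proof (cases "p3 = 0")
      case True
      then have "q3 = 0" using g3 hpoly_0D by auto
      with True show ?thesis
        using phom_one by (intro exI[of _ 1] exI[of _ 1] exI[of _ 0]) auto
    next
      case p3: False
      have le: "degree p3 \<le> degree p2" unfolding p3_def
      proof (rule degree_diff_le)
        show "degree (smult (lead_coeff p) p2) \<le> degree p2" by (rule degree_smult_le)
        show "degree (monom (lead_coeff p2) n * p) \<le> degree p2"
          using deg degree_mult_le[of "monom (lead_coeff p2) n" p] degree_monom_le[of "lead_coeff p2" n]
          unfolding n_def by linarith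
      qed
      have "coeff p3 (degree p2) = 0"
        using deg by (simp add: p3_def coeff_monom_mult n_def)
      then have "degree p3 < degree p2"
        using le p3 by (metis leading_coeff_0_iff order_le_less)
      from less.hyps[OF this g3 r3] show ?thesis .
    qed
    then obtain c e s s' where H: "c \<noteq> 0" "(c,e) \<in> \<Gamma>" "smult c p3 = s * p" "smult e q3 = s' * q" by blast
    have "smult (c * lead_coeff p) p2 = (s + smult c (monom (lead_coeff p2) n)) * p"
      using H(3) by (simp add: p3_def smult_diff_right algebra_simps)
    moreover have "smult (e * e1) q2 = (s' + smult e (monom e2 n)) * q"
      using H(4) by (simp add: q3_def smult_diff_right algebra_simps)
    moreover have "(c * lead_coeff p, e * e1) \<in> \<Gamma>" using phom_mult[OF H(2) m1] .
    moreover have "c * lead_coeff p \<noteq> 0" using H(1) pq(2) by simp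
    ultimately show ?thesis by blast
  qed
qed

end

text \<open>Zorn's lemma. The bound \<open>I\<close> on the admissible pairs lets one statement
  serve both homomorphisms that lift the identity (dual numbers) and unrestricted ones
  (places).\<close>

lemma phom_maximal:
  assumes "phom \<Gamma>" "\<Gamma> \<subseteq> I"
  shows "\<exists>M. phom M \<and> \<Gamma> \<subseteq> M \<and> M \<subseteq> I \<and> (\<forall>N. phom N \<longrightarrow> M \<subseteq> N \<longrightarrow> N \<subseteq> I \<longrightarrow> N = M)"
proof -
  define \<A> where "\<A> = {M. phom M \<and> \<Gamma> \<subseteq> M \<and> M \<subseteq> I}"
  have "\<exists>M\<in>\<A>. \<forall>X\<in>\<A>. M \<subseteq> X \<longrightarrow> X = M"
  proof (rule subset_Zorn_nonempty)
    show "\<A> \<noteq> {}" using assms by (auto simp: \<A>_def)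
    fix \<C> assume ne: "\<C> \<noteq> {}" and ch: "subset.chain \<A> \<C>"
    have sub: "M \<in> \<C> \<Longrightarrow> phom M \<and> \<Gamma> \<subseteq> M \<and> M \<subseteq> I" for M
      using ch by (auto simp: subset.chain_def \<A>_def)
    have tot: "M \<in> \<C> \<Longrightarrow> N \<in> \<C> \<Longrightarrow> M \<subseteq> N \<or> N \<subseteq> M" for M N
      using ch by (auto simp: subset.chain_def)
    have "phom (\<Union>\<C>)"
      unfolding phom_def
    proof (intro conjI allI impI)
      show "(1,1) \<in> \<Union>\<C>" using ne sub phom_one by blast
      fix x u y v assume "(x,u) \<in> \<Union>\<C>" "(y,v) \<in> \<Union>\<C>"
      then obtain M where M: "M \<in> \<C>" "(x,u) \<in> M" "(y,v) \<in> M" using tot by blast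
      then show "(x-y,u-v) \<in> \<Union>\<C>" "(x * y,u * v) \<in> \<Union>\<C>"
        using sub[OF M(1)] phom_diff[of M] phom_mult[of M] by blast+
    next
      fix u assume "(0,u) \<in> \<Union>\<C>"
      then show "u = 0" using sub phom_0D by blast
    qed
    then show "\<Union>\<C> \<in> \<A>" unfolding \<A>_def using ne sub by blast
  qed
  then obtain M where "M \<in> \<A>" "\<forall>X\<in>\<A>. M \<subseteq> X \<longrightarrow> X = M" by blast
  then show ?thesis unfolding \<A>_def by (intro exI[of _ M]) auto
qed

section \<open>Derivations of the complex numbers\<close>

text \<open>The ring of dual numbers. A map D is a derivation iff z \<mapsto> z + \<epsilon> D(z) is
  a ring homomorphism into it, so extending derivations becomes extending homomorphisms.\<close>

datatype dual = Dual (dre: complex) (ddu: complex)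

instantiation dual :: comm_ring_1
begin
definition "0 = Dual 0 0"
definition "1 = Dual 1 0"
definition "a + b = Dual (dre a + dre b) (ddu a + ddu b)"
definition "a - b = Dual (dre a - dre b) (ddu a - ddu b)"
definition "- a = Dual (- dre a) (- ddu a)"
definition "a * b = Dual (dre a * dre b) (ddu a * dre b + dre a * ddu b)"
instance
  by standard (auto simp: zero_dual_def one_dual_def plus_dual_def minus_dual_def uminus_dual_def
      times_dual_def algebra_simps)
end

lemma dual_sel [simp]:
  "dre 0 = 0" "ddu 0 = 0" "dre 1 = 1" "ddu 1 = 0"
  "dre (a + b) = dre a + dre b" "ddu (a + b) = ddu a + ddu b"
  "dre (a - b) = dre a - dre b" "ddu (a - b) = ddu a - ddu b"
  "dre (- a) = - dre a" "ddu (- a) = - ddu a"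
  "dre (a * b) = dre a * dre b" "ddu (a * b) = ddu a * dre b + dre a * ddu b"
  by (auto simp: zero_dual_def one_dual_def plus_dual_def minus_dual_def uminus_dual_def times_dual_def)

definition derivation :: "(complex \<Rightarrow> complex) \<Rightarrow> bool" where
  "derivation D \<longleftrightarrow> (\<forall>x y. D (x + y) = D x + D y) \<and> (\<forall>x y. D (x * y) = D x * y + x * D y)"

lemma derivation_add: "derivation D \<Longrightarrow> D (x + y) = D x + D y" by (simp add: derivation_def)
lemma derivation_mult: "derivation D \<Longrightarrow> D (x * y) = D x * y + x * D y" by (simp add: derivation_def)
lemma derivation_0: "derivation D \<Longrightarrow> D 0 = 0"
  using derivation_add[of D 0 0] by simp
lemma derivation_1: "derivation D \<Longrightarrow> D 1 = 0"
  using derivation_mult[of D 1 1] by simp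
lemma derivation_sum: "derivation D \<Longrightarrow> D (sum f A) = (\<Sum>a\<in>A. D (f a))"
  by (induction A rule: infinite_finite_induct) (auto simp: derivation_0 derivation_add)
lemma derivation_diff: "derivation D \<Longrightarrow> D (x - y) = D x - D y"
  using derivation_add[of D "x - y" y] by (simp add: algebra_simps)
lemma derivation_uminus: "derivation D \<Longrightarrow> D (- y) = - D y"
  using derivation_diff[of D 0 y] by (simp add: derivation_0)
lemma derivation_comb: "derivation D \<Longrightarrow> derivation D' \<Longrightarrow> derivation (\<lambda>x. D x + c * D' x)"
  by (auto simp: derivation_def algebra_simps)
lemma derivation_zero: "derivation (\<lambda>_. 0)" by (simp add: derivation_def)

lemma dre_poly_dual: "dre (poly q w) = poly (map_poly dre q) (dre w)"
  by (induction q) (auto simp: map_poly_pCons)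

lemma ddu_poly_dual:
  "ddu (poly q (Dual z v)) = poly (map_poly ddu q) z + v * poly (pderiv (map_poly dre q)) z"
proof (induction q)
  case (pCons a q)
  then show ?case by (auto simp: map_poly_pCons pderiv_pCons dre_poly_dual algebra_simps)
qed auto

text \<open>A maximal extension is defined everywhere. A number transcendental over the domain may
  receive any value. For an algebraic one the relation of least degree is separable in
  characteristic zero, since otherwise its derivative would be a shorter relation, and the condition
  on the value is a linear equation with nonzero coefficient.\<close>

lemma derivation_extension:
  assumes "phom \<Gamma>" "\<Gamma> \<subseteq> {(z,u). dre u = z}"
  shows "\<exists>D. derivation D \<and> (\<forall>z u. (z,u) \<in> \<Gamma> \<longrightarrow> D z = ddu u)"
proof -
  define I where "I = {(z,u). dre u = z}"
  obtain M where M: "phom M" "\<Gamma> \<subseteq> M" "M \<subseteq> I"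
    and mx: "\<And>N. phom N \<Longrightarrow> M \<subseteq> N \<Longrightarrow> N \<subseteq> I \<Longrightarrow> N = M"
    using phom_maximal[OF assms] unfolding I_def by auto
  have gp: "map_poly dre q = p" if "(p,q) \<in> hpoly M" for p q
    using that M(3) by (auto simp: hpoly_def I_def poly_eq_iff coeff_map_poly)
  have ext: "(z,Dual z v) \<in> M"
    if "\<And>p q. (p,q) \<in> hpoly M \<Longrightarrow> poly p z = 0 \<Longrightarrow> poly q (Dual z v) = 0" for z v
  proof -
    have "phom (pext M z (Dual z v))" using pext_phom[OF M(1)] that by blast
    moreover have "pext M z (Dual z v) \<subseteq> I"
      unfolding pext_def I_def using gp by (auto simp: dre_poly_dual)
    ultimately have "pext M z (Dual z v) = M" using mx pext_mono[OF M(1)] by blast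
    then show ?thesis using pext_mem[OF M(1)] by blast
  qed
  have tot: "\<exists>v. (z,Dual z v) \<in> M" for z
  proof (cases "\<exists>p q. (p,q) \<in> hpoly M \<and> p \<noteq> 0 \<and> poly p z = 0")
    case False
    then have "(z,Dual z 0) \<in> M" using ext[of z 0] hpoly_0D[OF M(1)] by (metis poly_0)
    then show ?thesis ..
  next
    case True
    define R where "R = {p. \<exists>q. (p,q) \<in> hpoly M \<and> p \<noteq> 0 \<and> poly p z = 0}"
    obtain p where p: "p \<in> R" "\<And>p'. p' \<in> R \<Longrightarrow> degree p \<le> degree p'"
      using True ex_has_least_nat[of "\<lambda>p. p \<in> R" _ degree] unfolding R_def by blast
    then obtain q where pq: "(p,q) \<in> hpoly M" "p \<noteq> 0" "poly p z = 0" unfolding R_def by blast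
    have dp: "degree p > 0" using pq(2,3) by (metis degree_eq_zeroE gr0I pCons_0_0 poly_const_conv)
    have nz: "poly (pderiv p) z \<noteq> 0"
    proof
      assume "poly (pderiv p) z = 0"
      moreover have "pderiv p \<noteq> 0" using dp by (simp add: pderiv_eq_0_iff)
      ultimately have "pderiv p \<in> R" using hpoly_pderiv[OF M(1) pq(1)] unfolding R_def by blast
      with p(2) have "degree p \<le> degree (pderiv p)" by blast
      then show False using dp by (simp add: degree_pderiv)
    qed
    \<comment> \<open>The solution of the equation obtained by differentiating p(z) = 0; the
      coefficients of \<open>map_poly ddu q\<close> are the prescribed derivatives of the
      coefficients of \<open>p\<close>.\<close>
    define v where "v = - poly (map_poly ddu q) z / poly (pderiv p) z"
    have q0: "poly q (Dual z v) = 0"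
      using gp[OF pq(1)] pq(3) nz
      by (intro dual.expand) (auto simp: dre_poly_dual ddu_poly_dual v_def)
    have "(z,Dual z v) \<in> M"
    proof (rule ext)
      fix p2 q2 assume h: "(p2,q2) \<in> hpoly M" "poly p2 z = 0"
      obtain c e s s' where c: "c \<noteq> 0" "(c,e) \<in> M" "smult e q2 = s' * q"
        using minimal_relation_divides[OF M(1) pq(1,2) _ pq(3) h] p(2) unfolding R_def by blast
      then have "e * poly q2 (Dual z v) = 0" using q0 by (metis mult_zero_right poly_mult poly_smult)
      \<comment> \<open>A dual number with nonzero first component is a unit, so the factor
        \<open>e\<close> cancels.\<close>
      moreover have "dre e = c" using c M(3) by (auto simp: I_def)
      ultimately show "poly q2 (Dual z v) = 0" using c(1)
        by (intro dual.expand) (auto simp: zero_dual_def times_dual_def)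
    qed
    then show ?thesis ..
  qed
  define D where "D z = (SOME v. (z,Dual z v) \<in> M)" for z
  have D: "(z,Dual z (D z)) \<in> M" for z unfolding D_def using tot by (rule someI_ex)
  have Du: "D z = ddu u" if "(z,u) \<in> M" for z u
    using phom_unique[OF M(1) D that] by (metis dual.sel(2))
  have "derivation D" unfolding derivation_def
  proof (intro conjI allI)
    fix x y
    show "D (x + y) = D x + D y" using Du[OF phom_add[OF M(1) D D]] by simp
    show "D (x * y) = D x * y + x * D y" using Du[OF phom_mult[OF M(1) D D]] by simp
  qed
  then show ?thesis using Du M(2) by blast
qed

lemma countable_subring:
  assumes "countable (Z :: complex set)"
  obtains A where "countable A" "Z \<subseteq> A" "1 \<in> A"
    "\<And>x y. x \<in> A \<Longrightarrow> y \<in> A \<Longrightarrow> x - y \<in> A \<and> x * y \<in> A"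
proof -
  define F where "F S = S \<union> (\<lambda>(x,y). x - y) ` (S \<times> S) \<union> (\<lambda>(x,y). x * y) ` (S \<times> S)" for S :: "complex set"
  define S where "S n = (F ^^ n) (insert 1 Z)" for n
  have S_Suc: "S (Suc n) = F (S n)" for n by (simp add: S_def)
  have cS: "countable (S n)" for n
    by (induction n) (use assms in \<open>auto simp: S_Suc F_def S_def[of 0]\<close>)
  have mono: "S m \<subseteq> S n" if "m \<le> n" for m n
    using that by (induction rule: dec_induct) (auto simp: S_Suc F_def)
  have cl: "x - y \<in> (\<Union>n. S n) \<and> x * y \<in> (\<Union>n. S n)" if xy: "x \<in> (\<Union>n. S n)" "y \<in> (\<Union>n. S n)" for x y
  proof -
    obtain m n where "x \<in> S m" "y \<in> S n" using xy by blast
    then have "x \<in> S (max m n)" "y \<in> S (max m n)"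
      using mono[of m "max m n"] mono[of n "max m n"] by auto
    then have "x - y \<in> S (Suc (max m n))" "x * y \<in> S (Suc (max m n))"
      by (auto simp: S_Suc F_def)
    then show ?thesis by blast
  qed
  show ?thesis
    by (rule that[of "\<Union>n. S n"])
      (use cS cl S_def[of 0] in auto)
qed

text \<open>A countable ring has countably many polynomials, each nonzero one with finitely many
  roots, so some number is transcendental over the ring generated by \<open>Z\<close>. The zero
  derivation of that ring extends with an arbitrary value at the new number.\<close>

lemma derivation_moving_new_element:
  assumes "countable (Z :: complex set)"
  shows "\<exists>c D. derivation D \<and> (\<forall>z\<in>Z. D z = 0) \<and> D c = 1"
proof -
  obtain A where A: "countable A" "Z \<subseteq> A" "1 \<in> A"
    "\<And>x y. x \<in> A \<Longrightarrow> y \<in> A \<Longrightarrow> x - y \<in> A \<and> x * y \<in> A"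
    using countable_subring[OF assms] by blast
  define R where "R = {p :: complex poly. \<forall>i. coeff p i \<in> A}"
  have "R \<subseteq> Poly ` lists A"
  proof
    fix p assume "p \<in> R"
    then have "coeffs p \<in> lists A" unfolding R_def by (auto simp: coeffs_def)
    then show "p \<in> Poly ` lists A" by (metis Poly_coeffs imageI)
  qed
  then have "countable R" using A(1) by (meson countable_image countable_lists countable_subset)
  then have "countable (\<Union>p\<in>R - {0}. {z. poly p z = 0})"
    by (intro countable_UN) (auto intro: countable_finite poly_roots_finite)
  then have "(\<Union>p\<in>R - {0}. {z. poly p z = 0}) \<noteq> UNIV"
    using uncountable_UNIV_complex by metis
  then obtain c where c: "\<And>p. p \<in> R \<Longrightarrow> poly p c = 0 \<Longrightarrow> p = 0" by blast
  define \<Gamma> where "\<Gamma> = (\<lambda>z. (z, Dual z 0)) ` A"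
  have ph: "phom \<Gamma>" unfolding phom_def
  proof (intro conjI allI impI)
    show "(1,1) \<in> \<Gamma>" using A(3) unfolding \<Gamma>_def by (auto simp: one_dual_def)
    fix x u y v assume "(x,u) \<in> \<Gamma>" "(y,v) \<in> \<Gamma>"
    then show "(x-y,u-v) \<in> \<Gamma>" "(x * y,u * v) \<in> \<Gamma>"
      using A(4)[of x y] unfolding \<Gamma>_def by (auto simp: minus_dual_def times_dual_def)
  next
    fix u assume "(0,u) \<in> \<Gamma>" then show "u = 0" by (auto simp: \<Gamma>_def zero_dual_def)
  qed
  have "phom (pext \<Gamma> c (Dual c 1))"
  proof (rule pext_phom[OF ph])
    fix p q assume pq: "(p,q) \<in> hpoly \<Gamma>" "poly p c = 0"
    then have "p \<in> R" unfolding R_def hpoly_def \<Gamma>_def by auto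
    then have "p = 0" using c pq by blast
    then have "q = 0" using hpoly_0D[OF ph] pq by auto
    then show "poly q (Dual c 1) = 0" by simp
  qed
  moreover have "pext \<Gamma> c (Dual c 1) \<subseteq> {(z,u). dre u = z}"
    unfolding pext_def
  proof clarify
    fix p q assume "(p,q) \<in> hpoly \<Gamma>"
    then have "(coeff p i, coeff q i) \<in> \<Gamma>" for i by (auto simp: hpoly_def)
    moreover have "dre u = z" if "(z,u) \<in> \<Gamma>" for z u using that by (auto simp: \<Gamma>_def)
    ultimately have "dre (coeff q i) = coeff p i" for i by blast
    then have "map_poly dre q = p"
      by (simp add: poly_eq_iff coeff_map_poly)
    then show "dre (poly q (Dual c 1)) = poly p c" by (simp add: dre_poly_dual)
  qed
  ultimately obtain D where D: "derivation D" "\<And>z u. (z,u) \<in> pext \<Gamma> c (Dual c 1) \<Longrightarrow> D z = ddu u"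
    using derivation_extension by blast
  have "D c = 1" using D(2)[OF pext_mem[OF ph]] by simp
  moreover have "D z = 0" if "z \<in> Z" for z
    using D(2)[of z "Dual z 0"] pext_mono[OF ph] that A(2) unfolding \<Gamma>_def by fastforce
  ultimately show ?thesis using D(1) by blast
qed

text \<open>A generic point of the linear space \<open>V\<close>: every tangent vector of
  \<open>V\<close> at \<open>\<phi>\<close> is the effect of a derivation. Induction on the
  coordinates splits \<open>V\<close> into \<open>V0\<close> and the line of
  \<open>\<omega>\<close>; the coefficient \<open>c\<close> of \<open>\<omega>\<close> is
  transcendental over all numbers found before. The set \<open>Z\<close> of constants grows by the
  entries of \<open>\<omega>\<close>, so that differentiating a multiple of \<open>\<omega>\<close>
  differentiates only its coefficient.\<close>

lemma generic_element_of_subspace: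
  assumes "finite X" "countable Z"
    and sub: "(\<lambda>_. 0) \<in> V" "\<And>\<phi> \<psi> c. \<phi> \<in> V \<Longrightarrow> \<psi> \<in> V \<Longrightarrow> (\<lambda>x. \<phi> x + c * \<psi> x) \<in> V"
  shows "\<exists>\<phi>\<in>V. \<forall>\<psi>\<in>V. \<exists>D. derivation D \<and> (\<forall>z\<in>Z. D z = 0) \<and> (\<forall>x\<in>X. D (\<phi> x) = \<psi> x)"
  using assms
proof (induction X arbitrary: Z V rule: finite_induct)
  case empty
  then show ?case using derivation_zero by auto
next
  case (insert x0 X)
  define V0 where "V0 = {\<phi>\<in>V. \<phi> x0 = 0}"
  have V0: "(\<lambda>_. 0) \<in> V0" "\<And>\<phi> \<psi> c. \<phi> \<in> V0 \<Longrightarrow> \<psi> \<in> V0 \<Longrightarrow> (\<lambda>x. \<phi> x + c * \<psi> x) \<in> V0"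
    using insert.prems(2,3) unfolding V0_def by auto
  show ?case
  proof (cases "V0 = V")
    case True
    obtain \<phi> where \<phi>: "\<phi> \<in> V" "\<And>\<psi>. \<psi> \<in> V \<Longrightarrow>
        \<exists>D. derivation D \<and> (\<forall>z\<in>Z. D z = 0) \<and> (\<forall>x\<in>X. D (\<phi> x) = \<psi> x)"
      using insert.IH[of Z V] insert.prems by blast
    have "\<phi>' x0 = 0" if "\<phi>' \<in> V" for \<phi>' using that True unfolding V0_def by auto
    then show ?thesis using \<phi> derivation_0 by (intro bexI[of _ \<phi>] ballI) (metis insertE)
  next
    case False
    then obtain \<omega>' where \<omega>': "\<omega>' \<in> V" "\<omega>' x0 \<noteq> 0" unfolding V0_def by blast
    define \<omega> where "\<omega> x = \<omega>' x / \<omega>' x0" for x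
    have \<omega>: "\<omega> \<in> V" "\<omega> x0 = 1"
      using insert.prems(3)[OF insert.prems(2) \<omega>'(1), of "1 / \<omega>' x0"] \<omega>'(2)
      by (auto simp: \<omega>_def[abs_def])
    obtain \<phi> where \<phi>: "\<phi> \<in> V0" "\<And>\<psi>. \<psi> \<in> V0 \<Longrightarrow>
        \<exists>D. derivation D \<and> (\<forall>z\<in>Z \<union> \<omega> ` insert x0 X. D z = 0) \<and> (\<forall>x\<in>X. D (\<phi> x) = \<psi> x)"
      using insert.IH[of "Z \<union> \<omega> ` insert x0 X" V0] V0 insert.prems(1) insert.hyps(1)
      by (auto simp: countable_finite)
    have "countable (Z \<union> \<omega> ` insert x0 X \<union> \<phi> ` insert x0 X)"
      using insert.prems(1) insert.hyps(1) by (auto simp: countable_finite)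
    from derivation_moving_new_element[OF this]
    obtain c D2 where D2: "derivation D2" "D2 c = 1"
      "\<And>z. z \<in> Z \<union> \<omega> ` insert x0 X \<union> \<phi> ` insert x0 X \<Longrightarrow> D2 z = 0" by metis
    show ?thesis
    proof (intro bexI[of _ "\<lambda>x. \<phi> x + c * \<omega> x"] ballI)
      show "(\<lambda>x. \<phi> x + c * \<omega> x) \<in> V" using \<phi>(1) \<omega>(1) insert.prems(3) unfolding V0_def by blast
      fix \<psi> assume \<psi>: "\<psi> \<in> V"
      define y where "y = \<psi> x0"
      have "(\<lambda>x. \<psi> x + (- y) * \<omega> x) \<in> V0"
        using insert.prems(3)[OF \<psi> \<omega>(1), of "-y"] \<omega>(2) unfolding V0_def y_def by auto
      from \<phi>(2)[OF this] obtain D1 where D1: "derivation D1" "\<And>z. z\<in>Z \<union> \<omega> ` insert x0 X \<Longrightarrow> D1 z = 0"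
        "\<And>x. x \<in> X \<Longrightarrow> D1 (\<phi> x) = \<psi> x - y * \<omega> x" by (metis (no_types, lifting) add_uminus_conv_diff mult_minus_left)
      \<comment> \<open>\<open>D1\<close> fits the entries of \<open>\<phi>\<close> but has an
        uncontrolled value at \<open>c\<close>; \<open>D2\<close> kills the entries and has value 1
        at \<open>c\<close>, so the multiple added here corrects that value to
        \<open>y\<close>.\<close>
      define D where "D x = D1 x + (y - D1 c) * D2 x" for x
      have D: "derivation D" unfolding D_def[abs_def] by (rule derivation_comb[OF D1(1) D2(1)])
      have "D (\<phi> x + c * \<omega> x) = \<psi> x" if "x \<in> insert x0 X" for x
      proof -
        have e: "D1 (\<omega> x) = 0" "D2 (\<omega> x) = 0" "D2 (\<phi> x) = 0" using D1(2) D2(3) that by auto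
        have f: "D1 (\<phi> x) = \<psi> x - y * \<omega> x"
          using that D1(3) \<phi>(1) \<omega>(2) derivation_0[OF D1(1)] unfolding V0_def y_def by auto
        show ?thesis unfolding derivation_add[OF D] derivation_mult[OF D]
          unfolding D_def using e f D2(2) by (simp add: algebra_simps)
      qed
      then show "\<exists>D. derivation D \<and> (\<forall>z\<in>Z. D z = 0) \<and> (\<forall>x\<in>insert x0 X. D (\<phi> x + c * \<omega> x) = \<psi> x)"
        using D D1(2) D2(3) by (intro exI[of _ D]) (auto simp: D_def)
    qed
  qed
qed

section \<open>Places of the complex numbers\<close>

lemma poly_eq_sum_atMost: "degree (p :: complex poly) \<le> n \<Longrightarrow> poly p x = (\<Sum>i\<le>n. coeff p i * x ^ i)"
  unfolding poly_altdef by (rule sum.mono_neutral_left) (auto simp: coeff_eq_0)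

text \<open>A valuation ring with its residue map to the complex numbers. The last clause makes
  elements of nonzero residue units, so that the kernel of \<open>\<psi>\<close> is the maximal
  ideal.\<close>

definition place :: "complex set \<Rightarrow> (complex \<Rightarrow> complex) \<Rightarrow> bool" where
  "place V \<psi> \<longleftrightarrow> 1 \<in> V \<and> \<psi> 1 = 1 \<and> (\<forall>x\<in>V. \<forall>y\<in>V. x - y \<in> V \<and> x * y \<in> V \<and> \<psi> (x - y) = \<psi> x - \<psi> y \<and> \<psi> (x * y) = \<psi> x * \<psi> y)
    \<and> (\<forall>z. z \<noteq> 0 \<longrightarrow> z \<in> V \<or> 1 / z \<in> V) \<and> (\<forall>z\<in>V. \<psi> z \<noteq> 0 \<longrightarrow> 1 / z \<in> V)"

text \<open>An equation for \<open>z\<close> whose image is a nonzero constant, so that no value for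
  \<open>z\<close> is consistent with it. Over a local domain it says that the maximal ideal
  generates the unit ideal once \<open>z\<close> is adjoined.\<close>

definition unit_relation :: "(complex \<times> complex) set \<Rightarrow> complex \<Rightarrow> nat \<Rightarrow> bool" where
  "unit_relation M z n \<longleftrightarrow> (\<exists>p q. (p,q) \<in> hpoly M \<and> poly p z = 0 \<and> coeff q 0 \<noteq> 0 \<and> (\<forall>i>0. coeff q i = 0) \<and> degree p \<le> n)"

text \<open>The equation of \<open>1 / z\<close>, multiplied by the \<open>n\<close>-th power of
  \<open>z\<close>, cancels the top coefficient of the equation of \<open>z\<close>. In the image
  nothing is lost: the coefficient of \<open>q\<close> at \<open>n > 0\<close> is zero, so
  \<open>q\<close> is merely scaled by the nonzero constant term of \<open>q2\<close>.\<close>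

lemma unit_relation_reduce:
  assumes M: "phom M" and r1: "unit_relation M z n" and r2: "unit_relation M (1 / z) m" and "m \<le> n" and z: "z \<noteq> 0"
  shows "n > 0 \<and> unit_relation M z (n - 1)"
proof -
  obtain p q where pq: "(p,q) \<in> hpoly M" "poly p z = 0" "coeff q 0 \<noteq> 0" "\<And>i. i > 0 \<Longrightarrow> coeff q i = 0" "degree p \<le> n"
    using r1 unfolding unit_relation_def by blast
  obtain p2 q2 where pq2: "(p2,q2) \<in> hpoly M" "poly p2 (1 / z) = 0" "coeff q2 0 \<noteq> 0" "\<And>i. i > 0 \<Longrightarrow> coeff q2 i = 0" "degree p2 \<le> m"
    using r2 unfolding unit_relation_def by blast
  have n: "n > 0"
  proof (rule ccontr)
    assume "\<not> n > 0"
    then have "degree p = 0" using pq(5) by simp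
    then have "p = 0" using pq(2) by (metis degree_eq_zeroE mult_zero_right pCons_0_0 poly_const_conv)
    then show False using hpoly_0D[OF M] pq(1,3) by (metis coeff_0)
  qed
  define r s where "r = (\<Sum>j\<le>m. monom (coeff p2 j) (n - j))" and "s = (\<Sum>j\<le>m. monom (coeff q2 j) (n - j))"
  have "(coeff r i, coeff s i) \<in> M" for i unfolding r_def s_def Polynomial.coeff_sum
    using pq2(1) by (intro phom_sum[OF M]) (auto intro: phom_zero[OF M] simp: hpoly_def)
  then have "(r,s) \<in> hpoly M" by (simp add: hpoly_def)
  define p' q' where "p' = smult (coeff p2 0) p - smult (coeff p n) r"
    and "q' = smult (coeff q2 0) q - smult (coeff q n) s"
  have "(p',q') \<in> hpoly M" unfolding p'_def q'_def
    using pq(1) pq2(1) \<open>(r,s) \<in> hpoly M\<close>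
    by (intro hpoly_diff[OF M] hpoly_smult[OF M]) (auto simp: hpoly_def)
  have q': "q' = smult (coeff q2 0) q" using pq(4)[OF n] by (simp add: q'_def)
  have "poly r z = (\<Sum>j\<le>m. coeff p2 j * z ^ (n - j))"
    unfolding r_def by (simp add: poly_sum poly_monom)
  also have "\<dots> = z ^ n * (\<Sum>j\<le>m. coeff p2 j * (1 / z) ^ j)"
    unfolding sum_distrib_left using z \<open>m \<le> n\<close>
    by (intro sum.cong) (auto simp: power_diff power_divide)
  also have "\<dots> = 0" using pq2(2) poly_eq_sum_atMost[OF pq2(5), of "1 / z"] by simp
  finally have "poly p' z = 0" using pq(2) by (simp add: p'_def)
  moreover have "degree p' \<le> n - 1"
  proof (rule degree_le, intro allI impI)
    fix i assume i: "i > n - 1"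
    have cr: "coeff r i = (\<Sum>j\<le>m. if n - j = i then coeff p2 j else 0)"
      unfolding r_def Polynomial.coeff_sum by simp
    show "coeff p' i = 0"
    proof (cases "i = n")
      case True
      have "coeff r n = (\<Sum>j\<le>m. if j = 0 then coeff p2 j else 0)"
        unfolding cr[unfolded True] using n by (intro sum.cong) auto
      then show ?thesis by (simp add: p'_def True)
    next
      case False
      then have "i > n" using i by simp
      then have "coeff r i = 0" unfolding cr by (intro sum.neutral) auto
      then show ?thesis using pq(5) \<open>i > n\<close> by (simp add: p'_def coeff_eq_0)
    qed
  qed
  moreover have "coeff q' 0 \<noteq> 0" "\<forall>i>0. coeff q' i = 0" using pq(3,4) pq2(3) by (auto simp: q')
  ultimately show ?thesis using \<open>(p',q') \<in> hpoly M\<close> n unfolding unit_relation_def by blast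
qed

text \<open>Chevalley's extension theorem. A homomorphism to the complex numbers with maximal domain
  is a place: elements of nonzero image are invertible in the domain, and a number outside it
  satisfies a \<open>unit_relation\<close> because the complex numbers are algebraically closed.
  Both \<open>z\<close> and \<open>1 / z\<close> cannot do so, by descent on the least degrees of
  such relations.\<close>

lemma phom_extends_to_place:
  assumes "phom (\<Gamma> :: (complex \<times> complex) set)"
  shows "\<exists>V \<psi>. place V \<psi> \<and> (\<forall>(z,u)\<in>\<Gamma>. z \<in> V \<and> \<psi> z = u)"
proof -
  obtain M where M: "phom M" "\<Gamma> \<subseteq> M" and mx: "\<And>N. phom N \<Longrightarrow> M \<subseteq> N \<Longrightarrow> N = M"
    using phom_maximal[OF assms subset_UNIV] by auto
  have ext: "(z,w) \<in> M"
    if "\<And>p q. (p,q) \<in> hpoly M \<Longrightarrow> poly p z = 0 \<Longrightarrow> poly q w = 0" for z w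
  proof -
    have "phom (pext M z w)" using pext_phom[OF M(1), of z w] that by metis
    from mx[OF this pext_mono[OF M(1)]] show ?thesis using pext_mem[OF M(1), of z w] by simp
  qed
  have inv: "(1 / z, 1 / u) \<in> M" if zu: "(z,u) \<in> M" "u \<noteq> 0" for z u
  proof (rule ext)
    fix p q assume pq: "(p,q) \<in> hpoly M" "poly p (1 / z) = 0"
    have z: "z \<noteq> 0" using zu phom_0D[OF M(1)] by blast
    define n where "n = max (degree p) (degree q)"
    have pw: "(z ^ k, u ^ k) \<in> M" for k
      by (induction k) (auto intro: phom_one[OF M(1)] phom_mult[OF M(1)] zu)
    have eq: "(\<Sum>i\<le>n. coeff r i * y ^ (n - i)) = y ^ n * poly r (1 / y)" if "degree r \<le> n" "y \<noteq> 0" for r :: "complex poly" and y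
      unfolding poly_eq_sum_atMost[OF that(1)] sum_distrib_left using that(2)
      by (intro sum.cong) (auto simp: power_diff power_divide)
    have "(\<Sum>i\<le>n. coeff p i * z ^ (n - i), \<Sum>i\<le>n. coeff q i * u ^ (n - i)) \<in> M"
      using pq(1) by (intro phom_sum[OF M(1)] phom_mult[OF M(1)] pw) (auto simp: hpoly_def)
    moreover have "(\<Sum>i\<le>n. coeff p i * z ^ (n - i)) = 0"
      using eq[of p z] z pq(2) by (simp add: n_def)
    ultimately have "(\<Sum>i\<le>n. coeff q i * u ^ (n - i)) = 0" using phom_0D[OF M(1)] by metis
    then show "poly q (1 / u) = 0" using eq[of q u] zu(2) by (simp add: n_def)
  qed
  \<comment> \<open>The images \<open>A\<close> of the relations of \<open>z\<close> behave like an
    ideal of a polynomial ring over a field, since leading coefficients with nonzero image can be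
    inverted. If the element \<open>q0\<close> of least degree were not constant, a root of it would
    be an admissible value for \<open>z\<close>.\<close>
  have rel: "\<exists>n. unit_relation M z n" if z: "z \<notin> fst ` M" for z
  proof -
    define A where "A = {q. \<exists>p. (p,q) \<in> hpoly M \<and> poly p z = 0}"
    have nr: "\<exists>q\<in>A. poly q w \<noteq> 0" for w
      using ext[of z w] z unfolding A_def by force
    obtain q0 where q0: "q0 \<in> A" "q0 \<noteq> 0" "\<And>q. q \<in> A \<Longrightarrow> q \<noteq> 0 \<Longrightarrow> degree q0 \<le> degree q"
      using nr[of 0] ex_has_least_nat[of "\<lambda>q. q \<in> A \<and> q \<noteq> 0" _ degree] by (metis poly_0)
    obtain p0 where p0: "(p0,q0) \<in> hpoly M" "poly p0 z = 0" using q0(1) unfolding A_def by blast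
    have "degree q0 = 0"
    proof (rule ccontr)
      assume "degree q0 \<noteq> 0"
      then have "\<not> constant (poly q0)" by (simp add: constant_degree)
      then obtain w where w: "poly q0 w = 0" using fundamental_theorem_of_algebra by blast
      have "poly q w = 0" if "q \<in> A" for q
        using that
      proof (induction "degree q" arbitrary: q rule: less_induct)
        case less
        show ?case
        proof (cases "q = 0")
          case False
          have dg: "degree q0 \<le> degree q" using q0(3) less.prems False by blast
          obtain p where p: "(p,q) \<in> hpoly M" "poly p z = 0" using less.prems unfolding A_def by blast
          define n c c0 e e0 where "n = degree q - degree q0" and "c = coeff p (degree q)"
            and "c0 = coeff p0 (degree q0)" and "e = lead_coeff q" and "e0 = lead_coeff q0"
          have e0: "e0 \<noteq> 0" using q0(2) by (simp add: e0_def)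
          have m: "(c,e) \<in> M" "(c0,e0) \<in> M" using p p0 by (auto simp: hpoly_def c_def c0_def e_def e0_def)
          have m': "(c * (1 / c0), e * (1 / e0)) \<in> M" by (intro phom_mult[OF M(1)] m inv e0)
          define q' p' where "q' = q - monom (e * (1 / e0)) n * q0" and "p' = p - monom (c * (1 / c0)) n * p0"
          have "(p',q') \<in> hpoly M" unfolding q'_def p'_def
            by (intro hpoly_diff[OF M(1)] hpoly_mult[OF M(1)] hpoly_monom[OF M(1)] p p0 m')
          moreover have "poly p' z = 0" using p p0 by (simp add: p'_def)
          ultimately have q'A: "q' \<in> A" unfolding A_def by blast
          have w': "poly q' w = poly q w" using w by (simp add: q'_def)
          show ?thesis
          proof (cases "q' = 0")
            case True
            then show ?thesis using w' by simp
          next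
            case q'0: False
            have "degree q' \<le> degree q" unfolding q'_def
              using dg degree_mult_le[of "monom (e * (1 / e0)) n" q0] degree_monom_le[of "e * (1 / e0)" n]
              by (intro degree_diff_le) (auto simp: n_def)
            moreover have "coeff q' (degree q) = 0"
              using dg e0 by (simp add: q'_def coeff_monom_mult n_def e_def e0_def)
            ultimately have "degree q' < degree q"
              using q'0 by (metis leading_coeff_0_iff order_le_less)
            from less.hyps[OF this q'A] show ?thesis using w' by simp
          qed
        qed simp
      qed
      then show False using nr[of w] by blast
    qed
    then have "coeff q0 0 \<noteq> 0" "\<forall>i>0. coeff q0 i = 0"
      using q0(2) by (auto simp: coeff_eq_0) (metis leading_coeff_0_iff)
    then show ?thesis using p0 unfolding unit_relation_def by blast
  qed
  have val: "z \<in> fst ` M \<or> 1 / z \<in> fst ` M" if z: "z \<noteq> 0" for z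
  proof (rule ccontr)
    assume "\<not> ?thesis"
    then have ex: "\<exists>n. unit_relation M z n" "\<exists>n. unit_relation M (1 / z) n" using rel by blast+
    define n m where "n = (LEAST n. unit_relation M z n)" and "m = (LEAST n. unit_relation M (1 / z) n)"
    have nm: "unit_relation M z n" "unit_relation M (1 / z) m"
      unfolding n_def m_def using ex by (auto intro: LeastI_ex)
    show False
    proof (cases "m \<le> n")
      case True
      from unit_relation_reduce[OF M(1) nm True z] have "n > 0" "unit_relation M z (n - 1)" by auto
      then show False using not_less_Least[of "n - 1" "unit_relation M z"] by (simp add: n_def)
    next
      case False
      have "unit_relation M (1 / (1 / z)) n" using nm(1) by simp
      from unit_relation_reduce[OF M(1) nm(2) this] z False
      have "m > 0" "unit_relation M (1 / z) (m - 1)" by auto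
      then show False using not_less_Least[of "m - 1" "unit_relation M (1 / z)"] by (simp add: m_def)
    qed
  qed
  define \<psi> where "\<psi> z = (SOME u. (z,u) \<in> M)" for z
  have \<psi>: "(z,\<psi> z) \<in> M" if "z \<in> fst ` M" for z
    unfolding \<psi>_def using that by (auto intro: someI)
  have \<psi>u: "\<psi> z = u" if "(z,u) \<in> M" for z u
    using phom_unique[OF M(1) \<psi> that] that by force
  have "place (fst ` M) \<psi>"
    unfolding place_def
  proof (intro conjI ballI allI impI)
    show "1 \<in> fst ` M" "\<psi> 1 = 1" using phom_one[OF M(1)] \<psi>u by force+
    fix x y assume "x \<in> fst ` M" "y \<in> fst ` M"
    then have "(x - y, \<psi> x - \<psi> y) \<in> M" "(x * y, \<psi> x * \<psi> y) \<in> M"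
      by (auto intro!: phom_diff[OF M(1)] phom_mult[OF M(1)] \<psi>)
    then show "x - y \<in> fst ` M" "x * y \<in> fst ` M" "\<psi> (x - y) = \<psi> x - \<psi> y" "\<psi> (x * y) = \<psi> x * \<psi> y"
      using \<psi>u by force+
  next
    fix z :: complex assume "z \<noteq> 0" then show "z \<in> fst ` M \<or> 1 / z \<in> fst ` M" by (rule val)
  next
    fix z assume "z \<in> fst ` M" "\<psi> z \<noteq> 0"
    then show "1 / z \<in> fst ` M" using inv[OF \<psi>] by force
  qed
  moreover have "\<forall>(z,u)\<in>\<Gamma>. z \<in> fst ` M \<and> \<psi> z = u" using M(2) \<psi>u by force
  ultimately show ?thesis by blast
qed

text \<open>Algebraic independence over the rational numbers in differential form: in characteristic
  zero it is equivalent to the freedom of the values of derivations.\<close>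

definition differentially_generic :: "'i set \<Rightarrow> ('i \<Rightarrow> complex) \<Rightarrow> bool" where
  "differentially_generic J x \<longleftrightarrow> (\<forall>y. \<exists>D. derivation D \<and> (\<forall>j\<in>J. D (x j) = y j))"

lemma derivation_poly_const:
  assumes "derivation D" "\<And>i. D (coeff p i) = 0"
  shows "D (poly p x) = poly (pderiv p) x * D x"
  using assms(2)
proof (induction p)
  case 0 then show ?case by (simp add: derivation_0[OF assms(1)])
next
  case (pCons a p)
  have "D a = 0" using pCons.prems[of 0] by simp
  moreover have "D (poly p x) = poly (pderiv p) x * D x"
    using pCons.IH pCons.prems[of "Suc _"] by simp
  ultimately show ?case
    by (simp add: derivation_add[OF assms(1)] derivation_mult[OF assms(1)] pderiv_pCons algebra_simps)
qed

text \<open>The numbers \<open>x j\<close> are adjoined to the integers one at a time with value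
  \<open>y j\<close>. The invariant says that a derivation vanishing on the adjoined numbers
  vanishes on the whole domain; hence some derivation kills the coefficients of a supposed relation
  of the next number and is 1 on that number.\<close>

lemma differentially_generic_specialises:
  assumes "finite J" and gen: "differentially_generic J x"
  shows "\<exists>V \<psi>. place V \<psi> \<and> (\<forall>j\<in>J. x j \<in> V \<and> \<psi> (x j) = y j)"
proof -
  have "\<exists>\<Gamma>. phom \<Gamma> \<and> (\<forall>j\<in>J'. (x j, y j) \<in> \<Gamma>) \<and>
      (\<forall>D. derivation D \<longrightarrow> (\<forall>j\<in>J'. D (x j) = 0) \<longrightarrow> (\<forall>(z,u)\<in>\<Gamma>. D z = 0))" if "J' \<subseteq> J" for J'
    using finite_subset[OF that assms(1)] that
  proof (induction J' rule: finite_induct)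
    case empty
    define \<Gamma> :: "(complex \<times> complex) set" where "\<Gamma> = range (\<lambda>n. (of_int n, of_int n))"
    have gr: "(of_int n, of_int n) \<in> \<Gamma>" for n unfolding \<Gamma>_def by (rule rangeI)
    have "phom \<Gamma>" unfolding phom_def
    proof (intro conjI allI impI)
      show "(1,1) \<in> \<Gamma>" using gr[of 1] by simp
      fix x u y v assume "(x,u) \<in> \<Gamma>" "(y,v) \<in> \<Gamma>"
      then obtain m n where "x = of_int m" "u = of_int m" "y = of_int n" "v = of_int n"
        unfolding \<Gamma>_def by auto
      then show "(x - y, u - v) \<in> \<Gamma>" "(x * y, u * v) \<in> \<Gamma>"
        using gr[of "m - n"] gr[of "m * n"] by simp_all
    qed (auto simp: \<Gamma>_def)
    moreover have "D (of_int n) = 0" if "derivation D" for D n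
    proof -
      have "D (of_nat k) = 0" for k
        by (induction k) (auto simp: derivation_0[OF that] derivation_1[OF that] derivation_add[OF that])
      then show ?thesis by (cases n rule: int_cases2) (auto simp: derivation_uminus[OF that])
    qed
    ultimately show ?case by (intro exI[of _ \<Gamma>]) (auto simp: \<Gamma>_def)
  next
    case (insert j J')
    then obtain \<Gamma> where \<Gamma>: "phom \<Gamma>" "\<forall>j\<in>J'. (x j, y j) \<in> \<Gamma>"
      "\<And>D z u. derivation D \<Longrightarrow> (\<forall>j\<in>J'. D (x j) = 0) \<Longrightarrow> (z,u) \<in> \<Gamma> \<Longrightarrow> D z = 0" by fast
    obtain D where D: "derivation D" "\<And>i. i \<in> J \<Longrightarrow> D (x i) = (if i = j then 1 else 0)"
      using gen[unfolded differentially_generic_def, rule_format, of "\<lambda>i. if i = j then 1 else 0"] by auto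
    have D0: "D z = 0" if "(z,u) \<in> \<Gamma>" for z u
      using \<Gamma>(3)[OF D(1) _ that] D(2) insert by force
    \<comment> \<open>Applying \<open>D\<close> to a relation shows that its formal derivative is
      again a relation, which is zero by induction on the degree; so the relation is constant and
      therefore trivial.\<close>
    have ind: "p = 0" if "(p,q) \<in> hpoly \<Gamma>" "poly p (x j) = 0" for p q
      using that
    proof (induction "degree p" arbitrary: p q rule: less_induct)
      case less
      have "D (coeff p i) = 0" for i using less.prems D0 unfolding hpoly_def by blast
      then have "poly (pderiv p) (x j) = 0"
        using derivation_poly_const[OF D(1), of p "x j"] less.prems(2) D(2)[of j] insert.prems
        by (simp add: derivation_0[OF D(1)])
      obtain q' where q': "(pderiv p, q') \<in> hpoly \<Gamma>" using hpoly_pderiv[OF \<Gamma>(1) less.prems(1)] by blast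
      have "degree p = 0"
      proof (rule ccontr)
        assume d: "degree p \<noteq> 0"
        then have "degree (pderiv p) < degree p" by (simp add: degree_pderiv)
        from less.hyps[OF this q' \<open>poly (pderiv p) (x j) = 0\<close>] have "pderiv p = 0" .
        then show False using d by (simp add: pderiv_eq_0_iff)
      qed
      then show ?case using less.prems(2) by (metis degree_eq_zeroE mult_zero_right pCons_0_0 poly_const_conv)
    qed
    have ph: "phom (pext \<Gamma> (x j) (y j))"
    proof (rule pext_phom[OF \<Gamma>(1)])
      fix p q assume pq: "(p,q) \<in> hpoly \<Gamma>" "poly p (x j) = 0"
      then have "p = 0" by (rule ind)
      then have "q = 0" using pq hpoly_0D[OF \<Gamma>(1)] by blast
      then show "poly q (y j) = 0" by simp
    qed
    have "D z = 0" if dz: "derivation D" "\<forall>i\<in>insert j J'. D (x i) = 0" "(z,u) \<in> pext \<Gamma> (x j) (y j)" for D z u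
    proof -
      obtain p q where pq: "(p,q) \<in> hpoly \<Gamma>" "z = poly p (x j)" using dz(3) unfolding pext_def by auto
      have "D (coeff p i) = 0" for i
        using \<Gamma>(3)[OF dz(1), of "coeff p i" "coeff q i"] dz(2) pq(1) unfolding hpoly_def by auto
      then show ?thesis using derivation_poly_const[OF dz(1), of p "x j"] dz(2) pq(2) by simp
    qed
    then show ?case
      using ph pext_mem[OF \<Gamma>(1), of "x j" "y j"] pext_mono[OF \<Gamma>(1), of "x j" "y j"] \<Gamma>(2)
      by (intro exI[of _ "pext \<Gamma> (x j) (y j)"]) blast
  qed
  from this[of J] obtain \<Gamma> where "phom \<Gamma>" "\<forall>j\<in>J. (x j, y j) \<in> \<Gamma>" by blast
  with phom_extends_to_place[of \<Gamma>] show ?thesis by fast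
qed

context
  fixes V \<psi> assumes pl: "place V \<psi>"
begin

lemma place_1: "1 \<in> V" "\<psi> 1 = 1" using pl by (auto simp: place_def)
lemma place_diff: "x \<in> V \<Longrightarrow> y \<in> V \<Longrightarrow> x - y \<in> V" "x \<in> V \<Longrightarrow> y \<in> V \<Longrightarrow> \<psi> (x - y) = \<psi> x - \<psi> y"
  using pl by (auto simp: place_def)
lemma place_mult: "x \<in> V \<Longrightarrow> y \<in> V \<Longrightarrow> x * y \<in> V" "x \<in> V \<Longrightarrow> y \<in> V \<Longrightarrow> \<psi> (x * y) = \<psi> x * \<psi> y"
  using pl by (auto simp: place_def)
lemma place_0: "0 \<in> V" "\<psi> 0 = 0"
  using place_diff[OF place_1(1) place_1(1)] by auto
lemma place_add: "x \<in> V \<Longrightarrow> y \<in> V \<Longrightarrow> x + y \<in> V" "x \<in> V \<Longrightarrow> y \<in> V \<Longrightarrow> \<psi> (x + y) = \<psi> x + \<psi> y"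
  using place_diff[of x "0 - y"] place_diff[of 0 y] place_0 by auto
lemma place_sum: "(\<And>i. i \<in> A \<Longrightarrow> x i \<in> V) \<Longrightarrow> sum x A \<in> V \<and> \<psi> (sum x A) = (\<Sum>i\<in>A. \<psi> (x i))"
  by (induction A rule: infinite_finite_induct) (auto simp: place_0 place_add)

text \<open>\<open>m\<close> is an entry of least valuation: any two nonzero entries are comparable,
  since one of their two quotients lies in \<open>V\<close>.\<close>

lemma place_pivot:
  assumes "finite R" "\<exists>r\<in>R. v r \<noteq> 0"
  shows "\<exists>m\<in>R. v m \<noteq> 0 \<and> (\<forall>r\<in>R. v r / v m \<in> V)"
  using assms
proof (induction R rule: finite_induct)
  case (insert a R)
  show ?case
  proof (cases "\<exists>r\<in>R. v r \<noteq> 0")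
    case False
    then show ?thesis using insert.prems place_0 place_1 by (intro bexI[of _ a]) auto
  next
    case True
    then obtain m where m: "m \<in> R" "v m \<noteq> 0" "\<And>r. r \<in> R \<Longrightarrow> v r / v m \<in> V" using insert.IH by blast
    show ?thesis
    proof (cases "v a / v m \<in> V")
      case True
      then show ?thesis using m by blast
    next
      case False
      then have a: "v a \<noteq> 0" using place_0 by auto
      then have am: "v m / v a \<in> V" using pl False m(2) unfolding place_def by (metis divide_eq_0_iff divide_divide_eq_right mult.left_neutral times_divide_eq_left)
      have "v r / v a \<in> V" if "r \<in> R" for r
        using place_mult(1)[OF m(3)[OF that] am] m(2) by simp
      then show ?thesis using a place_1(1) by (intro bexI[of _ a]) auto
    qed
  qed
qed simp

end

declare split_paired_All [simp del] split_paired_Ex [simp del]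

section \<open>Linear maps between spaces of finitely supported functions\<close>

lemma underdetermined_system:
  fixes t :: "'b \<Rightarrow> 'a \<Rightarrow> complex"
  assumes "finite Y" "finite X" "card Y < card X"
  shows "\<exists>\<phi>. (\<exists>x\<in>X. \<phi> x \<noteq> 0) \<and> (\<forall>y\<in>Y. (\<Sum>x\<in>X. t y x * \<phi> x) = 0)"
  using assms
proof (induction Y arbitrary: X t rule: finite_induct)
  case empty
  then show ?case by (intro exI[of _ "\<lambda>_. 1"]) (auto simp: card_gt_0_iff)
next
  case (insert y0 Y)
  show ?case
  proof (cases "\<exists>x0\<in>X. t y0 x0 \<noteq> 0")
    case False
    have "card Y < card X" using insert by simp
    from insert.IH[OF insert.prems(1) this, of t] False show ?thesis by force
  next
    case True
    then obtain x0 where x0: "x0 \<in> X" "t y0 x0 \<noteq> 0" by blast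
    define X' t' where "X' = X - {x0}" and "t' y x = t y x - t y x0 * t y0 x / t y0 x0" for y x
    have X': "finite X'" "card Y < card X'" "X = insert x0 X'" "x0 \<notin> X'"
      using insert x0 by (auto simp: X'_def)
    obtain \<phi> where \<phi>: "\<exists>x\<in>X'. \<phi> x \<noteq> 0" "\<And>y. y \<in> Y \<Longrightarrow> (\<Sum>x\<in>X'. t' y x * \<phi> x) = 0"
      using insert.IH[OF X'(1,2), of t'] by blast
    define s where "s = (\<Sum>x\<in>X'. t y0 x * \<phi> x)"
    define \<psi> where "\<psi> = \<phi>(x0 := - s / t y0 x0)"
    have sm: "(\<Sum>x\<in>X. t y x * \<psi> x) = t y x0 * (- s / t y0 x0) + (\<Sum>x\<in>X'. t y x * \<phi> x)" for y
    proof -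
      have "(\<Sum>x\<in>X'. t y x * \<psi> x) = (\<Sum>x\<in>X'. t y x * \<phi> x)"
        using X'(4) by (intro sum.cong) (auto simp: \<psi>_def)
      then show ?thesis using X' by (simp add: \<psi>_def)
    qed
    have "(\<Sum>x\<in>X. t y x * \<psi> x) = 0" if "y \<in> Y" for y
    proof -
      have "0 = (\<Sum>x\<in>X'. t y x * \<phi> x) - (\<Sum>x\<in>X'. t y x0 / t y0 x0 * (t y0 x * \<phi> x))"
        unfolding \<phi>(2)[OF that, symmetric] sum_subtractf[symmetric]
        by (intro sum.cong) (auto simp: t'_def algebra_simps)
      also have "\<dots> = (\<Sum>x\<in>X'. t y x * \<phi> x) - t y x0 / t y0 x0 * s"
        unfolding s_def sum_distrib_left ..
      finally show ?thesis unfolding sm by simp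
    qed
    moreover have "(\<Sum>x\<in>X. t y0 x * \<psi> x) = 0" unfolding sm using x0(2) by (simp add: s_def)
    moreover have "\<exists>x\<in>X. \<psi> x \<noteq> 0" using \<phi>(1) X' by (auto simp: \<psi>_def)
    ultimately show ?thesis by blast
  qed
qed

definition supp_in :: "'a set \<Rightarrow> ('a \<Rightarrow> complex) \<Rightarrow> bool" where
  "supp_in X \<phi> \<longleftrightarrow> (\<forall>x. \<phi> x \<noteq> 0 \<longrightarrow> x \<in> X)"

definition linop :: "(('a \<Rightarrow> complex) \<Rightarrow> 'b \<Rightarrow> complex) \<Rightarrow> bool" where
  "linop T \<longleftrightarrow> (\<forall>\<phi> \<psi> c y. T (\<lambda>x. \<phi> x + c * \<psi> x) y = T \<phi> y + c * T \<psi> y)"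

definition unit_fun :: "'a \<Rightarrow> 'a \<Rightarrow> complex" where
  "unit_fun a x = (if x = a then 1 else 0)"

lemma linopD: "linop T \<Longrightarrow> T (\<lambda>x. \<phi> x + c * \<psi> x) y = T \<phi> y + c * T \<psi> y"
  by (simp add: linop_def)

lemma linop_zero: "linop T \<Longrightarrow> T (\<lambda>_. 0) y = 0"
  unfolding linop_def by (drule spec[of _ "\<lambda>_. 0"], drule spec[of _ "\<lambda>_. 0"], drule spec[of _ 1]) force

lemma linop_expand:
  assumes "linop T" "finite X" "supp_in X \<phi>"
  shows "T \<phi> y = (\<Sum>x\<in>X. T (unit_fun x) y * \<phi> x)"
  using assms(2,3)
proof (induction X arbitrary: \<phi> rule: finite_induct)
  case empty
  then have "\<phi> = (\<lambda>_. 0)" by (auto simp: supp_in_def)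
  then show ?case using linop_zero[OF assms(1)] by simp
next
  case (insert a X)
  define \<psi> where "\<psi> = \<phi>(a := 0)"
  have "supp_in X \<psi>" using insert.prems by (auto simp: supp_in_def \<psi>_def)
  note IH = insert.IH[OF this]
  have "\<phi> = (\<lambda>x. \<psi> x + \<phi> a * unit_fun a x)" by (auto simp: \<psi>_def unit_fun_def)
  then have "T \<phi> y = T \<psi> y + \<phi> a * T (unit_fun a) y"
    using assms(1) unfolding linop_def by metis
  also have "\<dots> = (\<Sum>x\<in>X. T (unit_fun x) y * \<phi> x) + \<phi> a * T (unit_fun a) y"
    unfolding IH using insert.hyps by (intro arg_cong2[of _ _ _ _ "(+)"] sum.cong) (auto simp: \<psi>_def)
  finally show ?case using insert.hyps by (simp add: mult.commute)
qed

context
  fixes T :: "('a \<Rightarrow> complex) \<Rightarrow> 'b \<Rightarrow> complex" and X :: "'a set" and Y :: "'b set"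
  assumes T: "linop T" and fin: "finite X" "finite Y"
begin

lemma linop_kernel:
  assumes "card Y < card X"
  shows "\<exists>\<phi>. supp_in X \<phi> \<and> (\<exists>x\<in>X. \<phi> x \<noteq> 0) \<and> (\<forall>y\<in>Y. T \<phi> y = 0)"
proof -
  obtain \<phi> where \<phi>: "\<exists>x\<in>X. \<phi> x \<noteq> 0" "\<And>y. y \<in> Y \<Longrightarrow> (\<Sum>x\<in>X. T (unit_fun x) y * \<phi> x) = 0"
    using underdetermined_system[OF fin(2,1) assms, of "\<lambda>y x. T (unit_fun x) y"] by blast
  define \<psi> where "\<psi> x = (if x \<in> X then \<phi> x else 0)" for x
  have s: "supp_in X \<psi>" by (auto simp: supp_in_def \<psi>_def)
  have "T \<psi> y = 0" if "y \<in> Y" for y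
    unfolding linop_expand[OF T fin(1) s] \<phi>(2)[OF that, symmetric] by (intro sum.cong) (auto simp: \<psi>_def)
  then show ?thesis using s \<phi>(1) by (intro exI[of _ \<psi>]) (auto simp: \<psi>_def)
qed

lemma linop_injective_imp_surjective:
  assumes "card Y \<le> card X" and inj: "\<And>\<phi>. supp_in X \<phi> \<Longrightarrow> (\<forall>y\<in>Y. T \<phi> y = 0) \<Longrightarrow> \<phi> = (\<lambda>_. 0)"
  shows "\<exists>\<phi>. supp_in X \<phi> \<and> (\<forall>y\<in>Y. T \<phi> y = b y)"
proof -
  \<comment> \<open>The right-hand side enters as an extra column \<open>None\<close>, which gives
    more unknowns than equations; injectivity forces the coefficient of that column in a solution to
    be nonzero.\<close>
  define X' where "X' = insert None (Some ` X)"
  define t where "t y z = (case z of None \<Rightarrow> - b y | Some x \<Rightarrow> T (unit_fun x) y)" for y and z :: "'a option"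
  have "card X' = Suc (card X)" using fin by (auto simp: X'_def card_image)
  then have "card Y < card X'" "finite X'" using assms(1) fin by (auto simp: X'_def)
  then obtain \<phi> where \<phi>: "\<exists>x\<in>X'. \<phi> x \<noteq> 0" "\<And>y. y \<in> Y \<Longrightarrow> (\<Sum>x\<in>X'. t y x * \<phi> x) = 0"
    using underdetermined_system[OF fin(2), of X' t] by blast
  define \<psi> where "\<psi> x = (if x \<in> X then \<phi> (Some x) else 0)" for x
  have s: "supp_in X \<psi>" by (auto simp: supp_in_def \<psi>_def)
  have eq: "T \<psi> y = b y * \<phi> None" if "y \<in> Y" for y
  proof -
    have "T \<psi> y = (\<Sum>x\<in>X. t y (Some x) * \<phi> (Some x))"
      unfolding linop_expand[OF T fin(1) s] by (intro sum.cong) (auto simp: \<psi>_def t_def)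
    also have "\<dots> = (\<Sum>x\<in>X'. t y x * \<phi> x) + b y * \<phi> None"
      using fin by (simp add: X'_def sum.reindex t_def)
    finally show ?thesis using \<phi>(2)[OF that] by simp
  qed
  have n: "\<phi> None \<noteq> 0"
  proof
    assume n: "\<phi> None = 0"
    then have "\<psi> = (\<lambda>_. 0)" using inj[OF s] eq by simp
    then have "\<phi> (Some x) = 0" if "x \<in> X" for x using that by (metis \<psi>_def)
    then show False using \<phi>(1) n by (auto simp: X'_def)
  qed
  define \<xi> where "\<xi> x = 0 + (1 / \<phi> None) * \<psi> x" for x
  have "T \<xi> y = b y" if "y \<in> Y" for y
  proof -
    have "T \<xi> y = T (\<lambda>_. 0) y + (1 / \<phi> None) * T \<psi> y"
      unfolding \<xi>_def[abs_def] by (rule linopD[OF T])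
    then show ?thesis using eq[OF that] n linop_zero[OF T] by simp
  qed
  moreover have "supp_in X \<xi>" using s by (auto simp: supp_in_def \<xi>_def)
  ultimately show ?thesis by blast
qed

lemma linop_surjective_imp_card_le:
  assumes "\<And>b. \<exists>\<phi>. supp_in X \<phi> \<and> (\<forall>y\<in>Y. T \<phi> y = b y)"
  shows "card Y \<le> card X"
proof (rule ccontr)
  assume "\<not> ?thesis"
  then obtain h where h: "\<exists>y\<in>Y. h y \<noteq> 0" "\<And>x. x \<in> X \<Longrightarrow> (\<Sum>y\<in>Y. T (unit_fun x) y * h y) = 0"
    using underdetermined_system[OF fin, of "\<lambda>x y. T (unit_fun x) y"] by force
  obtain y0 where y0: "y0 \<in> Y" "h y0 \<noteq> 0" using h by blast
  obtain \<phi> where \<phi>: "supp_in X \<phi>" "\<And>y. y \<in> Y \<Longrightarrow> T \<phi> y = unit_fun y0 y" using assms by blast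
  have "h y0 = (\<Sum>y\<in>Y. unit_fun y0 y * h y)"
    using y0 fin by (simp add: unit_fun_def if_distrib[of "\<lambda>a. a * _"] cong: if_cong)
  also have "\<dots> = (\<Sum>y\<in>Y. (\<Sum>x\<in>X. T (unit_fun x) y * \<phi> x) * h y)"
    using \<phi>(2) linop_expand[OF T fin(1) \<phi>(1)] by simp
  also have "\<dots> = (\<Sum>x\<in>X. (\<Sum>y\<in>Y. T (unit_fun x) y * h y) * \<phi> x)"
    unfolding sum_distrib_right by (subst sum.swap) (simp add: mult_ac)
  also have "\<dots> = 0" using h(2) by simp
  finally show False using y0 by simp
qed

end

lemma linop_not_surjective_imp_annihilator:
  fixes T :: "('a \<Rightarrow> complex) \<Rightarrow> 'b \<Rightarrow> complex" and X :: "'a set" and Y :: "'b set"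
  assumes T: "linop T" and fin: "finite X" "finite Y"
    and "\<not> (\<forall>b. \<exists>\<phi>. supp_in X \<phi> \<and> (\<forall>y\<in>Y. T \<phi> y = b y))"
  shows "\<exists>h. (\<exists>y\<in>Y. h y \<noteq> 0) \<and> (\<forall>\<phi>. supp_in X \<phi> \<longrightarrow> (\<Sum>y\<in>Y. h y * T \<phi> y) = 0)"
proof (rule ccontr)
  assume H: "\<not> ?thesis"
  define t where "t y x = T (unit_fun x) y" for x y
  have inj: "\<forall>y\<in>Y. h y = 0" if h: "\<And>x. x \<in> X \<Longrightarrow> (\<Sum>y\<in>Y. t y x * h y) = 0" for h
  proof (rule ccontr)
    assume n: "\<not> ?thesis"
    have "(\<Sum>y\<in>Y. h y * T \<phi> y) = 0" if "supp_in X \<phi>" for \<phi>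
    proof -
      have "(\<Sum>y\<in>Y. h y * T \<phi> y) = (\<Sum>x\<in>X. (\<Sum>y\<in>Y. t y x * h y) * \<phi> x)"
        unfolding sum_distrib_right linop_expand[OF T fin(1) that] sum_distrib_left t_def
        by (subst sum.swap) (simp add: mult_ac)
      then show ?thesis using h by simp
    qed
    then show False using H n by blast
  qed
  \<comment> \<open>\<open>T T\<^sup>*\<close> is injective on functions on \<open>Y\<close>, hence surjective.\<close>
  define A where "A \<phi> x = (\<Sum>y\<in>Y. cnj (t y x) * \<phi> y)" for \<phi> x
  define U where "U \<phi> y = (\<Sum>x\<in>X. t y x * A \<phi> x)" for \<phi> y
  have A: "A (\<lambda>y. \<phi> y + c * \<psi> y) x = A \<phi> x + c * A \<psi> x" for \<phi> \<psi> c x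
    unfolding A_def by (simp add: algebra_simps sum.distrib sum_distrib_left)
  have U: "linop U"
    unfolding linop_def U_def A by (simp add: algebra_simps sum.distrib sum_distrib_left)
  have "\<exists>\<phi>. supp_in Y \<phi> \<and> (\<forall>y\<in>Y. U \<phi> y = b y)" for b
  proof (rule linop_injective_imp_surjective[OF U fin(2,2)])
    fix \<phi> assume s: "supp_in Y \<phi>" and z: "\<forall>y\<in>Y. U \<phi> y = 0"
    have "(\<Sum>x\<in>X. A \<phi> x * cnj (A \<phi> x)) = (\<Sum>y\<in>Y. cnj (\<phi> y) * U \<phi> y)"
    proof -
      have "(\<Sum>x\<in>X. A \<phi> x * cnj (A \<phi> x)) = (\<Sum>x\<in>X. \<Sum>y\<in>Y. A \<phi> x * (t y x * cnj (\<phi> y)))"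
        by (simp add: A_def sum_distrib_left)
      also have "\<dots> = (\<Sum>y\<in>Y. \<Sum>x\<in>X. A \<phi> x * (t y x * cnj (\<phi> y)))" by (rule sum.swap)
      finally show ?thesis by (simp add: U_def sum_distrib_left mult_ac)
    qed
    also have "\<dots> = 0" using z by simp
    finally have "complex_of_real (\<Sum>x\<in>X. (cmod (A \<phi> x))\<^sup>2) = 0"
      by (simp only: of_real_sum complex_norm_square)
    then have "A \<phi> x = 0" if "x \<in> X" for x
      using that fin unfolding of_real_eq_0_iff by (subst (asm) sum_nonneg_eq_0_iff) auto
    then have "cnj (A \<phi> x) = 0" if "x \<in> X" for x using that by simp
    then have "\<forall>y\<in>Y. cnj (\<phi> y) = 0" by (intro inj) (auto simp: A_def)
    then show "\<phi> = (\<lambda>_. 0)" using s by (auto simp: supp_in_def)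
  qed simp
  then have "\<exists>\<phi>. supp_in X \<phi> \<and> (\<forall>y\<in>Y. T \<phi> y = b y)" for b
  proof -
    obtain \<phi> where \<phi>: "\<And>y. y \<in> Y \<Longrightarrow> U \<phi> y = b y" using \<open>\<And>b. \<exists>\<phi>. supp_in Y \<phi> \<and> (\<forall>y\<in>Y. U \<phi> y = b y)\<close> by blast
    define \<psi> where "\<psi> x = (if x \<in> X then A \<phi> x else 0)" for x
    have s: "supp_in X \<psi>" by (auto simp: supp_in_def \<psi>_def)
    have "T \<psi> y = U \<phi> y" for y
      unfolding linop_expand[OF T fin(1) s] U_def by (intro sum.cong) (auto simp: \<psi>_def t_def)
    then show ?thesis using s \<phi> by auto
  qed
  then show False using assms(4) by blast
qed

section \<open>Flag preserving matrices\<close>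

text \<open>Basis vectors at one vertex, ordered by index; the span of all
  \<open>r \<preceq> c\<close> is a step of the coordinate flag at that vertex.\<close>

definition fle :: "'v \<times> nat \<Rightarrow> 'v \<times> nat \<Rightarrow> bool" (infix "\<preceq>" 50) where
  "x \<preceq> y \<longleftrightarrow> fst x = fst y \<and> snd x \<le> snd y"

lemma fle_refl [simp]: "x \<preceq> x" by (simp add: fle_def)
lemma fle_trans: "x \<preceq> y \<Longrightarrow> y \<preceq> z \<Longrightarrow> x \<preceq> z" by (auto simp: fle_def)
lemma fle_antisym: "x \<preceq> y \<Longrightarrow> y \<preceq> x \<Longrightarrow> x = y" by (auto simp: fle_def prod_eq_iff)
lemma fle_total: "fst x = fst y \<Longrightarrow> x \<preceq> y \<or> y \<preceq> x" by (auto simp: fle_def)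
lemma fle_fst: "x \<preceq> y \<Longrightarrow> fst x = fst y" by (auto simp: fle_def)

type_synonym 'x cmat = "'x \<Rightarrow> 'x \<Rightarrow> complex"

definition mm :: "'x set \<Rightarrow> 'x cmat \<Rightarrow> 'x cmat \<Rightarrow> 'x cmat" where
  "mm S A B = (\<lambda>r c. \<Sum>m\<in>S. A r m * B m c)"

definition ap :: "'x set \<Rightarrow> 'x cmat \<Rightarrow> ('x \<Rightarrow> complex) \<Rightarrow> 'x \<Rightarrow> complex" where
  "ap S A x = (\<lambda>r. \<Sum>m\<in>S. A r m * x m)"

lemma mm_assoc: "mm S (mm W A B) C = mm W A (mm S B C)"
  unfolding mm_def sum_distrib_left sum_distrib_right mult.assoc
  by (intro ext) (rule sum.swap)

lemma ap_mm: "ap S (mm W A B) x = ap W A (ap S B x)"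
  unfolding mm_def ap_def sum_distrib_left sum_distrib_right mult.assoc
  by (intro ext) (rule sum.swap)

lemma mm_eq_ap: "mm S A B r c = ap S A (\<lambda>m. B m c) r" by (simp add: mm_def ap_def)

lemma ap_cong: "(\<And>m. m \<in> S \<Longrightarrow> x m = y m) \<Longrightarrow> ap S A x = ap S A y"
  by (simp add: ap_def)

lemma ap_lin: "ap S A (\<lambda>m. x m + c * y m) r = ap S A x r + c * ap S A y r"
  by (simp add: ap_def algebra_simps sum.distrib sum_distrib_left)

lemma ap_diff: "ap S A (\<lambda>m. x m - y m) r = ap S A x r - ap S A y r"
  by (simp add: ap_def algebra_simps sum_subtractf)

text \<open>Upper triangular at every vertex, without entries between different vertices: such
  matrices preserve the grading and the coordinate flags.\<close>

definition flagged :: "('v \<times> nat) cmat \<Rightarrow> bool" where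
  "flagged G \<longleftrightarrow> (\<forall>r c. G r c \<noteq> 0 \<longrightarrow> r \<preceq> c)"

lemma flaggedD: "flagged G \<Longrightarrow> \<not> r \<preceq> c \<Longrightarrow> G r c = 0" by (auto simp: flagged_def)

lemma flagged_mm: "flagged A \<Longrightarrow> flagged B \<Longrightarrow> flagged (mm S A B)"
  unfolding flagged_def
proof (intro allI impI)
  fix r c assume A: "\<forall>r c. A r c \<noteq> 0 \<longrightarrow> r \<preceq> c" and B: "\<forall>r c. B r c \<noteq> 0 \<longrightarrow> r \<preceq> c" and "mm S A B r c \<noteq> 0"
  then obtain m where "A r m * B m c \<noteq> 0" unfolding mm_def by (meson sum.not_neutral_contains_not_neutral)
  then show "r \<preceq> c" using A B fle_trans by (metis mult_eq_0_iff)
qed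

text \<open>Back substitution: a nonzero entry of \<open>y\<close> with the largest index is removed
  by a multiple of its column, which affects only entries below it. The control of the support makes
  inverse matrices flagged.\<close>

lemma flagged_solve:
  assumes "finite S" "flagged G" and diag: "\<And>c. c \<in> S \<Longrightarrow> G c c \<noteq> 0"
  shows "\<exists>x. (\<forall>m. x m \<noteq> 0 \<longrightarrow> m \<in> S \<and> (\<exists>c\<in>S. y c \<noteq> 0 \<and> m \<preceq> c)) \<and> (\<forall>r\<in>S. ap S G x r = y r)"
proof (induction "card {r\<in>S. \<exists>c\<in>S. y c \<noteq> 0 \<and> r \<preceq> c}" arbitrary: y rule: less_induct)
  case less
  define A where "A = {c\<in>S. y c \<noteq> 0}"
  have finA: "finite A" using assms(1) by (simp add: A_def)
  show ?case
  proof (cases "A = {}")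
    case True
    then show ?thesis by (intro exI[of _ "\<lambda>_. 0"]) (auto simp: A_def ap_def)
  next
    case False
    obtain c where c: "c \<in> A" "\<And>c'. c' \<in> A \<Longrightarrow> snd c' \<le> snd c"
    proof -
      have "Max (snd ` A) \<in> snd ` A" using finA False by (intro Max_in) auto
      then obtain c where "c \<in> A" "snd c = Max (snd ` A)" by force
      then show ?thesis using finA by (intro that[of c]) auto
    qed
    define a where "a = y c / G c c"
    define y' where "y' r = y r - a * G r c" for r
    have y'c: "y' c = 0" using diag[of c] c(1) by (simp add: y'_def a_def A_def)
    have nz: "y r \<noteq> 0 \<or> r \<preceq> c" if "y' r \<noteq> 0" for r
      using that flaggedD[OF assms(2), of r c] by (cases "r \<preceq> c") (auto simp: y'_def)
    define Dn where "Dn y = {r\<in>S. \<exists>c\<in>S. y c \<noteq> 0 \<and> r \<preceq> c}" for y :: "'a \<times> nat \<Rightarrow> complex"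
    have sub: "Dn y' \<subseteq> Dn y" unfolding Dn_def using nz c(1) fle_trans unfolding A_def by blast
    have "c \<notin> Dn y'"
    proof
      assume "c \<in> Dn y'"
      then obtain c' where c': "c' \<in> S" "y' c' \<noteq> 0" "c \<preceq> c'" by (auto simp: Dn_def)
      then have "c' \<noteq> c" using y'c by auto
      then have "\<not> c' \<preceq> c" using c'(3) fle_antisym by blast
      then have "c' \<in> A" using nz[OF c'(2)] c'(1) by (auto simp: A_def)
      then have "snd c' \<le> snd c" by (rule c(2))
      then show False using c'(3) \<open>\<not> c' \<preceq> c\<close> by (auto simp: fle_def)
    qed
    moreover have "c \<in> Dn y" using c(1) by (auto simp: Dn_def A_def)
    moreover have "finite (Dn y)" using assms(1) by (simp add: Dn_def)
    ultimately have "card (Dn y') < card (Dn y)" using sub by (intro psubset_card_mono) auto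
    from less.hyps[OF this[unfolded Dn_def]] obtain x where
      x: "\<And>m. x m \<noteq> 0 \<Longrightarrow> m \<in> Dn y'" "\<And>r. r \<in> S \<Longrightarrow> ap S G x r = y' r" unfolding Dn_def by blast
    define z where "z m = x m + a * unit_fun c m" for m
    have "ap S G z r = y r" if "r \<in> S" for r
    proof -
      have "ap S G (unit_fun c) r = G r c"
        using assms(1) c(1) by (simp add: ap_def unit_fun_def A_def if_distrib[of "\<lambda>b. _ * b"] cong: if_cong)
      then show ?thesis unfolding z_def[abs_def] ap_lin using x(2)[OF that] by (simp add: y'_def)
    qed
    moreover have "m \<in> Dn y" if "z m \<noteq> 0" for m
      using that x(1)[of m] sub \<open>c \<in> Dn y\<close> by (auto simp: z_def unit_fun_def split: if_splits)
    ultimately show ?thesis unfolding Dn_def by blast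
  qed
qed

definition fpair :: "('v \<times> nat) set \<Rightarrow> ('v \<times> nat) cmat \<Rightarrow> ('v \<times> nat) cmat \<Rightarrow> bool" where
  "fpair S G H \<longleftrightarrow> flagged G \<and> flagged H \<and> (\<forall>r\<in>S. \<forall>c\<in>S. mm S G H r c = unit_fun c r) \<and>
     (\<forall>r\<in>S. \<forall>c\<in>S. mm S H G r c = unit_fun c r)"

lemma ap_unit: "finite S \<Longrightarrow> r \<in> S \<Longrightarrow> (\<And>c. c \<in> S \<Longrightarrow> A r c = unit_fun c r) \<Longrightarrow> ap S A x r = x r"
  unfolding ap_def by (subst sum.cong[OF refl, of S _ "\<lambda>m. if m = r then x m else 0"]) (auto simp: unit_fun_def)

lemma fpair_sym: "fpair S G H \<Longrightarrow> fpair S H G" by (auto simp: fpair_def)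

lemma fpair_ap: "fpair S G H \<Longrightarrow> finite S \<Longrightarrow> r \<in> S \<Longrightarrow> ap S G (ap S H x) r = x r"
  unfolding ap_mm[symmetric] by (rule ap_unit) (auto simp: fpair_def)

lemma fpair_mm: "fpair S G H \<Longrightarrow> finite S \<Longrightarrow> r \<in> S \<Longrightarrow> mm S G (mm S H A) r c = A r c"
  unfolding mm_eq_ap[of S G] mm_def[of S H] using fpair_ap[of S G H r "\<lambda>m. A m c"] by (simp add: ap_def)

lemma fpair_mm_right:
  assumes "fpair S G H" "finite S" "c \<in> S"
  shows "mm S (mm S A G) H r c = A r c"
proof -
  have "mm S (mm S A G) H r c = (\<Sum>m\<in>S. A r m * mm S G H m c)"
    by (simp add: mm_assoc) (simp add: mm_def)
  also have "\<dots> = (\<Sum>m\<in>S. if m = c then A r m else 0)"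
    using assms by (intro sum.cong) (auto simp: fpair_def unit_fun_def)
  finally show ?thesis using assms by simp
qed

text \<open>The columns of a right inverse come from \<open>flagged_solve\<close>. A right inverse
  is again flagged with nonzero diagonal, so it has a right inverse in turn, which must agree with
  \<open>G\<close>; right inverses are therefore two-sided.\<close>

lemma fpair_exists:
  assumes "finite S" "flagged G" and diag: "\<And>c. c \<in> S \<Longrightarrow> G c c \<noteq> 0"
  shows "\<exists>H. fpair S G H"
proof -
  have right: "\<exists>H. flagged H \<and> (\<forall>r\<in>S. \<forall>c\<in>S. mm S G H r c = unit_fun c r) \<and> (\<forall>c\<in>S. H c c \<noteq> 0)"
    if G: "flagged G" "\<And>c. c \<in> S \<Longrightarrow> G c c \<noteq> 0" for G
  proof -
    have "\<forall>c. \<exists>x. (\<forall>m. x m \<noteq> 0 \<longrightarrow> m \<preceq> c) \<and> (\<forall>r\<in>S. ap S G x r = unit_fun c r)"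
    proof
      fix c show "\<exists>x. (\<forall>m. x m \<noteq> 0 \<longrightarrow> m \<preceq> c) \<and> (\<forall>r\<in>S. ap S G x r = unit_fun c r)"
      proof -
        obtain x where x: "\<And>m. x m \<noteq> 0 \<Longrightarrow> \<exists>c'\<in>S. unit_fun c c' \<noteq> 0 \<and> m \<preceq> c'" "\<And>r. r \<in> S \<Longrightarrow> ap S G x r = unit_fun c r"
          using flagged_solve[OF assms(1) G, of "unit_fun c"] by blast
        have "m \<preceq> c" if "x m \<noteq> 0" for m using x(1)[OF that] unfolding unit_fun_def by (metis one_neq_zero)
        then show ?thesis using x(2) by blast
      qed
    qed
    then obtain x where x: "\<And>c m. x c m \<noteq> 0 \<Longrightarrow> m \<preceq> c" "\<And>c r. r \<in> S \<Longrightarrow> ap S G (x c) r = unit_fun c r"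
      by metis
    define H where "H m c = x c m" for m c
    have H1: "mm S G H r c = unit_fun c r" if "r \<in> S" for r c
      unfolding mm_eq_ap H_def by (rule x(2)[OF that])
    have H2: "flagged H" using x(1) by (auto simp: flagged_def H_def)
    have "H c c \<noteq> 0" if "c \<in> S" for c
    proof
      assume "H c c = 0"
      then have "G c m * H m c = 0" for m
        using flaggedD[OF G(1), of c m] flaggedD[OF H2, of m c] fle_antisym[of c m] by auto
      then have "mm S G H c c = 0" unfolding mm_def by (intro sum.neutral) blast
      then show False using H1[OF that, of c] by (simp add: unit_fun_def)
    qed
    then show ?thesis using H1 H2 by blast
  qed
  obtain H where H: "flagged H" "\<And>r c. r \<in> S \<Longrightarrow> c \<in> S \<Longrightarrow> mm S G H r c = unit_fun c r" "\<And>c. c \<in> S \<Longrightarrow> H c c \<noteq> 0"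
    using right[OF assms(2,3)] by auto
  obtain K where K: "flagged K" "\<And>r c. r \<in> S \<Longrightarrow> c \<in> S \<Longrightarrow> mm S H K r c = unit_fun c r"
    using right[OF H(1,3)] by auto
  have "G r c = K r c" if rc: "r \<in> S" "c \<in> S" for r c
  proof -
    have "mm S (mm S G H) K r c = K r c"
      unfolding mm_eq_ap[of S "mm S G H"] by (rule ap_unit[OF assms(1) rc(1)]) (use H rc in auto)
    moreover have "mm S G (mm S H K) r c = (\<Sum>m\<in>S. if m = c then G r m else 0)"
      unfolding mm_def[of S G] using K(2) rc by (intro sum.cong) (auto simp: unit_fun_def)
    ultimately show ?thesis using rc assms(1) by (simp add: mm_assoc)
  qed
  then have "mm S H G r c = unit_fun c r" if "r \<in> S" "c \<in> S" for r c
    using K(2)[OF that] that unfolding mm_def by simp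
  then show ?thesis using H assms(2) unfolding fpair_def by blast
qed

text \<open>Column echelon form, that is, the Schubert cell of a graded subspace: \<open>P\<close>
  collects the positions of last nonzero entries of vectors in \<open>N\<close>, and
  \<open>G\<close> has normalised vectors of \<open>N\<close> as columns at \<open>P\<close> and
  unit vectors elsewhere. In the coordinates of \<open>G\<close> the space \<open>N\<close> is the
  coordinate subspace of \<open>P\<close>.\<close>

lemma echelon_form:
  assumes S: "finite S"
    and N0: "(\<lambda>_. 0) \<in> N" and Nadd: "\<And>x y c. x \<in> N \<Longrightarrow> y \<in> N \<Longrightarrow> (\<lambda>r. x r + c * y r) \<in> N"
    and Nsupp: "\<And>x. x \<in> N \<Longrightarrow> supp_in S x"
    and Ngr: "\<And>x i. x \<in> N \<Longrightarrow> (\<lambda>r. if fst r = i then x r else 0) \<in> N"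
  shows "\<exists>P\<subseteq>S. \<exists>G H. fpair S G H \<and> (\<forall>x. supp_in S x \<longrightarrow> (x \<in> N \<longleftrightarrow> (\<forall>r\<in>S - P. ap S H x r = 0)))"
proof -
  define P where "P = {c\<in>S. \<exists>x\<in>N. x c = 1 \<and> (\<forall>r. x r \<noteq> 0 \<longrightarrow> r \<preceq> c)}"
  define w where "w c = (SOME x. x \<in> N \<and> x c = 1 \<and> (\<forall>r. x r \<noteq> 0 \<longrightarrow> r \<preceq> c))" for c
  have w: "w c \<in> N \<and> w c c = 1 \<and> (\<forall>r. w c r \<noteq> 0 \<longrightarrow> r \<preceq> c)" if "c \<in> P" for c
    using that someI_ex[of "\<lambda>x. x \<in> N \<and> x c = 1 \<and> (\<forall>r. x r \<noteq> 0 \<longrightarrow> r \<preceq> c)"]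
    unfolding P_def w_def by blast
  have PS: "P \<subseteq> S" "finite P" using S by (auto simp: P_def)
  have Nsum: "(\<lambda>r. \<Sum>m\<in>A. y m * w m r) \<in> N" if "A \<subseteq> P" for A y
    using finite_subset[OF that PS(2)] that
  proof (induction A rule: finite_induct)
    case (insert a A)
    then have "(\<lambda>r. (\<Sum>m\<in>A. y m * w m r) + y a * w a r) \<in> N" using w by (intro Nadd) auto
    then show ?case using insert.hyps by (simp add: add.commute)
  qed (use N0 in simp)
  define G where "G r c = (if c \<in> P then w c r else unit_fun c r)" for r c
  have fG: "flagged G" using w by (auto simp: flagged_def G_def unit_fun_def split: if_splits)
  have "G c c \<noteq> 0" for c using w by (auto simp: G_def unit_fun_def)
  then obtain H where H: "fpair S G H" using fpair_exists[OF S fG] by blast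
  have exp: "x r = (\<Sum>m\<in>P. ap S H x m * w m r) + (if r \<in> S - P then ap S H x r else 0)"
    if "r \<in> S" for x r
  proof -
    have "x r = ap S G (ap S H x) r" using fpair_ap[OF H S that] by simp
    also have "\<dots> = (\<Sum>m\<in>P. G r m * ap S H x m) + (\<Sum>m\<in>S - P. G r m * ap S H x m)"
      unfolding ap_def[of S G] using sum.subset_diff[OF PS(1) S, of "\<lambda>m. G r m * ap S H x m"] by (simp add: add.commute)
    also have "(\<Sum>m\<in>S - P. G r m * ap S H x m) = (\<Sum>m\<in>S - P. if m = r then ap S H x r else 0)"
      by (intro sum.cong) (auto simp: G_def unit_fun_def)
    also have "\<dots> = (if r \<in> S - P then ap S H x r else 0)" using S by auto
    finally show ?thesis by (simp add: G_def mult.commute)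
  qed
  have "x \<in> N \<longleftrightarrow> (\<forall>r\<in>S - P. ap S H x r = 0)" if s: "supp_in S x" for x
  proof
    assume z: "\<forall>r\<in>S - P. ap S H x r = 0"
    have "x = (\<lambda>r. \<Sum>m\<in>P. ap S H x m * w m r)"
    proof
      fix r
      show "x r = (\<Sum>m\<in>P. ap S H x m * w m r)"
      proof (cases "r \<in> S")
        case True
        then show ?thesis using exp[of r x] z by auto
      next
        case False
        have "w m r = 0" if "m \<in> P" for m using w[OF that] Nsupp False by (auto simp: supp_in_def)
        moreover have "x r = 0" using s False by (auto simp: supp_in_def)
        ultimately show ?thesis by simp
      qed
    qed
    then show "x \<in> N" using Nsum[of P "ap S H x"] by simp
  next
    assume x: "x \<in> N"
    \<comment> \<open>What the pivot vectors leave of \<open>x\<close>; it vanishes at all positions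
      in \<open>P\<close>. If it were nonzero, its last nonzero entry at some vertex would itself be
      a pivot position.\<close>
    define x' where "x' r = x r + (-1) * (\<Sum>m\<in>P. ap S H x m * w m r)" for r
    have x'N: "x' \<in> N" unfolding x'_def[abs_def] by (intro Nadd x Nsum) simp
    have x': "x' r = (if r \<in> S - P then ap S H x r else 0)" if "r \<in> S" for r
      using exp[OF that, of x] by (simp add: x'_def)
    show "\<forall>r\<in>S - P. ap S H x r = 0"
    proof (rule ccontr)
      assume "\<not> ?thesis"
      then obtain r0 where "r0 \<in> S - P" "ap S H x r0 \<noteq> 0" by blast
      then have r0: "r0 \<in> S" "x' r0 \<noteq> 0" using x'[of r0] by auto
      define A where "A = {r\<in>S. fst r = fst r0 \<and> x' r \<noteq> 0}"
      have A: "finite A" "A \<noteq> {}" using S r0 by (auto simp: A_def)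
      have "Max (snd ` A) \<in> snd ` A" using A by (intro Max_in) auto
      then obtain c where c: "c \<in> A" "snd c = Max (snd ` A)" by force
      define u where "u r = 0 + (1 / x' c) * (if fst r = fst r0 then x' r else 0)" for r
      have "u \<in> N" unfolding u_def[abs_def] by (intro Nadd N0 Ngr x'N)
      moreover have "u c = 1" using c(1) by (auto simp: u_def A_def)
      moreover have "r \<preceq> c" if "u r \<noteq> 0" for r
      proof -
        have "r \<in> A" using that Nsupp[OF x'N] by (auto simp: u_def A_def supp_in_def split: if_splits)
        then have "snd r \<le> snd c" using c(2) A(1) by simp
        then show ?thesis using \<open>r \<in> A\<close> c(1) by (auto simp: fle_def A_def)
      qed
      ultimately have "c \<in> P" using c(1) by (auto simp: P_def A_def)
      then have "x' c = 0" using x'[of c] PS by auto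
      then show False using c(1) by (auto simp: A_def)
    qed
  qed
  then show ?thesis using PS H by blast
qed

section \<open>Generic positions of subrepresentations\<close>

text \<open>The Bruhat order: positions move down within their vertices, so the Schubert cell of
  \<open>K'\<close> lies in the closure of the cell of \<open>K\<close>.\<close>

definition below :: "('v \<times> nat) set \<Rightarrow> ('v \<times> nat) set \<Rightarrow> bool" where
  "below K' K \<longleftrightarrow> (\<exists>\<beta>. bij_betw \<beta> K K' \<and> (\<forall>c\<in>K. \<beta> c \<preceq> c))"

lemma below_refl: "below K K"
  unfolding below_def by (intro exI[of _ id]) auto

text \<open>With \<open>H\<close> inverse to \<open>G\<close>, the representation \<open>f\<close>
  written in the basis of columns of \<open>G\<close>.\<close>

definition cj :: "('v \<times> nat) set \<Rightarrow> ('v \<times> nat) cmat \<Rightarrow> ('v \<times> nat) cmat \<Rightarrow> (nat \<Rightarrow> ('v \<times> nat) cmat) \<Rightarrow> nat \<Rightarrow> ('v \<times> nat) cmat" where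
  "cj S G H f = (\<lambda>k. mm S H (mm S (f k) G))"

text \<open>The dimension of the space of flagged matrices from the coordinates in \<open>S\<close>
  to those in \<open>W\<close>; for \<open>S = P\<close> and \<open>W = E - K\<close> it is the
  height.\<close>

definition cnt :: "('v \<times> nat) set \<Rightarrow> ('v \<times> nat) set \<Rightarrow> nat" where
  "cnt S W = card {(r,c). r \<in> W \<and> c \<in> S \<and> r \<preceq> c}"

lemma cnt_below:
  assumes "below P' P" "finite P" "finite W"
  shows "cnt P' W \<le> cnt P W"
proof -
  obtain \<beta> where \<beta>: "bij_betw \<beta> P P'" "\<And>c. c \<in> P \<Longrightarrow> \<beta> c \<preceq> c" using assms(1) unfolding below_def by blast
  have fin: "finite {(r,c). r \<in> W \<and> c \<in> P \<and> r \<preceq> c}"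
    by (rule finite_subset[of _ "W \<times> P"]) (use assms in auto)
  have "{(r,c). r \<in> W \<and> c \<in> P' \<and> r \<preceq> c} \<subseteq> (\<lambda>(r,c). (r, \<beta> c)) ` {(r,c). r \<in> W \<and> c \<in> P \<and> r \<preceq> c}"
  proof clarify
    fix a b c d assume h: "(a,b) \<in> W" "(c,d) \<in> P'" "(a,b) \<preceq> (c,d)"
    then obtain e where e: "e \<in> P" "(c,d) = \<beta> e" using \<beta>(1) unfolding bij_betw_def by blast
    then have "(a,b) \<preceq> e" using \<beta>(2) h(3) fle_trans by metis
    then show "((a,b),(c,d)) \<in> (\<lambda>(r,c). (r, \<beta> c)) ` {(r,c). r \<in> W \<and> c \<in> P \<and> r \<preceq> c}"
      using e h(1) by (intro image_eqI[of _ _ "((a,b),e)"]) auto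
  qed
  then show ?thesis unfolding cnt_def by (rule surj_card_le[OF fin])
qed

section \<open>Representations, Schubert cells and the differential of a pair\<close>

locale quiver =
  fixes Q :: "('v \<times> 'v) list"
begin

abbreviation src :: "nat \<Rightarrow> 'v" where "src k \<equiv> fst (Q ! k)"
abbreviation tgt :: "nat \<Rightarrow> 'v" where "tgt k \<equiv> snd (Q ! k)"
abbreviation arrows :: "nat set" where "arrows \<equiv> {..<length Q}"

definition rep :: "(nat \<Rightarrow> ('v \<times> nat) cmat) \<Rightarrow> bool" where
  "rep f \<longleftrightarrow> (\<forall>k r c. f k r c \<noteq> 0 \<longrightarrow> fst r = tgt k \<and> fst c = src k)"

definition stab :: "(nat \<Rightarrow> ('v \<times> nat) cmat) \<Rightarrow> ('v \<times> nat) set \<Rightarrow> ('v \<times> nat) set \<Rightarrow> bool" where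
  "stab f E K \<longleftrightarrow> (\<forall>k\<in>arrows. \<forall>r\<in>E - K. \<forall>c\<in>K. f k r c = 0)"

text \<open>\<open>epos f E K\<close>: some subrepresentation of \<open>f\<close> lies in the Schubert cell of index \<open>K\<close>.\<close>

definition epos :: "(nat \<Rightarrow> ('v \<times> nat) cmat) \<Rightarrow> ('v \<times> nat) set \<Rightarrow> ('v \<times> nat) set \<Rightarrow> bool" where
  "epos f E K \<longleftrightarrow> K \<subseteq> E \<and> (\<exists>G H. fpair E G H \<and> stab (cj E G H f) E K)"

text \<open>\<open>univ E K\<close>: every representation has a subrepresentation in the Schubert variety of index \<open>K\<close>.\<close>

definition univ :: "('v \<times> nat) set \<Rightarrow> ('v \<times> nat) set \<Rightarrow> bool" where
  "univ E K \<longleftrightarrow> (\<forall>f. rep f \<longrightarrow> (\<exists>K'. below K' K \<and> epos f E K'))"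

text \<open>\<open>Tsurj S f W g\<close>: the differential whose cokernel is the flagged \<open>Ext(f, g)\<close> is surjective.\<close>

definition Tsurj :: "('v \<times> nat) set \<Rightarrow> (nat \<Rightarrow> ('v \<times> nat) cmat) \<Rightarrow> ('v \<times> nat) set \<Rightarrow> (nat \<Rightarrow> ('v \<times> nat) cmat) \<Rightarrow> bool" where
  "Tsurj S f W g \<longleftrightarrow> (\<forall>y. \<exists>\<phi>. flagged \<phi> \<and> (\<forall>k\<in>arrows. \<forall>r\<in>W. \<forall>c\<in>S. fst r = tgt k \<longrightarrow> fst c = src k \<longrightarrow>
     mm S \<phi> (f k) r c - mm W (g k) \<phi> r c = y k r c))"

text \<open>The dimension of the target of the differential in \<open>Tsurj\<close>. It depends only
  on the numbers of indices at each vertex, which is why it is invariant under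
  \<open>below\<close>.\<close>

definition ar :: "('v \<times> nat) set \<Rightarrow> ('v \<times> nat) set \<Rightarrow> nat" where
  "ar S W = card {(k,r,c). k \<in> arrows \<and> r \<in> W \<and> c \<in> S \<and> fst r = tgt k \<and> fst c = src k}"

lemma finite_ar: "finite S \<Longrightarrow> finite W \<Longrightarrow> finite {(k,r,c). k \<in> arrows \<and> r \<in> W \<and> c \<in> S \<and> fst r = tgt k \<and> fst c = src k}"
  by (rule finite_subset[of _ "arrows \<times> W \<times> S"]) auto

lemma finite_cnt: "finite S \<Longrightarrow> finite W \<Longrightarrow> finite {(r,c). r \<in> W \<and> c \<in> S \<and> r \<preceq> c}"
  by (rule finite_subset[of _ "W \<times> S"]) auto

lemma ar_below:
  assumes "below P' P" shows "ar P' W = ar P W"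
proof -
  obtain \<beta> where \<beta>: "bij_betw \<beta> P P'" "\<And>c. c \<in> P \<Longrightarrow> \<beta> c \<preceq> c" using assms(1) unfolding below_def by blast
  have fs: "fst (\<beta> c) = fst c" if "c \<in> P" for c using \<beta>(2)[OF that] by (rule fle_fst)
  have "bij_betw (\<lambda>(k,r,c). (k,r,\<beta> c)) {(k,r,c). k \<in> arrows \<and> r \<in> W \<and> c \<in> P \<and> fst r = tgt k \<and> fst c = src k}
      {(k,r,c). k \<in> arrows \<and> r \<in> W \<and> c \<in> P' \<and> fst r = tgt k \<and> fst c = src k}"
  proof (rule bij_betwI')
    fix x y assume "x \<in> {(k,r,c). k \<in> arrows \<and> r \<in> W \<and> c \<in> P \<and> fst r = tgt k \<and> fst c = src k}"
      "y \<in> {(k,r,c). k \<in> arrows \<and> r \<in> W \<and> c \<in> P \<and> fst r = tgt k \<and> fst c = src k}"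
    then show "((case x of (k, r, c) \<Rightarrow> (k, r, \<beta> c)) = (case y of (k, r, c) \<Rightarrow> (k, r, \<beta> c))) = (x = y)"
      using inj_on_eq_iff[OF bij_betw_imp_inj_on[OF \<beta>(1)]] by (cases x, cases y) (simp del: split_paired_all)
  next
    fix x assume "x \<in> {(k,r,c). k \<in> arrows \<and> r \<in> W \<and> c \<in> P \<and> fst r = tgt k \<and> fst c = src k}"
    moreover obtain k r c where "x = (k,r,c)" by (cases x)
    ultimately show "(case x of (k, r, c) \<Rightarrow> (k, r, \<beta> c)) \<in> {(k,r,c). k \<in> arrows \<and> r \<in> W \<and> c \<in> P' \<and> fst r = tgt k \<and> fst c = src k}"
      using bij_betw_apply[OF \<beta>(1), of c] fs[of c] by simp
  next
    fix y assume y: "y \<in> {(k,r,c). k \<in> arrows \<and> r \<in> W \<and> c \<in> P' \<and> fst r = tgt k \<and> fst c = src k}"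
    obtain k r c where krc: "y = (k,r,c)" by (cases y)
    then obtain e where "e \<in> P" "c = \<beta> e" using y \<beta>(1) unfolding bij_betw_def by blast
    then show "\<exists>x\<in>{(k,r,c). k \<in> arrows \<and> r \<in> W \<and> c \<in> P \<and> fst r = tgt k \<and> fst c = src k}. y = (case x of (k, r, c) \<Rightarrow> (k, r, \<beta> c))"
      using y krc fs by (intro bexI[of _ "(k,r,e)"]) auto
  qed
  from bij_betw_same_card[OF this] show ?thesis unfolding ar_def by simp
qed

definition Top :: "('v \<times> nat) set \<Rightarrow> (nat \<Rightarrow> ('v \<times> nat) cmat) \<Rightarrow> ('v \<times> nat) set \<Rightarrow> (nat \<Rightarrow> ('v \<times> nat) cmat) \<Rightarrow>
    (('v \<times> nat) \<times> ('v \<times> nat) \<Rightarrow> complex) \<Rightarrow> nat \<times> ('v \<times> nat) \<times> ('v \<times> nat) \<Rightarrow> complex" where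
  "Top S f W g \<phi> = (\<lambda>(k,r,c). mm S (curry \<phi>) (f k) r c - mm W (g k) (curry \<phi>) r c)"

lemma linop_Top: "linop (Top S f W g)"
  unfolding linop_def Top_def mm_def curry_def
  by (auto simp: algebra_simps sum.distrib sum_distrib_left)

lemma Tsurj_iff_Top:
  "Tsurj S f W g \<longleftrightarrow> (\<forall>b. \<exists>\<phi>. supp_in {(r,c). r \<in> W \<and> c \<in> S \<and> r \<preceq> c} \<phi> \<and>
     (\<forall>y\<in>{(k,r,c). k \<in> arrows \<and> r \<in> W \<and> c \<in> S \<and> fst r = tgt k \<and> fst c = src k}. Top S f W g \<phi> y = b y))"
  (is "?L \<longleftrightarrow> ?R")
proof
  assume L: ?L
  show ?R
  proof
    fix b
    obtain \<phi> where \<phi>: "flagged \<phi>" "\<forall>k\<in>arrows. \<forall>r\<in>W. \<forall>c\<in>S. fst r = tgt k \<longrightarrow> fst c = src k \<longrightarrow>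
     mm S \<phi> (f k) r c - mm W (g k) \<phi> r c = b (k,r,c)"
      using L[unfolded Tsurj_def, rule_format, of "\<lambda>k r c. b (k,r,c)"] by blast
    define \<psi> where "\<psi> = (\<lambda>(r,c). if r \<in> W \<and> c \<in> S then \<phi> r c else 0)"
    have e: "mm S (curry \<psi>) A r c = mm S \<phi> A r c" if "r \<in> W" for r c A
      using that by (auto simp: mm_def curry_def \<psi>_def)
    have e': "mm W A (curry \<psi>) r c = mm W A \<phi> r c" if "c \<in> S" for r c A
      using that by (auto simp: mm_def curry_def \<psi>_def)
    show "\<exists>\<phi>. supp_in {(r,c). r \<in> W \<and> c \<in> S \<and> r \<preceq> c} \<phi> \<and>
     (\<forall>y\<in>{(k,r,c). k \<in> arrows \<and> r \<in> W \<and> c \<in> S \<and> fst r = tgt k \<and> fst c = src k}. Top S f W g \<phi> y = b y)"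
    proof (intro exI[of _ \<psi>] conjI)
      show "supp_in {(r,c). r \<in> W \<and> c \<in> S \<and> r \<preceq> c} \<psi>"
        using \<phi>(1) by (auto simp: supp_in_def \<psi>_def flagged_def split: if_splits)
      show "\<forall>y\<in>{(k,r,c). k \<in> arrows \<and> r \<in> W \<and> c \<in> S \<and> fst r = tgt k \<and> fst c = src k}. Top S f W g \<psi> y = b y"
        using \<phi>(2) by (auto simp: Top_def e e')
    qed
  qed
next
  assume R: ?R
  show ?L unfolding Tsurj_def
  proof
    fix y
    obtain \<phi> where \<phi>: "supp_in {(r,c). r \<in> W \<and> c \<in> S \<and> r \<preceq> c} \<phi>"
     "\<forall>x\<in>{(k,r,c). k \<in> arrows \<and> r \<in> W \<and> c \<in> S \<and> fst r = tgt k \<and> fst c = src k}. Top S f W g \<phi> x = (\<lambda>(k,r,c). y k r c) x"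
      using R[rule_format, of "\<lambda>(k,r,c). y k r c"] by blast
    show "\<exists>\<phi>. flagged \<phi> \<and> (\<forall>k\<in>arrows. \<forall>r\<in>W. \<forall>c\<in>S. fst r = tgt k \<longrightarrow> fst c = src k \<longrightarrow>
     mm S \<phi> (f k) r c - mm W (g k) \<phi> r c = y k r c)"
    proof (intro exI[of _ "curry \<phi>"] conjI ballI impI)
      show "flagged (curry \<phi>)" using \<phi>(1) by (auto simp: flagged_def supp_in_def)
      fix k r c assume "k \<in> arrows" "r \<in> W" "c \<in> S" "fst r = tgt k" "fst c = src k"
      then show "mm S (curry \<phi>) (f k) r c - mm W (g k) (curry \<phi>) r c = y k r c"
        using bspec[OF \<phi>(2), of "(k,r,c)"] by (simp add: Top_def)
    qed
  qed
qed

lemma Tsurj_imp_count: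
  assumes "Tsurj S f W g" "finite S" "finite W"
  shows "ar S W \<le> cnt S W"
  unfolding ar_def cnt_def
  using assms(1) unfolding Tsurj_iff_Top
  by (intro linop_surjective_imp_card_le[OF linop_Top finite_cnt finite_ar]) (use assms in auto)

text \<open>Right exactness of Ext: surjectivity passes to a subrepresentation of the source and a
  quotient of the target, because at the entries from \<open>P\<close> to \<open>W - M\<close> both
  products involve only indices from \<open>P\<close> and from \<open>W - M\<close>.\<close>

lemma Tsurj_subquotient:
  assumes T: "Tsurj S f W g" and sub: "P \<subseteq> S" "M \<subseteq> W" and fin: "finite S" "finite W"
    and st: "stab f S P" "stab g W M"
  shows "Tsurj P f (W - M) g"
  unfolding Tsurj_def
proof
  fix y
  obtain \<phi> where \<phi>: "flagged \<phi>" "\<And>k r c. k \<in> arrows \<Longrightarrow> r \<in> W \<Longrightarrow> c \<in> S \<Longrightarrow> fst r = tgt k \<Longrightarrow> fst c = src k \<Longrightarrow>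
     mm S \<phi> (f k) r c - mm W (g k) \<phi> r c = y k r c"
    using T[unfolded Tsurj_def, rule_format, of y] by blast
  have "mm P \<phi> (f k) r c - mm (W - M) (g k) \<phi> r c = y k r c"
    if h: "k \<in> arrows" "r \<in> W - M" "c \<in> P" "fst r = tgt k" "fst c = src k" for k r c
  proof -
    have "mm S \<phi> (f k) r c = mm P \<phi> (f k) r c" unfolding mm_def
      using h st(1) sub fin by (intro sum.mono_neutral_right) (auto simp: stab_def)
    moreover have "mm W (g k) \<phi> r c = mm (W - M) (g k) \<phi> r c" unfolding mm_def
      using h st(2) sub fin by (intro sum.mono_neutral_right) (auto simp: stab_def)
    ultimately show ?thesis using \<phi>(2)[of k r c] h sub by auto
  qed
  then show "\<exists>\<phi>. flagged \<phi> \<and> (\<forall>k\<in>arrows. \<forall>r\<in>W - M. \<forall>c\<in>P. fst r = tgt k \<longrightarrow> fst c = src k \<longrightarrow>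
     mm P \<phi> (f k) r c - mm (W - M) (g k) \<phi> r c = y k r c)"
    using \<phi>(1) by blast
qed

lemma mm_conj_product:
  assumes "fpair S G H" "finite S"
  shows "mm S (mm W A (mm S B G)) (mm S H C) = mm W A (mm S B C)"
proof -
  have "mm S G (mm S H C) m c = C m c" if "m \<in> S" for m c by (rule fpair_mm[OF assms that])
  then have "mm S B (mm S G (mm S H C)) = mm S B C" by (simp add: mm_def[of S B])
  then show ?thesis by (simp add: mm_assoc)
qed

text \<open>Solutions are transported by \<phi> \<mapsto> H' \<phi> G, which keeps them
  flagged.\<close>

lemma Tsurj_conj:
  assumes T: "Tsurj S f W g" and p: "fpair S G H" "fpair W G' H'" and fin: "finite S" "finite W"
  shows "Tsurj S (cj S G H f) W (cj W G' H' g)"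
  unfolding Tsurj_def
proof
  fix y :: "nat \<Rightarrow> 'v \<times> nat \<Rightarrow> 'v \<times> nat \<Rightarrow> complex"
  define z where "z k = mm W G' (mm S (y k) H)" for k
  obtain \<phi> where \<phi>: "flagged \<phi>" "\<And>k r c. k \<in> arrows \<Longrightarrow> r \<in> W \<Longrightarrow> c \<in> S \<Longrightarrow> fst r = tgt k \<Longrightarrow> fst c = src k \<Longrightarrow>
     mm S \<phi> (f k) r c - mm W (g k) \<phi> r c = z k r c"
    using T[unfolded Tsurj_def, rule_format, of z] by blast
  define \<psi> where "\<psi> = mm W H' (mm S \<phi> G)"
  have fl: "flagged G" "flagged H" "flagged G'" "flagged H'" using p by (auto simp: fpair_def)
  have "mm S \<psi> (cj S G H f k) r c - mm W (cj W G' H' g k) \<psi> r c = y k r c"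
    if h: "k \<in> arrows" "r \<in> W" "c \<in> S" "fst r = tgt k" "fst c = src k" for k r c
  proof -
    have "mm S \<psi> (cj S G H f k) = mm W H' (mm S \<phi> (mm S (f k) G))"
      unfolding \<psi>_def cj_def using mm_conj_product[OF p(1) fin(1)] by simp
    moreover have "mm W (cj W G' H' g k) \<psi> = mm W H' (mm W (g k) (mm S \<phi> G))"
      unfolding \<psi>_def cj_def using mm_conj_product[OF p(2) fin(2)] by simp
    ultimately have "mm S \<psi> (cj S G H f k) r c - mm W (cj W G' H' g k) \<psi> r c =
        mm W H' (mm S (mm S \<phi> (f k)) G) r c - mm W H' (mm S (mm W (g k) \<phi>) G) r c"
      by (simp add: mm_assoc)
    also have "\<dots> = (\<Sum>m\<in>W. \<Sum>n\<in>S. H' r m * ((mm S \<phi> (f k) m n - mm W (g k) \<phi> m n) * G n c))"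
      unfolding mm_def[of W H'] mm_def[of S _ G]
      by (simp add: sum_distrib_left sum_subtractf[symmetric] algebra_simps)
    \<comment> \<open>The equation of \<open>\<phi>\<close> is available only at entries with the
      vertices of the arrow; at all others a flagged factor vanishes.\<close>
    also have "\<dots> = (\<Sum>m\<in>W. \<Sum>n\<in>S. H' r m * (z k m n * G n c))"
    proof (intro sum.cong refl)
      fix m n assume mn: "m \<in> W" "n \<in> S"
      show "H' r m * ((mm S \<phi> (f k) m n - mm W (g k) \<phi> m n) * G n c) = H' r m * (z k m n * G n c)"
      proof (cases "r \<preceq> m \<and> n \<preceq> c")
        case True
        then have "fst m = tgt k" "fst n = src k" using h fle_fst by metis+
        then show ?thesis using \<phi>(2)[OF h(1) mn] by simp
      next
        case False
        then show ?thesis using flaggedD[OF fl(4), of r m] flaggedD[OF fl(1), of n c] by auto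
      qed
    qed
    also have "\<dots> = mm W H' (mm S (z k) G) r c"
      unfolding mm_def[of W H'] mm_def[of S _ G] by (simp add: sum_distrib_left)
    also have "\<dots> = mm W H' (mm W G' (mm S (mm S (y k) H) G)) r c" unfolding z_def by (simp add: mm_assoc)
    also have "\<dots> = mm S (mm S (y k) H) G r c" by (rule fpair_mm[OF fpair_sym[OF p(2)] fin(2) h(2)])
    also have "\<dots> = y k r c" by (rule fpair_mm_right[OF fpair_sym[OF p(1)] fin(1) h(3)])
    finally show ?thesis .
  qed
  then show "\<exists>\<phi>. flagged \<phi> \<and> (\<forall>k\<in>arrows. \<forall>r\<in>W. \<forall>c\<in>S. fst r = tgt k \<longrightarrow> fst c = src k \<longrightarrow>
     mm S \<phi> (cj S G H f k) r c - mm W (cj W G' H' g k) \<phi> r c = y k r c)"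
    using flagged_mm[OF fl(4) flagged_mm[OF \<phi>(1) fl(1)]] unfolding \<psi>_def by blast
qed

lemma rep_cj: "rep f \<Longrightarrow> fpair S G H \<Longrightarrow> rep (cj S G H f)"
  unfolding rep_def
proof (intro allI impI)
  fix k r c assume f: "\<forall>k r c. f k r c \<noteq> 0 \<longrightarrow> fst r = tgt k \<and> fst c = src k" and p: "fpair S G H" and n: "cj S G H f k r c \<noteq> 0"
  then obtain m where "H r m * mm S (f k) G m c \<noteq> 0" unfolding cj_def mm_def[of S H]
    by (meson sum.not_neutral_contains_not_neutral)
  then have m: "H r m \<noteq> 0" "mm S (f k) G m c \<noteq> 0" by auto
  from m(2) obtain n where "f k m n * G n c \<noteq> 0" unfolding mm_def[of S "f k"]
    by (meson sum.not_neutral_contains_not_neutral)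
  then have "f k m n \<noteq> 0" "G n c \<noteq> 0" by auto
  moreover have "r \<preceq> m" "n \<preceq> c" using p m(1) \<open>G n c \<noteq> 0\<close> unfolding fpair_def flagged_def by blast+
  ultimately show "fst r = tgt k \<and> fst c = src k"
    using f fle_fst by metis
qed

text \<open>The recursion of \<open>in_Shat\<close> on subsets of a finite index set, so that nested
  tuples keep their indices instead of being renumbered; \<open>ar\<close> and \<open>cnt\<close>
  stand for the arrow sum and the height.\<close>

function Sh :: "('v \<times> nat) set \<Rightarrow> ('v \<times> nat) set \<Rightarrow> bool" where
  "Sh E K = (if finite E \<and> K \<subset> E then (\<forall>P. Sh K P \<longrightarrow> ar P (E - K) \<le> cnt P (E - K)) else finite E \<and> K = E)"
  by auto
termination by (relation "Wellfounded.measure (\<lambda>(E,K). card E)") (auto intro: psubset_card_mono)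

declare Sh.simps [simp del]

lemma ar_empty: "ar P {} = 0"
proof -
  have "{(k,r,c). k \<in> arrows \<and> r \<in> {} \<and> c \<in> P \<and> fst r = tgt k \<and> fst c = src k} = {}" by blast
  then show ?thesis unfolding ar_def by (metis card.empty)
qed

lemma Sh_iff: "finite E \<Longrightarrow> Sh E K \<longleftrightarrow> K \<subseteq> E \<and> (\<forall>P. Sh K P \<longrightarrow> ar P (E - K) \<le> cnt P (E - K))"
  using Sh.simps[of E K] ar_empty by (cases "K = E") auto

lemma Sh_subset: "Sh E K \<Longrightarrow> K \<subseteq> E"
  using Sh.simps[of E K] by (auto split: if_splits)

lemma Sh_full: "finite E \<Longrightarrow> Sh E E" using Sh.simps[of E E] by auto

text \<open>For \<open>P\<close> in the recursive set of \<open>K\<close>, the representation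
  \<open>f\<close> on \<open>K\<close> has a subrepresentation at a position below \<open>P\<close>.
  Restricting the surjection to it and comparing dimensions gives the inequality there; returning to
  \<open>P\<close> leaves \<open>ar\<close> unchanged and can only enlarge
  \<open>cnt\<close>.\<close>

lemma Tsurj_imp_Sh:
  assumes T: "Tsurj K f (E - K) g" and f: "rep f" and E: "finite E" "K \<subseteq> E"
    and U: "\<And>P. Sh K P \<Longrightarrow> univ K P"
  shows "Sh E K"
  unfolding Sh_iff[OF E(1)]
proof (intro conjI allI impI E)
  fix P assume P: "Sh K P"
  have fin: "finite K" "finite (E - K)" using E finite_subset by auto
  obtain P' where P': "below P' P" "epos f K P'" using U[OF P] f unfolding univ_def by blast
  then obtain G H where GH: "fpair K G H" "stab (cj K G H f) K P'" "P' \<subseteq> K" unfolding epos_def by blast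
  define I where "I = (\<lambda>r c :: 'v \<times> nat. unit_fun c r)"
  have I: "flagged I" by (auto simp: flagged_def I_def unit_fun_def)
  obtain I' where I': "fpair (E - K) I I'" using fpair_exists[OF fin(2) I] by (auto simp: I_def unit_fun_def)
  have "Tsurj K (cj K G H f) (E - K) (cj (E - K) I I' g)" by (rule Tsurj_conj[OF T GH(1) I' fin])
  from Tsurj_subquotient[OF this GH(3) _ fin GH(2), of "{}"]
  have "Tsurj P' (cj K G H f) (E - K) (cj (E - K) I I' g)" by (simp add: stab_def)
  from Tsurj_imp_count[OF this _ fin(2)] GH(3) fin have "ar P' (E - K) \<le> cnt P' (E - K)"
    using finite_subset by blast
  moreover have "finite P" using Sh_subset[OF P] fin(1) finite_subset by blast
  ultimately show "ar P (E - K) \<le> cnt P (E - K)"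
    using ar_below[OF P'(1), of "E - K"] cnt_below[OF P'(1) _ fin(2)] by simp
qed

definition dgen :: "('v \<times> nat) set \<Rightarrow> (nat \<Rightarrow> ('v \<times> nat) cmat) \<Rightarrow> bool" where
  "dgen E f \<longleftrightarrow> (\<forall>M. \<exists>D. derivation D \<and> (\<forall>k\<in>arrows. \<forall>r\<in>E. \<forall>c\<in>E. fst r = tgt k \<longrightarrow> fst c = src k \<longrightarrow> D (f k r c) = M k r c))"

lemma derivation_mm:
  assumes "derivation D"
  shows "D (mm S A B r c) = mm S (\<lambda>r c. D (A r c)) B r c + mm S A (\<lambda>r c. D (B r c)) r c"
  unfolding mm_def derivation_sum[OF assms] derivation_mult[OF assms] sum.distrib ..

text \<open>Differentiating \<open>f G = G f'\<close> shows that every tangent direction of the space of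
  representations comes from moving the subrepresentation inside its Schubert cell.\<close>

lemma dgen_imp_Tsurj:
  assumes f: "rep f" "dgen E f" and E: "finite E" "K \<subseteq> E" and p: "fpair E G H" and st: "stab (cj E G H f) E K"
  shows "Tsurj K (cj E G H f) (E - K) (cj E G H f)"
  unfolding Tsurj_def
proof
  fix y :: "nat \<Rightarrow> 'v \<times> nat \<Rightarrow> 'v \<times> nat \<Rightarrow> complex"
  define f' where "f' = cj E G H f"
  define z where "z k r c = (if r \<in> E - K \<and> c \<in> K \<and> fst r = tgt k \<and> fst c = src k then y k r c else 0)" for k r c
  \<comment> \<open>The prescribed block, extended by zero and carried back to the original
    coordinates, taken as tangent vector of \<open>f\<close>.\<close>
  define M where "M k = mm E G (mm E (z k) H)" for k
  obtain D where D: "derivation D" "\<And>k r c. k \<in> arrows \<Longrightarrow> r \<in> E \<Longrightarrow> c \<in> E \<Longrightarrow> fst r = tgt k \<Longrightarrow> fst c = src k \<Longrightarrow> D (f k r c) = M k r c"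
    using f(2)[unfolded dgen_def, rule_format, of M] by blast
  have fl: "flagged G" "flagged H" using p by (auto simp: fpair_def)
  have "rep z" by (auto simp: rep_def z_def)
  then have "rep M" unfolding M_def[abs_def] using rep_cj[OF _ fpair_sym[OF p]] unfolding cj_def by blast
  have DM: "D (f k r c) = M k r c" if "k \<in> arrows" "r \<in> E" "c \<in> E" for k r c
  proof (cases "fst r = tgt k \<and> fst c = src k")
    case False
    then have "f k r c = 0" "M k r c = 0" using f(1) \<open>rep M\<close> unfolding rep_def by blast+
    then show ?thesis by (simp add: derivation_0[OF D(1)])
  qed (use D(2) that in auto)
  define DG where "DG r c = D (G r c)" for r c
  have "flagged DG" using fl(1) derivation_0[OF D(1)] unfolding flagged_def DG_def by metis
  \<comment> \<open>The logarithmic derivative of the frame: an infinitesimal motion within the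
    group of flagged matrices.\<close>
  define \<xi> where "\<xi> = mm E H DG"
  have \<xi>: "flagged \<xi>" unfolding \<xi>_def by (rule flagged_mm[OF fl(2) \<open>flagged DG\<close>])
  have "mm K \<xi> (f' k) r c - mm (E - K) (f' k) \<xi> r c = y k r c"
    if h: "k \<in> arrows" "r \<in> E - K" "c \<in> K" "fst r = tgt k" "fst c = src k" for k r c
  proof -
    define Df where "Df r c = D (f' k r c)" for r c
    have eq: "mm E DG (f' k) m c + mm E G Df m c = mm E (M k) G m c + mm E (f k) DG m c" if m: "m \<in> E" for m
    proof -
      have "mm E G (f' k) m c = mm E (f k) G m c"
        unfolding f'_def cj_def by (rule fpair_mm[OF p E(1) m])
      then have "mm E DG (f' k) m c + mm E G Df m c = mm E (\<lambda>r c. D (f k r c)) G m c + mm E (f k) DG m c"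
        unfolding DG_def[abs_def] Df_def[abs_def] derivation_mm[OF D(1), symmetric] by simp
      moreover have "mm E (\<lambda>r c. D (f k r c)) G m c = mm E (M k) G m c"
        unfolding mm_def using DM[OF h(1) m] by simp
      ultimately show ?thesis by simp
    qed
    have rc: "r \<in> E" "c \<in> E" using h E by auto
    have "(\<Sum>m\<in>E. H r m * (mm E DG (f' k) m c + mm E G Df m c)) = (\<Sum>m\<in>E. H r m * (mm E (M k) G m c + mm E (f k) DG m c))"
      using eq by simp
    then have "mm E H (mm E DG (f' k)) r c + mm E H (mm E G Df) r c = mm E H (mm E (M k) G) r c + mm E H (mm E (f k) DG) r c"
      unfolding mm_def[of E H] by (simp add: distrib_left sum.distrib)
    moreover have "mm E H (mm E DG (f' k)) = mm E \<xi> (f' k)" unfolding \<xi>_def by (simp add: mm_assoc)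
    \<comment> \<open>By stability this entry of \<open>f'\<close> is the number 0, so its
      derivative is 0 as well.\<close>
    moreover have "mm E H (mm E G Df) r c = 0"
      using fpair_mm[OF fpair_sym[OF p] E(1) rc(1), of Df c] st h derivation_0[OF D(1)]
      unfolding Df_def f'_def stab_def by simp
    moreover have "mm E H (mm E (M k) G) r c = y k r c"
    proof -
      have "mm E H (mm E (M k) G) r c = mm E H (mm E G (mm E (mm E (z k) H) G)) r c"
        unfolding M_def by (simp add: mm_assoc)
      also have "\<dots> = mm E (mm E (z k) H) G r c" by (rule fpair_mm[OF fpair_sym[OF p] E(1) rc(1)])
      also have "\<dots> = z k r c" by (rule fpair_mm_right[OF fpair_sym[OF p] E(1) rc(2)])
      finally show ?thesis using h by (simp add: z_def)
    qed
    moreover have "mm E H (mm E (f k) DG) r c = mm E (f' k) \<xi> r c"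
    proof -
      have "mm E G \<xi> m c = DG m c" if "m \<in> E" for m unfolding \<xi>_def by (rule fpair_mm[OF p E(1) that])
      then have "mm E (f k) (mm E G \<xi>) m c = mm E (f k) DG m c" for m by (simp add: mm_def[of E "f k"])
      then have "mm E H (mm E (f k) DG) r c = mm E H (mm E (f k) (mm E G \<xi>)) r c" by (simp add: mm_def[of E H])
      then show ?thesis unfolding f'_def cj_def by (simp add: mm_assoc)
    qed
    moreover have "mm E \<xi> (f' k) r c = mm K \<xi> (f' k) r c" unfolding mm_def
      using h st E by (intro sum.mono_neutral_right) (auto simp: stab_def f'_def)
    moreover have "mm E (f' k) \<xi> r c = mm (E - K) (f' k) \<xi> r c" unfolding mm_def
      using h st E by (intro sum.mono_neutral_right) (auto simp: stab_def f'_def)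
    ultimately show ?thesis by (simp add: algebra_simps)
  qed
  then show "\<exists>\<phi>. flagged \<phi> \<and> (\<forall>k\<in>arrows. \<forall>r\<in>E - K. \<forall>c\<in>K. fst r = tgt k \<longrightarrow> fst c = src k \<longrightarrow>
      mm K \<phi> (cj E G H f k) r c - mm (E - K) (cj E G H f k) \<phi> r c = y k r c)"
    using \<xi> unfolding f'_def by blast
qed

lemma dgen_epos_imp_Sh:
  assumes f: "rep f" "dgen E f" and E: "finite E" and ep: "epos f E K" and U: "\<And>P. Sh K P \<Longrightarrow> univ K P"
  shows "Sh E K"
proof -
  obtain G H where GH: "fpair E G H" "stab (cj E G H f) E K" "K \<subseteq> E" using ep unfolding epos_def by blast
  show ?thesis
    by (rule Tsurj_imp_Sh[OF dgen_imp_Tsurj[OF f E GH(3,1,2)] rep_cj[OF f(1) GH(1)] E GH(3) U])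
qed

end

section \<open>Adapted frames of subrepresentations and their specialisation\<close>

lemma mm_nonzero: "mm S A B r c \<noteq> 0 \<Longrightarrow> \<exists>m\<in>S. A r m \<noteq> 0 \<and> B m c \<noteq> 0"
proof (rule ccontr)
  assume "mm S A B r c \<noteq> 0" "\<not> ?thesis"
  moreover have "mm S A B r c = 0" unfolding mm_def using calculation(2) by (intro sum.neutral) auto
  ultimately show False by simp
qed

text \<open>One step of a triangular elimination inside a subspace: the unknowns are the indices of
  \<open>K\<close> up to \<open>c\<close>, the conditions only those strictly before
  \<open>c\<close>, so a nonzero solution remains. The functionals \<open>lf\<close> are left open
  because they are pivot entries for frames along a place and inner products for orthonormal
  frames.\<close>

lemma frame_step:
  fixes lf :: "('v \<times> nat) \<Rightarrow> (('v \<times> nat) \<Rightarrow> complex) \<Rightarrow> complex"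
  assumes E: "finite E" "K \<subseteq> E" and p: "fpair E G H" and c: "c \<in> K"
    and lf: "\<And>c' x y a. lf c' (\<lambda>r. x r + a * y r) = lf c' x + a * lf c' y"
  shows "\<exists>x. supp_in {m\<in>K. m \<preceq> c} x \<and> (\<exists>r\<in>E. ap E G x r \<noteq> 0) \<and>
     (\<forall>c'\<in>K. c' \<preceq> c \<longrightarrow> c' \<noteq> c \<longrightarrow> lf c' (ap E G x) = 0)"
proof -
  define X Y where "X = {m\<in>K. m \<preceq> c}" and "Y = {m\<in>K. m \<preceq> c \<and> m \<noteq> c}"
  have "finite K" using E finite_subset by blast
  then have fin: "finite X" "finite Y" by (auto simp: X_def Y_def)
  have "X = insert c Y" using c by (auto simp: X_def Y_def)
  then have card: "card Y < card X" using fin by (simp add: Y_def)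
  define T where "T x c' = lf c' (ap E G x)" for x c'
  have "T (\<lambda>m. x m + a * y m) c' = T x c' + a * T y c'" for x y a c'
  proof -
    have "ap E G (\<lambda>m. x m + a * y m) = (\<lambda>r. ap E G x r + a * ap E G y r)" by (rule ext, rule ap_lin)
    then show ?thesis unfolding T_def by (simp only: lf)
  qed
  then have "linop T" unfolding linop_def by simp
  from linop_kernel[OF this fin card]
  obtain x where x: "supp_in X x" "\<exists>m\<in>X. x m \<noteq> 0" "\<And>c'. c' \<in> Y \<Longrightarrow> T x c' = 0" by auto
  have "\<exists>r\<in>E. ap E G x r \<noteq> 0"
  proof (rule ccontr)
    assume z: "\<not> ?thesis"
    obtain m where m: "m \<in> E" "x m \<noteq> 0" using x(2) E by (auto simp: X_def)
    have "ap E H (ap E G x) m = 0" using z by (simp add: ap_def[of E H])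
    then show False using fpair_ap[OF fpair_sym[OF p] E(1) m(1)] m(2) by simp
  qed
  moreover have "lf c' (ap E G x) = 0" if "c' \<in> K" "c' \<preceq> c" "c' \<noteq> c" for c'
    using x(3)[of c'] that by (simp add: Y_def T_def)
  ultimately show ?thesis using x(1) unfolding X_def by (intro exI[of _ x]) blast
qed

lemma ap_flagged_supp:
  assumes "flagged G" "supp_in {m\<in>K. m \<preceq> c} x" "ap E G x r \<noteq> 0"
  shows "r \<preceq> c"
proof -
  obtain m where "G r m * x m \<noteq> 0" using assms(3) unfolding ap_def by (meson sum.not_neutral_contains_not_neutral)
  then have "G r m \<noteq> 0" "x m \<noteq> 0" by auto
  then have "r \<preceq> m" "m \<preceq> c" using assms(1,2) by (auto simp: flagged_def supp_in_def)
  then show ?thesis by (rule fle_trans)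
qed

text \<open>Dividing by an entry of least valuation makes the vector integral with nonzero residue;
  dividing further by the last entry of nonzero residue makes the residue vector end with 1 at
  \<open>b\<close>.\<close>

lemma place_normalise:
  assumes pl: "place V \<psi>" and E: "finite E" and nz: "\<exists>r\<in>E. v r \<noteq> 0" and sup: "\<And>r. v r \<noteq> 0 \<Longrightarrow> r \<preceq> c"
  shows "\<exists>b\<in>E. v b \<noteq> 0 \<and> (\<forall>r\<in>E. v r / v b \<in> V) \<and> (\<forall>r\<in>E. b \<preceq> r \<longrightarrow> r \<noteq> b \<longrightarrow> \<psi> (v r / v b) = 0)"
proof -
  obtain m where m: "m \<in> E" "v m \<noteq> 0" "\<And>r. r \<in> E \<Longrightarrow> v r / v m \<in> V"
    using place_pivot[OF pl E nz] by blast
  define B where "B = {r\<in>E. \<psi> (v r / v m) \<noteq> 0}"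
  have B: "finite B" "m \<in> B" using E m place_1[OF pl] by (auto simp: B_def)
  have "Max (snd ` B) \<in> snd ` B" using B by (intro Max_in) auto
  then obtain b where b: "b \<in> B" "snd b = Max (snd ` B)" by force
  have bE: "b \<in> E" "\<psi> (v b / v m) \<noteq> 0" using b by (auto simp: B_def)
  have vb: "v b \<noteq> 0" using bE(2) place_0[OF pl] by auto
  have "1 / (v b / v m) \<in> V" using pl m(3)[OF bE(1)] bE(2) unfolding place_def by blast
  then have inv: "v m / v b \<in> V" by simp
  have q: "v r / v b = (v r / v m) * (v m / v b)" for r using m(2) by simp
  have "v r / v b \<in> V" if "r \<in> E" for r unfolding q[of r] by (intro place_mult[OF pl] m(3) that inv)
  moreover have "\<psi> (v r / v b) = 0" if "r \<in> E" "b \<preceq> r" "r \<noteq> b" for r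
  proof -
    have "r \<notin> B"
    proof
      assume "r \<in> B"
      then have "snd r \<le> snd b" using b(2) B(1) by simp
      then show False using that by (auto simp: fle_def prod_eq_iff)
    qed
    then have "\<psi> (v r / v m) = 0" using that by (simp add: B_def)
    then show ?thesis unfolding q[of r] using place_mult(2)[OF pl m(3)[OF that(1)] inv] by simp
  qed
  ultimately show ?thesis using bE vb by blast
qed

lemma wf_strict_fle: "wf {(x,y). x \<preceq> y \<and> x \<noteq> y}"
  by (rule wf_subset[OF wf_measure[of snd]]) (auto simp: fle_def)

text \<open>Each new vector is required to vanish at the pivots already chosen. Without this
  condition the residues of linearly independent vectors could become dependent.\<close>

lemma place_frame:
  assumes pl: "place V \<psi>" and E: "finite E" "K \<subseteq> E" and p: "fpair E G H"
  shows "\<exists>x b. \<forall>c\<in>K. supp_in {m\<in>K. m \<preceq> c} (x c) \<and> b c \<in> E \<and> b c \<preceq> c \<and> ap E G (x c) (b c) = 1 \<and>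
      (\<forall>r\<in>E. ap E G (x c) r \<in> V) \<and> (\<forall>r\<in>E. b c \<preceq> r \<longrightarrow> r \<noteq> b c \<longrightarrow> \<psi> (ap E G (x c) r) = 0) \<and>
      (\<forall>c'\<in>K. c' \<preceq> c \<longrightarrow> c' \<noteq> c \<longrightarrow> ap E G (x c) (b c') = 0)"
proof -
  define R where "R = {(x :: 'a \<times> nat, y). x \<preceq> y \<and> x \<noteq> y}"
  define P where "P F c xb \<longleftrightarrow> (c \<in> K \<longrightarrow> supp_in {m\<in>K. m \<preceq> c} (fst xb) \<and> snd xb \<in> E \<and> snd xb \<preceq> c \<and> ap E G (fst xb) (snd xb) = 1 \<and>
      (\<forall>r\<in>E. ap E G (fst xb) r \<in> V) \<and> (\<forall>r\<in>E. snd xb \<preceq> r \<longrightarrow> r \<noteq> snd xb \<longrightarrow> \<psi> (ap E G (fst xb) r) = 0) \<and>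
      (\<forall>c'\<in>K. c' \<preceq> c \<longrightarrow> c' \<noteq> c \<longrightarrow> ap E G (fst xb) (snd (F c')) = 0))"
    for F :: "'a \<times> nat \<Rightarrow> ('a \<times> nat \<Rightarrow> complex) \<times> ('a \<times> nat)" and c xb
  have "\<exists>F. \<forall>c. P F c (F c)"
  proof (rule dependent_wf_choice[of R])
    show "wf R" unfolding R_def by (rule wf_strict_fle)
    show "P f x r = P g x r" if "\<And>z. (z, x) \<in> R \<Longrightarrow> f z = g z" for f g x r
    proof -
      have e: "f z = g z" if "z \<preceq> x" "z \<noteq> x" for z using that \<open>\<And>z. (z, x) \<in> R \<Longrightarrow> f z = g z\<close> by (simp add: R_def)
      have "(\<forall>c'\<in>K. c' \<preceq> x \<longrightarrow> c' \<noteq> x \<longrightarrow> ap E G (fst r) (snd (f c')) = 0) \<longleftrightarrow>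
          (\<forall>c'\<in>K. c' \<preceq> x \<longrightarrow> c' \<noteq> x \<longrightarrow> ap E G (fst r) (snd (g c')) = 0)" using e by metis
      then show ?thesis unfolding P_def by (simp only:)
    qed
    fix c and F :: "'a \<times> nat \<Rightarrow> ('a \<times> nat \<Rightarrow> complex) \<times> ('a \<times> nat)"
    show "\<exists>xb. P F c xb"
    proof (cases "c \<in> K")
      case True
      obtain x where x: "supp_in {m\<in>K. m \<preceq> c} x" "\<exists>r\<in>E. ap E G x r \<noteq> 0"
        "\<And>c'. c' \<in> K \<Longrightarrow> c' \<preceq> c \<Longrightarrow> c' \<noteq> c \<Longrightarrow> ap E G x (snd (F c')) = 0"
      proof -
        have "\<exists>x. supp_in {m\<in>K. m \<preceq> c} x \<and> (\<exists>r\<in>E. ap E G x r \<noteq> 0) \<and>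
            (\<forall>c'\<in>K. c' \<preceq> c \<longrightarrow> c' \<noteq> c \<longrightarrow> (\<lambda>c' v. v (snd (F c'))) c' (ap E G x) = 0)"
          by (rule frame_step[OF E p True]) simp
        then show ?thesis using that by blast
      qed
      have fG: "flagged G" using p by (simp add: fpair_def)
      define v where "v = ap E G x"
      have sup: "r \<preceq> c" if "v r \<noteq> 0" for r using ap_flagged_supp[OF fG x(1)] that unfolding v_def .
      obtain b where b: "b \<in> E" "v b \<noteq> 0" "\<And>r. r \<in> E \<Longrightarrow> v r / v b \<in> V"
        "\<And>r. r \<in> E \<Longrightarrow> b \<preceq> r \<Longrightarrow> r \<noteq> b \<Longrightarrow> \<psi> (v r / v b) = 0"
        using place_normalise[OF pl E(1), of v c] x(2) sup unfolding v_def by blast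
      define x' where "x' m = x m / v b" for m
      have v': "ap E G x' r = v r / v b" for r
        unfolding v_def ap_def x'_def sum_divide_distrib by simp
      have "supp_in {m\<in>K. m \<preceq> c} x'" using x(1) by (auto simp: supp_in_def x'_def)
      then have "P F c (x', b)" unfolding P_def using b sup x(3) by (simp add: v' v_def)
      then show ?thesis ..
    qed (simp add: P_def)
  qed
  then obtain F where F: "\<And>c. P F c (F c)" by blast
  show ?thesis
  proof (rule exI[of _ "\<lambda>c. fst (F c)"], rule exI[of _ "\<lambda>c. snd (F c)"], rule ballI)
    fix c assume "c \<in> K"
    then show "supp_in {m\<in>K. m \<preceq> c} (fst (F c)) \<and> snd (F c) \<in> E \<and> snd (F c) \<preceq> c \<and> ap E G (fst (F c)) (snd (F c)) = 1 \<and>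
      (\<forall>r\<in>E. ap E G (fst (F c)) r \<in> V) \<and> (\<forall>r\<in>E. snd (F c) \<preceq> r \<longrightarrow> r \<noteq> snd (F c) \<longrightarrow> \<psi> (ap E G (fst (F c)) r) = 0) \<and>
      (\<forall>c'\<in>K. c' \<preceq> c \<longrightarrow> c' \<noteq> c \<longrightarrow> ap E G (fst (F c)) (snd (F c')) = 0)"
      using F[of c] unfolding P_def by simp
  qed
qed

context quiver
begin

lemma stab_cjI:
  assumes E: "finite E" "K \<subseteq> E" and p: "fpair E G H"
    and inv: "\<And>k c. k \<in> arrows \<Longrightarrow> c \<in> K \<Longrightarrow> \<exists>u. \<forall>r\<in>E. mm E (f k) G r c = (\<Sum>m\<in>K. G r m * u m)"
  shows "stab (cj E G H f) E K"
  unfolding stab_def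
proof (intro ballI)
  fix k r c assume h: "k \<in> arrows" "r \<in> E - K" "c \<in> K"
  obtain u where u: "\<And>r. r \<in> E \<Longrightarrow> mm E (f k) G r c = (\<Sum>m\<in>K. G r m * u m)" using inv[OF h(1,3)] by blast
  define u' where "u' m = (if m \<in> K then u m else 0)" for m
  have "(\<Sum>m\<in>K. G r m * u m) = ap E G u' r" for r
    unfolding ap_def u'_def using E by (intro sum.mono_neutral_cong_left) auto
  then have "cj E G H f k r c = ap E H (ap E G u') r"
    unfolding cj_def mm_def[of E H] ap_def[of E H] using u by simp
  also have "\<dots> = u' r" using h by (intro fpair_ap[OF fpair_sym[OF p] E(1)]) auto
  finally show "cj E G H f k r c = 0" using h by (simp add: u'_def)
qed

lemma stab_invariance:
  assumes E: "finite E" "K \<subseteq> E" and p: "fpair E G H" and st: "stab (cj E G H f) E K"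
    and k: "k \<in> arrows" and x: "supp_in K x"
  shows "\<exists>z. supp_in K z \<and> (\<forall>r\<in>E. ap E (f k) (ap E G x) r = ap E G z r)"
proof (intro exI conjI ballI)
  define z where "z m = (if m \<in> K then ap E (cj E G H f k) x m else 0)" for m
  show "supp_in K z" by (auto simp: supp_in_def z_def)
  have z: "ap E (cj E G H f k) x m = z m" if "m \<in> E" for m
  proof (cases "m \<in> K")
    case False
    have "cj E G H f k m c * x c = 0" for c
      using st k that False x unfolding stab_def supp_in_def by (cases "c \<in> K") auto
    then have "ap E (cj E G H f k) x m = 0" unfolding ap_def by (intro sum.neutral) blast
    then show ?thesis using False by (simp add: z_def)
  qed (simp add: z_def)
  fix r assume r: "r \<in> E"
  have "ap E (f k) (ap E G x) r = ap E G (ap E H (ap E (f k) (ap E G x))) r"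
    using fpair_ap[OF p E(1) r] by simp
  also have "ap E H (ap E (f k) (ap E G x)) = ap E (cj E G H f k) x"
    unfolding cj_def by (simp add: ap_mm)
  also have "ap E G (ap E (cj E G H f k) x) r = ap E G z r"
    using z by (subst ap_cong[of E _ z]) auto
  finally show "ap E (f k) (ap E G x) r = ap E G z r" .
qed

text \<open>Specialising a generic representation along a place, the normalised frame of a
  subrepresentation specialises to a frame whose last nonzero entries can only move down.\<close>

lemma dgen_epos_imp_univ:
  assumes f0: "rep f0" "dgen E f0" and E: "finite E" and ep: "epos f0 E K"
  shows "univ E K"
  unfolding univ_def
proof (intro allI impI)
  fix f1 assume f1: "rep f1"
  obtain G H where p: "fpair E G H" and st: "stab (cj E G H f0) E K" and KE: "K \<subseteq> E"
    using ep unfolding epos_def by blast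
  have finK: "finite K" using KE E finite_subset by blast
  define J where "J = {(k,r,c). k \<in> arrows \<and> r \<in> E \<and> c \<in> E \<and> fst r = tgt k \<and> fst c = src k}"
  have "finite J" unfolding J_def by (rule finite_ar[OF E E])
  moreover have "differentially_generic J (\<lambda>(k,r,c). f0 k r c)"
    unfolding differentially_generic_def
  proof
    fix y
    obtain D where D: "derivation D" "\<forall>k\<in>arrows. \<forall>r\<in>E. \<forall>c\<in>E. fst r = tgt k \<longrightarrow> fst c = src k \<longrightarrow> D (f0 k r c) = y (k,r,c)"
      using f0(2)[unfolded dgen_def, rule_format, of "\<lambda>k r c. y (k,r,c)"] by blast
    have "D (case j of (k,r,c) \<Rightarrow> f0 k r c) = y j" if "j \<in> J" for j
    proof -
      obtain k r c where "j = (k,r,c)" by (cases j)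
      then show ?thesis using that D(2) by (simp add: J_def)
    qed
    then show "\<exists>D. derivation D \<and> (\<forall>j\<in>J. D (case j of (k,r,c) \<Rightarrow> f0 k r c) = y j)" using D(1) by blast
  qed
  ultimately obtain V \<psi> where pl: "place V \<psi>" and
    sp: "\<And>j. j \<in> J \<Longrightarrow> (\<lambda>(k,r,c). f0 k r c) j \<in> V \<and> \<psi> ((\<lambda>(k,r,c). f0 k r c) j) = (\<lambda>(k,r,c). f1 k r c) j"
    using differentially_generic_specialises[of J "\<lambda>(k,r,c). f0 k r c" "\<lambda>(k,r,c). f1 k r c"] by blast
  have spec: "f0 k r c \<in> V" "\<psi> (f0 k r c) = f1 k r c" if "k \<in> arrows" "r \<in> E" "c \<in> E" for k r c
  proof -
    have "f0 k r c \<in> V \<and> \<psi> (f0 k r c) = f1 k r c"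
    proof (cases "fst r = tgt k \<and> fst c = src k")
      case True
      then show ?thesis using sp[of "(k,r,c)"] that by (simp add: J_def)
    next
      case False
      then have "f0 k r c = 0" "f1 k r c = 0" using f0(1) f1 unfolding rep_def by blast+
      then show ?thesis using place_0[OF pl] by simp
    qed
    then show "f0 k r c \<in> V" "\<psi> (f0 k r c) = f1 k r c" by auto
  qed
  obtain x b where fr0: "\<forall>c\<in>K. supp_in {m\<in>K. m \<preceq> c} (x c) \<and> b c \<in> E \<and> b c \<preceq> c \<and> ap E G (x c) (b c) = 1 \<and>
      (\<forall>r\<in>E. ap E G (x c) r \<in> V) \<and> (\<forall>r\<in>E. b c \<preceq> r \<longrightarrow> r \<noteq> b c \<longrightarrow> \<psi> (ap E G (x c) r) = 0) \<and>
      (\<forall>c'\<in>K. c' \<preceq> c \<longrightarrow> c' \<noteq> c \<longrightarrow> ap E G (x c) (b c') = 0)"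
    using place_frame[OF pl E KE p] by (elim exE)
  have fr1: "supp_in {m\<in>K. m \<preceq> c} (x c)" "b c \<in> E" "b c \<preceq> c" "ap E G (x c) (b c) = 1" if "c \<in> K" for c
    using bspec[OF fr0 that] by simp_all
  have fr2: "ap E G (x c) r \<in> V" "b c \<preceq> r \<Longrightarrow> r \<noteq> b c \<Longrightarrow> \<psi> (ap E G (x c) r) = 0" if "c \<in> K" "r \<in> E" for c r
    using bspec[OF fr0 that(1)] that(2) by simp_all
  have fr3: "ap E G (x c) (b c') = 0" if "c \<in> K" "c' \<in> K" "c' \<preceq> c" "c' \<noteq> c" for c c'
    using bspec[OF fr0 that(1)] that by simp
  note fr = fr1 fr2 fr3
  define v where "v c = ap E G (x c)" for c
  have fG: "flagged G" using p by (simp add: fpair_def)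
  have vsup: "r \<preceq> c" if "c \<in> K" "v c r \<noteq> 0" for c r
    using ap_flagged_supp[OF fG fr(1)[OF that(1)]] that(2) unfolding v_def .
  \<comment> \<open>The matrix of pivot entries is unitriangular: different vertices do not
    interact, and at earlier pivots the vectors vanish by construction.\<close>
  have v0: "v c (b c') = 0" if "c \<in> K" "c' \<in> K" "\<not> c \<preceq> c'" for c c'
  proof (cases "fst c = fst c'")
    case True
    then have "c' \<preceq> c" "c' \<noteq> c" using fle_total[OF True] that(3) by auto
    then show ?thesis using fr(7)[OF that(1,2)] by (simp add: v_def)
  next
    case False
    show ?thesis
    proof (rule ccontr)
      assume "v c (b c') \<noteq> 0"
      then show False using vsup[OF that(1)] fr(3)[OF that(2)] False fle_fst by metis
    qed
  qed
  have triang: "(\<Sum>c\<in>K. u c * v c (b c0)) = u c0 + (\<Sum>c\<in>{c\<in>K. c \<preceq> c0 \<and> c \<noteq> c0}. u c * v c (b c0))"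
    if "c0 \<in> K" for u c0
  proof -
    have "(\<Sum>c\<in>K. u c * v c (b c0)) = (\<Sum>c\<in>insert c0 {c\<in>K. c \<preceq> c0 \<and> c \<noteq> c0}. u c * v c (b c0))"
      using finK that v0[OF _ that] by (intro sum.mono_neutral_right) auto
    then show ?thesis using finK fr(4)[OF that] by (simp add: v_def)
  qed
  have inj: "u c0 = 0" if "c0 \<in> K" "\<And>r. r \<in> E \<Longrightarrow> (\<Sum>c\<in>K. u c * v c r) = 0" for u c0
    using that(1)
  proof (induction c0 rule: wf_induct_rule[OF wf_strict_fle])
    case (1 c0)
    have "(\<Sum>c\<in>{c\<in>K. c \<preceq> c0 \<and> c \<noteq> c0}. u c * v c (b c0)) = 0"
      using 1 by (intro sum.neutral) auto
    then show ?case using triang[OF 1(2), of u] that(2)[OF fr(2)[OF 1(2)]] by simp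
  qed
  have binj: "inj_on b K"
  proof (rule inj_onI, rule ccontr)
    fix c c' assume h: "c \<in> K" "c' \<in> K" "b c = b c'" "c \<noteq> c'"
    have n: "v c (b c') \<noteq> 0" "v c' (b c) \<noteq> 0" using fr(4) h unfolding v_def by (metis zero_neq_one)+
    then have "c \<preceq> c'" "c' \<preceq> c" using v0 h by blast+
    then show False using h(4) fle_antisym by blast
  qed
  define K' where "K' = b ` K"
  have bel: "below K' K" unfolding below_def K'_def using binj fr(3) by (intro exI[of _ b]) (auto simp: bij_betw_def)
  have K'E: "K' \<subseteq> E" using fr(2) by (auto simp: K'_def)
  \<comment> \<open>Residues of the frame vectors as columns at the pivots, unit vectors at all
    other positions. A residue vector is 1 at its pivot and 0 beyond it, so the matrix is flagged
    with nonzero diagonal.\<close>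
  define G1 where "G1 r e = (if e \<in> K' then (if r \<in> E then \<psi> (v (inv_into K b e) r) else 0) else unit_fun e r)" for r e
  have G1b: "G1 r (b c) = (if r \<in> E then \<psi> (v c r) else 0)" if "c \<in> K" for r c
    using that binj by (simp add: G1_def K'_def)
  have fl1: "flagged G1" unfolding flagged_def
  proof (intro allI impI)
    fix r e assume n: "G1 r e \<noteq> 0"
    show "r \<preceq> e"
    proof (cases "e \<in> K'")
      case True
      then obtain c where c: "c \<in> K" "e = b c" by (auto simp: K'_def)
      then have r: "r \<in> E" "\<psi> (v c r) \<noteq> 0" using n G1b by (auto split: if_splits)
      then have "v c r \<noteq> 0" using place_0[OF pl] by metis
      then have "fst r = fst (b c)" using vsup[OF c(1)] fr(3)[OF c(1)] fle_fst by metis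
      then show ?thesis using fle_total[of r "b c"] fr(6)[OF c(1) r(1)] r(2) c(2) unfolding v_def by auto
    next
      case False
      then show ?thesis using n by (auto simp: G1_def unit_fun_def split: if_splits)
    qed
  qed
  have "G1 e e \<noteq> 0" if "e \<in> E" for e
  proof (cases "e \<in> K'")
    case True
    then obtain c where "c \<in> K" "e = b c" by (auto simp: K'_def)
    then show ?thesis using G1b that fr(4) place_1[OF pl] by (simp add: v_def)
  qed (simp add: G1_def unit_fun_def)
  then obtain H1 where p1: "fpair E G1 H1" using fpair_exists[OF E fl1] by blast
  have "stab (cj E G1 H1 f1) E K'"
  proof (rule stab_cjI[OF E K'E p1])
    fix k e assume k: "k \<in> arrows" and e: "e \<in> K'"
    then obtain c where c: "c \<in> K" "e = b c" by (auto simp: K'_def)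
    have xs: "supp_in K (x c)" if "c \<in> K" for c using fr(1)[OF that] by (auto simp: supp_in_def)
    obtain z where z: "supp_in K z" "\<And>r. r \<in> E \<Longrightarrow> ap E (f0 k) (v c) r = ap E G z r"
      using stab_invariance[OF E KE p st k xs[OF c(1)]] unfolding v_def by blast
    define T where "T u m = (\<Sum>c\<in>K. x c m * u c)" for u m
    have T: "linop T" unfolding linop_def T_def by (simp add: algebra_simps sum.distrib sum_distrib_left)
    have vT: "ap E G (T u) r = (\<Sum>c\<in>K. u c * v c r)" for u r
      unfolding T_def v_def ap_def sum_distrib_left by (subst sum.swap) (simp add: mult_ac)
    have Tsupp: "supp_in K (T u)" for u unfolding supp_in_def T_def
    proof (intro allI impI)
      fix m assume "(\<Sum>c\<in>K. x c m * u c) \<noteq> 0"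
      then obtain c where "c \<in> K" "x c m * u c \<noteq> 0" by (meson sum.not_neutral_contains_not_neutral)
      then show "m \<in> K" using xs[of c] by (auto simp: supp_in_def)
    qed
    \<comment> \<open>The frame is a basis of the subrepresentation, so the image of a frame vector
      can be expanded in it.\<close>
    have "\<exists>u. supp_in K u \<and> (\<forall>m\<in>K. T u m = z m)"
    proof (rule linop_injective_imp_surjective[OF T finK finK])
      fix u assume u: "supp_in K u" "\<forall>y\<in>K. T u y = 0"
      then have "T u = (\<lambda>_. 0)" using Tsupp[of u] unfolding supp_in_def by blast
      then have "(\<Sum>c\<in>K. u c * v c r) = 0" for r using vT[of u r] by (simp add: ap_def)
      then have "u c = 0" if "c \<in> K" for c using inj[OF that] by blast
      moreover have "u c = 0" if "c \<notin> K" for c using u(1) that by (auto simp: supp_in_def)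
      ultimately show "u = (\<lambda>_. 0)" by blast
    qed simp
    then obtain u where u: "supp_in K u" "\<And>m. m \<in> K \<Longrightarrow> T u m = z m" by blast
    have "T u = z"
    proof
      fix m show "T u m = z m"
        using Tsupp[of u] z(1) u(2)[of m] unfolding supp_in_def by metis
    qed
    then have uv: "ap E (f0 k) (v c) r = (\<Sum>c\<in>K. u c * v c r)" if "r \<in> E" for r
      using vT[of u r] z(2)[OF that] by simp
    have vV: "v c r \<in> V" if "c \<in> K" "r \<in> E" for c r using fr(5)[OF that] by (simp add: v_def)
    have w: "ap E (f0 k) (v c) r \<in> V \<and> \<psi> (ap E (f0 k) (v c) r) = (\<Sum>m\<in>E. f1 k r m * \<psi> (v c m))" if r: "r \<in> E" for r
    proof -
      have "f0 k r m * v c m \<in> V" "\<psi> (f0 k r m * v c m) = f1 k r m * \<psi> (v c m)" if "m \<in> E" for m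
        using place_mult[OF pl spec(1)[OF k r that] vV[OF c(1) that]] spec(2)[OF k r that] by auto
      then show ?thesis unfolding ap_def using place_sum[OF pl, of E "\<lambda>m. f0 k r m * v c m"] by simp
    qed
    \<comment> \<open>The expansion coefficients result from unitriangular substitution with
      integral data, hence lie in the valuation ring and can be specialised.\<close>
    have uV: "u c0 \<in> V" if "c0 \<in> K" for c0
      using that
    proof (induction c0 rule: wf_induct_rule[OF wf_strict_fle])
      case (1 c0)
      have "u c0 = ap E (f0 k) (v c) (b c0) - (\<Sum>c\<in>{c\<in>K. c \<preceq> c0 \<and> c \<noteq> c0}. u c * v c (b c0))"
        using triang[OF 1(2), of u] uv[OF fr(2)[OF 1(2)]] by simp
      moreover have "(\<Sum>c\<in>{c\<in>K. c \<preceq> c0 \<and> c \<noteq> c0}. u c * v c (b c0)) \<in> V"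
        using 1 vV fr(2) by (intro conjunct1[OF place_sum[OF pl]] place_mult(1)[OF pl]) auto
      ultimately show ?case using place_diff(1)[OF pl conjunct1[OF w[OF fr(2)[OF 1(2)]]]] by simp
    qed
    show "\<exists>u. \<forall>r\<in>E. mm E (f1 k) G1 r e = (\<Sum>m\<in>K'. G1 r m * u m)"
    proof (intro exI ballI)
      fix r assume r: "r \<in> E"
      have "mm E (f1 k) G1 r e = (\<Sum>m\<in>E. f1 k r m * \<psi> (v c m))"
        unfolding mm_def c(2) G1b[OF c(1)] by simp
      also have "\<dots> = \<psi> (\<Sum>c\<in>K. u c * v c r)" using w[OF r] uv[OF r] by simp
      also have "\<dots> = (\<Sum>c\<in>K. \<psi> (u c) * \<psi> (v c r))"
        using place_sum[OF pl, of K "\<lambda>c. u c * v c r"] place_mult[OF pl uV vV[OF _ r]] by simp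
      also have "\<dots> = (\<Sum>c\<in>K. G1 r (b c) * \<psi> (u (inv_into K b (b c))))"
        using G1b r binj by (intro sum.cong) (auto simp: mult.commute)
      also have "\<dots> = (\<Sum>m\<in>K'. G1 r m * \<psi> (u (inv_into K b m)))"
        unfolding K'_def by (subst sum.reindex[OF binj]) simp
      finally show "mm E (f1 k) G1 r e = (\<Sum>m\<in>K'. G1 r m * \<psi> (u (inv_into K b m)))" .
    qed
  qed
  then have "epos f1 E K'" unfolding epos_def using K'E p1 by blast
  then show "\<exists>K'. below K' K \<and> epos f1 E K'" using bel by blast
qed

text \<open>Joint genericity: a single derivation has to produce both tangent vectors, which is more
  than \<open>dgen\<close> for each of the two.\<close>

definition jgen :: "('v \<times> nat) set \<Rightarrow> (nat \<Rightarrow> ('v \<times> nat) cmat) \<Rightarrow> ('v \<times> nat) set \<Rightarrow> (nat \<Rightarrow> ('v \<times> nat) cmat) \<Rightarrow> bool" where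
  "jgen S f W g \<longleftrightarrow> (\<forall>M N. \<exists>D. derivation D \<and>
     (\<forall>k\<in>arrows. \<forall>r\<in>S. \<forall>c\<in>S. fst r = tgt k \<longrightarrow> fst c = src k \<longrightarrow> D (f k r c) = M k r c) \<and>
     (\<forall>k\<in>arrows. \<forall>r\<in>W. \<forall>c\<in>W. fst r = tgt k \<longrightarrow> fst c = src k \<longrightarrow> D (g k r c) = N k r c))"

lemma mm_lin_left: "mm S (\<lambda>r c. A r c + B r c) C r c = mm S A C r c + mm S B C r c"
  by (simp add: mm_def algebra_simps sum.distrib)
lemma mm_lin_right: "mm S C (\<lambda>r c. A r c + B r c) r c = mm S C A r c + mm S C B r c"
  by (simp add: mm_def algebra_simps sum.distrib)
lemma mm_uminus_right: "mm S C (\<lambda>r c. - A r c) r c = - mm S C A r c"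
  by (simp add: mm_def sum_negf)
lemma mm_uminus_left: "mm S (\<lambda>r c. - A r c) C r c = - mm S A C r c"
  by (simp add: mm_def sum_negf)

lemma mm_lin_left_fun: "mm S (\<lambda>r c. A r c + B r c) C = (\<lambda>r c. mm S A C r c + mm S B C r c)"
  by (intro ext mm_lin_left)
lemma mm_uminus_left_fun: "mm S (\<lambda>r c. - A r c) C = (\<lambda>r c. - mm S A C r c)"
  by (intro ext mm_uminus_left)

lemma mm_unit_left: "finite S \<Longrightarrow> r \<in> S \<Longrightarrow> mm S (\<lambda>r c. unit_fun c r) A r c = A r c"
  unfolding mm_eq_ap by (rule ap_unit) auto
lemma mm_unit_right: "finite S \<Longrightarrow> c \<in> S \<Longrightarrow> mm S A (\<lambda>r c. unit_fun c r) r c = A r c"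
  unfolding mm_def unit_fun_def by (simp add: if_distrib[of "\<lambda>b. _ * b"] cong: if_cong)

lemma generic_numbers_exist:
  assumes "finite J" shows "\<exists>x. differentially_generic J x"
  using generic_element_of_subspace[OF assms, of "{}" UNIV] unfolding differentially_generic_def by auto

text \<open>Conjugates of block triangular \<open>f'\<close> by \<open>G = 1 + uu\<close>, with
  \<open>uu\<close> flagged from \<open>K\<close> to \<open>W\<close>, form a family of
  representations with a subrepresentation in the cell of \<open>K\<close>. Its tangent space
  consists of the block triangular matrices and the image of the differential, so
  \<open>Tsurj\<close> makes it everything. A member with generic parameters is thus a generic
  representation, and specialisation gives all others.\<close>

lemma Tsurj_generic_imp_univ:
  assumes E: "finite E" "K \<subseteq> E"
    and T: "\<And>f g. rep f \<Longrightarrow> rep g \<Longrightarrow> jgen K f (E - K) g \<Longrightarrow> Tsurj K f (E - K) g"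
  shows "univ E K"
proof -
  define W where "W = E - K"
  define J where "J = (Inl ` (arrows \<times> E \<times> E) \<union> Inr ` (E \<times> E) :: (nat \<times> ('v \<times> nat) \<times> ('v \<times> nat) + ('v \<times> nat) \<times> ('v \<times> nat)) set)"
  have "finite J" using E by (simp add: J_def)
  then obtain x where x: "differentially_generic J x" using generic_numbers_exist by blast
  define blk where "blk k r c \<longleftrightarrow> r \<in> E \<and> c \<in> E \<and> fst r = tgt k \<and> fst c = src k" for k r c
  define f' where "f' k r c = (if blk k r c \<and> \<not> (r \<in> W \<and> c \<in> K) then x (Inl (k,r,c)) else 0)" for k r c
  define uu where "uu r c = (if r \<in> W \<and> c \<in> K \<and> r \<preceq> c then x (Inr (r,c)) else 0)" for r c
  have D: "\<exists>D. derivation D \<and> (\<forall>k\<in>arrows. \<forall>r c. blk k r c \<and> \<not> (r \<in> W \<and> c \<in> K) \<longrightarrow> D (f' k r c) = M k r c) \<and>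
      (\<forall>r c. r \<in> W \<and> c \<in> K \<and> r \<preceq> c \<longrightarrow> D (uu r c) = N r c)" for M N
  proof -
    obtain D where D: "derivation D" "\<And>j. j \<in> J \<Longrightarrow> D (x j) = (\<lambda>j. case j of Inl (k,r,c) \<Rightarrow> M k r c | Inr (r,c) \<Rightarrow> N r c) j"
      using x[unfolded differentially_generic_def, rule_format, of "\<lambda>j. case j of Inl (k,r,c) \<Rightarrow> M k r c | Inr (r,c) \<Rightarrow> N r c"] by blast
    have "D (f' k r c) = M k r c" if "k \<in> arrows" "blk k r c" "\<not> (r \<in> W \<and> c \<in> K)" for k r c
      using D(2)[of "Inl (k,r,c)"] that by (auto simp: f'_def J_def blk_def)
    moreover have "D (uu r c) = N r c" if "r \<in> W" "c \<in> K" "r \<preceq> c" for r c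
      using D(2)[of "Inr (r,c)"] that E by (auto simp: uu_def J_def W_def)
    ultimately show ?thesis using D(1) by blast
  qed
  have f': "rep f'" by (auto simp: rep_def f'_def blk_def split: if_splits)
  have "jgen K f' W f'"
    unfolding jgen_def
  proof (intro allI)
    fix M N :: "nat \<Rightarrow> 'v \<times> nat \<Rightarrow> 'v \<times> nat \<Rightarrow> complex"
    obtain D where "derivation D" "\<And>k r c. k \<in> arrows \<Longrightarrow> blk k r c \<and> \<not> (r \<in> W \<and> c \<in> K) \<Longrightarrow> D (f' k r c) = (if r \<in> K then M k r c else N k r c)"
      using D[of "\<lambda>k r c. if r \<in> K then M k r c else N k r c" "\<lambda>_ _. 0"] by blast
    note DD = this
    show "\<exists>D. derivation D \<and>
     (\<forall>k\<in>arrows. \<forall>r\<in>K. \<forall>c\<in>K. fst r = tgt k \<longrightarrow> fst c = src k \<longrightarrow> D (f' k r c) = M k r c) \<and>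
     (\<forall>k\<in>arrows. \<forall>r\<in>W. \<forall>c\<in>W. fst r = tgt k \<longrightarrow> fst c = src k \<longrightarrow> D (f' k r c) = N k r c)"
    proof (intro exI[of _ D] conjI ballI impI DD(1))
      fix k r c assume "k \<in> arrows" "r \<in> K" "c \<in> K" "fst r = tgt k" "fst c = src k"
      then show "D (f' k r c) = M k r c" using DD(2)[of k r c] E by (auto simp: blk_def W_def)
    next
      fix k r c assume "k \<in> arrows" "r \<in> W" "c \<in> W" "fst r = tgt k" "fst c = src k"
      then show "D (f' k r c) = N k r c" using DD(2)[of k r c] E by (auto simp: blk_def W_def)
    qed
  qed
  then have Ts: "Tsurj K f' W f'" using T[OF f' f'] by (simp add: W_def)
  define G where "G r c = unit_fun c r + uu r c" for r c
  define H where "H r c = unit_fun c r + (- uu r c)" for r c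
  have KW: "c \<notin> W" if "c \<in> K" for c using that by (simp add: W_def)
  \<comment> \<open>Matrices supported on \<open>W \<times> K\<close> have product zero.\<close>
  have nil: "mm E A B = (\<lambda>_ _. 0)" if "\<And>r c. A r c \<noteq> 0 \<Longrightarrow> c \<in> K" "\<And>r c. B r c \<noteq> 0 \<Longrightarrow> r \<in> W" for A B
  proof (intro ext)
    fix r c
    have "A r m * B m c = 0" for m using that KW by (metis mult_eq_0_iff)
    then show "mm E A B r c = 0" unfolding mm_def by (intro sum.neutral) blast
  qed
  have uuWK: "r \<in> W \<and> c \<in> K \<and> r \<preceq> c" if "uu r c \<noteq> 0" for r c using that by (auto simp: uu_def split: if_splits)
  have absorb_left: "mm E G B r c = B r c" "mm E H B r c = B r c" if "r \<in> E" "\<And>r c. B r c \<noteq> 0 \<Longrightarrow> r \<in> W" for B r c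
    using mm_unit_left[OF E(1) that(1), of B c] nil[of uu B] uuWK that(2)
    unfolding G_def[abs_def] H_def[abs_def] mm_lin_left mm_uminus_left by auto
  have absorb_right: "mm E B G r c = B r c" "mm E B H r c = B r c" if "c \<in> E" "\<And>r c. B r c \<noteq> 0 \<Longrightarrow> c \<in> K" for B r c
    using mm_unit_right[OF E(1) that(1), of B r] nil[of B uu] uuWK that(2)
    unfolding G_def[abs_def] H_def[abs_def] mm_lin_right mm_uminus_right by auto
  have p: "fpair E G H"
    unfolding fpair_def
  proof (intro conjI ballI)
    show "flagged G" "flagged H" using uuWK by (auto simp: flagged_def G_def H_def unit_fun_def split: if_splits)
    fix r c assume rc: "r \<in> E" "c \<in> E"
    have "mm E G H r c = mm E G (\<lambda>r c. unit_fun c r) r c - mm E G uu r c"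
      unfolding H_def[abs_def] mm_lin_right mm_uminus_right by simp
    also have "\<dots> = G r c - uu r c" using mm_unit_right[OF E(1) rc(2)] absorb_left[OF rc(1), of uu] uuWK by auto
    finally show "mm E G H r c = unit_fun c r" by (simp add: G_def)
    have "mm E H G r c = mm E H (\<lambda>r c. unit_fun c r) r c + mm E H uu r c"
      unfolding G_def[abs_def] mm_lin_right by simp
    also have "\<dots> = H r c + uu r c" using mm_unit_right[OF E(1) rc(2)] absorb_left[OF rc(1), of uu] uuWK by auto
    finally show "mm E H G r c = unit_fun c r" by (simp add: H_def)
  qed
  define f where "f = cj E H G f'"
  have f: "rep f" unfolding f_def by (rule rep_cj[OF f' fpair_sym[OF p]])
  have cjf: "cj E G H f k r c = f' k r c" if "r \<in> E" "c \<in> E" for k r c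
  proof -
    have "cj E G H f k r c = mm E H (mm E G (mm E (mm E (f' k) H) G)) r c"
      unfolding cj_def f_def by (simp add: mm_assoc)
    also have "\<dots> = mm E (mm E (f' k) H) G r c" by (rule fpair_mm[OF fpair_sym[OF p] E(1) that(1)])
    also have "\<dots> = f' k r c" by (rule fpair_mm_right[OF fpair_sym[OF p] E(1) that(2)])
    finally show ?thesis .
  qed
  have "stab (cj E G H f) E K" unfolding stab_def
  proof (intro ballI)
    fix k r c assume "k \<in> arrows" "r \<in> E - K" "c \<in> K"
    then show "cj E G H f k r c = 0" using cjf[of r c k] E(2) by (auto simp: f'_def W_def)
  qed
  then have ep: "epos f E K" unfolding epos_def using p E(2) by blast
  have "dgen E f" unfolding dgen_def
  proof
    fix M0 :: "nat \<Rightarrow> 'v \<times> nat \<Rightarrow> 'v \<times> nat \<Rightarrow> complex"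
    define M where "M k r c = (if fst r = tgt k \<and> fst c = src k then M0 k r c else 0)" for k r c
    have rM: "rep M" by (auto simp: rep_def M_def)
    define M' where "M' = cj E G H M"
    have rM': "rep M'" unfolding M'_def by (rule rep_cj[OF rM p])
    \<comment> \<open>This is the use of \<open>Tsurj\<close>: the block from \<open>K\<close> to
      \<open>W\<close> of the transported tangent vector is produced by moving the frame.\<close>
    obtain \<xi>0 where \<xi>0: "flagged \<xi>0" "\<And>k r c. k \<in> arrows \<Longrightarrow> r \<in> W \<Longrightarrow> c \<in> K \<Longrightarrow> fst r = tgt k \<Longrightarrow> fst c = src k \<Longrightarrow>
        mm K \<xi>0 (f' k) r c - mm W (f' k) \<xi>0 r c = M' k r c"
      using Ts[unfolded Tsurj_def, rule_format, of M'] by blast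
    define \<xi> where "\<xi> r c = (if r \<in> W \<and> c \<in> K then \<xi>0 r c else 0)" for r c
    have \<xi>WK: "r \<in> W \<and> c \<in> K \<and> r \<preceq> c" if "\<xi> r c \<noteq> 0" for r c
      using that \<xi>0(1) by (auto simp: \<xi>_def flagged_def split: if_splits)
    have \<xi>eq: "mm E \<xi> (f' k) r c - mm E (f' k) \<xi> r c = M' k r c"
      if h: "k \<in> arrows" "r \<in> W" "c \<in> K" "fst r = tgt k" "fst c = src k" for k r c
    proof -
      have "mm E \<xi> (f' k) r c = mm K \<xi>0 (f' k) r c" unfolding mm_def
        using E h by (intro sum.mono_neutral_cong_right) (auto simp: \<xi>_def)
      moreover have "mm E (f' k) \<xi> r c = mm W (f' k) \<xi>0 r c" unfolding mm_def
        using E h by (intro sum.mono_neutral_cong_right) (auto simp: \<xi>_def W_def)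
      ultimately show ?thesis using \<xi>0(2)[OF h] by simp
    qed
    \<comment> \<open>What the motion of the frame does not account for is assigned to the free
      entries of \<open>f'\<close>.\<close>
    define N where "N k r c = M' k r c - (mm E \<xi> (f' k) r c - mm E (f' k) \<xi> r c)" for k r c
    obtain D where D: "derivation D" "\<And>k r c. k \<in> arrows \<Longrightarrow> blk k r c \<Longrightarrow> \<not> (r \<in> W \<and> c \<in> K) \<Longrightarrow> D (f' k r c) = N k r c"
      "\<And>r c. r \<in> W \<Longrightarrow> c \<in> K \<Longrightarrow> r \<preceq> c \<Longrightarrow> D (uu r c) = \<xi> r c"
      using D[of N \<xi>] by blast
    have Duu: "D (uu r c) = \<xi> r c" for r c
      using D(3)[of r c] \<xi>WK[of r c] derivation_0[OF D(1)] by (auto simp: uu_def)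
    have Dunit: "D (unit_fun a r) = 0" for a r :: "'v \<times> nat"
      by (simp add: unit_fun_def derivation_0[OF D(1)] derivation_1[OF D(1)])
    have DG: "D (G r c) = \<xi> r c" for r c
      unfolding G_def derivation_add[OF D(1)] Duu Dunit by simp
    have DH: "D (H r c) = - \<xi> r c" for r c
      unfolding H_def derivation_add[OF D(1)] derivation_uminus[OF D(1)] Duu Dunit by simp
    have r\<xi>: "rep (\<lambda>k r c. mm E \<xi> (f' k) r c)" "rep (\<lambda>k r c. mm E (f' k) \<xi> r c)"
    proof -
      have "fst r = tgt k \<and> fst c = src k" if "mm E \<xi> (f' k) r c \<noteq> 0" for k r c
      proof -
        from mm_nonzero[OF that] obtain m where m: "\<xi> r m \<noteq> 0" "f' k m c \<noteq> 0" by blast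
        then show ?thesis using \<xi>WK[OF m(1)] f' fle_fst[of r m] unfolding rep_def by metis
      qed
      moreover have "fst r = tgt k \<and> fst c = src k" if "mm E (f' k) \<xi> r c \<noteq> 0" for k r c
      proof -
        from mm_nonzero[OF that] obtain m where m: "f' k r m \<noteq> 0" "\<xi> m c \<noteq> 0" by blast
        then show ?thesis using \<xi>WK[OF m(2)] f' fle_fst[of m c] unfolding rep_def by metis
      qed
      ultimately show "rep (\<lambda>k r c. mm E \<xi> (f' k) r c)" "rep (\<lambda>k r c. mm E (f' k) \<xi> r c)" by (auto simp: rep_def)
    qed
    have key: "M' k r c = D (f' k r c) + (mm E \<xi> (f' k) r c - mm E (f' k) \<xi> r c)" if h: "k \<in> arrows" "r \<in> E" "c \<in> E" for k r c
    proof (cases "fst r = tgt k \<and> fst c = src k")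
      case False
      then have "M' k r c = 0" "f' k r c = 0" "mm E \<xi> (f' k) r c = 0" "mm E (f' k) \<xi> r c = 0"
        using rM' f' r\<xi> unfolding rep_def by blast+
      then show ?thesis by (simp add: derivation_0[OF D(1)])
    next
      case True
      show ?thesis
      proof (cases "r \<in> W \<and> c \<in> K")
        case WK: True
        then have "f' k r c = 0" by (simp add: f'_def)
        then show ?thesis using \<xi>eq[of k r c] h True WK by (simp add: derivation_0[OF D(1)])
      next
        case False
        then show ?thesis using D(2)[of k r c] h True by (simp add: blk_def N_def)
      qed
    qed
    have "D (f k r c) = M0 k r c" if h: "k \<in> arrows" "r \<in> E" "c \<in> E" "fst r = tgt k" "fst c = src k" for k r c
    proof -
      define Df where "Df r c = D (f' k r c)" for r c
      have "D (f k r c) = mm E \<xi> (mm E (f' k) H) r c + mm E G (\<lambda>r c. mm E Df H r c + mm E (f' k) (\<lambda>r c. - \<xi> r c) r c) r c"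
        unfolding f_def cj_def derivation_mm[OF D(1)] DG DH Df_def ..
      also have "\<dots> = mm E \<xi> (mm E (f' k) H) r c + mm E G (mm E Df H) r c - mm E G (mm E (f' k) \<xi>) r c"
        unfolding mm_lin_right mm_uminus_right by (simp add: mm_uminus_right)
      finally have 1: "D (f k r c) = mm E \<xi> (mm E (f' k) H) r c + mm E G (mm E Df H) r c - mm E G (mm E (f' k) \<xi>) r c" .
      have "M k r c = mm E G (mm E H (mm E (mm E (M k) G) H)) r c"
        using fpair_mm[OF p E(1) h(2)] fpair_mm_right[OF p E(1) h(3)] by simp
      also have "\<dots> = mm E G (mm E (M' k) H) r c" unfolding M'_def cj_def by (simp add: mm_assoc)
      also have "\<dots> = mm E G (mm E (\<lambda>r c. Df r c + (mm E \<xi> (f' k) r c + (- mm E (f' k) \<xi> r c))) H) r c"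
      proof -
        have "mm E (M' k) H m c = mm E (\<lambda>r c. Df r c + (mm E \<xi> (f' k) r c + (- mm E (f' k) \<xi> r c))) H m c" if "m \<in> E" for m
          unfolding mm_def[of E _ H] using key[OF h(1) that] by (intro sum.cong) (auto simp: Df_def)
        then show ?thesis by (simp add: mm_def[of E G])
      qed
      also have "\<dots> = mm E G (mm E Df H) r c + (mm E G (mm E (mm E \<xi> (f' k)) H) r c - mm E G (mm E (mm E (f' k) \<xi>) H) r c)"
        unfolding mm_lin_left_fun mm_uminus_left_fun mm_lin_right mm_uminus_right by simp
      also have "mm E G (mm E (mm E \<xi> (f' k)) H) r c = mm E (mm E G \<xi>) (mm E (f' k) H) r c"
        by (simp add: mm_assoc)
      also have "\<dots> = mm E \<xi> (mm E (f' k) H) r c"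
        using absorb_left(1)[OF h(2), of \<xi>] \<xi>WK by (simp add: mm_def[of E _ "mm E (f' k) H"])
      also have "mm E G (mm E (mm E (f' k) \<xi>) H) r c = mm E (mm E G (f' k)) (mm E \<xi> H) r c"
        by (simp add: mm_assoc)
      also have "\<dots> = mm E (mm E G (f' k)) \<xi> r c"
        using absorb_right(2)[OF h(3), of \<xi>] \<xi>WK by (simp add: mm_def[of E "mm E G (f' k)"])
      also have "\<dots> = mm E G (mm E (f' k) \<xi>) r c" by (simp add: mm_assoc)
      finally have "M k r c = D (f k r c)" using 1 by simp
      then show ?thesis using h by (simp add: M_def)
    qed
    then show "\<exists>D. derivation D \<and> (\<forall>k\<in>arrows. \<forall>r\<in>E. \<forall>c\<in>E. fst r = tgt k \<longrightarrow> fst c = src k \<longrightarrow> D (f k r c) = M0 k r c)"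
      using D(1) by blast
  qed
  from dgen_epos_imp_univ[OF f this E(1) ep] show ?thesis .
qed

end

section \<open>Belkale's recursion\<close>

lemma cnt_below_right:
  assumes "below M' M" "finite P" "finite M'"
  shows "cnt P M \<le> cnt P M'"
proof -
  obtain \<beta> where \<beta>: "bij_betw \<beta> M M'" "\<And>c. c \<in> M \<Longrightarrow> \<beta> c \<preceq> c" using assms(1) unfolding below_def by blast
  have fin: "finite {(r,c). r \<in> M' \<and> c \<in> P \<and> r \<preceq> c}"
    by (rule finite_subset[of _ "M' \<times> P"]) (use assms in auto)
  have "inj_on (\<lambda>x. (\<beta> (fst x), snd x)) {(r,c). r \<in> M \<and> c \<in> P \<and> r \<preceq> c}"
  proof (rule inj_onI)
    fix x y assume "x \<in> {(r,c). r \<in> M \<and> c \<in> P \<and> r \<preceq> c}" "y \<in> {(r,c). r \<in> M \<and> c \<in> P \<and> r \<preceq> c}"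
      "(\<beta> (fst x), snd x) = (\<beta> (fst y), snd y)"
    then show "x = y" using inj_on_eq_iff[OF bij_betw_imp_inj_on[OF \<beta>(1)], of "fst x" "fst y"]
      by (simp add: case_prod_beta prod_eq_iff)
  qed
  moreover have "(\<lambda>x. (\<beta> (fst x), snd x)) ` {(r,c). r \<in> M \<and> c \<in> P \<and> r \<preceq> c} \<subseteq> {(r,c). r \<in> M' \<and> c \<in> P \<and> r \<preceq> c}"
  proof
    fix y assume "y \<in> (\<lambda>x. (\<beta> (fst x), snd x)) ` {(r,c). r \<in> M \<and> c \<in> P \<and> r \<preceq> c}"
    then obtain r c where "r \<in> M" "c \<in> P" "r \<preceq> c" "y = (\<beta> r, c)" by auto
    then show "y \<in> {(r,c). r \<in> M' \<and> c \<in> P \<and> r \<preceq> c}"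
      using bij_betw_apply[OF \<beta>(1), of r] fle_trans[OF \<beta>(2), of r c] by simp
  qed
  ultimately show ?thesis unfolding cnt_def using fin by (intro card_inj_on_le)
qed

lemma cnt_diff:
  assumes "finite P" "finite W" "M \<subseteq> W"
  shows "cnt P (W - M) + cnt P M = cnt P W"
proof -
  have f: "finite {(r,c). r \<in> W - M \<and> c \<in> P \<and> r \<preceq> c}" "finite {(r,c). r \<in> M \<and> c \<in> P \<and> r \<preceq> c}"
    by (rule finite_subset[of _ "W \<times> P"]; use assms in auto)+
  have "{(r,c). r \<in> W \<and> c \<in> P \<and> r \<preceq> c} = {(r,c). r \<in> W - M \<and> c \<in> P \<and> r \<preceq> c} \<union> {(r,c). r \<in> M \<and> c \<in> P \<and> r \<preceq> c}"
    using assms(3) by auto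
  moreover have "{(r,c). r \<in> W - M \<and> c \<in> P \<and> r \<preceq> c} \<inter> {(r,c). r \<in> M \<and> c \<in> P \<and> r \<preceq> c} = {}" by auto
  ultimately show ?thesis unfolding cnt_def using card_Un_disjoint[OF f] by simp
qed

definition restr :: "'x set \<Rightarrow> ('x \<Rightarrow> complex) \<Rightarrow> 'x \<Rightarrow> complex" where
  "restr S x = (\<lambda>r. if r \<in> S then x r else 0)"

lemma supp_in_restr [simp]: "supp_in S (restr S x)" by (auto simp: supp_in_def restr_def)
lemma ap_restr [simp]: "ap S A (restr S x) = ap S A x" by (simp add: ap_def restr_def)
lemma restr_apply: "r \<in> S \<Longrightarrow> restr S x r = x r" by (simp add: restr_def)

lemma supp_in_lin: "supp_in S x \<Longrightarrow> supp_in S y \<Longrightarrow> supp_in S (\<lambda>r. x r + c * y r)"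
  unfolding supp_in_def by (metis add_0 mult_zero_right)

lemma ap_graded:
  assumes "flagged \<phi>"
  shows "ap S \<phi> (\<lambda>c. if fst c = i then x c else 0) r = (if fst r = i then ap S \<phi> x r else 0)"
proof -
  have "\<phi> r c * (if fst c = i then x c else 0) = (if fst r = i then \<phi> r c * x c else 0)" for c
    using flaggedD[OF assms, of r c] fle_fst[of r c] by (cases "r \<preceq> c") auto
  then show ?thesis by (simp add: ap_def)
qed

lemma mm_cong: "(\<And>m. m \<in> S \<Longrightarrow> A r m = A' r m) \<Longrightarrow> (\<And>m. m \<in> S \<Longrightarrow> B m c = B' m c) \<Longrightarrow> mm S A B r c = mm S A' B' r c"
  by (simp add: mm_def)

context quiver
begin

lemma ar_swap_below:
  assumes "below M' M" shows "ar P M' = ar P M"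
proof -
  obtain \<beta> where \<beta>: "bij_betw \<beta> M M'" "\<And>c. c \<in> M \<Longrightarrow> \<beta> c \<preceq> c" using assms(1) unfolding below_def by blast
  have fs: "fst (\<beta> c) = fst c" if "c \<in> M" for c using \<beta>(2)[OF that] by (rule fle_fst)
  have "bij_betw (\<lambda>(k,r,c). (k,\<beta> r,c)) {(k,r,c). k \<in> arrows \<and> r \<in> M \<and> c \<in> P \<and> fst r = tgt k \<and> fst c = src k}
      {(k,r,c). k \<in> arrows \<and> r \<in> M' \<and> c \<in> P \<and> fst r = tgt k \<and> fst c = src k}"
  proof (rule bij_betwI')
    fix x y assume "x \<in> {(k,r,c). k \<in> arrows \<and> r \<in> M \<and> c \<in> P \<and> fst r = tgt k \<and> fst c = src k}"
      "y \<in> {(k,r,c). k \<in> arrows \<and> r \<in> M \<and> c \<in> P \<and> fst r = tgt k \<and> fst c = src k}"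
    then show "((case x of (k, r, c) \<Rightarrow> (k, \<beta> r, c)) = (case y of (k, r, c) \<Rightarrow> (k, \<beta> r, c))) = (x = y)"
      using inj_on_eq_iff[OF bij_betw_imp_inj_on[OF \<beta>(1)]] by (cases x, cases y) (simp del: split_paired_all)
  next
    fix x assume "x \<in> {(k,r,c). k \<in> arrows \<and> r \<in> M \<and> c \<in> P \<and> fst r = tgt k \<and> fst c = src k}"
    moreover obtain k r c where "x = (k,r,c)" by (cases x)
    ultimately show "(case x of (k, r, c) \<Rightarrow> (k, \<beta> r, c)) \<in> {(k,r,c). k \<in> arrows \<and> r \<in> M' \<and> c \<in> P \<and> fst r = tgt k \<and> fst c = src k}"
      using bij_betw_apply[OF \<beta>(1), of r] fs[of r] by simp
  next
    fix y assume y: "y \<in> {(k,r,c). k \<in> arrows \<and> r \<in> M' \<and> c \<in> P \<and> fst r = tgt k \<and> fst c = src k}"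
    obtain k r c where krc: "y = (k,r,c)" by (cases y)
    then obtain e where "e \<in> M" "r = \<beta> e" using y \<beta>(1) unfolding bij_betw_def by blast
    then show "\<exists>x\<in>{(k,r,c). k \<in> arrows \<and> r \<in> M \<and> c \<in> P \<and> fst r = tgt k \<and> fst c = src k}. y = (case x of (k, r, c) \<Rightarrow> (k, \<beta> r, c))"
      using y krc fs by (intro bexI[of _ "(k,e,c)"]) auto
  qed
  from bij_betw_same_card[OF this] show ?thesis unfolding ar_def by simp
qed

lemma ar_diff:
  assumes "finite P" "finite W" "M \<subseteq> W"
  shows "ar P (W - M) + ar P M = ar P W"
proof -
  have fM: "finite M" using assms finite_subset by blast
  have f: "finite {(k,r,c). k \<in> arrows \<and> r \<in> W - M \<and> c \<in> P \<and> fst r = tgt k \<and> fst c = src k}"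
     "finite {(k,r,c). k \<in> arrows \<and> r \<in> M \<and> c \<in> P \<and> fst r = tgt k \<and> fst c = src k}"
    using finite_ar[OF assms(1), of "W - M"] finite_ar[OF assms(1) fM] assms(2) by auto
  have "{(k,r,c). k \<in> arrows \<and> r \<in> W \<and> c \<in> P \<and> fst r = tgt k \<and> fst c = src k} =
    {(k,r,c). k \<in> arrows \<and> r \<in> W - M \<and> c \<in> P \<and> fst r = tgt k \<and> fst c = src k} \<union>
    {(k,r,c). k \<in> arrows \<and> r \<in> M \<and> c \<in> P \<and> fst r = tgt k \<and> fst c = src k}"
    using assms(3) by auto
  moreover have "{(k,r,c). k \<in> arrows \<and> r \<in> W - M \<and> c \<in> P \<and> fst r = tgt k \<and> fst c = src k} \<inter>
    {(k,r,c). k \<in> arrows \<and> r \<in> M \<and> c \<in> P \<and> fst r = tgt k \<and> fst c = src k} = {}" by auto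
  ultimately show ?thesis unfolding ar_def using card_Un_disjoint[OF f] by simp
qed

lemma jgen_exists:
  assumes "finite S" "finite W"
  shows "\<exists>f g. rep f \<and> rep g \<and> jgen S f W g"
proof -
  define J where "J = (Inl ` (arrows \<times> S \<times> S) \<union> Inr ` (arrows \<times> W \<times> W) :: (nat \<times> ('v \<times> nat) \<times> ('v \<times> nat) + nat \<times> ('v \<times> nat) \<times> ('v \<times> nat)) set)"
  have "finite J" using assms by (simp add: J_def)
  then obtain x where x: "differentially_generic J x" using generic_numbers_exist by blast
  define f where "f k r c = (if fst r = tgt k \<and> fst c = src k then x (Inl (k,r,c)) else 0)" for k r c
  define g where "g k r c = (if fst r = tgt k \<and> fst c = src k then x (Inr (k,r,c)) else 0)" for k r c
  have "rep f" "rep g" by (auto simp: rep_def f_def g_def split: if_splits)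
  moreover have "jgen S f W g" unfolding jgen_def
  proof (intro allI)
    fix M N :: "nat \<Rightarrow> 'v \<times> nat \<Rightarrow> 'v \<times> nat \<Rightarrow> complex"
    obtain D where D: "derivation D" "\<And>j. j \<in> J \<Longrightarrow> D (x j) = (\<lambda>j. case j of Inl (k,r,c) \<Rightarrow> M k r c | Inr (k,r,c) \<Rightarrow> N k r c) j"
      using x[unfolded differentially_generic_def, rule_format, of "\<lambda>j. case j of Inl (k,r,c) \<Rightarrow> M k r c | Inr (k,r,c) \<Rightarrow> N k r c"] by blast
    show "\<exists>D. derivation D \<and>
     (\<forall>k\<in>arrows. \<forall>r\<in>S. \<forall>c\<in>S. fst r = tgt k \<longrightarrow> fst c = src k \<longrightarrow> D (f k r c) = M k r c) \<and>
     (\<forall>k\<in>arrows. \<forall>r\<in>W. \<forall>c\<in>W. fst r = tgt k \<longrightarrow> fst c = src k \<longrightarrow> D (g k r c) = N k r c)"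
    proof (intro exI[of _ D] conjI ballI impI D(1))
      fix k r c assume "k \<in> arrows" "r \<in> S" "c \<in> S" "fst r = tgt k" "fst c = src k"
      then show "D (f k r c) = M k r c" using D(2)[of "Inl (k,r,c)"] by (simp add: J_def f_def)
    next
      fix k r c assume "k \<in> arrows" "r \<in> W" "c \<in> W" "fst r = tgt k" "fst c = src k"
      then show "D (g k r c) = N k r c" using D(2)[of "Inr (k,r,c)"] by (simp add: J_def g_def)
    qed
  qed
  ultimately show ?thesis by blast
qed

lemma jgen_dgen:
  assumes "jgen S f W g" shows "dgen S f" "dgen W g"
proof -
  show "dgen S f" unfolding dgen_def
  proof
    fix M show "\<exists>D. derivation D \<and> (\<forall>k\<in>arrows. \<forall>r\<in>S. \<forall>c\<in>S. fst r = tgt k \<longrightarrow> fst c = src k \<longrightarrow> D (f k r c) = M k r c)"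
      using assms[unfolded jgen_def, rule_format, of M "\<lambda>_ _ _. 0"] by blast
  qed
  show "dgen W g" unfolding dgen_def
  proof
    fix M show "\<exists>D. derivation D \<and> (\<forall>k\<in>arrows. \<forall>r\<in>W. \<forall>c\<in>W. fst r = tgt k \<longrightarrow> fst c = src k \<longrightarrow> D (g k r c) = M k r c)"
      using assms[unfolded jgen_def, rule_format, of "\<lambda>_ _ _. 0" M] by blast
  qed
qed

lemma fpair_unit: "finite S \<Longrightarrow> fpair S (\<lambda>r c. unit_fun c r) (\<lambda>r c. unit_fun c r)"
  unfolding fpair_def by (intro conjI ballI) (auto simp: flagged_def mm_unit_left, auto simp: unit_fun_def split: if_splits)

lemma Tsurj_cong:
  assumes "Tsurj S f W g" "\<And>k m c. k \<in> arrows \<Longrightarrow> m \<in> S \<Longrightarrow> c \<in> S \<Longrightarrow> f' k m c = f k m c"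
    "\<And>k m c. k \<in> arrows \<Longrightarrow> m \<in> W \<Longrightarrow> c \<in> W \<Longrightarrow> g' k m c = g k m c"
  shows "Tsurj S f' W g'"
proof -
  have "mm S \<phi> (f' k) r c - mm W (g' k) \<phi> r c = mm S \<phi> (f k) r c - mm W (g k) \<phi> r c"
    if "k \<in> arrows" "r \<in> W" "c \<in> S" for \<phi> k r c
    using assms(2,3)[OF that(1)] that by (simp add: mm_def)
  note eq = this
  show ?thesis unfolding Tsurj_def
  proof
    fix y
    obtain \<phi> where \<phi>: "flagged \<phi>" "\<forall>k\<in>arrows. \<forall>r\<in>W. \<forall>c\<in>S. fst r = tgt k \<longrightarrow> fst c = src k \<longrightarrow>
        mm S \<phi> (f k) r c - mm W (g k) \<phi> r c = y k r c"
      using assms(1)[unfolded Tsurj_def, rule_format, of y] by blast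
    then show "\<exists>\<phi>. flagged \<phi> \<and> (\<forall>k\<in>arrows. \<forall>r\<in>W. \<forall>c\<in>S. fst r = tgt k \<longrightarrow> fst c = src k \<longrightarrow>
        mm S \<phi> (f' k) r c - mm W (g' k) \<phi> r c = y k r c)"
      using eq by (intro exI[of _ \<phi>]) simp
  qed
qed

lemma cj_inverse:
  assumes "fpair S G H" "finite S" "r \<in> S" "c \<in> S"
  shows "cj S H G (cj S G H f) k r c = f k r c"
proof -
  have "cj S H G (cj S G H f) k r c = mm S G (mm S H (mm S (mm S (f k) G) H)) r c"
    unfolding cj_def by (simp add: mm_assoc)
  also have "\<dots> = mm S (mm S (f k) G) H r c" by (rule fpair_mm[OF assms(1-3)])
  also have "\<dots> = f k r c" by (rule fpair_mm_right[OF assms(1,2,4)])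
  finally show ?thesis .
qed

text \<open>A subrepresentation of a subrepresentation: the inner change of basis is extended by the
  identity outside \<open>P\<close> and composed with the outer one.\<close>

lemma epos_compose:
  assumes S: "finite S" "P \<subseteq> S" and p: "fpair S G H" and st: "stab (cj S G H f) S P"
    and ep: "epos (cj S G H f) P P2"
  shows "epos f S P2"
proof -
  define f' where "f' = cj S G H f"
  have finP: "finite P" using S finite_subset by blast
  obtain G2 H2 where p2: "fpair P G2 H2" and st2: "stab (cj P G2 H2 f') P P2" and P2: "P2 \<subseteq> P"
    using ep unfolding epos_def f'_def by blast
  define ex where "ex A r c = (if r \<in> P \<and> c \<in> P then A r c else unit_fun c r)" for A and r c :: "'v \<times> nat"
  have exfl: "flagged (ex A)" if "flagged A" for A
    using that by (auto simp: flagged_def ex_def unit_fun_def split: if_splits)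
  have exmm: "mm S (ex A) (ex B) r c = ex (mm P A B) r c" if "r \<in> S" "c \<in> S" for A B r c
  proof (cases "r \<in> P \<and> c \<in> P")
    case True
    have "mm S (ex A) (ex B) r c = mm P A B r c" unfolding mm_def
      using S True by (intro sum.mono_neutral_cong_right) (auto simp: ex_def unit_fun_def)
    then show ?thesis using True by (simp add: ex_def)
  next
    case False
    have "mm S (ex A) (ex B) r c = (\<Sum>m\<in>S. if m = r then unit_fun c r else 0)" unfolding mm_def
    proof (intro sum.cong refl)
      fix m
      show "ex A r m * ex B m c = (if m = r then unit_fun c r else 0)"
      proof (cases "r \<in> P")
        case False
        then show ?thesis by (simp add: ex_def unit_fun_def)
      next
        case True
        then have "c \<notin> P" "r \<noteq> c" using \<open>\<not> (r \<in> P \<and> c \<in> P)\<close> by auto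
        then show ?thesis by (cases "m = c") (simp_all add: ex_def unit_fun_def)
      qed
    qed
    then show ?thesis using False that S by (auto simp: ex_def)
  qed
  have pex: "fpair S (ex G2) (ex H2)"
    unfolding fpair_def
  proof (intro conjI ballI)
    show "flagged (ex G2)" "flagged (ex H2)" using p2 exfl by (auto simp: fpair_def)
    fix r c assume rc: "r \<in> S" "c \<in> S"
    show "mm S (ex G2) (ex H2) r c = unit_fun c r" "mm S (ex H2) (ex G2) r c = unit_fun c r"
      using exmm[OF rc, of G2 H2] exmm[OF rc, of H2 G2] p2 unfolding fpair_def by (simp_all add: ex_def)
  qed
  define G3 H3 where "G3 = mm S G (ex G2)" and "H3 = mm S (ex H2) H"
  have p3: "fpair S G3 H3" unfolding fpair_def
  proof (intro conjI ballI)
    show "flagged G3" "flagged H3" unfolding G3_def H3_def using p pex by (auto simp: fpair_def intro: flagged_mm)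
    fix r c assume rc: "r \<in> S" "c \<in> S"
    have "mm S (ex G2) (mm S (ex H2) H) m c = H m c" if "m \<in> S" for m by (rule fpair_mm[OF pex S(1) that])
    then have "mm S G3 H3 r c = mm S G H r c" unfolding G3_def H3_def mm_assoc by (intro mm_cong) auto
    then show "mm S G3 H3 r c = unit_fun c r" using p rc by (simp add: fpair_def)
    have "mm S H (mm S G (ex G2)) m c = ex G2 m c" if "m \<in> S" for m by (rule fpair_mm[OF fpair_sym[OF p] S(1) that])
    then have "mm S H3 G3 r c = mm S (ex H2) (ex G2) r c" unfolding G3_def H3_def mm_assoc by (intro mm_cong) auto
    then show "mm S H3 G3 r c = unit_fun c r" using pex rc by (simp add: fpair_def)
  qed
  have "stab (cj S G3 H3 f) S P2" unfolding stab_def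
  proof (intro ballI)
    fix k r c assume h: "k \<in> arrows" "r \<in> S - P2" "c \<in> P2"
    have cP: "c \<in> P" using h P2 by blast
    have e: "cj S G3 H3 f k = mm S (ex H2) (mm S (f' k) (ex G2))"
      unfolding cj_def G3_def H3_def f'_def by (simp add: mm_assoc)
    have z: "mm S (f' k) (ex G2) m c = (if m \<in> P then mm P (f' k) G2 m c else 0)" if m: "m \<in> S" for m
    proof (cases "m \<in> P")
      case True
      have "mm S (f' k) (ex G2) m c = mm P (f' k) G2 m c" unfolding mm_def
        using S cP by (intro sum.mono_neutral_cong_right) (auto simp: ex_def unit_fun_def)
      then show ?thesis using True by simp
    next
      case False
      have "f' k m n * ex G2 n c = 0" if "n \<in> S" for n
        using st h(1) m False cP that unfolding stab_def f'_def
        by (cases "n \<in> P") (auto simp: ex_def unit_fun_def)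
      then have "mm S (f' k) (ex G2) m c = 0" unfolding mm_def by (intro sum.neutral) blast
      then show ?thesis using False by simp
    qed
    show "cj S G3 H3 f k r c = 0"
    proof (cases "r \<in> P")
      case True
      have "cj S G3 H3 f k r c = mm P H2 (mm P (f' k) G2) r c" unfolding e mm_def[of S "ex H2"] mm_def[of P H2]
        using S True z by (intro sum.mono_neutral_cong_right) (auto simp: ex_def unit_fun_def)
      then have "cj S G3 H3 f k r c = cj P G2 H2 f' k r c" by (simp add: cj_def)
      then show ?thesis using st2 h True by (auto simp: stab_def)
    next
      case False
      have "cj S G3 H3 f k r c = 0" unfolding e mm_def[of S "ex H2"]
        using False z h by (intro sum.neutral) (auto simp: ex_def unit_fun_def)
      then show ?thesis .
    qed
  qed
  then show ?thesis unfolding epos_def using p3 P2 S(2) by blast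
qed

end

section \<open>Surjectivity of the differential for a generic pair\<close>

context quiver
begin

text \<open>A generic flagged homomorphism \<open>\<phi>\<close> from \<open>f\<close> to
  \<open>g\<close> controls the cokernel. Let \<open>P\<close> be the position of its kernel and
  \<open>M\<close> that of its image. Deformations of \<open>f\<close> and \<open>g\<close> reach
  every entry of the target outside the block from \<open>P\<close> to \<open>W - M\<close>, because
  \<open>\<phi>\<close> is an isomorphism between the complementary parts. On the block the
  differential is injective, since by genericity no homomorphism has a nonzero component there. So
  surjectivity reduces to one comparison of dimensions for \<open>P\<close> and
  \<open>W - M\<close>. The bound \<open>n\<close> keeps \<open>U\<close> available while the
  induction runs over \<open>card S\<close>.\<close>

lemma Tsurj_generic:
  assumes U: "\<And>X P. finite X \<Longrightarrow> card X < n \<Longrightarrow> Sh X P \<Longrightarrow> univ X P"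
    and S: "finite S" "card S < n" and W: "finite W"
    and H0: "\<And>P. Sh S P \<Longrightarrow> ar P W \<le> cnt P W"
    and fg: "rep f" "rep g" "jgen S f W g"
  shows "Tsurj S f W g"
  using S H0 fg
proof (induction "card S" arbitrary: S f g rule: less_induct)
  case less
  note S = less.prems(1,2) and H0 = less.prems(3) and f = less.prems(4) and g = less.prems(5) and jg = less.prems(6)
  define X where "X = {(r,c). r \<in> W \<and> c \<in> S \<and> r \<preceq> c}"
  define Y where "Y = {(k,r,c). k \<in> arrows \<and> r \<in> W \<and> c \<in> S \<and> fst r = tgt k \<and> fst c = src k}"
  define Kr where "Kr = {\<phi>. supp_in X \<phi> \<and> (\<forall>y\<in>Y. Top S f W g \<phi> y = 0)}"
  have finX: "finite X" unfolding X_def by (rule finite_cnt[OF S(1) W])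
  have "(\<lambda>_. 0) \<in> Kr" using linop_zero[OF linop_Top] by (auto simp: Kr_def supp_in_def)
  moreover have "(\<lambda>x. \<phi> x + c * \<psi> x) \<in> Kr" if "\<phi> \<in> Kr" "\<psi> \<in> Kr" for \<phi> \<psi> c
    using that by (simp add: Kr_def supp_in_lin linopD[OF linop_Top])
  \<comment> \<open>\<open>Kr\<close> is the space of flagged homomorphisms; at the generic point
    \<open>\<phi>0\<close> each of its elements is a derivative of \<open>\<phi>0\<close>.\<close>
  ultimately obtain \<phi>0 where \<phi>0: "\<phi>0 \<in> Kr"
    "\<forall>\<psi>\<in>Kr. \<exists>D. derivation D \<and> (\<forall>z\<in>{}. D z = 0) \<and> (\<forall>x\<in>X. D (\<phi>0 x) = \<psi> x)"
    using generic_element_of_subspace[OF finX countable_empty, of Kr] by blast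
  define \<phi> where "\<phi> = curry \<phi>0"
  have \<phi>X: "(r,c) \<in> X" if "\<phi> r c \<noteq> 0" for r c using \<phi>0(1) that by (auto simp: \<phi>_def Kr_def supp_in_def)
  have fl: "flagged \<phi>" using \<phi>X by (auto simp: flagged_def X_def)
  have Kr_iff: "(\<lambda>(r,c). \<theta> r c) \<in> Kr \<longleftrightarrow> (\<forall>k\<in>arrows. \<forall>r\<in>W. \<forall>c\<in>S. mm S \<theta> (f k) r c = mm W (g k) \<theta> r c)"
    if \<theta>: "\<And>r c. \<theta> r c \<noteq> 0 \<Longrightarrow> (r,c) \<in> X" for \<theta>
  proof -
    have cu: "curry (\<lambda>(r,c). \<theta> r c) = \<theta>" by (auto simp: curry_def)
    have "supp_in X (\<lambda>(r,c). \<theta> r c)" using \<theta> by (auto simp: supp_in_def)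
    moreover have "(\<forall>y\<in>Y. Top S f W g (\<lambda>(r,c). \<theta> r c) y = 0) \<longleftrightarrow>
        (\<forall>k\<in>arrows. \<forall>r\<in>W. \<forall>c\<in>S. mm S \<theta> (f k) r c = mm W (g k) \<theta> r c)"
    proof (intro iffI ballI)
      fix k r c assume a: "\<forall>y\<in>Y. Top S f W g (\<lambda>(r,c). \<theta> r c) y = 0" and h: "k \<in> arrows" "r \<in> W" "c \<in> S"
      show "mm S \<theta> (f k) r c = mm W (g k) \<theta> r c"
      proof (cases "fst r = tgt k \<and> fst c = src k")
        case True
        then have "(k,r,c) \<in> Y" using h by (simp add: Y_def)
        from bspec[OF a this] show ?thesis by (simp add: Top_def cu)
      next
        case False
        have "mm S \<theta> (f k) r c = 0"
        proof (rule ccontr)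
          assume "mm S \<theta> (f k) r c \<noteq> 0"
          from mm_nonzero[OF this] obtain m where m: "\<theta> r m \<noteq> 0" "f k m c \<noteq> 0" by blast
          then have "fst r = fst m" using \<theta>[OF m(1)] by (auto simp: X_def fle_def)
          then show False using m f False by (auto simp: rep_def)
        qed
        moreover have "mm W (g k) \<theta> r c = 0"
        proof (rule ccontr)
          assume "mm W (g k) \<theta> r c \<noteq> 0"
          from mm_nonzero[OF this] obtain m where m: "g k r m \<noteq> 0" "\<theta> m c \<noteq> 0" by blast
          then have "fst m = fst c" using \<theta>[OF m(2)] by (auto simp: X_def fle_def)
          then show False using m g False by (auto simp: rep_def)
        qed
        ultimately show ?thesis by simp
      qed
    next
      fix y assume "\<forall>k\<in>arrows. \<forall>r\<in>W. \<forall>c\<in>S. mm S \<theta> (f k) r c = mm W (g k) \<theta> r c" "y \<in> Y"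
      then show "Top S f W g (\<lambda>(r,c). \<theta> r c) y = 0" by (auto simp: Y_def Top_def cu)
    qed
    ultimately show ?thesis by (simp add: Kr_def)
  qed
  have int: "mm S \<phi> (f k) r c = mm W (g k) \<phi> r c" if "k \<in> arrows" "r \<in> W" "c \<in> S" for k r c
  proof -
    have "(\<lambda>(r,c). \<phi> r c) = \<phi>0" by (auto simp: \<phi>_def curry_def)
    then show ?thesis using Kr_iff[of \<phi>] \<phi>X \<phi>0(1) that by simp
  qed
  have gen: "\<exists>D. derivation D \<and> (\<forall>r c. D (\<phi> r c) = \<theta> r c)"
    if \<theta>: "\<And>r c. \<theta> r c \<noteq> 0 \<Longrightarrow> (r,c) \<in> X" "\<And>k r c. k \<in> arrows \<Longrightarrow> r \<in> W \<Longrightarrow> c \<in> S \<Longrightarrow> mm S \<theta> (f k) r c = mm W (g k) \<theta> r c" for \<theta>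
  proof -
    have "(\<lambda>(r,c). \<theta> r c) \<in> Kr" using Kr_iff[of \<theta>] \<theta> by blast
    from bspec[OF \<phi>0(2) this] obtain D where D: "derivation D" "\<And>x. x \<in> X \<Longrightarrow> D (\<phi>0 x) = (\<lambda>(r,c). \<theta> r c) x" by blast
    have "D (\<phi> r c) = \<theta> r c" for r c
    proof (cases "(r,c) \<in> X")
      case True
      from D(2)[OF this] show ?thesis by (simp add: \<phi>_def)
    next
      case False
      then show ?thesis using \<phi>X[of r c] \<theta>(1)[of r c] derivation_0[OF D(1)] by metis
    qed
    then show ?thesis using D(1) by blast
  qed
  have apint: "ap S \<phi> (ap S (f k) x) r = ap W (g k) (ap S \<phi> x) r" if "k \<in> arrows" "r \<in> W" for k r x
    unfolding ap_mm[symmetric] unfolding ap_def using int[OF that] by simp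

  \<comment> \<open>Kernel and image of \<open>\<phi>\<close> are brought to coordinate form;
    \<open>P\<close> and \<open>M\<close> are their Schubert positions.\<close>
  define N where "N = {x. supp_in S x \<and> (\<forall>r\<in>W. ap S \<phi> x r = 0)}"
  have "\<exists>P\<subseteq>S. \<exists>G H. fpair S G H \<and> (\<forall>x. supp_in S x \<longrightarrow> (x \<in> N \<longleftrightarrow> (\<forall>r\<in>S - P. ap S H x r = 0)))"
  proof (rule echelon_form[OF S(1)])
    show "(\<lambda>_. 0) \<in> N" by (auto simp: N_def supp_in_def ap_def)
    fix x y c assume "x \<in> N" "y \<in> N"
    then show "(\<lambda>r. x r + c * y r) \<in> N" by (simp add: N_def supp_in_lin ap_lin)
  next
    fix x assume "x \<in> N" then show "supp_in S x" by (simp add: N_def)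
  next
    fix x i assume "x \<in> N"
    then show "(\<lambda>r. if fst r = i then x r else 0) \<in> N" by (simp add: N_def supp_in_def ap_graded[OF fl])
  qed
  then obtain P G H where P: "P \<subseteq> S" and p: "fpair S G H" and N: "\<And>x. supp_in S x \<Longrightarrow> x \<in> N \<longleftrightarrow> (\<forall>r\<in>S - P. ap S H x r = 0)"
    by blast
  define I where "I = {y. supp_in W y \<and> (\<exists>x. \<forall>r\<in>W. y r = ap S \<phi> x r)}"
  have "\<exists>M\<subseteq>W. \<exists>G H. fpair W G H \<and> (\<forall>x. supp_in W x \<longrightarrow> (x \<in> I \<longleftrightarrow> (\<forall>r\<in>W - M. ap W H x r = 0)))"
  proof (rule echelon_form[OF W])
    show "(\<lambda>_. 0) \<in> I" by (auto simp: I_def supp_in_def ap_def intro!: exI[of _ "\<lambda>_. 0"])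
    fix x y c assume "x \<in> I" "y \<in> I"
    then obtain x' y' where "\<And>r. r \<in> W \<Longrightarrow> x r = ap S \<phi> x' r" "\<And>r. r \<in> W \<Longrightarrow> y r = ap S \<phi> y' r" "supp_in W x" "supp_in W y"
      unfolding I_def by blast
    then show "(\<lambda>r. x r + c * y r) \<in> I"
      unfolding I_def by (intro CollectI conjI supp_in_lin exI[of _ "\<lambda>r. x' r + c * y' r"]) (simp_all add: ap_lin)
  next
    fix x assume "x \<in> I" then show "supp_in W x" by (simp add: I_def)
  next
    fix x i assume "x \<in> I"
    then obtain x' where "\<And>r. r \<in> W \<Longrightarrow> x r = ap S \<phi> x' r" "supp_in W x" unfolding I_def by blast
    then show "(\<lambda>r. if fst r = i then x r else 0) \<in> I"
      unfolding I_def by (intro CollectI conjI exI[of _ "\<lambda>c. if fst c = i then x' c else 0"]) (simp_all add: supp_in_def ap_graded[OF fl])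
  qed
  then obtain M G' H' where M: "M \<subseteq> W" and p': "fpair W G' H'" and I: "\<And>x. supp_in W x \<Longrightarrow> x \<in> I \<longleftrightarrow> (\<forall>r\<in>W - M. ap W H' x r = 0)"
    by blast
  have I0: "ap W H' y r = 0" if "\<And>r. r \<in> W \<Longrightarrow> y r = ap S \<phi> x r" "r \<in> W - M" for x y r
  proof -
    have "restr W y \<in> I" unfolding I_def using that(1) by (auto simp: restr_apply intro!: exI[of _ x])
    then have "ap W H' (restr W y) r = 0" using I[OF supp_in_restr] that(2) by blast
    then show ?thesis by simp
  qed
  have NG: "ap S \<phi> (\<lambda>m. G m c) r = 0" if c: "c \<in> P" and r: "r \<in> W" for c r
  proof -
    have "ap S H (\<lambda>m. G m c) r = 0" if "r \<in> S - P" for r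
    proof -
      have "mm S H G r c = unit_fun c r" using p that c P by (auto simp: fpair_def)
      then show ?thesis using that c by (auto simp: mm_eq_ap unit_fun_def)
    qed
    then have "restr S (\<lambda>m. G m c) \<in> N" using N[OF supp_in_restr] by simp
    then show ?thesis using r unfolding N_def by simp
  qed
  have flG: "flagged G" "flagged H" "flagged G'" "flagged H'" using p p' by (auto simp: fpair_def)
  define fh gh where "fh = cj S G H f" and "gh = cj W G' H' g"
  have rfh: "rep fh" "rep gh" unfolding fh_def gh_def using rep_cj f g p p' by auto
  have stP: "stab fh S P" unfolding stab_def
  proof (intro ballI)
    fix k r c assume h: "k \<in> arrows" "r \<in> S - P" "c \<in> P"
    define x where "x = ap S (f k) (\<lambda>m. G m c)"
    have "ap S \<phi> x r = 0" if "r \<in> W" for r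
    proof -
      have "ap S \<phi> x r = ap W (g k) (ap S \<phi> (\<lambda>m. G m c)) r" unfolding x_def by (rule apint[OF h(1) that])
      also have "\<dots> = 0" using NG[OF h(3)] by (simp add: ap_def[of W])
      finally show ?thesis .
    qed
    then have "restr S x \<in> N" by (simp add: N_def)
    then have "ap S H (restr S x) r = 0" using N[OF supp_in_restr] h(2) by blast
    moreover have "fh k r c = ap S H x r" by (simp add: fh_def cj_def mm_def ap_def x_def)
    ultimately show "fh k r c = 0" by simp
  qed
  have stM: "stab gh W M" unfolding stab_def
  proof (intro ballI)
    fix k r c assume h: "k \<in> arrows" "r \<in> W - M" "c \<in> M"
    have "ap W H' (\<lambda>m. G' m c) r = 0" if "r \<in> W - M" for r
    proof -
      have "mm W H' G' r c = unit_fun c r" using p' that h(3) M by (auto simp: fpair_def)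
      then show ?thesis using that h(3) by (auto simp: mm_eq_ap unit_fun_def)
    qed
    then have "restr W (\<lambda>m. G' m c) \<in> I" using I[OF supp_in_restr] by simp
    then obtain x where x: "\<And>r. r \<in> W \<Longrightarrow> G' r c = ap S \<phi> x r" unfolding I_def by (auto simp: restr_apply)
    have "ap W (g k) (\<lambda>m. G' m c) r = ap S \<phi> (ap S (f k) x) r" if "r \<in> W" for r
      unfolding apint[OF h(1) that] using x by (simp add: ap_def[of W])
    then have "ap W H' (ap W (g k) (\<lambda>m. G' m c)) r = 0" using I0 h(2) by blast
    then show "gh k r c = 0" unfolding gh_def cj_def mm_eq_ap[of W H'] by (simp add: mm_def ap_def)
  qed
  have epP: "epos f S P" unfolding epos_def using P p stP unfolding fh_def by blast
  have epM: "epos g W M" unfolding epos_def using M p' stM unfolding gh_def by blast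
  have finP: "finite P" "finite M" using P M S(1) W finite_subset by auto

  \<comment> \<open>\<open>\<phi>\<close> in the adapted coordinates: it vanishes on the columns in
    \<open>P\<close> and on the rows outside \<open>M\<close>.\<close>
  define ph where "ph = mm W H' (mm S \<phi> G)"
  have phfl: "flagged ph" unfolding ph_def by (intro flagged_mm fl flG)
  have phP: "ph r c = 0" if "c \<in> P" for r c
    unfolding ph_def mm_def[of W H'] mm_eq_ap[of S \<phi>] using NG[OF that] by simp
  have phM: "ph r c = 0" if "r \<in> W - M" for r c
    unfolding ph_def mm_eq_ap[of W H'] using I0[of "\<lambda>m. mm S \<phi> G m c" "\<lambda>m. G m c" r] that by (simp add: mm_eq_ap)
  have aph: "ap S ph x = ap W H' (ap S \<phi> (ap S G x))" for x unfolding ph_def by (simp add: ap_mm)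
  \<comment> \<open>Derivatives of \<open>\<phi>\<close> map the kernel of \<open>\<phi>\<close> into its image.\<close>
  have Dph: "mm W H' (mm S (\<lambda>r c. D (\<phi> r c)) G) r c = 0" if D: "derivation D" and r: "r \<in> W - M" and c: "c \<in> P" for D r c
  proof -
    have "mm S (\<lambda>r c. D (\<phi> r c)) G m c = ap S \<phi> (\<lambda>n. - D (G n c)) m" if m: "m \<in> W" for m
    proof -
      have "mm S \<phi> G m c = 0" using NG[OF c m] by (simp add: mm_eq_ap)
      then have "mm S (\<lambda>r c. D (\<phi> r c)) G m c + mm S \<phi> (\<lambda>r c. D (G r c)) m c = 0"
        using derivation_mm[OF D, of S \<phi> G m c] derivation_0[OF D] by simp
      then show ?thesis by (simp add: mm_def ap_def sum_negf eq_neg_iff_add_eq_0)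
    qed
    from I0[of "\<lambda>m. mm S (\<lambda>r c. D (\<phi> r c)) G m c" "\<lambda>n. - D (G n c)", OF this r]
    have "ap W H' (\<lambda>m. mm S (\<lambda>r c. D (\<phi> r c)) G m c) r = 0" .
    then show ?thesis by (simp add: mm_eq_ap[of W H'])
  qed
  have mmconj: "mm S (mm W H' (mm S A G)) (fh k) = mm W H' (mm S (mm S A (f k)) G)" for A k
    unfolding fh_def cj_def mm_conj_product[OF p S(1)] by (simp add: mm_assoc)
  have mmconj': "mm W (gh k) (mm W H' (mm S A G)) = mm W H' (mm S (mm W (g k) A) G)" for A k
    unfolding gh_def cj_def mm_conj_product[OF p' W] by (simp add: mm_assoc)
  \<comment> \<open>In the original coordinates every homomorphism \<open>h\<close> is a derivative
    of \<open>\<phi>\<close>, and such derivatives have no component from the kernel to the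
    cokernel.\<close>
  have ker0: "h r c = 0"
    if h: "flagged h" "\<And>k r c. k \<in> arrows \<Longrightarrow> r \<in> W \<Longrightarrow> c \<in> S \<Longrightarrow> mm S h (fh k) r c = mm W (gh k) h r c"
      and rc: "r \<in> W - M" "c \<in> P" for h r c
  proof -
    define h' where "h' = mm W G' (mm S h H)"
    define \<theta> where "\<theta> r c = (if r \<in> W \<and> c \<in> S then h' r c else 0)" for r c
    have "flagged h'" unfolding h'_def by (intro flagged_mm h flG)
    then have \<theta>X: "(r,c) \<in> X" if "\<theta> r c \<noteq> 0" for r c
      using that by (auto simp: \<theta>_def X_def flagged_def split: if_splits)
    have hh: "mm W H' (mm S h' G) r c = h r c" if "r \<in> W" "c \<in> S" for r c
    proof -
      have "mm W H' (mm S h' G) r c = mm W H' (mm W G' (mm S (mm S h H) G)) r c"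
        unfolding h'_def by (simp add: mm_assoc)
      also have "\<dots> = mm S (mm S h H) G r c" by (rule fpair_mm[OF fpair_sym[OF p'] W that(1)])
      also have "\<dots> = h r c" by (rule fpair_mm_right[OF fpair_sym[OF p] S(1) that(2)])
      finally show ?thesis .
    qed
    have eq: "mm S \<theta> (f k) r c = mm W (g k) \<theta> r c" if kr: "k \<in> arrows" "r \<in> W" "c \<in> S" for k r c
    proof -
      have a: "mm S \<theta> (f k) r c = mm S h' (f k) r c" if "r \<in> W" for r c
        using that by (simp add: mm_def \<theta>_def)
      have b: "mm W (g k) \<theta> r c = mm W (g k) h' r c" if "c \<in> S" for r c
        using that by (simp add: mm_def \<theta>_def)
      have c1: "mm W H' (mm S (mm S h' (f k)) G) r c = mm W H' (mm S (mm W (g k) h') G) r c" if "r \<in> W" "c \<in> S" for r c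
      proof -
        have "mm S h (fh k) r c = mm S (mm W H' (mm S h' G)) (fh k) r c"
          using hh[OF that(1)] by (simp add: mm_def[of S _ "fh k"])
        moreover have "mm W (gh k) h r c = mm W (gh k) (mm W H' (mm S h' G)) r c"
          using hh[OF _ that(2)] by (simp add: mm_def[of W "gh k"])
        ultimately show ?thesis using h(2)[OF kr(1) that] by (simp add: mmconj mmconj')
      qed
      have undo: "A r c = mm W G' (mm W H' (mm S (mm S A G) H)) r c" if "r \<in> W" "c \<in> S" for A r c
        using fpair_mm[OF p' W that(1), of "mm S (mm S A G) H"] fpair_mm_right[OF p S(1) that(2), of A r] by simp
      have "mm S h' (f k) r c = mm W G' (mm S (mm W H' (mm S (mm S h' (f k)) G)) H) r c"
        using undo[OF kr(2,3), of "mm S h' (f k)"] by (simp add: mm_assoc)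
      also have "\<dots> = mm W G' (mm S (mm W H' (mm S (mm W (g k) h') G)) H) r c"
        unfolding mm_def[of W G'] mm_def[of S _ H] using c1 by simp
      also have "\<dots> = mm W (g k) h' r c"
        using undo[OF kr(2,3), of "mm W (g k) h'"] by (simp add: mm_assoc)
      finally show ?thesis using a[OF kr(2)] b[OF kr(3)] by simp
    qed
    obtain D where D: "derivation D" "\<And>r c. D (\<phi> r c) = \<theta> r c" using gen[OF \<theta>X eq] by blast
    have "mm W H' (mm S \<theta> G) r c = 0" using Dph[OF D(1) rc] D(2) by simp
    moreover have "mm W H' (mm S \<theta> G) r c = mm W H' (mm S h' G) r c"
      unfolding mm_def by (simp add: \<theta>_def)
    ultimately show ?thesis using hh[of r c] rc P by auto
  qed
  \<comment> \<open>The relation between \<open>\<phi>\<close>, \<open>f\<close> and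
    \<open>g\<close> is differentiated in arbitrary directions of \<open>f\<close> and
    \<open>g\<close>, as joint genericity permits; the derivative of \<open>\<phi>\<close> yields
    \<open>\<theta>\<close>.\<close>
  have dir: "\<exists>\<theta>. flagged \<theta> \<and> (\<forall>r\<in>W - M. \<forall>c\<in>P. \<theta> r c = 0) \<and> (\<forall>k\<in>arrows. \<forall>r\<in>W. \<forall>c\<in>S.
      mm S \<theta> (fh k) r c - mm W (gh k) \<theta> r c = mm W (MW k) ph r c - mm S ph (MS k) r c)"
    if m: "rep MS" "rep MW" for MS MW
  proof -
    define A B where "A = cj S H G MS" and "B = cj W H' G' MW"
    have rAB: "rep A" "rep B" unfolding A_def B_def using rep_cj[OF m(1) fpair_sym[OF p]] rep_cj[OF m(2) fpair_sym[OF p']] by auto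
    obtain D where D: "derivation D"
      "\<And>k r c. k \<in> arrows \<Longrightarrow> r \<in> S \<Longrightarrow> c \<in> S \<Longrightarrow> fst r = tgt k \<Longrightarrow> fst c = src k \<Longrightarrow> D (f k r c) = A k r c"
      "\<And>k r c. k \<in> arrows \<Longrightarrow> r \<in> W \<Longrightarrow> c \<in> W \<Longrightarrow> fst r = tgt k \<Longrightarrow> fst c = src k \<Longrightarrow> D (g k r c) = B k r c"
      using jg[unfolded jgen_def, rule_format, of A B] by blast
    have Df: "D (f k r c) = A k r c" if "k \<in> arrows" "r \<in> S" "c \<in> S" for k r c
      using D(2)[OF that] f rAB(1) derivation_0[OF D(1)] unfolding rep_def by metis
    have Dg: "D (g k r c) = B k r c" if "k \<in> arrows" "r \<in> W" "c \<in> W" for k r c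
      using D(3)[OF that] g rAB(2) derivation_0[OF D(1)] unfolding rep_def by metis
    define \<phi>' where "\<phi>' r c = D (\<phi> r c)" for r c
    have "flagged \<phi>'" using fl derivation_0[OF D(1)] unfolding flagged_def \<phi>'_def by metis
    define \<theta> where "\<theta> = mm W H' (mm S \<phi>' G)"
    have "flagged \<theta>" unfolding \<theta>_def by (intro flagged_mm flG \<open>flagged \<phi>'\<close>)
    moreover have "\<theta> r c = 0" if "r \<in> W - M" "c \<in> P" for r c
      using Dph[OF D(1) that] unfolding \<theta>_def \<phi>'_def[abs_def] .
    moreover have "mm S \<theta> (fh k) r c - mm W (gh k) \<theta> r c = mm W (MW k) ph r c - mm S ph (MS k) r c"
      if h: "k \<in> arrows" "r \<in> W" "c \<in> S" for k r c
    proof -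
      have d: "mm S \<phi>' (f k) r c - mm W (g k) \<phi>' r c = mm W (B k) \<phi> r c - mm S \<phi> (A k) r c" if rc: "r \<in> W" "c \<in> S" for r c
      proof -
        have "mm S \<phi>' (f k) r c + mm S \<phi> (\<lambda>r c. D (f k r c)) r c = mm W (\<lambda>r c. D (g k r c)) \<phi> r c + mm W (g k) \<phi>' r c"
          using derivation_mm[OF D(1), of S \<phi> "f k" r c] derivation_mm[OF D(1), of W "g k" \<phi> r c] int[OF h(1) rc]
          unfolding \<phi>'_def[abs_def] by simp
        moreover have "mm S \<phi> (\<lambda>r c. D (f k r c)) r c = mm S \<phi> (A k) r c"
          unfolding mm_def using Df[OF h(1) _ rc(2)] by simp
        moreover have "mm W (\<lambda>r c. D (g k r c)) \<phi> r c = mm W (B k) \<phi> r c"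
          unfolding mm_def using Dg[OF h(1) rc(1)] by simp
        ultimately show ?thesis by (simp add: algebra_simps)
      qed
      have lin: "mm W H' (mm S A1 G) r c - mm W H' (mm S A2 G) r c = (\<Sum>m\<in>W. \<Sum>n\<in>S. H' r m * ((A1 m n - A2 m n) * G n c))" for A1 A2
        unfolding mm_def by (simp add: sum_distrib_left sum_subtractf[symmetric] algebra_simps)
      have "mm S \<theta> (fh k) r c - mm W (gh k) \<theta> r c = mm W H' (mm S (mm S \<phi>' (f k)) G) r c - mm W H' (mm S (mm W (g k) \<phi>') G) r c"
        unfolding \<theta>_def mmconj mmconj' ..
      also have "\<dots> = mm W H' (mm S (mm W (B k) \<phi>) G) r c - mm W H' (mm S (mm S \<phi> (A k)) G) r c"
        unfolding lin using d by (intro sum.cong refl) simp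
      also have "mm W H' (mm S (mm W (B k) \<phi>) G) r c = mm W (MW k) ph r c"
      proof -
        have "mm W H' (mm S (mm W (B k) \<phi>) G) r c = mm W H' (mm W G' (mm W (MW k) ph)) r c"
          unfolding B_def cj_def ph_def by (simp add: mm_assoc)
        also have "\<dots> = mm W (MW k) ph r c" by (rule fpair_mm[OF fpair_sym[OF p'] W h(2)])
        finally show ?thesis .
      qed
      also have "mm W H' (mm S (mm S \<phi> (A k)) G) r c = mm S ph (MS k) r c"
      proof -
        have "mm W H' (mm S (mm S \<phi> (A k)) G) = mm S (mm S (mm S ph (MS k)) H) G"
          unfolding A_def cj_def ph_def by (simp add: mm_assoc)
        then show ?thesis using fpair_mm_right[OF fpair_sym[OF p] S(1) h(3)] by simp
      qed
      finally show ?thesis .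
    qed
    ultimately show ?thesis by blast
  qed

  \<comment> \<open>Preimages of the unit vectors of the image; they are the columns of
    \<open>q\<close>, the inverse of the isomorphism from \<open>S - P\<close> to
    \<open>M\<close>.\<close>
  have "\<exists>a. supp_in (S - P) a \<and> (\<forall>c. a c \<noteq> 0 \<longrightarrow> fst c = fst m) \<and> (\<forall>r\<in>W. ap S ph a r = unit_fun m r)" if m: "m \<in> M" for m
  proof -
    have "ap W H' (\<lambda>n. G' n m) r = 0" if "r \<in> W - M" for r
    proof -
      have "mm W H' G' r m = unit_fun m r" using p' that m M by (auto simp: fpair_def)
      then show ?thesis using that m by (auto simp: mm_eq_ap unit_fun_def)
    qed
    then have "restr W (\<lambda>n. G' n m) \<in> I" using I[OF supp_in_restr] by simp
    then obtain x where x: "\<And>r. r \<in> W \<Longrightarrow> G' r m = ap S \<phi> x r" unfolding I_def by (auto simp: restr_apply)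
    define b where "b = ap S H x"
    define a where "a c = (if fst c = fst m then (if c \<in> S - P then b c else 0) else 0)" for c
    have "ap S ph a r = unit_fun m r" if r: "r \<in> W" for r
    proof -
      have "ap S ph (\<lambda>c. if c \<in> S - P then b c else 0) r = ap S ph b r"
        unfolding ap_def using phP by (intro sum.cong) auto
      also have "\<dots> = ap W H' (ap S \<phi> (ap S G b)) r" by (simp add: aph)
      also have "ap S \<phi> (ap S G b) = ap S \<phi> x"
        unfolding b_def by (rule ap_cong) (rule fpair_ap[OF p S(1)])
      also have "ap W H' (ap S \<phi> x) r = ap W H' (\<lambda>n. G' n m) r" using x by (simp add: ap_def[of W])
      also have "\<dots> = unit_fun m r" using p' r m M by (auto simp: fpair_def mm_eq_ap)
      finally have "ap S ph (\<lambda>c. if c \<in> S - P then b c else 0) r = unit_fun m r" .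
      then show ?thesis unfolding a_def ap_graded[OF phfl] by (auto simp: unit_fun_def)
    qed
    then show ?thesis by (intro exI[of _ a]) (auto simp: supp_in_def a_def split: if_splits)
  qed
  then obtain q0 where q0: "\<And>m. m \<in> M \<Longrightarrow> supp_in (S - P) (q0 m)" "\<And>m c. m \<in> M \<Longrightarrow> q0 m c \<noteq> 0 \<Longrightarrow> fst c = fst m"
      "\<And>m r. m \<in> M \<Longrightarrow> r \<in> W \<Longrightarrow> ap S ph (q0 m) r = unit_fun m r" by metis
  define q where "q c m = (if m \<in> M then q0 m c else 0)" for c m
  have q: "c \<in> S - P \<and> m \<in> M \<and> fst c = fst m" if "q c m \<noteq> 0" for c m
    using that q0(1,2)[of m] by (auto simp: q_def supp_in_def split: if_splits)
  have pq: "mm S ph q r m = unit_fun m r" if "m \<in> M" "r \<in> W" for r m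
    using q0(3)[OF that] that by (simp add: mm_eq_ap q_def)
  have phinj: "x c = 0" if x: "supp_in (S - P) x" "\<And>r. r \<in> W \<Longrightarrow> ap S ph x r = 0" and c: "c \<in> S - P" for x c
  proof -
    have "ap S \<phi> (ap S G x) r = 0" if "r \<in> W" for r
    proof -
      have "ap S \<phi> (ap S G x) r = ap W G' (ap S ph x) r" unfolding aph using fpair_ap[OF p' W that] by simp
      then show ?thesis using x(2) by (simp add: ap_def[of W])
    qed
    then have "restr S (ap S G x) \<in> N" by (simp add: N_def)
    then have "ap S H (ap S G x) c = 0" using N[OF supp_in_restr] c by simp
    then show ?thesis using fpair_ap[OF fpair_sym[OF p] S(1)] c by simp
  qed
  have qp: "mm W q ph c c' = unit_fun c' c" if cc: "c \<in> S - P" "c' \<in> S - P" for c c'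
  proof -
    define x where "x = (\<lambda>c. mm W q ph c c' - unit_fun c' c)"
    have "supp_in (S - P) x" unfolding supp_in_def
    proof (intro allI impI)
      fix c assume "x c \<noteq> 0"
      then have "mm W q ph c c' \<noteq> 0 \<or> c = c'" by (auto simp: x_def unit_fun_def split: if_splits)
      then show "c \<in> S - P" using mm_nonzero[of W q ph c c'] q cc by blast
    qed
    moreover have "ap S ph x r = 0" if r: "r \<in> W" for r
    proof -
      have "ap S ph x r = mm S ph (mm W q ph) r c' - mm S ph (\<lambda>r c. unit_fun c r) r c'"
        unfolding x_def ap_diff by (simp add: mm_eq_ap)
      also have "mm S ph (\<lambda>r c. unit_fun c r) r c' = ph r c'" using cc S(1) by (intro mm_unit_right) auto
      also have "mm S ph (mm W q ph) r c' = (\<Sum>m\<in>W. mm S ph q r m * ph m c')"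
        unfolding mm_assoc[symmetric] by (simp add: mm_def[of W _ ph])
      also have "\<dots> = (\<Sum>m\<in>W. if m = r then ph m c' else 0)"
      proof (intro sum.cong refl)
        fix m assume m: "m \<in> W"
        show "mm S ph q r m * ph m c' = (if m = r then ph m c' else 0)"
          using pq[of m r] phM[of m c'] m r by (cases "m \<in> M") (auto simp: unit_fun_def)
      qed
      also have "\<dots> = ph r c'" using r W by simp
      finally show ?thesis by simp
    qed
    ultimately have "x c = 0" using phinj cc by blast
    then show ?thesis by (simp add: x_def)
  qed
  \<comment> \<open>Outside the block every \<open>y\<close> has the form required by
    \<open>dir\<close>: columns outside \<open>P\<close> come from MW = y q, columns in
    \<open>P\<close> from MS = - q y.\<close>
  have ydir: "\<exists>\<theta>. flagged \<theta> \<and> (\<forall>r\<in>W - M. \<forall>c\<in>P. \<theta> r c = 0) \<and> (\<forall>k\<in>arrows. \<forall>r\<in>W. \<forall>c\<in>S.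
      mm S \<theta> (fh k) r c - mm W (gh k) \<theta> r c = y k r c)"
    if y: "rep y" "\<And>k r c. k \<in> arrows \<Longrightarrow> r \<in> W - M \<Longrightarrow> c \<in> P \<Longrightarrow> y k r c = 0" for y
  proof -
    define MW where "MW k r m = (\<Sum>c\<in>S - P. y k r c * q c m)" for k r m
    define MS where "MS k c c2 = (if c2 \<in> P then - (\<Sum>m\<in>M. q c m * y k m c2) else 0)" for k c c2
    have "rep MW" unfolding rep_def
    proof (intro allI impI)
      fix k r m assume "MW k r m \<noteq> 0"
      then obtain c where "y k r c * q c m \<noteq> 0" unfolding MW_def by (metis (no_types, lifting) sum.neutral)
      then show "fst r = tgt k \<and> fst m = src k" using y(1) q[of c m] unfolding rep_def by (metis mult_eq_0_iff)
    qed
    moreover have "rep MS" unfolding rep_def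
    proof (intro allI impI)
      fix k r m assume "MS k r m \<noteq> 0"
      then have "(\<Sum>n\<in>M. q r n * y k n m) \<noteq> 0" unfolding MS_def by (metis neg_equal_0_iff_equal)
      then obtain c where "q r c * y k c m \<noteq> 0" by (metis (no_types, lifting) sum.neutral)
      then show "fst r = tgt k \<and> fst m = src k" using y(1) q[of r c] unfolding rep_def by (metis mult_eq_0_iff)
    qed
    moreover have "mm W (MW k) ph r c - mm S ph (MS k) r c = y k r c" if h: "k \<in> arrows" "r \<in> W" "c \<in> S" for k r c
    proof (cases "c \<in> P")
      case True
      have "mm W (MW k) ph r c = 0" using phP[OF True] by (simp add: mm_def)
      moreover have "mm S ph (MS k) r c = - (\<Sum>m\<in>M. mm S ph q r m * y k m c)"
      proof -
        have "mm S ph (MS k) r c = - (\<Sum>n\<in>S. \<Sum>m\<in>M. ph r n * q n m * y k m c)"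
          using True by (simp add: mm_def MS_def sum_distrib_left sum_negf mult.assoc)
        also have "(\<Sum>n\<in>S. \<Sum>m\<in>M. ph r n * q n m * y k m c) = (\<Sum>m\<in>M. \<Sum>n\<in>S. ph r n * q n m * y k m c)" by (rule sum.swap)
        finally show ?thesis by (simp add: mm_def sum_distrib_right)
      qed
      moreover have "(\<Sum>m\<in>M. mm S ph q r m * y k m c) = (\<Sum>m\<in>M. if m = r then y k m c else 0)"
        using pq h by (intro sum.cong) (auto simp: unit_fun_def)
      moreover have "\<dots> = y k r c" using y(2)[OF h(1) _ True, of r] h(2) finP by auto
      ultimately show ?thesis by simp
    next
      case False
      then have c: "c \<in> S - P" using h by simp
      have "mm S ph (MS k) r c = 0" using False by (simp add: mm_def MS_def)
      moreover have "mm W (MW k) ph r c = (\<Sum>c'\<in>S - P. y k r c' * mm W q ph c' c)"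
      proof -
        have "mm W (MW k) ph r c = (\<Sum>m\<in>W. \<Sum>c'\<in>S - P. y k r c' * (q c' m * ph m c))"
          by (simp add: mm_def MW_def sum_distrib_right mult.assoc)
        also have "\<dots> = (\<Sum>c'\<in>S - P. \<Sum>m\<in>W. y k r c' * (q c' m * ph m c))" by (rule sum.swap)
        finally show ?thesis by (simp add: mm_def sum_distrib_left)
      qed
      moreover have "\<dots> = (\<Sum>c'\<in>S - P. if c' = c then y k r c' else 0)"
        using qp[OF _ c] by (intro sum.cong) (auto simp: unit_fun_def)
      moreover have "\<dots> = y k r c" using c S(1) by simp
      ultimately show ?thesis by simp
    qed
    ultimately show ?thesis using dir[of MS MW] by simp
  qed

  define W' where "W' = W - M"
  have finW': "finite W'" using W by (simp add: W'_def)
  \<comment> \<open>\<open>y h\<close> is \<open>h f - g h\<close>, with its support restricted to blocks.\<close>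
  define y where "y h k r c = mm S h (fh k) r c - mm W (gh k) h r c" for h k r c
  have yrep: "rep (y h)" if "flagged h" for h
    unfolding rep_def
  proof (intro allI impI)
    fix k r c assume "y h k r c \<noteq> 0"
    then have "mm S h (fh k) r c \<noteq> 0 \<or> mm W (gh k) h r c \<noteq> 0" by (auto simp: y_def)
    then show "fst r = tgt k \<and> fst c = src k"
    proof
      assume "mm S h (fh k) r c \<noteq> 0"
      from mm_nonzero[OF this] obtain m where m: "h r m \<noteq> 0" "fh k m c \<noteq> 0" by blast
      then have "fst r = fst m" using that fle_fst unfolding flagged_def by blast
      then show ?thesis using m rfh unfolding rep_def by metis
    next
      assume "mm W (gh k) h r c \<noteq> 0"
      from mm_nonzero[OF this] obtain m where m: "gh k r m \<noteq> 0" "h m c \<noteq> 0" by blast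
      then have "fst m = fst c" using that fle_fst unfolding flagged_def by blast
      then show ?thesis using m rfh unfolding rep_def by metis
    qed
  qed
  have ysmall: "y h k r c = mm P h (fh k) r c - mm W' (gh k) h r c"
    if h: "\<And>r c. h r c \<noteq> 0 \<Longrightarrow> r \<in> W' \<and> c \<in> P" for h k r c
  proof -
    have hz: "h r m = 0" if "m \<notin> P" for r m using h that by blast
    have hz': "h m c = 0" if "m \<notin> W'" for m c using h that by blast
    have "mm S h (fh k) r c = mm P h (fh k) r c" unfolding mm_def
      using P S(1) hz by (intro sum.mono_neutral_right) simp_all
    moreover have "mm W (gh k) h r c = mm W' (gh k) h r c" unfolding mm_def
      using W hz' W'_def by (intro sum.mono_neutral_right) auto
    ultimately show ?thesis by (simp add: y_def)
  qed
  \<comment> \<open>If the block operator kills \<open>h\<close>, then \<open>ydir\<close> provides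
    a \<open>\<theta>\<close> without block component such that h - \<theta> is a homomorphism, and
    \<open>ker0\<close> applies to the difference.\<close>
  have T'inj: "h = (\<lambda>_. 0)"
    if h: "supp_in {(r,c). r \<in> W' \<and> c \<in> P \<and> r \<preceq> c} h"
      "\<forall>x\<in>{(k,r,c). k \<in> arrows \<and> r \<in> W' \<and> c \<in> P \<and> fst r = tgt k \<and> fst c = src k}. Top P fh W' gh h x = 0" for h
  proof -
    define h' where "h' = curry h"
    have h's: "r \<in> W' \<and> c \<in> P \<and> r \<preceq> c" if "h' r c \<noteq> 0" for r c using that h(1) by (auto simp: h'_def supp_in_def)
    have fh': "flagged h'" using h's by (auto simp: flagged_def)
    have y0: "y h' k r c = 0" if a: "k \<in> arrows" "r \<in> W - M" "c \<in> P" for k r c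
    proof (cases "fst r = tgt k \<and> fst c = src k")
      case True
      then have "Top P fh W' gh h (k,r,c) = 0" using h(2) a by (simp add: W'_def)
      moreover have "y h' k r c = mm P h' (fh k) r c - mm W' (gh k) h' r c" by (rule ysmall) (use h's in blast)
      ultimately show ?thesis by (simp add: Top_def h'_def)
    next
      case False
      then show ?thesis using yrep[OF fh'] unfolding rep_def by blast
    qed
    obtain \<theta> where \<theta>: "flagged \<theta>" "\<And>r c. r \<in> W - M \<Longrightarrow> c \<in> P \<Longrightarrow> \<theta> r c = 0"
      "\<And>k r c. k \<in> arrows \<Longrightarrow> r \<in> W \<Longrightarrow> c \<in> S \<Longrightarrow> y \<theta> k r c = y h' k r c"
      using ydir[OF yrep[OF fh'] y0] unfolding y_def by blast
    define d where "d r c = h' r c + (- \<theta> r c)" for r c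
    have "flagged d" using fh' \<theta>(1) unfolding flagged_def d_def by (metis add_0 neg_equal_0_iff_equal)
    moreover have "mm S d (fh k) r c = mm W (gh k) d r c" if "k \<in> arrows" "r \<in> W" "c \<in> S" for k r c
      using \<theta>(3)[OF that] unfolding d_def[abs_def] mm_lin_left mm_lin_right mm_uminus_left mm_uminus_right y_def
      by (simp add: algebra_simps)
    ultimately have "d r c = 0" if "r \<in> W - M" "c \<in> P" for r c using ker0[of d] that by blast
    then have "h' r c = 0" if "r \<in> W - M" "c \<in> P" for r c using \<theta>(2) that by (simp add: d_def)
    then have "h' r c = 0" for r c using h's[of r c] unfolding W'_def by blast
    then show ?thesis by (auto simp: h'_def curry_def)
  qed
  \<comment> \<open>If \<open>P = S\<close>, the image is trivial and the claim is \<open>H0\<close>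
    for \<open>S\<close> itself. Otherwise induction applies to \<open>P\<close> with a fresh
    generic pair, whose target has a subrepresentation at a position below \<open>M\<close>; the
    dimension count there implies the one at \<open>M\<close>.\<close>
  have count: "ar P W' \<le> cnt P W'"
  proof (cases "P = S")
    case True
    have "M = {}"
    proof (rule ccontr)
      assume "M \<noteq> {}"
      then obtain m where m: "m \<in> M" by blast
      have "ph r c = 0" if "c \<in> S" for r c using phP that True by blast
      then have "mm S ph q m m = 0" by (simp add: mm_def)
      moreover have "mm S ph q m m = 1" using pq[OF m, of m] m M by (auto simp: unit_fun_def)
      ultimately show False by simp
    qed
    then show ?thesis using H0[OF Sh_full[OF S(1)]] True by (simp add: W'_def)
  next
    case False
    then have cP: "card P < card S" using P S(1) by (simp add: psubsetI psubset_card_mono)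
    have UP: "univ Z P2" if "Z \<subseteq> S" "Sh Z P2" for Z P2
    proof -
      have "finite Z" "card Z \<le> card S" using that(1) S(1) by (auto intro: finite_subset card_mono)
      then show ?thesis using U[of Z P2] that(2) S(2) by simp
    qed
    \<comment> \<open>A subrepresentation of the kernel is also one of the generic \<open>f\<close>,
      so its position lies in the recursive set of \<open>S\<close>, and the hypothesis for
      \<open>S\<close> is inherited up to moving positions down.\<close>
    have HP: "ar P2 W \<le> cnt P2 W" if P2: "Sh P P2" for P2
    proof -
      obtain P2' where P2': "below P2' P2" "epos fh P P2'" using UP[OF P P2] rfh(1) unfolding univ_def by blast
      have ep: "epos f S P2'" using epos_compose[OF S(1) P p] stP P2'(2) unfolding fh_def by blast
      then have "P2' \<subseteq> S" by (simp add: epos_def)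
      then have "Sh S P2'" using dgen_epos_imp_Sh[OF f jgen_dgen(1)[OF jg] S(1) ep] UP by blast
      from H0[OF this] show ?thesis
        using ar_below[OF P2'(1), of W] cnt_below[OF P2'(1) _ W] Sh_subset[OF P2] finP(1) finite_subset by fastforce
    qed
    obtain f2 g2 where fg2: "rep f2" "rep g2" "jgen P f2 W g2" using jgen_exists[OF finP(1) W] by blast
    have "card P < n" using cP S(2) by simp
    from less.hyps[OF cP finP(1) this HP fg2] have T2: "Tsurj P f2 W g2" .
    have "univ W M" by (rule dgen_epos_imp_univ[OF g jgen_dgen(2)[OF jg] W epM])
    then obtain M' where M': "below M' M" "epos g2 W M'" using fg2(2) unfolding univ_def by blast
    obtain G3 H3 where p3: "fpair W G3 H3" "stab (cj W G3 H3 g2) W M'" and M'W: "M' \<subseteq> W" using M'(2) unfolding epos_def by blast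
    have finM': "finite M'" using M'W W finite_subset by blast
    have "Tsurj P (cj P (\<lambda>r c. unit_fun c r) (\<lambda>r c. unit_fun c r) f2) W (cj W G3 H3 g2)"
      by (rule Tsurj_conj[OF T2 fpair_unit[OF finP(1)] p3(1) finP(1) W])
    from Tsurj_subquotient[OF this subset_refl M'W finP(1) W _ p3(2)]
    have "Tsurj P (cj P (\<lambda>r c. unit_fun c r) (\<lambda>r c. unit_fun c r) f2) (W - M') (cj W G3 H3 g2)" by (simp add: stab_def)
    from Tsurj_imp_count[OF this finP(1)] W have "ar P (W - M') \<le> cnt P (W - M')" by simp
    moreover have "ar P (W - M') = ar P (W - M)"
      using ar_diff[OF finP(1) W M] ar_diff[OF finP(1) W M'W] ar_swap_below[OF M'(1), of P] by simp
    moreover have "cnt P (W - M') \<le> cnt P (W - M)"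
      using cnt_diff[OF finP(1) W M] cnt_diff[OF finP(1) W M'W] cnt_below_right[OF M'(1) finP(1) finM'] by simp
    ultimately show ?thesis by (simp add: W'_def)
  qed
  \<comment> \<open>The block is solved by dimension count and injectivity; the remaining error
    vanishes on the block and is covered by \<open>ydir\<close>.\<close>
  have "Tsurj S fh W gh" unfolding Tsurj_def
  proof
    fix z :: "nat \<Rightarrow> 'v \<times> nat \<Rightarrow> 'v \<times> nat \<Rightarrow> complex"
    define z' where "z' k r c = (if fst r = tgt k \<and> fst c = src k then z k r c else 0)" for k r c
    have "\<exists>h. supp_in {(r,c). r \<in> W' \<and> c \<in> P \<and> r \<preceq> c} h \<and>
      (\<forall>x\<in>{(k,r,c). k \<in> arrows \<and> r \<in> W' \<and> c \<in> P \<and> fst r = tgt k \<and> fst c = src k}. Top P fh W' gh h x = (\<lambda>(k,r,c). z' k r c) x)"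
      by (rule linop_injective_imp_surjective[OF linop_Top finite_cnt[OF finP(1) finW'] finite_ar[OF finP(1) finW'] count[unfolded ar_def cnt_def] T'inj])
    then obtain h where h: "supp_in {(r,c). r \<in> W' \<and> c \<in> P \<and> r \<preceq> c} h"
      "\<forall>x\<in>{(k,r,c). k \<in> arrows \<and> r \<in> W' \<and> c \<in> P \<and> fst r = tgt k \<and> fst c = src k}. Top P fh W' gh h x = (\<lambda>(k,r,c). z' k r c) x"
      by blast
    define h' where "h' = curry h"
    have h's: "r \<in> W' \<and> c \<in> P \<and> r \<preceq> c" if "h' r c \<noteq> 0" for r c using that h(1) by (auto simp: h'_def supp_in_def)
    have fh': "flagged h'" using h's by (auto simp: flagged_def)
    define v where "v k r c = z' k r c - y h' k r c" for k r c
    have "rep v" unfolding rep_def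
    proof (intro allI impI, rule ccontr)
      fix k r c assume n: "v k r c \<noteq> 0" and b: "\<not> (fst r = tgt k \<and> fst c = src k)"
      then have "y h' k r c = 0" using yrep[OF fh'] unfolding rep_def by blast
      moreover have "z' k r c = 0" using b by (simp only: z'_def if_False)
      ultimately show False using n by (simp add: v_def)
    qed
    moreover have "v k r c = 0" if a: "k \<in> arrows" "r \<in> W - M" "c \<in> P" for k r c
    proof (cases "fst r = tgt k \<and> fst c = src k")
      case True
      then have "Top P fh W' gh h (k,r,c) = z' k r c" using bspec[OF h(2), of "(k,r,c)"] a by (simp add: W'_def)
      moreover have "y h' k r c = mm P h' (fh k) r c - mm W' (gh k) h' r c" by (rule ysmall) (use h's in blast)
      ultimately show ?thesis by (simp add: Top_def h'_def v_def)
    next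
      case False
      then show ?thesis using \<open>rep v\<close> unfolding rep_def by blast
    qed
    ultimately obtain \<theta> where \<theta>: "flagged \<theta>"
      "\<And>k r c. k \<in> arrows \<Longrightarrow> r \<in> W \<Longrightarrow> c \<in> S \<Longrightarrow> mm S \<theta> (fh k) r c - mm W (gh k) \<theta> r c = v k r c"
      using ydir[of v] by blast
    define d where "d r c = h' r c + \<theta> r c" for r c
    have "flagged d" using fh' \<theta>(1) unfolding flagged_def d_def by (metis add_0)
    moreover have "mm S d (fh k) r c - mm W (gh k) d r c = z k r c"
      if "k \<in> arrows" "r \<in> W" "c \<in> S" "fst r = tgt k" "fst c = src k" for k r c
      using \<theta>(2)[OF that(1-3)] that(4,5) unfolding d_def[abs_def] mm_lin_left mm_lin_right v_def y_def z'_def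
      by (simp add: algebra_simps)
    ultimately show "\<exists>\<phi>. flagged \<phi> \<and> (\<forall>k\<in>arrows. \<forall>r\<in>W. \<forall>c\<in>S. fst r = tgt k \<longrightarrow> fst c = src k \<longrightarrow>
        mm S \<phi> (fh k) r c - mm W (gh k) \<phi> r c = z k r c)" by blast
  qed
  from Tsurj_conj[OF this fpair_sym[OF p] fpair_sym[OF p'] S(1) W]
  show "Tsurj S f W g"
    by (rule Tsurj_cong) (simp_all add: fh_def gh_def cj_inverse[OF p S(1)] cj_inverse[OF p' W])
qed

theorem Sh_imp_univ:
  assumes "finite E" "Sh E K"
  shows "univ E K"
  using assms
proof (induction "card E" arbitrary: E K rule: less_induct)
  case less
  show ?case
  proof (cases "K = E")
    case True
    have "epos f E E" for f unfolding epos_def using fpair_unit[OF less.prems(1)] by (auto simp: stab_def)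
    then show ?thesis unfolding univ_def using below_refl True by blast
  next
    case False
    have KE: "K \<subseteq> E" using Sh_subset[OF less.prems(2)] .
    have finK: "finite K" using KE less.prems(1) finite_subset by blast
    have cK: "card K < card E" using KE False less.prems(1) by (simp add: psubsetI psubset_card_mono)
    have H0: "ar P (E - K) \<le> cnt P (E - K)" if "Sh K P" for P
      using less.prems(2) that unfolding Sh_iff[OF less.prems(1)] by blast
    show ?thesis
    proof (rule Tsurj_generic_imp_univ[OF less.prems(1) KE])
      fix f g assume "rep f" "rep g" "jgen K f (E - K) g"
      then show "Tsurj K f (E - K) g"
        using less.hyps finK cK H0 less.prems(1) by (intro Tsurj_generic[of "card E"]) auto
    qed
  qed
qed

end

section \<open>Necessity of the inequalities\<close>

definition ip :: "'x set \<Rightarrow> ('x \<Rightarrow> complex) \<Rightarrow> ('x \<Rightarrow> complex) \<Rightarrow> complex" where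
  "ip E u v = (\<Sum>r\<in>E. u r * cnj (v r))"

definition sqn :: "'x set \<Rightarrow> ('x \<Rightarrow> complex) \<Rightarrow> real" where
  "sqn E u = (\<Sum>r\<in>E. (cmod (u r))\<^sup>2)"

lemma ip_self: "ip E u u = of_real (sqn E u)"
  unfolding ip_def sqn_def of_real_sum complex_norm_square ..

lemma sqn_nonneg: "sqn E u \<ge> 0" unfolding sqn_def by (intro sum_nonneg) auto

lemma ip_lin: "ip E (\<lambda>r. x r + a * y r) v = ip E x v + a * ip E y v"
  by (simp add: ip_def algebra_simps sum.distrib sum_distrib_left)

lemma ip_cnj: "cnj (ip E u v) = ip E v u"
  by (simp add: ip_def mult.commute)

lemma ip_sum_left: "ip E (\<lambda>r. \<Sum>c\<in>K. z c * v c r) w = (\<Sum>c\<in>K. z c * ip E (v c) w)"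
  unfolding ip_def sum_distrib_right sum_distrib_left mult.assoc by (rule sum.swap)

lemma ip_sum_right: "ip E w (\<lambda>r. \<Sum>c\<in>K. z c * v c r) = (\<Sum>c\<in>K. cnj (z c) * ip E w (v c))"
proof -
  have "ip E w (\<lambda>r. \<Sum>c\<in>K. z c * v c r) = cnj (\<Sum>c\<in>K. z c * ip E (v c) w)"
    unfolding ip_sum_left[symmetric] by (simp add: ip_cnj)
  then show ?thesis by (simp add: ip_cnj)
qed

context
  fixes E :: "'x set" and K :: "'y set" and v :: "'y \<Rightarrow> 'x \<Rightarrow> complex"
  assumes K: "finite K" and on: "\<And>c c'. c \<in> K \<Longrightarrow> c' \<in> K \<Longrightarrow> ip E (v c) (v c') = (if c = c' then 1 else 0)"
begin

lemma parseval:
  assumes "\<And>r. r \<in> E \<Longrightarrow> w r = (\<Sum>c\<in>K. z c * v c r)"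
  shows "sqn E w = (\<Sum>c\<in>K. (cmod (ip E w (v c)))\<^sup>2)"
proof -
  have w: "ip E w u = ip E (\<lambda>r. \<Sum>c\<in>K. z c * v c r) u" "ip E u w = ip E u (\<lambda>r. \<Sum>c\<in>K. z c * v c r)" for u
    using assms by (simp_all add: ip_def)
  have z: "ip E w (v c) = z c" if "c \<in> K" for c
    unfolding w ip_sum_left using K on that by (simp add: if_distrib[of "\<lambda>b. _ * b"] cong: if_cong)
  have "ip E w w = (\<Sum>c\<in>K. cnj (z c) * ip E w (v c))" unfolding w(2) ip_sum_right ..
  also have "\<dots> = (\<Sum>c\<in>K. of_real ((cmod (ip E w (v c)))\<^sup>2))"
    using z by (intro sum.cong) (auto simp: complex_norm_square[symmetric] mult.commute simp del: of_real_power)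
  finally have "complex_of_real (sqn E w) = of_real (\<Sum>c\<in>K. (cmod (ip E w (v c)))\<^sup>2)"
    by (simp add: ip_self)
  then show ?thesis using of_real_eq_iff by blast
qed

lemma bessel: "(\<Sum>c\<in>K. (cmod (ip E w (v c)))\<^sup>2) \<le> sqn E w"
proof -
  define z where "z c = ip E w (v c)" for c
  define p where "p = (\<lambda>r. \<Sum>c\<in>K. z c * v c r)"
  have pv: "ip E p (v c) = z c" if "c \<in> K" for c
    unfolding p_def ip_sum_left using K on that by (simp add: if_distrib[of "\<lambda>b. _ * b"] cong: if_cong)
  have pp: "sqn E p = (\<Sum>c\<in>K. (cmod (z c))\<^sup>2)" using parseval[of p z] pv by (simp add: p_def)
  have wp: "ip E w p = of_real (\<Sum>c\<in>K. (cmod (z c))\<^sup>2)"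
    unfolding p_def ip_sum_right z_def[symmetric] of_real_sum complex_norm_square by (simp add: mult.commute)
  define d where "d = (\<lambda>r. w r + (-1) * p r)"
  have "ip E d d = ip E w d - ip E p d" unfolding d_def ip_lin by simp
  also have "ip E w d = cnj (ip E w w + (-1) * ip E p w)" unfolding ip_cnj[of E d w, symmetric] unfolding d_def ip_lin ..
  also have "ip E p d = cnj (ip E w p + (-1) * ip E p p)" unfolding ip_cnj[of E d p, symmetric] unfolding d_def ip_lin ..
  also have "cnj (ip E w w + (-1) * ip E p w) - cnj (ip E w p + (-1) * ip E p p) = of_real (sqn E w - (\<Sum>c\<in>K. (cmod (z c))\<^sup>2))"
    using wp ip_cnj[of E p w] by (simp add: ip_self pp)
  finally have "complex_of_real (sqn E d) = of_real (sqn E w - (\<Sum>c\<in>K. (cmod (z c))\<^sup>2))" by (simp add: ip_self)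
  then have "sqn E d = sqn E w - (\<Sum>c\<in>K. (cmod (z c))\<^sup>2)" using of_real_eq_iff by blast
  then show ?thesis using sqn_nonneg[of E d] by (simp add: z_def)
qed

end

text \<open>Gram-Schmidt within the subrepresentation, in the order of \<open>\<preceq>\<close>. The
  vector of index \<open>c\<close> stays in the flag step of \<open>c\<close>, which later bounds
  its quadratic form by \<open>a c\<close>.\<close>

lemma orthonormal_frame:
  assumes E: "finite E" "K \<subseteq> E" and p: "fpair E G H"
  shows "\<exists>x. (\<forall>c\<in>K. supp_in {m\<in>K. m \<preceq> c} (x c)) \<and>
     (\<forall>c\<in>K. \<forall>c'\<in>K. ip E (ap E G (x c)) (ap E G (x c')) = (if c = c' then 1 else 0))"
proof -
  define R where "R = {(x :: 'a \<times> nat, y). x \<preceq> y \<and> x \<noteq> y}"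
  define P where "P F c x \<longleftrightarrow> (c \<in> K \<longrightarrow> supp_in {m\<in>K. m \<preceq> c} x \<and> ip E (ap E G x) (ap E G x) = 1 \<and>
      (\<forall>c'\<in>K. c' \<preceq> c \<longrightarrow> c' \<noteq> c \<longrightarrow> ip E (ap E G x) (ap E G (F c')) = 0))"
    for F :: "'a \<times> nat \<Rightarrow> ('a \<times> nat \<Rightarrow> complex)" and c x
  have "\<exists>F. \<forall>c. P F c (F c)"
  proof (rule dependent_wf_choice[of R])
    show "wf R" unfolding R_def by (rule wf_strict_fle)
    show "P f x r = P g x r" if "\<And>z. (z, x) \<in> R \<Longrightarrow> f z = g z" for f g x r
    proof -
      have e: "f z = g z" if "z \<preceq> x" "z \<noteq> x" for z using that \<open>\<And>z. (z, x) \<in> R \<Longrightarrow> f z = g z\<close> by (simp add: R_def)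
      have "(\<forall>c'\<in>K. c' \<preceq> x \<longrightarrow> c' \<noteq> x \<longrightarrow> ip E (ap E G r) (ap E G (f c')) = 0) \<longleftrightarrow>
          (\<forall>c'\<in>K. c' \<preceq> x \<longrightarrow> c' \<noteq> x \<longrightarrow> ip E (ap E G r) (ap E G (g c')) = 0)" using e by metis
      then show ?thesis unfolding P_def by (simp only:)
    qed
    fix c and F :: "'a \<times> nat \<Rightarrow> ('a \<times> nat \<Rightarrow> complex)"
    show "\<exists>x. P F c x"
    proof (cases "c \<in> K")
      case True
      have "\<exists>x. supp_in {m\<in>K. m \<preceq> c} x \<and> (\<exists>r\<in>E. ap E G x r \<noteq> 0) \<and>
          (\<forall>c'\<in>K. c' \<preceq> c \<longrightarrow> c' \<noteq> c \<longrightarrow> (\<lambda>c' v. ip E v (ap E G (F c'))) c' (ap E G x) = 0)"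
        by (rule frame_step[OF E p True]) (simp add: ip_lin)
      then obtain x r where x: "supp_in {m\<in>K. m \<preceq> c} x" "r \<in> E" "ap E G x r \<noteq> 0"
        "\<forall>c'\<in>K. c' \<preceq> c \<longrightarrow> c' \<noteq> c \<longrightarrow> ip E (ap E G x) (ap E G (F c')) = 0" by blast
      define s where "s = sqn E (ap E G x)"
      have "s > 0" unfolding s_def sqn_def using E x(2,3) by (intro sum_pos2[of _ r]) auto
      define a where "a = complex_of_real (1 / sqrt s)"
      have aa: "a * cnj a * of_real s = 1"
        unfolding a_def using \<open>s > 0\<close> by (simp add: of_real_mult[symmetric] del: of_real_mult)
      have v': "ap E G (\<lambda>m. a * x m) = (\<lambda>r. a * ap E G x r)" by (simp add: ap_def sum_distrib_left algebra_simps)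
      have l: "ip E (\<lambda>r. a * y r) w = a * ip E y w" "ip E w (\<lambda>r. a * y r) = cnj a * ip E w y" for y w
        by (simp_all add: ip_def sum_distrib_left algebra_simps)
      have "supp_in {m\<in>K. m \<preceq> c} (\<lambda>m. a * x m)" using x(1) by (simp add: supp_in_def)
      then have "P F c (\<lambda>m. a * x m)" unfolding P_def v' l using x(4) aa by (simp add: ip_self s_def mult.assoc)
      then show ?thesis by (intro exI[of _ "\<lambda>m. a * x m"])
    qed (simp add: P_def)
  qed
  then obtain F where F: "\<And>c. P F c (F c)" by blast
  have fG: "flagged G" using p by (simp add: fpair_def)
  have F1: "supp_in {m\<in>K. m \<preceq> c} (F c)" "ip E (ap E G (F c)) (ap E G (F c)) = 1"
      "c' \<in> K \<Longrightarrow> c' \<preceq> c \<Longrightarrow> c' \<noteq> c \<Longrightarrow> ip E (ap E G (F c)) (ap E G (F c')) = 0" if "c \<in> K" for c c'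
    using F[of c] that unfolding P_def by auto
  have "ip E (ap E G (F c)) (ap E G (F c')) = (if c = c' then 1 else 0)" if cc: "c \<in> K" "c' \<in> K" for c c'
  proof (cases "fst c = fst c'")
    case True
    then consider "c = c'" | "c' \<preceq> c" "c' \<noteq> c" | "c \<preceq> c'" "c \<noteq> c'" using fle_total by blast
    then show ?thesis
    proof cases
      case 3
      then have "cnj (ip E (ap E G (F c')) (ap E G (F c))) = 0" using F1(3)[OF cc(2,1)] by simp
      then show ?thesis using 3 by (simp add: ip_cnj)
    qed (use F1 cc in auto)
  next
    case False
    have "ap E G (F c) r * cnj (ap E G (F c') r) = 0" for r
    proof (rule ccontr)
      assume "ap E G (F c) r * cnj (ap E G (F c') r) \<noteq> 0"
      then have "ap E G (F c) r \<noteq> 0" "ap E G (F c') r \<noteq> 0" by auto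
      then have "r \<preceq> c" "r \<preceq> c'" using ap_flagged_supp[OF fG F1(1)] cc by blast+
      then show False using False fle_fst by metis
    qed
    then have "ip E (ap E G (F c)) (ap E G (F c')) = 0" unfolding ip_def by (intro sum.neutral) blast
    then show ?thesis using False by auto
  qed
  then show ?thesis using F1(1) by blast
qed

context quiver
begin

text \<open>All vertices at once, as one matrix over \<open>E\<close>; for a representation the
  entries between different vertices vanish by \<open>mu_graded\<close>.\<close>

definition mu :: "('v \<times> nat) set \<Rightarrow> (nat \<Rightarrow> ('v \<times> nat) cmat) \<Rightarrow> ('v \<times> nat) cmat" where
  "mu E f r c = (\<Sum>k\<in>arrows. \<Sum>m\<in>E. f k r m * cnj (f k c m)) - (\<Sum>k\<in>arrows. \<Sum>m\<in>E. cnj (f k m r) * f k m c)"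

definition adj :: "('v \<times> nat) cmat \<Rightarrow> ('v \<times> nat) cmat" where "adj A r c = cnj (A c r)"

lemma mu_quadratic_form:
  "(\<Sum>r\<in>E. \<Sum>s\<in>E. cnj (v r) * mu E f r s * v s) =
    of_real (\<Sum>k\<in>arrows. sqn E (ap E (adj (f k)) v) - sqn E (ap E (f k) v))"
proof -
  have 1: "(\<Sum>r\<in>E. \<Sum>s\<in>E. cnj (v r) * (\<Sum>m\<in>E. A r m * cnj (A s m)) * v s) = of_real (sqn E (ap E (adj A) v))" for A
  proof -
    have "of_real (sqn E (ap E (adj A) v)) = (\<Sum>m\<in>E. (\<Sum>s\<in>E. cnj (A s m) * v s) * (\<Sum>r\<in>E. A r m * cnj (v r)))"
      unfolding sqn_def of_real_sum complex_norm_square by (simp add: ap_def adj_def)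
    also have "\<dots> = (\<Sum>m\<in>E. \<Sum>r\<in>E. \<Sum>s\<in>E. cnj (v r) * (A r m * cnj (A s m)) * v s)"
      unfolding sum_product by (subst sum.swap) (simp add: algebra_simps)
    also have "\<dots> = (\<Sum>r\<in>E. \<Sum>m\<in>E. \<Sum>s\<in>E. cnj (v r) * (A r m * cnj (A s m)) * v s)" by (rule sum.swap)
    also have "\<dots> = (\<Sum>r\<in>E. \<Sum>s\<in>E. \<Sum>m\<in>E. cnj (v r) * (A r m * cnj (A s m)) * v s)"
      by (intro sum.cong refl sum.swap)
    finally show ?thesis by (simp add: sum_distrib_left sum_distrib_right)
  qed
  have 2: "(\<Sum>r\<in>E. \<Sum>s\<in>E. cnj (v r) * (\<Sum>m\<in>E. cnj (A m r) * A m s) * v s) = of_real (sqn E (ap E A v))" for A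
    using 1[of "adj A"] unfolding adj_def by (simp add: adj_def[abs_def])
  have "(\<Sum>r\<in>E. \<Sum>s\<in>E. cnj (v r) * mu E f r s * v s) =
     (\<Sum>k\<in>arrows. (\<Sum>r\<in>E. \<Sum>s\<in>E. cnj (v r) * (\<Sum>m\<in>E. f k r m * cnj (f k s m)) * v s)) -
     (\<Sum>k\<in>arrows. (\<Sum>r\<in>E. \<Sum>s\<in>E. cnj (v r) * (\<Sum>m\<in>E. cnj (f k m r) * f k m s) * v s))"
  proof -
    have "(\<Sum>k\<in>arrows. (\<Sum>r\<in>E. \<Sum>s\<in>E. cnj (v r) * B k r s * v s)) = (\<Sum>r\<in>E. \<Sum>s\<in>E. cnj (v r) * (\<Sum>k\<in>arrows. B k r s) * v s)" for B
      unfolding sum_distrib_left sum_distrib_right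
      by (subst sum.swap, intro sum.cong refl, rule sum.swap)
    then show ?thesis unfolding mu_def by (simp add: sum_subtractf algebra_simps)
  qed
  then show ?thesis unfolding 1 2 by (simp add: sum_subtractf)
qed

text \<open>The trace over an orthonormal frame is estimated from both sides. The quadratic form at
  the vector of index \<open>c\<close> is an average of values \<open>a r\<close> with
  \<open>r \<preceq> c\<close>, hence at most \<open>a c\<close>. Invariance makes the norm of f v
  equal to that of its frame coordinates, whereas the adjoint satisfies only Bessel's inequality; as
  the double sums of coordinates agree, the trace is nonnegative.\<close>

theorem necessity:
  assumes E: "finite E" and f: "rep f"
    and mu: "\<And>r c. r \<in> E \<Longrightarrow> c \<in> E \<Longrightarrow> mu E f r c = (if r = c then of_real (a r) else 0)"
    and mono: "\<And>r c. r \<in> E \<Longrightarrow> c \<in> E \<Longrightarrow> r \<preceq> c \<Longrightarrow> a r \<le> a c"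
    and Sh: "Sh E K"
  shows "(\<Sum>c\<in>K. a c) \<ge> 0"
proof -
  obtain K' where K': "below K' K" "epos f E K'" using Sh_imp_univ[OF E Sh] f unfolding univ_def by blast
  obtain G H where p: "fpair E G H" and st: "stab (cj E G H f) E K'" and K'E: "K' \<subseteq> E" using K'(2) unfolding epos_def by blast
  have finK': "finite K'" using K'E E finite_subset by blast
  have KE: "K \<subseteq> E" by (rule Sh_subset[OF Sh])
  obtain \<beta> where \<beta>: "bij_betw \<beta> K K'" "\<And>c. c \<in> K \<Longrightarrow> \<beta> c \<preceq> c" using K'(1) unfolding below_def by blast
  have "(\<Sum>c\<in>K'. a c) = (\<Sum>c\<in>K. a (\<beta> c))" using sum.reindex_bij_betw[OF \<beta>(1), of a] by simp
  also have "\<dots> \<le> (\<Sum>c\<in>K. a c)"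
  proof (rule sum_mono)
    fix c assume c: "c \<in> K"
    then have "\<beta> c \<in> K'" using bij_betw_apply[OF \<beta>(1)] by blast
    then show "a (\<beta> c) \<le> a c" using mono[of "\<beta> c" c] c \<beta>(2) KE K'E by blast
  qed
  finally have le: "(\<Sum>c\<in>K'. a c) \<le> (\<Sum>c\<in>K. a c)" .
  obtain x where x: "\<And>c. c \<in> K' \<Longrightarrow> supp_in {m\<in>K'. m \<preceq> c} (x c)"
     "\<And>c c'. c \<in> K' \<Longrightarrow> c' \<in> K' \<Longrightarrow> ip E (ap E G (x c)) (ap E G (x c')) = (if c = c' then 1 else 0)"
    using orthonormal_frame[OF E K'E p] by blast
  define v where "v c = ap E G (x c)" for c
  have on: "ip E (v c) (v c') = (if c = c' then 1 else 0)" if "c \<in> K'" "c' \<in> K'" for c c' using x(2)[OF that] by (simp add: v_def)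
  have fG: "flagged G" using p by (simp add: fpair_def)
  have xs: "supp_in K' (x c)" if "c \<in> K'" for c using x(1)[OF that] by (auto simp: supp_in_def)
  define T where "T u m = (\<Sum>c\<in>K'. x c m * u c)" for u m
  have T: "linop T" unfolding linop_def T_def by (simp add: algebra_simps sum.distrib sum_distrib_left)
  have vT: "ap E G (T u) r = (\<Sum>c\<in>K'. u c * v c r)" for u r
    unfolding T_def v_def ap_def sum_distrib_left by (subst sum.swap) (simp add: mult_ac)
  have Tsupp: "supp_in K' (T u)" for u unfolding supp_in_def
  proof (intro allI impI, rule ccontr)
    fix m assume m: "T u m \<noteq> 0" "m \<notin> K'"
    then have "x c m = 0" if "c \<in> K'" for c using xs[OF that] by (auto simp: supp_in_def)
    then show False using m(1) by (simp add: T_def)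
  qed
  have span: "\<exists>z. \<forall>r\<in>E. ap E (f k) (v c) r = (\<Sum>c'\<in>K'. z c' * v c' r)" if k: "k \<in> arrows" and c: "c \<in> K'" for k c
  proof -
    obtain z where z: "supp_in K' z" "\<And>r. r \<in> E \<Longrightarrow> ap E (f k) (v c) r = ap E G z r"
      using stab_invariance[OF E K'E p st k xs[OF c]] unfolding v_def by blast
    have "\<exists>u. supp_in K' u \<and> (\<forall>m\<in>K'. T u m = z m)"
    proof (rule linop_injective_imp_surjective[OF T finK' finK'])
      fix u assume u: "supp_in K' u" "\<forall>y\<in>K'. T u y = 0"
      then have "T u = (\<lambda>_. 0)" using Tsupp[of u] unfolding supp_in_def by blast
      then have s: "(\<Sum>c\<in>K'. u c * v c r) = 0" for r using vT[of u r] by (simp add: ap_def)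
      have "u c = 0" if c: "c \<in> K'" for c
      proof -
        have "0 = ip E (\<lambda>r. \<Sum>c\<in>K'. u c * v c r) (v c)" unfolding s by (simp add: ip_def)
        also have "\<dots> = u c" unfolding ip_sum_left using finK' on c by (simp add: if_distrib[of "\<lambda>b. _ * b"] cong: if_cong)
        finally show ?thesis by simp
      qed
      moreover have "u c = 0" if "c \<notin> K'" for c using u(1) that by (auto simp: supp_in_def)
      ultimately show "u = (\<lambda>_. 0)" by blast
    qed simp
    then obtain u where u: "supp_in K' u" "\<And>m. m \<in> K' \<Longrightarrow> T u m = z m" by blast
    have "T u = z"
    proof
      fix m show "T u m = z m" using Tsupp[of u] z(1) u(2)[of m] unfolding supp_in_def by metis
    qed
    then show ?thesis using z(2) vT[of u] by (intro exI[of _ u]) simp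
  qed
  have upper: "(\<Sum>k\<in>arrows. sqn E (ap E (adj (f k)) (v c)) - sqn E (ap E (f k) (v c))) \<le> a c" if c: "c \<in> K'" for c
  proof -
    have "(\<Sum>r\<in>E. \<Sum>s\<in>E. cnj (v c r) * mu E f r s * v c s) = of_real (\<Sum>r\<in>E. a r * (cmod (v c r))\<^sup>2)"
    proof -
      have "(\<Sum>s\<in>E. cnj (v c r) * mu E f r s * v c s) = of_real (a r * (cmod (v c r))\<^sup>2)" if r: "r \<in> E" for r
      proof -
        have "(\<Sum>s\<in>E. cnj (v c r) * mu E f r s * v c s) = (\<Sum>s\<in>E. if s = r then cnj (v c r) * of_real (a r) * v c r else 0)"
          using mu r by (intro sum.cong) auto
        also have "\<dots> = of_real (a r * (cmod (v c r))\<^sup>2)"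
          using r E by (simp only: of_real_mult complex_norm_square) (simp add: mult_ac)
        finally show ?thesis .
      qed
      then show ?thesis by simp
    qed
    then have "complex_of_real (\<Sum>k\<in>arrows. sqn E (ap E (adj (f k)) (v c)) - sqn E (ap E (f k) (v c))) = of_real (\<Sum>r\<in>E. a r * (cmod (v c r))\<^sup>2)"
      using mu_quadratic_form[of "v c" E f] by simp
    then have "(\<Sum>k\<in>arrows. sqn E (ap E (adj (f k)) (v c)) - sqn E (ap E (f k) (v c))) = (\<Sum>r\<in>E. a r * (cmod (v c r))\<^sup>2)"
      using of_real_eq_iff by blast
    also have "\<dots> \<le> (\<Sum>r\<in>E. a c * (cmod (v c r))\<^sup>2)"
    proof (rule sum_mono)
      fix r assume r: "r \<in> E"
      show "a r * (cmod (v c r))\<^sup>2 \<le> a c * (cmod (v c r))\<^sup>2"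
      proof (cases "v c r = 0")
        case False
        then have "r \<preceq> c" using ap_flagged_supp[OF fG x(1)[OF c]] unfolding v_def by blast
        then have "a r \<le> a c" using mono r c K'E by blast
        then show ?thesis by (intro mult_right_mono) auto
      qed simp
    qed
    also have "\<dots> = a c * sqn E (v c)" by (simp add: sqn_def sum_distrib_left)
    also have "sqn E (v c) = 1" using on[OF c c] by (simp add: ip_self)
    finally show ?thesis by simp
  qed
  have adjip: "ip E (ap E (f k) u) w = ip E u (ap E (adj (f k)) w)" for k u w
  proof -
    have "ip E (ap E (f k) u) w = (\<Sum>r\<in>E. \<Sum>m\<in>E. f k r m * u m * cnj (w r))" by (simp add: ip_def ap_def sum_distrib_right)
    also have "\<dots> = (\<Sum>m\<in>E. \<Sum>r\<in>E. f k r m * u m * cnj (w r))" by (rule sum.swap)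
    finally show ?thesis by (simp add: ip_def ap_def adj_def sum_distrib_left mult_ac)
  qed
  have "0 \<le> (\<Sum>k\<in>arrows. \<Sum>c\<in>K'. sqn E (ap E (adj (f k)) (v c)) - sqn E (ap E (f k) (v c)))"
  proof (rule sum_nonneg)
    fix k assume k: "k \<in> arrows"
    have "(\<Sum>c\<in>K'. sqn E (ap E (f k) (v c))) = (\<Sum>c\<in>K'. \<Sum>c'\<in>K'. (cmod (ip E (ap E (f k) (v c)) (v c')))\<^sup>2)"
    proof (intro sum.cong refl)
      fix c assume "c \<in> K'"
      then obtain z where "\<forall>r\<in>E. ap E (f k) (v c) r = (\<Sum>c'\<in>K'. z c' * v c' r)" using span[OF k] by blast
      then show "sqn E (ap E (f k) (v c)) = (\<Sum>c'\<in>K'. (cmod (ip E (ap E (f k) (v c)) (v c')))\<^sup>2)"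
        using parseval[OF finK' on, of "ap E (f k) (v c)" z] by blast
    qed
    also have "\<dots> = (\<Sum>c'\<in>K'. \<Sum>c\<in>K'. (cmod (ip E (ap E (adj (f k)) (v c')) (v c)))\<^sup>2)"
    proof (subst sum.swap, intro sum.cong refl)
      fix c c'
      have "cmod (ip E (ap E (f k) (v c)) (v c')) = cmod (cnj (ip E (ap E (adj (f k)) (v c')) (v c)))"
        unfolding adjip ip_cnj ..
      then show "(cmod (ip E (ap E (f k) (v c)) (v c')))\<^sup>2 = (cmod (ip E (ap E (adj (f k)) (v c')) (v c)))\<^sup>2"
        by (simp only: complex_mod_cnj)
    qed
    also have "\<dots> \<le> (\<Sum>c'\<in>K'. sqn E (ap E (adj (f k)) (v c')))"
      by (intro sum_mono bessel[OF finK' on]) auto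
    finally show "0 \<le> (\<Sum>c\<in>K'. sqn E (ap E (adj (f k)) (v c)) - sqn E (ap E (f k) (v c)))" by (simp add: sum_subtractf)
  qed
  also have "\<dots> = (\<Sum>c\<in>K'. \<Sum>k\<in>arrows. sqn E (ap E (adj (f k)) (v c)) - sqn E (ap E (f k) (v c)))" by (rule sum.swap)
  also have "\<dots> \<le> (\<Sum>c\<in>K'. a c)" by (intro sum_mono upper)
  finally show ?thesis using le by simp
qed

end

section \<open>Minimisation over spaces of matrices\<close>

lemma compact_box: "compact {x :: 'i \<Rightarrow> complex. \<forall>j. x j \<in> (if j \<in> X then cball 0 R else {0})}"
proof -
  define S where "S j = (if j \<in> X then cball 0 R else {0 :: complex})" for j :: 'i
  have "compact (S j)" for j by (simp add: S_def)
  then have "compactin (product_topology (\<lambda>i. euclidean) UNIV) (Pi\<^sub>E UNIV S)"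
    unfolding compactin_PiE by simp
  then have "compact (Pi\<^sub>E UNIV S)" unfolding euclidean_product_topology by simp
  moreover have "Pi\<^sub>E UNIV S = {x. \<forall>j. x j \<in> (if j \<in> X then cball 0 R else {0})}"
    by (auto simp: S_def PiE_def Pi_def extensional_def)
  ultimately show ?thesis by simp
qed

text \<open>First and second order conditions at a minimum. Only \<open>t\<close> of absolute value
  at most 1 is inspected, where higher terms are dominated by lower ones.\<close>

lemma nonneg_polynomial_at_zero:
  fixes c1 c2 c3 c4 :: real
  assumes "\<And>t. 0 \<le> c1 * t + c2 * t^2 + c3 * t^3 + c4 * t^4"
  shows "c1 = 0" "c2 \<ge> 0"
proof -
  have bound: "c * t ^ n \<le> \<bar>c\<bar> * t" if "0 < t" "t \<le> 1" "n \<ge> 1" for c t :: real and n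
  proof -
    have "c * t ^ n \<le> \<bar>c\<bar> * t ^ n" using that by (intro mult_right_mono) auto
    also have "\<dots> \<le> \<bar>c\<bar> * t ^ 1" using that by (intro mult_left_mono power_decreasing) auto
    finally show ?thesis by simp
  qed
  define C where "C = \<bar>c2\<bar> + \<bar>c3\<bar> + \<bar>c4\<bar>"
  have lim: "0 \<le> a" if "\<And>t. 0 < t \<Longrightarrow> t \<le> 1 \<Longrightarrow> 0 \<le> a + t * B" "B \<ge> 0" for a B :: real
  proof (rule ccontr)
    assume "\<not> 0 \<le> a"
    define t where "t = min 1 (- a / (2 * (B + 1)))"
    have t: "0 < t" "t \<le> 1" using \<open>\<not> 0 \<le> a\<close> that(2) by (auto simp: t_def divide_neg_pos)
    have "t * B \<le> (- a / (2 * (B + 1))) * (B + 1)"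
      using t that(2) by (intro mult_mono) (auto simp: t_def)
    also have "\<dots> = - a / 2" using that(2) by (simp add: field_simps)
    finally show False using that(1)[OF t] \<open>\<not> 0 \<le> a\<close> by simp
  qed
  have "0 \<le> s * c1" if s: "s = 1 \<or> s = -1" for s
  proof (rule lim[of _ C])
    fix t :: real assume t: "0 < t" "t \<le> 1"
    have "0 \<le> c1 * (s * t) + c2 * (s * t)^2 + c3 * (s * t)^3 + c4 * (s * t)^4" by (rule assms)
    also have "\<dots> \<le> t * (s * c1) + \<bar>c2\<bar> * t * t + \<bar>c3\<bar> * t * t + \<bar>c4\<bar> * t * t"
    proof -
      have "c2 * (s * t)^2 \<le> \<bar>c2\<bar> * t * t"
        using s t by (auto simp: power2_eq_square mult.assoc intro!: mult_right_mono)
      moreover have "c3 * (s * t)^3 \<le> \<bar>c3\<bar> * t * t"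
      proof -
        have "c3 * (s * t)^3 = (s * c3 * t ^ 2) * t" using s by (auto simp: power3_eq_cube power2_eq_square)
        also have "\<dots> \<le> (\<bar>s * c3\<bar> * t) * t" using bound[OF t, of 2 "s * c3"] t by (intro mult_right_mono) auto
        finally show ?thesis using s by auto
      qed
      moreover have "c4 * (s * t)^4 \<le> \<bar>c4\<bar> * t * t"
      proof -
        have "c4 * (s * t)^4 = (c4 * t ^ 3) * t" using s by (auto simp: power4_eq_xxxx power3_eq_cube)
        also have "\<dots> \<le> (\<bar>c4\<bar> * t) * t" using bound[OF t, of 3 c4] t by (intro mult_right_mono) auto
        finally show ?thesis .
      qed
      ultimately show ?thesis by (simp add: mult_ac)
    qed
    also have "\<dots> = t * (s * c1 + t * C)" by (simp add: C_def algebra_simps)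
    finally show "0 \<le> s * c1 + t * C" using t by (simp add: zero_le_mult_iff)
  qed (simp add: C_def)
  from this[of 1] this[of "-1"] show c1: "c1 = 0" by simp
  show "c2 \<ge> 0"
  proof (rule lim[of _ "\<bar>c3\<bar> + \<bar>c4\<bar>"])
    fix t :: real assume t: "0 < t" "t \<le> 1"
    have "0 \<le> c2 * t^2 + c3 * t^3 + c4 * t^4" using assms[of t] c1 by simp
    also have "\<dots> = t^2 * (c2 + c3 * t + c4 * t^2)" by (simp add: algebra_simps power2_eq_square power3_eq_cube power4_eq_xxxx)
    finally have "0 \<le> c2 + c3 * t + c4 * t^2" using t by (simp add: zero_le_mult_iff)
    also have "\<dots> \<le> c2 + t * (\<bar>c3\<bar> + \<bar>c4\<bar>)"
      using bound[OF t, of 1 c3] bound[OF t, of 2 c4] by (simp add: algebra_simps)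
    finally show "0 \<le> c2 + t * (\<bar>c3\<bar> + \<bar>c4\<bar>)" .
  qed simp
qed

definition bil :: "'x set \<Rightarrow> 'x cmat \<Rightarrow> ('x \<Rightarrow> complex) \<Rightarrow> ('x \<Rightarrow> complex) \<Rightarrow> complex" where
  "bil E Z x y = (\<Sum>m\<in>E. \<Sum>n\<in>E. cnj (x m) * Z m n * y n)"

lemma bil_right: "bil E Z x (\<lambda>m. a * y m + b * z m) = a * bil E Z x y + b * bil E Z x z"
proof -
  have "bil E Z x (\<lambda>m. a * y m + b * z m) = (\<Sum>m\<in>E. \<Sum>n\<in>E. a * (cnj (x m) * Z m n * y n) + b * (cnj (x m) * Z m n * z n))"
    unfolding bil_def by (intro sum.cong refl) (simp add: algebra_simps)
  then show ?thesis unfolding bil_def sum.distrib sum_distrib_left by simp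
qed

lemma bil_left: "bil E Z (\<lambda>m. a * y m + b * z m) x = cnj a * bil E Z y x + cnj b * bil E Z z x"
proof -
  have "bil E Z (\<lambda>m. a * y m + b * z m) x = (\<Sum>m\<in>E. \<Sum>n\<in>E. cnj a * (cnj (y m) * Z m n * x n) + cnj b * (cnj (z m) * Z m n * x n))"
    unfolding bil_def by (intro sum.cong refl) (simp add: algebra_simps)
  then show ?thesis unfolding bil_def sum.distrib sum_distrib_left by simp
qed

lemma bil_herm:
  assumes "\<And>r c. r \<in> E \<Longrightarrow> c \<in> E \<Longrightarrow> X c r = cnj (X r c)"
  shows "bil E X y x = cnj (bil E X x y)"
proof -
  have "cnj (bil E X x y) = (\<Sum>m\<in>E. \<Sum>n\<in>E. x m * cnj (X m n) * cnj (y n))"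
    unfolding bil_def by simp
  also have "\<dots> = (\<Sum>m\<in>E. \<Sum>n\<in>E. cnj (y n) * X n m * x m)"
  proof (intro sum.cong refl)
    fix m n assume "m \<in> E" "n \<in> E"
    show "x m * cnj (X m n) * cnj (y n) = cnj (y n) * X n m * x m"
      unfolding assms[OF \<open>m \<in> E\<close> \<open>n \<in> E\<close>, symmetric] by (simp only: mult_ac)
  qed
  also have "\<dots> = bil E X y x" unfolding bil_def by (rule sum.swap)
  finally show ?thesis by simp
qed

text \<open>The maximiser of \<open>\<Sum>c. w c (u\<^sup>*Xu)\<^sub>c\<^sub>c\<close> over unitary matrices \<open>u\<close> diagonalises \<open>X\<close>, with
  eigenvalues ordered like the weights \<open>w\<close>; this is seen by rotating two columns of \<open>u\<close>.\<close>

lemma hermitian_diagonalisation: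
  fixes E :: "'x set" and X :: "'x cmat" and cls :: "'x \<Rightarrow> 'b" and w :: "'x \<Rightarrow> real"
  assumes E: "finite E" and herm: "\<And>r c. r \<in> E \<Longrightarrow> c \<in> E \<Longrightarrow> X c r = cnj (X r c)"
    and cls: "\<And>r c. r \<in> E \<Longrightarrow> c \<in> E \<Longrightarrow> X r c \<noteq> 0 \<Longrightarrow> cls r = cls c"
    and w: "\<And>r c. r \<in> E \<Longrightarrow> c \<in> E \<Longrightarrow> r \<noteq> c \<Longrightarrow> cls r = cls c \<Longrightarrow> w r \<noteq> w c"
  shows "\<exists>u. (\<forall>r c. u r c \<noteq> 0 \<longrightarrow> r \<in> E \<and> c \<in> E \<and> cls r = cls c) \<and>
     (\<forall>r\<in>E. \<forall>c\<in>E. ip E (\<lambda>m. u m c) (\<lambda>m. u m r) = unit_fun c r) \<and>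
     (\<forall>r\<in>E. \<forall>c\<in>E. r \<noteq> c \<longrightarrow> bil E X (\<lambda>m. u m r) (\<lambda>m. u m c) = 0) \<and>
     (\<forall>r\<in>E. \<forall>c\<in>E. cls r = cls c \<longrightarrow> w r < w c \<longrightarrow>
        Re (bil E X (\<lambda>m. u m r) (\<lambda>m. u m r)) \<le> Re (bil E X (\<lambda>m. u m c) (\<lambda>m. u m c)))"
proof -
  define I where "I = (\<lambda>r c :: 'x. if r = c then 1 else (0::complex))"
  define B where "B = {(r,c). r \<in> E \<and> c \<in> E \<and> cls r = cls c}"
  define col where "col v c m = v (m, c)" for v :: "'x \<times> 'x \<Rightarrow> complex" and c m
  have bilI: "bil E I x y = (\<Sum>m\<in>E. cnj (x m) * y m)" for x y
  proof -
    have "(\<Sum>n\<in>E. cnj (x m) * I m n * y n) = cnj (x m) * y m" if "m \<in> E" for m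
      using E that by (simp add: I_def if_distrib[of "\<lambda>b. _ * b"] if_distrib[of "\<lambda>b. b * _"] cong: if_cong)
    then show ?thesis by (simp add: bil_def)
  qed
  \<comment> \<open>The unitary matrices mixing only indices of one class, as a closed subset of a
    compact box.\<close>
  define U where "U = {v. (\<forall>j. v j \<in> (if j \<in> B then cball 0 1 else {0})) \<and>
      (\<forall>r\<in>E. \<forall>c\<in>E. bil E I (col v r) (col v c) = I r c)}"
  have cont: "continuous_on UNIV (\<lambda>v. bil E Z (col v r) (col v c))" for Z r c
    unfolding bil_def col_def by (intro continuous_intros) auto
  have "closed {v. bil E I (col v r) (col v c) = I r c}" for r c
    by (intro closed_Collect_eq cont continuous_intros)
  then have "closed (\<Inter>r\<in>E. \<Inter>c\<in>E. {v. bil E I (col v r) (col v c) = I r c})" by (intro closed_INT ballI)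
  then have "compact ({v. \<forall>j. v j \<in> (if j \<in> B then cball 0 1 else {0})} \<inter>
      (\<Inter>r\<in>E. \<Inter>c\<in>E. {v. bil E I (col v r) (col v c) = I r c}))"
    by (intro compact_Int_closed compact_box)
  moreover have "U = {v. \<forall>j. v j \<in> (if j \<in> B then cball 0 1 else {0})} \<inter>
      (\<Inter>r\<in>E. \<Inter>c\<in>E. {v. bil E I (col v r) (col v c) = I r c})" unfolding U_def by blast
  ultimately have cU: "compact U" by simp
  define v0 where "v0 = (\<lambda>(r,c). if r = c \<and> r \<in> E then 1 else (0::complex))"
  have "v0 \<in> U"
  proof -
    have "bil E I (col v0 r) (col v0 c) = I r c" if "r \<in> E" "c \<in> E" for r c
      unfolding bilI using that E
      by (simp add: col_def v0_def I_def if_distrib[of cnj] if_distrib[of "\<lambda>b. b * _"] cong: if_cong)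
    then show ?thesis unfolding U_def by (auto simp: v0_def B_def split: if_splits)
  qed
  define \<Phi> where "\<Phi> v = (\<Sum>c\<in>E. w c * Re (bil E X (col v c) (col v c)))" for v
  have "continuous_on U \<Phi>" unfolding \<Phi>_def
    by (intro continuous_intros continuous_on_subset[OF cont]) auto
  then obtain v where v: "v \<in> U" and mx: "\<And>v'. v' \<in> U \<Longrightarrow> \<Phi> v' \<le> \<Phi> v"
    using continuous_attains_sup[OF cU] \<open>v0 \<in> U\<close> by blast
  have gram: "bil E I (col v r) (col v c) = I r c" if "r \<in> E" "c \<in> E" for r c
    using v that unfolding U_def by blast
  have vB: "v j = 0" if "j \<notin> B" for j
  proof -
    have "v j \<in> (if j \<in> B then cball 0 1 else {0})" using v unfolding U_def by blast
    then show ?thesis using that by simp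
  qed
  \<comment> \<open>Columns \<open>r\<close> and \<open>c\<close> are rotated by the angle with
    tangent \<open>t\<close> and the phase \<open>z\<close>; the inequality is maximality, freed of
    the positive factor \<open>s * s\<close>.\<close>
  have rot: "(w r - w c) * (t\<^sup>2 * (Re (bil E X (col v c) (col v c)) - Re (bil E X (col v r) (col v r))) + 2 * t * Re (z * bil E X (col v r) (col v c))) \<le> 0"
    if rc: "r \<in> E" "c \<in> E" "r \<noteq> c" "cls r = cls c" and z: "cmod z = 1" for r c t z
  proof -
    define s where "s = 1 / sqrt (1 + t\<^sup>2)"
    have pos: "1 + t\<^sup>2 > 0" by (simp add: add_pos_nonneg)
    have ss: "s * s * (1 + t\<^sup>2) = 1" unfolding s_def using pos by (simp add: field_simps)
    have ssc: "complex_of_real s * complex_of_real s * (1 + (complex_of_real t)\<^sup>2) = 1"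
    proof -
      have "complex_of_real s * complex_of_real s * (1 + (complex_of_real t)\<^sup>2) = complex_of_real (s * s * (1 + t\<^sup>2))" by simp
      then show ?thesis using ss by simp
    qed
    have zz: "z * cnj z = 1" using z by (simp add: complex_norm_square[symmetric])
    define p1 p2 where "p1 = complex_of_real s" and "p2 = complex_of_real (s * t) * z"
    define cr where "cr m = p1 * col v r m + p2 * col v c m" for m
    define cc where "cc m = (- cnj p2) * col v r m + p1 * col v c m" for m
    define v' where "v' = (\<lambda>(m,n). if n = r then cr m else if n = c then cc m else v (m,n))"
    have cols: "col v' r = cr" "col v' c = cc" "\<And>n. n \<noteq> r \<Longrightarrow> n \<noteq> c \<Longrightarrow> col v' n = col v n"
      using rc(3) by (auto simp: col_def v'_def)
    have pp: "p1 * cnj p1 + p2 * cnj p2 = 1"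
    proof -
      have "p2 * cnj p2 = of_real (s * t) * of_real (s * t) * (z * cnj z)" by (simp add: p2_def mult_ac)
      then have "p2 * cnj p2 = of_real (s * t * (s * t))" using zz by simp
      then have "p1 * cnj p1 + p2 * cnj p2 = of_real (s * s + s * t * (s * t))" by (simp add: p1_def)
      also have "s * s + s * t * (s * t) = s * s * (1 + t\<^sup>2)" by (simp add: algebra_simps power2_eq_square)
      finally show ?thesis using ss by simp
    qed
    have p1c: "cnj p1 = p1" by (simp add: p1_def)
    have brr: "bil E Z cr cr = cnj p1 * (p1 * bil E Z (col v r) (col v r) + p2 * bil E Z (col v r) (col v c)) +
        cnj p2 * (p1 * bil E Z (col v c) (col v r) + p2 * bil E Z (col v c) (col v c))" for Z
      unfolding cr_def[abs_def] bil_left bil_right ..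
    have bcc: "bil E Z cc cc = - p2 * ((- cnj p2) * bil E Z (col v r) (col v r) + p1 * bil E Z (col v r) (col v c)) +
        p1 * ((- cnj p2) * bil E Z (col v c) (col v r) + p1 * bil E Z (col v c) (col v c))" for Z
      unfolding cc_def[abs_def] bil_left bil_right by (simp add: p1c)
    have brc: "bil E Z cr cc = cnj p1 * ((- cnj p2) * bil E Z (col v r) (col v r) + p1 * bil E Z (col v r) (col v c)) +
        cnj p2 * ((- cnj p2) * bil E Z (col v c) (col v r) + p1 * bil E Z (col v c) (col v c))" for Z
      unfolding cr_def[abs_def] cc_def[abs_def] bil_left bil_right ..
    have IX: "bil E I y x = cnj (bil E I x y)" for x y by (rule bil_herm) (auto simp: I_def)
    have gr: "bil E I (col v r) (col v r) = 1" "bil E I (col v c) (col v c) = 1" "bil E I (col v r) (col v c) = 0" "bil E I (col v c) (col v r) = 0"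
      using gram rc by (auto simp: I_def)
    have gother: "bil E I cr (col v n) = 0" "bil E I cc (col v n) = 0" if "n \<in> E" "n \<noteq> r" "n \<noteq> c" for n
      unfolding cr_def[abs_def] cc_def[abs_def] bil_left using gram rc that by (auto simp: I_def)
    have gram': "bil E I (col v' a) (col v' b) = I a b" if ab: "a \<in> E" "b \<in> E" for a b
    proof -
      have 1: "bil E I cr cr = 1" unfolding brr gr using pp by (simp add: mult.commute)
      have 2: "bil E I cc cc = 1" unfolding bcc gr using pp by (simp add: p1c add.commute)
      have 3: "bil E I cr cc = 0" unfolding brc gr by (simp add: p1c)
      have 4: "bil E I cc cr = 0" using IX[of cc cr] 3 by simp
      have 5: "bil E I (col v n) cr = 0" "bil E I (col v n) cc = 0" if "n \<in> E" "n \<noteq> r" "n \<noteq> c" for n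
        using IX[of "col v n" cr] IX[of "col v n" cc] gother[OF that] by simp_all
      have I1: "I r r = 1" "I c c = 1" "I r c = 0" "I c r = 0" using rc(3) by (auto simp: I_def)
      have I2: "I r n = 0" "I n r = 0" if "n \<noteq> r" for n using that by (auto simp: I_def)
      have I3: "I c n = 0" "I n c = 0" if "n \<noteq> c" for n using that by (auto simp: I_def)
      consider (rr) "a = r" "b = r" | (rc) "a = r" "b = c" | (cr) "a = c" "b = r" | (cc) "a = c" "b = c"
        | (ro) "a = r" "b \<noteq> r" "b \<noteq> c" | (co) "a = c" "b \<noteq> r" "b \<noteq> c" | (or) "a \<noteq> r" "a \<noteq> c" "b = r"
        | (oc) "a \<noteq> r" "a \<noteq> c" "b = c" | (oo) "a \<noteq> r" "a \<noteq> c" "b \<noteq> r" "b \<noteq> c" by metis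
      then show ?thesis
      proof cases
        case rr then show ?thesis by (simp only: cols(1) 1 I1)
      next
        case rc then show ?thesis by (simp only: cols(1,2) 3 I1)
      next
        case cr then show ?thesis by (simp only: cols(1,2) 4 I1)
      next
        case cc then show ?thesis by (simp only: cols(2) 2 I1)
      next
        case ro then show ?thesis using cols(3)[OF ro(2,3)] gother(1)[OF ab(2) ro(2,3)] I2(1)[OF ro(2)] by (simp only: cols(1))
      next
        case co then show ?thesis using cols(3)[OF co(2,3)] gother(2)[OF ab(2) co(2,3)] I3(1)[OF co(3)] by (simp only: cols(2))
      next
        case or then show ?thesis using cols(3)[OF or(1,2)] 5(1)[OF ab(1) or(1,2)] I2(2)[OF or(1)] by (simp only: cols(1))
      next
        case oc then show ?thesis using cols(3)[OF oc(1,2)] 5(2)[OF ab(1) oc(1,2)] I3(2)[OF oc(2)] by (simp only: cols(2))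
      next
        case oo then show ?thesis using cols(3)[OF oo(1,2)] cols(3)[OF oo(3,4)] gram[OF ab] by (simp only:)
      qed
    qed
    have v'B: "v' j = 0" if j: "j \<notin> B" for j
    proof -
      obtain m n where mn: "j = (m,n)" by (cases j)
      have "(m,r) \<notin> B" "(m,c) \<notin> B" if "n = r \<or> n = c" using j that rc mn by (auto simp: B_def)
      then show ?thesis using vB[of "(m,r)"] vB[of "(m,c)"] vB[OF j] mn by (auto simp: v'_def cr_def cc_def col_def)
    qed
    have v'1: "cmod (v' (m,n)) \<le> 1" if "m \<in> E" "n \<in> E" for m n
    proof -
      have "complex_of_real (\<Sum>m\<in>E. (cmod (v' (m,n)))\<^sup>2) = bil E I (col v' n) (col v' n)"
        unfolding bilI of_real_sum complex_norm_square by (simp add: col_def mult.commute)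
      also have "\<dots> = 1" using gram'[OF that(2,2)] by (simp add: I_def)
      finally have "(\<Sum>m\<in>E. (cmod (v' (m,n)))\<^sup>2) = 1" using of_real_eq_1_iff by blast
      moreover have "(cmod (v' (m,n)))\<^sup>2 \<le> (\<Sum>m\<in>E. (cmod (v' (m,n)))\<^sup>2)" using that E by (intro member_le_sum) auto
      ultimately show ?thesis by (simp add: power_le_one_iff abs_square_le_1)
    qed
    have "v' \<in> U" unfolding U_def
    proof (intro CollectI conjI allI ballI)
      fix j show "v' j \<in> (if j \<in> B then cball 0 1 else {0})"
        using v'B[of j] v'1[of "fst j" "snd j"] by (auto simp: B_def)
    qed (use gram' in blast)
    from mx[OF this] have "\<Phi> v' \<le> \<Phi> v" .
    define q where "q n = Re (bil E X (col v n) (col v n))" for n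
    define \<beta> where "\<beta> = Re (z * bil E X (col v r) (col v c))"
    have cr_sym: "bil E X (col v c) (col v r) = cnj (bil E X (col v r) (col v c))" by (rule bil_herm[OF herm])
    have imq: "bil E X (col v n) (col v n) = of_real (q n)" for n
      using bil_herm[of E X "col v n" "col v n", OF herm] unfolding q_def by (simp add: complex_eq_iff)
    have zq: "Re (p2 * bil E X (col v r) (col v c)) = s * t * \<beta>" "Re (cnj p2 * cnj (bil E X (col v r) (col v c))) = s * t * \<beta>"
    proof -
      have "Re (p2 * bil E X (col v r) (col v c)) = Re (of_real (s * t) * (z * bil E X (col v r) (col v c)))"
        by (simp only: p2_def mult.assoc)
      also have "\<dots> = s * t * \<beta>" unfolding \<beta>_def by (simp only: times_complex.sel Re_complex_of_real Im_complex_of_real mult_zero_left diff_0_right)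
      finally show 1: "Re (p2 * bil E X (col v r) (col v c)) = s * t * \<beta>" .
      have "cnj p2 * cnj (bil E X (col v r) (col v c)) = cnj (p2 * bil E X (col v r) (col v c))" by (rule complex_cnj_mult[symmetric])
      then show "Re (cnj p2 * cnj (bil E X (col v r) (col v c))) = s * t * \<beta>"
        unfolding 1[symmetric] by (simp only: cnj.sel)
    qed
    have p2p2: "p2 * cnj p2 = of_real (s * s * t\<^sup>2)"
    proof -
      have "p2 * cnj p2 = of_real (s * t) * of_real (s * t) * (z * cnj z)" by (simp add: p2_def mult_ac)
      then show ?thesis using zz by (simp add: power2_eq_square)
    qed
    have qr: "Re (bil E X cr cr) = s * s * (q r + t\<^sup>2 * q c + 2 * t * \<beta>)"
    proof -
      have "bil E X cr cr = of_real (s * s * q r) + of_real s * (p2 * bil E X (col v r) (col v c)) +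
          of_real s * (cnj p2 * cnj (bil E X (col v r) (col v c))) + (p2 * cnj p2) * of_real (q c)"
        unfolding brr imq cr_sym p1c by (simp add: p1_def algebra_simps)
      then have "Re (bil E X cr cr) = s * s * q r + s * (s * t * \<beta>) + s * (s * t * \<beta>) + s * s * t\<^sup>2 * q c"
        unfolding p2p2 using zq by simp
      then show ?thesis by (simp add: algebra_simps)
    qed
    have qc: "Re (bil E X cc cc) = s * s * (q c + t\<^sup>2 * q r - 2 * t * \<beta>)"
    proof -
      have "bil E X cc cc = (p2 * cnj p2) * of_real (q r) - of_real s * (p2 * bil E X (col v r) (col v c)) -
          of_real s * (cnj p2 * cnj (bil E X (col v r) (col v c))) + of_real (s * s * q c)"
        unfolding bcc imq cr_sym by (simp add: p1_def algebra_simps)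
      then have "Re (bil E X cc cc) = s * s * t\<^sup>2 * q r - s * (s * t * \<beta>) - s * (s * t * \<beta>) + s * s * q c"
        unfolding p2p2 using zq by simp
      then show ?thesis by (simp add: algebra_simps)
    qed
    define E' where "E' = E - {r,c}"
    have EE: "E = insert r (insert c E')" "r \<notin> insert c E'" "c \<notin> E'" "finite E'" using rc E by (auto simp: E'_def)
    have split: "(\<Sum>n\<in>E. g n) = g r + g c + (\<Sum>n\<in>E'. g n)" for g :: "'x \<Rightarrow> real"
      using EE by (simp add: add.assoc)
    have "(\<Sum>n\<in>E'. w n * Re (bil E X (col v' n) (col v' n))) = (\<Sum>n\<in>E'. w n * Re (bil E X (col v n) (col v n)))"
      by (intro sum.cong) (auto simp: cols E'_def)
    then have "w r * Re (bil E X cr cr) + w c * Re (bil E X cc cc) \<le> w r * q r + w c * q c"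
      using \<open>\<Phi> v' \<le> \<Phi> v\<close> unfolding \<Phi>_def split cols q_def by simp
    then have "w r * (s * s * (q r + t\<^sup>2 * q c + 2 * t * \<beta>)) + w c * (s * s * (q c + t\<^sup>2 * q r - 2 * t * \<beta>)) \<le> (s * s * (1 + t\<^sup>2)) * (w r * q r + w c * q c)"
      unfolding qr qc ss by simp
    then have "s * s * ((w r - w c) * (t\<^sup>2 * (q c - q r) + 2 * t * \<beta>)) \<le> 0"
      by (simp add: algebra_simps)
    moreover have "s * s > 0" using pos by (simp add: s_def)
    ultimately have "(w r - w c) * (t\<^sup>2 * (q c - q r) + 2 * t * \<beta>) \<le> 0" by (meson mult_le_0_iff not_le)
    then show ?thesis unfolding q_def \<beta>_def .
  qed
  \<comment> \<open>Since \<open>t\<close> may have either sign, the linear coefficient vanishes and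
    the quadratic one has a sign; distinct weights allow cancelling \<open>w r - w c\<close> in the
    former.\<close>
  have crit: "Re (z * bil E X (col v r) (col v c)) = 0 \<and> (w r - w c) * (Re (bil E X (col v c) (col v c)) - Re (bil E X (col v r) (col v r))) \<le> 0"
    if rc: "r \<in> E" "c \<in> E" "r \<noteq> c" "cls r = cls c" and z: "cmod z = 1" for r c z
  proof -
    have "0 \<le> (- 2 * (w r - w c) * Re (z * bil E X (col v r) (col v c))) * t +
       (- ((w r - w c) * (Re (bil E X (col v c) (col v c)) - Re (bil E X (col v r) (col v r))))) * t^2 + 0 * t^3 + 0 * t^4" for t
      using rot[OF rc z, of t] by (simp add: algebra_simps)
    from nonneg_polynomial_at_zero[OF this] show ?thesis using w[OF rc(1,2,3,4)] by simp
  qed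
  have off: "bil E X (col v r) (col v c) = 0" if rc: "r \<in> E" "c \<in> E" "r \<noteq> c" for r c
  proof (cases "cls r = cls c")
    case True
    have "Re (1 * bil E X (col v r) (col v c)) = 0" "Re (\<i> * bil E X (col v r) (col v c)) = 0"
      using crit[OF rc True, of 1] crit[OF rc True, of \<i>] by simp_all
    then show ?thesis by (simp add: complex_eq_iff)
  next
    case False
    have z: "cnj (col v r m) * X m n * col v c n = 0" if mn: "m \<in> E" "n \<in> E" for m n
    proof (rule ccontr)
      assume "cnj (col v r m) * X m n * col v c n \<noteq> 0"
      then have n: "v (m,r) \<noteq> 0" "X m n \<noteq> 0" "v (n,c) \<noteq> 0" by (auto simp: col_def)
      then have "(m,r) \<in> B" "(n,c) \<in> B" using vB by blast+
      then show False using False cls[OF mn n(2)] by (simp add: B_def)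
    qed
    show ?thesis unfolding bil_def by (intro sum.neutral ballI z)
  qed
  define u where "u r c = v (r,c)" for r c
  have cu: "(\<lambda>m. u m c) = col v c" for c by (simp add: u_def col_def fun_eq_iff)
  have u1: "r \<in> E \<and> c \<in> E \<and> cls r = cls c" if "u r c \<noteq> 0" for r c
    using vB[of "(r,c)"] that by (auto simp: u_def B_def)
  have u2: "ip E (\<lambda>m. u m c) (\<lambda>m. u m r) = unit_fun c r" if "r \<in> E" "c \<in> E" for r c
  proof -
    have "ip E (\<lambda>m. u m c) (\<lambda>m. u m r) = bil E I (col v r) (col v c)"
      unfolding cu bilI ip_def by (intro sum.cong refl) (rule mult.commute)
    also have "\<dots> = I r c" by (rule gram[OF that])
    finally show ?thesis by (simp only: I_def unit_fun_def)
  qed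
  have u3: "bil E X (\<lambda>m. u m r) (\<lambda>m. u m c) = 0" if "r \<in> E" "c \<in> E" "r \<noteq> c" for r c
    unfolding cu by (rule off[OF that])
  have u4: "Re (bil E X (\<lambda>m. u m r) (\<lambda>m. u m r)) \<le> Re (bil E X (\<lambda>m. u m c) (\<lambda>m. u m c))"
    if rc: "r \<in> E" "c \<in> E" "cls r = cls c" "w r < w c" for r c
  proof -
    have "r \<noteq> c" using rc(4) by auto
    then have "(w r - w c) * (Re (bil E X (col v c) (col v c)) - Re (bil E X (col v r) (col v r))) \<le> 0"
      using crit[OF rc(1,2) _ rc(3), of 1] by simp
    then show ?thesis unfolding cu using rc(4) by (simp add: mult_le_0_iff)
  qed
  show ?thesis
    by (rule exI[of _ u]) (use u1 u2 u3 u4 in blast)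
qed

lemma right_inverse_if_left_inverse:
  assumes E: "finite E" and ab: "\<And>r c. r \<in> E \<Longrightarrow> c \<in> E \<Longrightarrow> mm E A B r c = unit_fun c r"
    and rc: "r \<in> E" "c \<in> E"
  shows "mm E B A r c = unit_fun c r"
proof -
  have AB: "ap E A (ap E B x) r = x r" if "r \<in> E" for x r
    unfolding ap_mm[symmetric] using ab that by (intro ap_unit[OF E]) auto
  have "linop (ap E B)" unfolding linop_def by (simp add: ap_lin)
  then have "\<exists>x. supp_in E x \<and> (\<forall>r\<in>E. ap E B x r = unit_fun c r)"
  proof (rule linop_injective_imp_surjective[OF _ E E])
    fix x assume x: "supp_in E x" "\<forall>y\<in>E. ap E B x y = 0"
    have "x r = 0" for r
    proof (cases "r \<in> E")
      case True
      have "ap E A (ap E B x) r = 0" using x(2) by (simp add: ap_def[of E A])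
      then show ?thesis using AB[OF True] by simp
    next
      case False
      then show ?thesis using x(1) by (auto simp: supp_in_def)
    qed
    then show "x = (\<lambda>_. 0)" by blast
  qed simp
  then obtain x where x: "\<And>r. r \<in> E \<Longrightarrow> ap E B x r = unit_fun c r" by blast
  have "x m = A m c" if "m \<in> E" for m
  proof -
    have "x m = ap E A (ap E B x) m" using AB[OF that] by simp
    also have "\<dots> = ap E A (unit_fun c) m" using x by (simp add: ap_def[of E A])
    also have "\<dots> = A m c" using E rc by (simp add: ap_def unit_fun_def if_distrib[of "\<lambda>b. _ * b"] cong: if_cong)
    finally show ?thesis .
  qed
  then show ?thesis using x[OF rc(1)] by (simp add: mm_def ap_def)
qed

section \<open>Trace forms and variations of the squared distance\<close>

definition tr :: "'x set \<Rightarrow> 'x cmat \<Rightarrow> complex" where "tr E A = (\<Sum>r\<in>E. A r r)"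

lemma tr_mm_commute: "tr E (mm E A B) = tr E (mm E B A)"
  unfolding tr_def mm_def by (subst sum.swap) (simp add: mult.commute)

definition mip :: "'x set \<Rightarrow> 'x cmat \<Rightarrow> 'x cmat \<Rightarrow> real" where
  "mip E A B = (\<Sum>r\<in>E. \<Sum>c\<in>E. Re (A r c * cnj (B r c)))"

lemma mip_self: "mip E A A = (\<Sum>r\<in>E. \<Sum>c\<in>E. (cmod (A r c))\<^sup>2)"
  unfolding mip_def by (simp add: complex_norm_square[symmetric] del: of_real_power)

lemma mip_cong: "(\<And>r c. r \<in> E \<Longrightarrow> c \<in> E \<Longrightarrow> A r c = A' r c) \<Longrightarrow> (\<And>r c. r \<in> E \<Longrightarrow> c \<in> E \<Longrightarrow> B r c = B' r c) \<Longrightarrow> mip E A B = mip E A' B'"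
  by (simp add: mip_def)

lemma mip_add_right: "mip E A (\<lambda>r c. B r c + C r c) = mip E A B + mip E A C"
  by (simp add: mip_def sum.distrib algebra_simps)
lemma mip_diff_right: "mip E A (\<lambda>r c. B r c - C r c) = mip E A B - mip E A C"
  by (simp add: mip_def sum_subtractf algebra_simps)
lemma mip_add_left: "mip E (\<lambda>r c. B r c + C r c) A = mip E B A + mip E C A"
  by (simp add: mip_def sum.distrib algebra_simps)
lemma mip_diff_left: "mip E (\<lambda>r c. B r c - C r c) A = mip E B A - mip E C A"
  by (simp add: mip_def sum_subtractf algebra_simps)
lemma mip_scale_right: "mip E A (\<lambda>r c. of_real t * B r c) = t * mip E A B"
  by (simp add: mip_def sum_distrib_left algebra_simps)
lemma mip_scale_left: "mip E (\<lambda>r c. of_real t * B r c) A = t * mip E B A"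
  by (simp add: mip_def sum_distrib_left algebra_simps)
lemma mip_commute: "mip E A B = mip E B A"
  by (simp add: mip_def algebra_simps)
lemma mip_sum_right: "mip E A (\<lambda>r c. \<Sum>k\<in>K. B k r c) = (\<Sum>k\<in>K. mip E A (B k))"
proof -
  have "mip E A (\<lambda>r c. \<Sum>k\<in>K. B k r c) = (\<Sum>r\<in>E. \<Sum>c\<in>E. \<Sum>k\<in>K. Re (A r c * cnj (B k r c)))"
    by (simp add: mip_def sum_distrib_left)
  also have "\<dots> = (\<Sum>r\<in>E. \<Sum>k\<in>K. \<Sum>c\<in>E. Re (A r c * cnj (B k r c)))" by (intro sum.cong refl sum.swap)
  also have "\<dots> = (\<Sum>k\<in>K. \<Sum>r\<in>E. \<Sum>c\<in>E. Re (A r c * cnj (B k r c)))" by (rule sum.swap)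
  finally show ?thesis by (simp add: mip_def)
qed

lemma cmod_quadratic:
  "(cmod (X + of_real t * Y + of_real (t\<^sup>2) * Z))\<^sup>2 = (cmod X)\<^sup>2 + 2 * t * Re (X * cnj Y) +
     t\<^sup>2 * ((cmod Y)\<^sup>2 + 2 * Re (X * cnj Z)) + 2 * t^3 * Re (Y * cnj Z) + t^4 * (cmod Z)\<^sup>2"
  unfolding cmod_power2 by (simp add: power2_eq_square power3_eq_cube power4_eq_xxxx algebra_simps)

context quiver
begin

lemma adj_adj [simp]: "adj (adj A) = A" by (simp add: adj_def fun_eq_iff)
lemma adj_mm: "adj (mm E A B) = mm E (adj B) (adj A)"
  by (simp add: adj_def mm_def fun_eq_iff mult.commute)

lemma mip_eq_tr: "mip E A B = Re (tr E (mm E A (adj B)))"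
  by (simp add: mip_def tr_def mm_def adj_def)

lemma mip_adj: "mip E (adj A) (adj B) = mip E A B"
  unfolding mip_def adj_def by (subst sum.swap) (simp add: algebra_simps)

lemma mu_eq: "mu E f r c = (\<Sum>k\<in>arrows. mm E (f k) (adj (f k)) r c) - (\<Sum>k\<in>arrows. mm E (adj (f k)) (f k) r c)"
  by (simp add: mu_def mm_def adj_def)

lemma adj_mu: "adj (mu E f) = mu E f"
  by (simp add: adj_def mu_def fun_eq_iff mult.commute)

text \<open>The polarisation of the quadratic map \<mu>, that is, its derivative at \<open>f\<close>
  in direction \<open>p\<close>.\<close>

definition dmu :: "('v \<times> nat) set \<Rightarrow> (nat \<Rightarrow> ('v \<times> nat) cmat) \<Rightarrow> (nat \<Rightarrow> ('v \<times> nat) cmat) \<Rightarrow> ('v \<times> nat) cmat" where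
  "dmu E f p r c = (\<Sum>k\<in>arrows. mm E (f k) (adj (p k)) r c + mm E (p k) (adj (f k)) r c) -
     (\<Sum>k\<in>arrows. mm E (adj (f k)) (p k) r c + mm E (adj (p k)) (f k) r c)"

definition act :: "('v \<times> nat) set \<Rightarrow> ('v \<times> nat) cmat \<Rightarrow> ('v \<times> nat) cmat \<Rightarrow> ('v \<times> nat) cmat" where
  "act E X A r c = mm E X A r c - mm E A X r c"

lemma dmu_commute: "dmu E f p = dmu E p f"
  by (simp add: dmu_def fun_eq_iff add.commute)

lemma dmu_self: "dmu E p p r c = of_real 2 * mu E p r c"
  unfolding dmu_def mu_eq sum.distrib by simp

lemma dmu_add: "dmu E f (\<lambda>k r c. p k r c + q k r c) r c = dmu E f p r c + dmu E f q r c"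
  by (simp add: dmu_def mm_def adj_def sum.distrib algebra_simps)

lemma mu_expand:
  "mu E (\<lambda>k r c. f k r c + of_real t * p k r c) r c = mu E f r c + of_real t * dmu E f p r c + of_real (t\<^sup>2) * mu E p r c"
proof -
  have 1: "mm E (\<lambda>r c. A r c + of_real t * B r c) (adj (\<lambda>r c. A r c + of_real t * B r c)) r c =
      mm E A (adj A) r c + of_real t * (mm E A (adj B) r c + mm E B (adj A) r c) + of_real (t\<^sup>2) * mm E B (adj B) r c" for A B
    by (simp add: mm_def adj_def sum.distrib sum_distrib_left algebra_simps power2_eq_square)
  have 2: "mm E (adj (\<lambda>r c. A r c + of_real t * B r c)) (\<lambda>r c. A r c + of_real t * B r c) r c =
      mm E (adj A) A r c + of_real t * (mm E (adj A) B r c + mm E (adj B) A r c) + of_real (t\<^sup>2) * mm E (adj B) B r c" for A B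
    by (simp add: mm_def adj_def sum.distrib sum_distrib_left algebra_simps power2_eq_square)
  show ?thesis unfolding mu_eq dmu_def 1 2 sum.distrib sum_distrib_left[symmetric] by (simp add: algebra_simps)
qed

lemma mu_add: "mu E (\<lambda>k r c. f k r c + p k r c) r c = mu E f r c + dmu E f p r c + mu E p r c"
  using mu_expand[of E f 1 p r c] by simp

text \<open>The defining identity of a momentum map: its derivative paired with \<open>X\<close> is
  the infinitesimal action of \<open>X\<close> paired with the direction. It converts a vanishing
  gradient into a commutation relation.\<close>

lemma dmu_pairing:
  assumes X: "adj X = X"
  shows "mip E X (dmu E f p) = 2 * (\<Sum>k\<in>arrows. mip E (act E X (f k)) (p k))"
proof -
  have 1: "mip E X (mm E A (adj B)) = mip E (mm E X B) A" for A B
    unfolding mip_eq_tr by (simp add: adj_mm mm_assoc)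
  have 2: "mip E X (mm E (adj B) A) = mip E (mm E B X) A" for A B
  proof -
    have "tr E (mm E X (mm E (adj A) B)) = tr E (mm E (mm E B X) (adj A))"
      using tr_mm_commute[of E "mm E X (adj A)" B] by (simp add: mm_assoc)
    then show ?thesis unfolding mip_eq_tr by (simp add: adj_mm)
  qed
  have 3: "mip E X (adj C) = mip E X C" for C using mip_adj[of E X C] X by simp
  have 4: "mip E X (mm E A (adj B)) = mip E (mm E X A) B" for A B
    using 1[of B A] 3[of "mm E B (adj A)"] by (simp add: adj_mm)
  have 5: "mip E X (mm E (adj A) B) = mip E (mm E B X) A" for A B
    using 2[of A B] 3[of "mm E (adj B) A"] 2[of B A] by (simp add: adj_mm)
  have "mip E X (dmu E f p) = (\<Sum>k\<in>arrows. mip E X (\<lambda>r c. mm E (f k) (adj (p k)) r c + mm E (p k) (adj (f k)) r c)) -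
      (\<Sum>k\<in>arrows. mip E X (\<lambda>r c. mm E (adj (f k)) (p k) r c + mm E (adj (p k)) (f k) r c))"
    unfolding dmu_def[abs_def] mip_diff_right mip_sum_right ..
  also have "\<dots> = (\<Sum>k\<in>arrows. 2 * mip E (mm E X (f k)) (p k)) - (\<Sum>k\<in>arrows. 2 * mip E (mm E (f k) X) (p k))"
  proof -
    have "mip E X (\<lambda>r c. mm E (f k) (adj (p k)) r c + mm E (p k) (adj (f k)) r c) = 2 * mip E (mm E X (f k)) (p k)" for k
      unfolding mip_add_right using 4[of "f k" "p k"] 1[of "p k" "f k"] by simp
    moreover have "mip E X (\<lambda>r c. mm E (adj (f k)) (p k) r c + mm E (adj (p k)) (f k) r c) = 2 * mip E (mm E (f k) X) (p k)" for k
      unfolding mip_add_right using 2[of "f k" "p k"] 5[of "p k" "f k"] by simp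
    ultimately show ?thesis by simp
  qed
  also have "\<dots> = 2 * (\<Sum>k\<in>arrows. mip E (act E X (f k)) (p k))"
    unfolding act_def[abs_def] mip_diff_left by (simp add: sum_subtractf sum_distrib_left algebra_simps)
  finally show ?thesis .
qed

lemma mu_pairing:
  assumes X: "adj X = X"
  shows "mip E X (mu E p) = (\<Sum>k\<in>arrows. mip E (act E X (p k)) (p k))"
proof -
  have "dmu E p p = (\<lambda>r c. of_real 2 * mu E p r c)" by (intro ext dmu_self)
  then have "mip E X (dmu E p p) = 2 * mip E X (mu E p)" by (simp only: mip_scale_right)
  then show ?thesis using dmu_pairing[OF X, of E p p] by simp
qed

lemma mu_graded: "rep f \<Longrightarrow> mu E f r c \<noteq> 0 \<Longrightarrow> fst r = fst c"
proof (rule ccontr)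
  assume f: "rep f" and n: "mu E f r c \<noteq> 0" and ne: "fst r \<noteq> fst c"
  have z: "f k r m * cnj (f k c m) = 0" "cnj (f k m r) * f k m c = 0" for k m
    using f ne unfolding rep_def by (metis complex_cnj_zero mult_zero_left mult_zero_right)+
  have "(\<Sum>k\<in>arrows. \<Sum>m\<in>E. f k r m * cnj (f k c m)) = 0" by (intro sum.neutral ballI z)
  moreover have "(\<Sum>k\<in>arrows. \<Sum>m\<in>E. cnj (f k m r) * f k m c) = 0" by (intro sum.neutral ballI z)
  ultimately have "mu E f r c = 0" unfolding mu_def by (simp only: diff_self)
  then show False using n by simp
qed

definition dg :: "('v \<times> nat \<Rightarrow> real) \<Rightarrow> ('v \<times> nat) cmat" where
  "dg a r c = (if r = c then of_real (a r) else 0)"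

lemma adj_dg: "adj (dg a) = dg a" by (simp add: adj_def dg_def fun_eq_iff)

definition XX :: "('v \<times> nat) set \<Rightarrow> ('v \<times> nat \<Rightarrow> real) \<Rightarrow> (nat \<Rightarrow> ('v \<times> nat) cmat) \<Rightarrow> ('v \<times> nat) cmat" where
  "XX E a f r c = mu E f r c - dg a r c"

lemma adj_XX: "adj (XX E a f) = XX E a f"
proof (intro ext)
  fix r c
  have "cnj (mu E f c r) = mu E f r c" "cnj (dg a c r) = dg a r c"
    using fun_cong[OF fun_cong[OF adj_mu[of E f], of r], of c] fun_cong[OF fun_cong[OF adj_dg[of a], of r], of c]
    by (simp_all add: adj_def)
  then show "adj (XX E a f) r c = XX E a f r c" by (simp add: adj_def XX_def)
qed

definition JJ :: "('v \<times> nat) set \<Rightarrow> ('v \<times> nat \<Rightarrow> real) \<Rightarrow> (nat \<Rightarrow> ('v \<times> nat) cmat) \<Rightarrow> real" where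
  "JJ E a f = mip E (XX E a f) (XX E a f)"

definition nn :: "('v \<times> nat) set \<Rightarrow> (nat \<Rightarrow> ('v \<times> nat) cmat) \<Rightarrow> real" where
  "nn E f = (\<Sum>k\<in>arrows. mip E (f k) (f k))"

text \<open>As \<mu> is quadratic, the distance is exactly a quartic in \<open>t\<close>, so the
  variation conditions can be read off its coefficients.\<close>

lemma JJ_expand:
  "JJ E a (\<lambda>k r c. f k r c + of_real t * p k r c) = JJ E a f + 2 * t * mip E (XX E a f) (dmu E f p) +
     t\<^sup>2 * (mip E (dmu E f p) (dmu E f p) + 2 * mip E (XX E a f) (mu E p)) +
     2 * t^3 * mip E (dmu E f p) (mu E p) + t^4 * mip E (mu E p) (mu E p)"
proof -
  have X: "XX E a (\<lambda>k r c. f k r c + of_real t * p k r c) r c = XX E a f r c + of_real t * dmu E f p r c + of_real (t\<^sup>2) * mu E p r c" for r c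
    unfolding XX_def mu_expand by simp
  have "JJ E a (\<lambda>k r c. f k r c + of_real t * p k r c) = (\<Sum>r\<in>E. \<Sum>c\<in>E. (cmod (XX E a f r c))\<^sup>2 + 2 * t * Re (XX E a f r c * cnj (dmu E f p r c)) +
     t\<^sup>2 * ((cmod (dmu E f p r c))\<^sup>2 + 2 * Re (XX E a f r c * cnj (mu E p r c))) + 2 * t^3 * Re (dmu E f p r c * cnj (mu E p r c)) + t^4 * (cmod (mu E p r c))\<^sup>2)"
    unfolding JJ_def mip_self X cmod_quadratic ..
  then show ?thesis unfolding JJ_def mip_self unfolding mip_def
    by (simp only: sum.distrib sum_distrib_left distrib_left mult.assoc)
qed

lemma nn_expand:
  "nn E (\<lambda>k r c. f k r c + of_real t * p k r c) = nn E f + 2 * t * (\<Sum>k\<in>arrows. mip E (f k) (p k)) + t\<^sup>2 * nn E p"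
proof -
  have "mip E (\<lambda>r c. A r c + of_real t * B r c) (\<lambda>r c. A r c + of_real t * B r c) = mip E A A + 2 * t * mip E A B + t\<^sup>2 * mip E B B" for A B
    unfolding mip_add_left mip_add_right mip_scale_left mip_scale_right using mip_commute[of E B A]
    by (simp add: algebra_simps power2_eq_square)
  then show ?thesis by (simp add: nn_def sum.distrib sum_distrib_left)
qed

definition supp_rep :: "('v \<times> nat) set \<Rightarrow> (nat \<Rightarrow> ('v \<times> nat) cmat) \<Rightarrow> bool" where
  "supp_rep E f \<longleftrightarrow> (\<forall>k r c. f k r c \<noteq> 0 \<longrightarrow> k \<in> arrows \<and> r \<in> E \<and> c \<in> E \<and> fst r = tgt k \<and> fst c = src k)"

lemma supp_rep_rep: "supp_rep E f \<Longrightarrow> rep f" by (auto simp: supp_rep_def rep_def)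

lemma supp_rep_lin: "supp_rep E f \<Longrightarrow> supp_rep E p \<Longrightarrow> supp_rep E (\<lambda>k r c. f k r c + z * p k r c)"
  unfolding supp_rep_def
proof (intro allI impI)
  fix k r c
  assume f: "\<forall>k r c. f k r c \<noteq> 0 \<longrightarrow> k \<in> arrows \<and> r \<in> E \<and> c \<in> E \<and> fst r = tgt k \<and> fst c = src k"
    and p: "\<forall>k r c. p k r c \<noteq> 0 \<longrightarrow> k \<in> arrows \<and> r \<in> E \<and> c \<in> E \<and> fst r = tgt k \<and> fst c = src k"
    and n: "f k r c + z * p k r c \<noteq> 0"
  from n have "f k r c \<noteq> 0 \<or> p k r c \<noteq> 0" by auto
  then show "k \<in> arrows \<and> r \<in> E \<and> c \<in> E \<and> fst r = tgt k \<and> fst c = src k"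
    using f[THEN spec, THEN spec, THEN spec, of k r c] p[THEN spec, THEN spec, THEN spec, of k r c] by blast
qed

text \<open>The weight \<open>d\<close> is positive in the auxiliary problem, where growth
  guarantees a minimum, and 0 in the problem of interest.\<close>

definition minimiser :: "('v \<times> nat) set \<Rightarrow> ('v \<times> nat \<Rightarrow> real) \<Rightarrow> real \<Rightarrow> (nat \<Rightarrow> ('v \<times> nat) cmat) \<Rightarrow> bool" where
  "minimiser E a d f \<longleftrightarrow> supp_rep E f \<and> (\<forall>g. supp_rep E g \<longrightarrow> JJ E a f + d * nn E f \<le> JJ E a g + d * nn E g)"

text \<open>The first variation is the pairing with twice \<open>q\<close>, where \<open>q\<close>
  combines the commutator with \<open>XX E a f\<close> and the penalty term; evaluating it in the
  direction \<open>q\<close> itself shows that \<open>q\<close> vanishes.\<close>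

lemma minimiser_conditions:
  assumes E: "finite E" and m: "minimiser E a d f"
  shows "\<And>p. supp_rep E p \<Longrightarrow> mip E (dmu E f p) (dmu E f p) + 2 * mip E (XX E a f) (mu E p) + d * nn E p \<ge> 0"
    and "\<And>k r c. k \<in> arrows \<Longrightarrow> r \<in> E \<Longrightarrow> c \<in> E \<Longrightarrow> 2 * act E (XX E a f) (f k) r c + of_real d * f k r c = 0"
proof -
  have f: "supp_rep E f" using m by (simp add: minimiser_def)
  have poly: "0 \<le> (2 * mip E (XX E a f) (dmu E f p) + 2 * d * (\<Sum>k\<in>arrows. mip E (f k) (p k))) * t +
     (mip E (dmu E f p) (dmu E f p) + 2 * mip E (XX E a f) (mu E p) + d * nn E p) * t^2 +
     (2 * mip E (dmu E f p) (mu E p)) * t^3 + (mip E (mu E p) (mu E p)) * t^4" if p: "supp_rep E p" for p t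
  proof -
    have "JJ E a f + d * nn E f \<le> JJ E a (\<lambda>k r c. f k r c + of_real t * p k r c) + d * nn E (\<lambda>k r c. f k r c + of_real t * p k r c)"
      using m supp_rep_lin[OF f p] by (simp add: minimiser_def)
    then show ?thesis unfolding JJ_expand nn_expand by (simp add: algebra_simps)
  qed
  show "mip E (dmu E f p) (dmu E f p) + 2 * mip E (XX E a f) (mu E p) + d * nn E p \<ge> 0" if "supp_rep E p" for p
    using nonneg_polynomial_at_zero(2)[OF poly[OF that]] .
  define q where "q k r c = 2 * act E (XX E a f) (f k) r c + of_real d * f k r c" for k r c
  \<comment> \<open>The gradient cut off to an admissible direction; over \<open>E\<close> this
    changes nothing, because \<open>q\<close> is graded like \<open>f\<close>.\<close>
  define p where "p k r c = (if k \<in> arrows \<and> r \<in> E \<and> c \<in> E \<and> fst r = tgt k \<and> fst c = src k then q k r c else 0)" for k r c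
  have p: "supp_rep E p" by (auto simp: supp_rep_def p_def)
  have gX: "fst r = fst c" if "XX E a f r c \<noteq> 0" for r c
    using that mu_graded[OF supp_rep_rep[OF f], of E r c] by (auto simp: XX_def dg_def split: if_splits)
  have qrep: "fst r = tgt k \<and> fst c = src k" if n: "q k r c \<noteq> 0" for k r c
  proof (rule ccontr)
    assume b: "\<not> ?thesis"
    have "f k r c = 0" using f b unfolding supp_rep_def by blast
    moreover have "mm E (XX E a f) (f k) r c = 0"
    proof (rule ccontr)
      assume "mm E (XX E a f) (f k) r c \<noteq> 0"
      from mm_nonzero[OF this] obtain m where "XX E a f r m \<noteq> 0" "f k m c \<noteq> 0" by blast
      then show False using gX f b unfolding supp_rep_def by metis
    qed
    moreover have "mm E (f k) (XX E a f) r c = 0"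
    proof (rule ccontr)
      assume "mm E (f k) (XX E a f) r c \<noteq> 0"
      from mm_nonzero[OF this] obtain m where "f k r m \<noteq> 0" "XX E a f m c \<noteq> 0" by blast
      then show False using gX f b unfolding supp_rep_def by metis
    qed
    ultimately show False using n by (simp add: q_def act_def)
  qed
  have qp: "q k r c = p k r c" if "k \<in> arrows" "r \<in> E" "c \<in> E" for k r c
    using qrep[of k r c] that by (auto simp: p_def)
  have "0 = 2 * mip E (XX E a f) (dmu E f p) + 2 * d * (\<Sum>k\<in>arrows. mip E (f k) (p k))"
    using nonneg_polynomial_at_zero(1)[OF poly[OF p]] by simp
  also have "\<dots> = 2 * (\<Sum>k\<in>arrows. mip E (q k) (p k))"
  proof -
    have "mip E (q k) (p k) = 2 * mip E (act E (XX E a f) (f k)) (p k) + d * mip E (f k) (p k)" for k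
    proof -
      have "mip E (q k) (p k) = mip E (\<lambda>r c. of_real 2 * act E (XX E a f) (f k) r c + of_real d * f k r c) (p k)"
        by (simp add: q_def[abs_def])
      then show ?thesis unfolding mip_add_left mip_scale_left .
    qed
    then show ?thesis unfolding dmu_pairing[OF adj_XX] by (simp add: sum.distrib sum_distrib_left algebra_simps)
  qed
  finally have "(\<Sum>k\<in>arrows. mip E (q k) (p k)) = 0" by simp
  moreover have "mip E (q k) (p k) = mip E (q k) (q k)" if "k \<in> arrows" for k
    by (rule mip_cong) (use qp that in auto)
  ultimately have z: "(\<Sum>k\<in>arrows. mip E (q k) (q k)) = 0" by simp
  have "mip E (q k) (q k) = 0" if "k \<in> arrows" for k
    using z that by (subst (asm) sum_nonneg_eq_0_iff) (auto simp: mip_self intro!: sum_nonneg)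
  then show "2 * act E (XX E a f) (f k) r c + of_real d * f k r c = 0" if krc: "k \<in> arrows" "r \<in> E" "c \<in> E" for k r c
  proof -
    have "(\<Sum>r\<in>E. \<Sum>c\<in>E. (cmod (q k r c))\<^sup>2) = 0" using \<open>\<And>k. k \<in> arrows \<Longrightarrow> mip E (q k) (q k) = 0\<close>[OF krc(1)] by (simp add: mip_self)
    then have "(\<Sum>c\<in>E. (cmod (q k r c))\<^sup>2) = 0" using E krc by (subst (asm) sum_nonneg_eq_0_iff) (auto intro!: sum_nonneg)
    then have "(cmod (q k r c))\<^sup>2 = 0" using E krc by (subst (asm) sum_nonneg_eq_0_iff) auto
    then show ?thesis by (simp add: q_def)
  qed
qed

end

section \<open>Unitary changes of basis\<close>

lemma inv_mm: "finite E \<Longrightarrow> (\<And>r c. r \<in> E \<Longrightarrow> c \<in> E \<Longrightarrow> mm E G H r c = unit_fun c r) \<Longrightarrow> r \<in> E \<Longrightarrow> mm E G (mm E H A) r c = A r c"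
  unfolding mm_assoc[symmetric] mm_eq_ap[of E "mm E G H"] by (rule ap_unit) auto

lemma inv_mm_right:
  assumes "finite E" "\<And>r c. r \<in> E \<Longrightarrow> c \<in> E \<Longrightarrow> mm E G H r c = unit_fun c r" "c \<in> E"
  shows "mm E (mm E A G) H r c = A r c"
proof -
  have "mm E (mm E A G) H r c = (\<Sum>m\<in>E. A r m * mm E G H m c)"
    by (simp add: mm_assoc) (simp add: mm_def)
  also have "\<dots> = (\<Sum>m\<in>E. if m = c then A r m else 0)"
    using assms by (intro sum.cong) (auto simp: unit_fun_def)
  finally show ?thesis using assms by simp
qed

context quiver
begin

definition uni :: "('v \<times> nat) set \<Rightarrow> ('v \<times> nat) cmat \<Rightarrow> bool" where
  "uni E u \<longleftrightarrow> (\<forall>r\<in>E. \<forall>c\<in>E. mm E (adj u) u r c = unit_fun c r) \<and> (\<forall>r\<in>E. \<forall>c\<in>E. mm E u (adj u) r c = unit_fun c r)"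

definition cu :: "('v \<times> nat) set \<Rightarrow> ('v \<times> nat) cmat \<Rightarrow> ('v \<times> nat) cmat \<Rightarrow> ('v \<times> nat) cmat" where
  "cu E u A = mm E (adj u) (mm E A u)"

context
  fixes E and u assumes E: "finite E" and u: "uni E u"
begin

lemma uni1: "r \<in> E \<Longrightarrow> c \<in> E \<Longrightarrow> mm E (adj u) u r c = unit_fun c r" using u by (simp add: uni_def)
lemma uni2: "r \<in> E \<Longrightarrow> c \<in> E \<Longrightarrow> mm E u (adj u) r c = unit_fun c r" using u by (simp add: uni_def)

lemma cu_mm: "mm E (cu E u A) (cu E u B) = cu E u (mm E A B)"
proof -
  have "mm E u (mm E (adj u) C) m c = C m c" if "m \<in> E" for C m c by (rule inv_mm[OF E uni2 that])
  then have "mm E A (mm E u (mm E (adj u) C)) = mm E A C" for A C by (simp add: mm_def[of E A])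
  then show ?thesis unfolding cu_def by (simp add: mm_assoc)
qed

lemma adj_cu: "adj (cu E u A) = cu E u (adj A)"
  unfolding cu_def adj_mm by (simp add: mm_assoc)

lemma cu_diff: "cu E u (\<lambda>r c. A r c - B r c) r c = cu E u A r c - cu E u B r c"
  by (simp add: cu_def mm_def sum_subtractf sum_distrib_left algebra_simps)

lemma cu_scale_add: "cu E u (\<lambda>r c. x * A r c + y * B r c) r c = x * cu E u A r c + y * cu E u B r c"
  by (simp add: cu_def mm_def sum.distrib sum_distrib_left algebra_simps)

lemma cu_sum: "cu E u (\<lambda>r c. \<Sum>k\<in>K. A k r c) r c = (\<Sum>k\<in>K. cu E u (A k) r c)"
proof (induction K rule: infinite_finite_induct)
  case (insert k K)
  have "cu E u (\<lambda>r c. \<Sum>k\<in>insert k K. A k r c) r c = cu E u (\<lambda>r c. 1 * A k r c + 1 * (\<Sum>k\<in>K. A k r c)) r c"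
    using insert.hyps by simp
  also have "\<dots> = cu E u (A k) r c + cu E u (\<lambda>r c. \<Sum>k\<in>K. A k r c) r c" unfolding cu_scale_add by simp
  finally show ?case using insert by simp
qed (simp_all add: cu_def mm_def)

lemma cu_mu: "mu E (\<lambda>k. cu E u (f k)) r c = cu E u (mu E f) r c"
proof -
  have "mu E f = (\<lambda>r c. (\<Sum>k\<in>arrows. mm E (f k) (adj (f k)) r c) - (\<Sum>k\<in>arrows. mm E (adj (f k)) (f k) r c))"
    by (intro ext) (rule mu_eq)
  then show ?thesis unfolding mu_eq adj_cu cu_mm by (simp add: cu_diff cu_sum)
qed

lemma cu_act: "act E (cu E u X) (cu E u A) r c = cu E u (act E X A) r c"
  unfolding act_def[abs_def] cu_mm cu_diff ..

lemma mip_cu: "mip E (cu E u A) (cu E u B) = mip E A B"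
proof -
  define M where "M = mm E A (adj B)"
  have "mip E (cu E u A) (cu E u B) = Re (tr E (cu E u M))" unfolding mip_eq_tr adj_cu cu_mm M_def ..
  also have "tr E (cu E u M) = tr E (mm E (mm E M u) (adj u))" unfolding cu_def by (rule tr_mm_commute)
  also have "\<dots> = tr E M" unfolding tr_def by (intro sum.cong refl inv_mm_right[OF E uni2])
  finally show ?thesis unfolding M_def mip_eq_tr .
qed

lemma cu_undo: "r \<in> E \<Longrightarrow> c \<in> E \<Longrightarrow> mm E u (mm E (cu E u A) (adj u)) r c = A r c"
proof -
  assume rc: "r \<in> E" "c \<in> E"
  have "mm E u (mm E (cu E u A) (adj u)) r c = mm E u (mm E (adj u) (mm E (mm E A u) (adj u))) r c"
    unfolding cu_def by (simp add: mm_assoc)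
  also have "\<dots> = mm E (mm E A u) (adj u) r c" by (rule inv_mm[OF E uni2 rc(1)])
  also have "\<dots> = A r c" by (rule inv_mm_right[OF E uni2 rc(2)])
  finally show ?thesis .
qed

lemma cu_dg:
  assumes "\<And>r c. u r c \<noteq> 0 \<Longrightarrow> a r = a c" "r \<in> E" "c \<in> E"
  shows "cu E u (dg a) r c = dg a r c"
proof -
  have 1: "mm E (dg a) u m c = u m c * of_real (a c)" if "m \<in> E" for m
  proof -
    have "mm E (dg a) u m c = (\<Sum>n\<in>E. if n = m then of_real (a m) * u m c else 0)"
      unfolding mm_def dg_def by (intro sum.cong) auto
    also have "\<dots> = of_real (a m) * u m c" using that E by simp
    finally show ?thesis using assms(1)[of m c] by (cases "u m c = 0") auto
  qed
  have "cu E u (dg a) r c = mm E (adj u) u r c * of_real (a c)"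
    unfolding cu_def mm_def[of E "adj u"] using 1 by (simp add: sum_distrib_right mult.assoc)
  then show ?thesis using uni1[OF assms(2,3)] by (simp add: unit_fun_def dg_def)
qed

lemma uni_entry_le: "r \<in> E \<Longrightarrow> c \<in> E \<Longrightarrow> cmod (u r c) \<le> 1"
proof -
  assume rc: "r \<in> E" "c \<in> E"
  have "complex_of_real (\<Sum>m\<in>E. (cmod (u m c))\<^sup>2) = mm E (adj u) u c c"
    unfolding of_real_sum complex_norm_square by (simp add: mm_def adj_def mult.commute)
  also have "\<dots> = 1" using uni1[OF rc(2,2)] by (simp add: unit_fun_def)
  finally have "(\<Sum>m\<in>E. (cmod (u m c))\<^sup>2) = 1" using of_real_eq_1_iff by blast
  moreover have "(cmod (u r c))\<^sup>2 \<le> (\<Sum>m\<in>E. (cmod (u m c))\<^sup>2)" using rc E by (intro member_le_sum) auto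
  ultimately show ?thesis by (simp add: abs_square_le_1)
qed

lemma unitary_sandwich_le:
  assumes B: "\<And>m. m \<in> E \<Longrightarrow> cmod (x m) \<le> 1" "\<And>m. m \<in> E \<Longrightarrow> cmod (y m) \<le> 1"
    and A: "\<And>m n. m \<in> E \<Longrightarrow> n \<in> E \<Longrightarrow> cmod (A m n) \<le> C"
  shows "cmod (\<Sum>m\<in>E. x m * (\<Sum>n\<in>E. A m n * y n)) \<le> real (card E) * real (card E) * C"
proof -
  have "cmod (\<Sum>m\<in>E. x m * (\<Sum>n\<in>E. A m n * y n)) \<le> (\<Sum>m\<in>E. cmod (x m * (\<Sum>n\<in>E. A m n * y n)))" by (rule norm_sum)
  also have "\<dots> \<le> (\<Sum>m\<in>E. real (card E) * C)"
  proof (rule sum_mono)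
    fix m assume m: "m \<in> E"
    have "cmod (\<Sum>n\<in>E. A m n * y n) \<le> (\<Sum>n\<in>E. cmod (A m n * y n))" by (rule norm_sum)
    also have "\<dots> \<le> (\<Sum>n\<in>E. C)"
    proof (rule sum_mono)
      fix n assume n: "n \<in> E"
      have "cmod (A m n * y n) \<le> C * 1" unfolding norm_mult using A[OF m n] B(2)[OF n] by (intro mult_mono) (auto intro: order_trans[OF norm_ge_zero])
      then show "cmod (A m n * y n) \<le> C" by simp
    qed
    finally have s: "cmod (\<Sum>n\<in>E. A m n * y n) \<le> real (card E) * C" by simp
    have "cmod (x m * (\<Sum>n\<in>E. A m n * y n)) \<le> 1 * (real (card E) * C)"
      unfolding norm_mult using s B(1)[OF m] by (intro mult_mono) (auto intro: order_trans[OF norm_ge_zero])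
    then show "cmod (x m * (\<Sum>n\<in>E. A m n * y n)) \<le> real (card E) * C" by simp
  qed
  finally show ?thesis by (simp add: mult.assoc)
qed

end

lemma supp_rep_cu:
  assumes f: "supp_rep E f" and u: "\<And>r c. u r c \<noteq> 0 \<Longrightarrow> r \<in> E \<and> c \<in> E \<and> fst r = fst c"
  shows "supp_rep E (\<lambda>k. cu E u (f k))"
  unfolding supp_rep_def
proof (intro allI impI)
  fix k r c assume n: "cu E u (f k) r c \<noteq> 0"
  from mm_nonzero[OF n[unfolded cu_def]] obtain m where m: "adj u r m \<noteq> 0" "mm E (f k) u m c \<noteq> 0" by blast
  from mm_nonzero[OF m(2)] obtain n where n: "f k m n \<noteq> 0" "u n c \<noteq> 0" by blast
  have "u m r \<noteq> 0" using m(1) by (simp add: adj_def)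
  then show "k \<in> arrows \<and> r \<in> E \<and> c \<in> E \<and> fst r = tgt k \<and> fst c = src k"
    using u[of m r] u[OF n(2)] f n(1) unfolding supp_rep_def by metis
qed

text \<open>Eigenvectors mix only indices of one class; \<open>cls\<close> refines the vertex, and
  in the sufficiency proof it also records the value of \<open>a\<close>. With the index within the
  vertex as weight, the eigenvalues increase inside each class.\<close>

lemma diagonalising_unitary:
  fixes cls :: "'v \<times> nat \<Rightarrow> 'b"
  assumes E: "finite E" and X: "adj X = X" and cls: "\<And>r c. r \<in> E \<Longrightarrow> c \<in> E \<Longrightarrow> X r c \<noteq> 0 \<Longrightarrow> cls r = cls c"
    and fs: "\<And>r c. cls r = cls c \<Longrightarrow> fst r = fst c"
  shows "\<exists>u x. uni E u \<and> (\<forall>r c. u r c \<noteq> 0 \<longrightarrow> r \<in> E \<and> c \<in> E \<and> cls r = cls c) \<and>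
     (\<forall>r\<in>E. \<forall>c\<in>E. cu E u X r c = (if r = c then of_real (x r) else 0)) \<and>
     (\<forall>r\<in>E. \<forall>c\<in>E. cls r = cls c \<longrightarrow> r \<preceq> c \<longrightarrow> x r \<le> x c)"
proof -
  have herm: "X c r = cnj (X r c)" for r c using fun_cong[OF fun_cong[OF X, of c], of r] by (simp add: adj_def)
  have w: "real (snd r) \<noteq> real (snd c)" if "r \<noteq> c" "cls r = cls c" for r c :: "'v \<times> nat"
    using fs[OF that(2)] that(1) by (auto simp: prod_eq_iff)
  have "\<exists>u. (\<forall>r c. u r c \<noteq> 0 \<longrightarrow> r \<in> E \<and> c \<in> E \<and> cls r = cls c) \<and>
     (\<forall>r\<in>E. \<forall>c\<in>E. ip E (\<lambda>m. u m c) (\<lambda>m. u m r) = unit_fun c r) \<and>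
     (\<forall>r\<in>E. \<forall>c\<in>E. r \<noteq> c \<longrightarrow> bil E X (\<lambda>m. u m r) (\<lambda>m. u m c) = 0) \<and>
     (\<forall>r\<in>E. \<forall>c\<in>E. cls r = cls c \<longrightarrow> real (snd r) < real (snd c) \<longrightarrow>
        Re (bil E X (\<lambda>m. u m r) (\<lambda>m. u m r)) \<le> Re (bil E X (\<lambda>m. u m c) (\<lambda>m. u m c)))"
  proof (rule hermitian_diagonalisation[OF E])
    show "X c r = cnj (X r c)" for r c by (rule herm)
    show "cls r = cls c" if "r \<in> E" "c \<in> E" "X r c \<noteq> 0" for r c using cls[OF that] .
    show "real (snd r) \<noteq> real (snd c)" if "r \<noteq> c" "cls r = cls c" for r c using w[OF that] .
  qed
  then obtain u where u: "\<forall>r c. u r c \<noteq> 0 \<longrightarrow> r \<in> E \<and> c \<in> E \<and> cls r = cls c"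
     "\<forall>r\<in>E. \<forall>c\<in>E. ip E (\<lambda>m. u m c) (\<lambda>m. u m r) = unit_fun c r"
     "\<forall>r\<in>E. \<forall>c\<in>E. r \<noteq> c \<longrightarrow> bil E X (\<lambda>m. u m r) (\<lambda>m. u m c) = 0"
     "\<forall>r\<in>E. \<forall>c\<in>E. cls r = cls c \<longrightarrow> real (snd r) < real (snd c) \<longrightarrow>
        Re (bil E X (\<lambda>m. u m r) (\<lambda>m. u m r)) \<le> Re (bil E X (\<lambda>m. u m c) (\<lambda>m. u m c))"
    by (elim exE conjE) rule
  have cb: "cu E u X r c = bil E X (\<lambda>m. u m r) (\<lambda>m. u m c)" for r c
    by (simp add: cu_def bil_def mm_def adj_def sum_distrib_left mult.assoc)
  have u1: "mm E (adj u) u r c = unit_fun c r" if "r \<in> E" "c \<in> E" for r c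
    using u(2) that by (simp add: ip_def mm_def adj_def mult.commute)
  have un: "uni E u" unfolding uni_def by (intro conjI ballI u1 right_inverse_if_left_inverse[OF E u1])
  define x where "x r = Re (cu E u X r r)" for r
  have real: "cu E u X r r = of_real (x r)" for r
  proof -
    have "adj (cu E u X) r r = cu E u X r r" using adj_cu[OF E un, of X] X by simp
    then show ?thesis by (simp add: adj_def x_def complex_eq_iff)
  qed
  have "x r \<le> x c" if "r \<in> E" "c \<in> E" "cls r = cls c" "r \<preceq> c" for r c
  proof (cases "r = c")
    case False
    then have "snd r < snd c" using that(4) by (auto simp: fle_def prod_eq_iff)
    then show ?thesis using u(4) that by (simp add: x_def cb)
  qed simp
  then show ?thesis using un u(1,3) real cb by (intro exI[of _ u] exI[of _ x]) auto
qed

section \<open>Existence of a minimiser\<close>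

lemma XX_graded: "rep f \<Longrightarrow> XX E a f r c \<noteq> 0 \<Longrightarrow> fst r = fst c"
  using mu_graded[of f E r c] by (auto simp: XX_def dg_def split: if_splits)

lemma JJ_nonneg: "JJ E a f \<ge> 0" unfolding JJ_def mip_self by (intro sum_nonneg) auto
lemma nn_nonneg: "nn E f \<ge> 0" unfolding nn_def mip_self by (intro sum_nonneg) auto

lemma nn_entry: "finite E \<Longrightarrow> k \<in> arrows \<Longrightarrow> r \<in> E \<Longrightarrow> c \<in> E \<Longrightarrow> (cmod (f k r c))\<^sup>2 \<le> nn E f"
proof -
  assume h: "finite E" "k \<in> arrows" "r \<in> E" "c \<in> E"
  have "(cmod (f k r c))\<^sup>2 \<le> (\<Sum>c\<in>E. (cmod (f k r c))\<^sup>2)" using h by (intro member_le_sum) auto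
  also have "\<dots> \<le> (\<Sum>r\<in>E. \<Sum>c\<in>E. (cmod (f k r c))\<^sup>2)" using h by (intro member_le_sum[of r E "\<lambda>r. \<Sum>c\<in>E. (cmod (f k r c))\<^sup>2"]) (auto intro: sum_nonneg)
  also have "\<dots> \<le> nn E f" unfolding nn_def mip_self using h
    by (intro member_le_sum[of k arrows "\<lambda>k. \<Sum>r\<in>E. \<Sum>c\<in>E. (cmod (f k r c))\<^sup>2"]) (auto intro!: sum_nonneg)
  finally show ?thesis .
qed

lemma minimum_on_box:
  assumes E: "finite E" and R: "R \<ge> 0"
  shows "\<exists>f. supp_rep E f \<and> (\<forall>k r c. cmod (f k r c) \<le> R) \<and>
     (\<forall>g. supp_rep E g \<longrightarrow> (\<forall>k r c. cmod (g k r c) \<le> R) \<longrightarrow> JJ E a f + d * nn E f \<le> JJ E a g + d * nn E g)"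
proof -
  define B where "B = {(k,r,c). k \<in> arrows \<and> r \<in> E \<and> c \<in> E \<and> fst r = tgt k \<and> fst c = src k}"
  define C where "C = {x :: nat \<times> ('v \<times> nat) \<times> ('v \<times> nat) \<Rightarrow> complex. \<forall>j. x j \<in> (if j \<in> B then cball 0 R else {0})}"
  define rp where "rp x k r c = x (k,r,c)" for x :: "nat \<times> ('v \<times> nat) \<times> ('v \<times> nat) \<Rightarrow> complex" and k r c
  have "compact C" unfolding C_def by (rule compact_box)
  moreover have "(\<lambda>_. 0) \<in> C" using R by (simp add: C_def)
  then have "C \<noteq> {}" by blast
  moreover have "continuous_on C (\<lambda>x. JJ E a (rp x) + d * nn E (rp x))"
  proof (rule continuous_on_subset[of UNIV])
    show "continuous_on UNIV (\<lambda>x. JJ E a (rp x) + d * nn E (rp x))"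
      unfolding JJ_def nn_def mip_def XX_def mu_def rp_def
      by (intro continuous_intros) auto
  qed simp
  ultimately obtain x where x: "x \<in> C" "\<And>y. y \<in> C \<Longrightarrow> JJ E a (rp x) + d * nn E (rp x) \<le> JJ E a (rp y) + d * nn E (rp y)"
    using continuous_attains_inf[of C "\<lambda>x. JJ E a (rp x) + d * nn E (rp x)"] by blast
  have C_iff: "x \<in> C \<longleftrightarrow> supp_rep E (rp x) \<and> (\<forall>k r c. cmod (rp x k r c) \<le> R)" for x
  proof
    assume x: "x \<in> C"
    have 1: "x j = 0" if "j \<notin> B" for j
    proof -
      have "x j \<in> (if j \<in> B then cball 0 R else {0})" using x unfolding C_def by blast
      then show ?thesis using that by simp
    qed
    have 2: "cmod (x j) \<le> R" for j
    proof (cases "j \<in> B")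
      case True
      have "x j \<in> (if j \<in> B then cball 0 R else {0})" using x unfolding C_def by blast
      then show ?thesis using True by simp
    qed (use 1 R in simp)
    have "(k,r,c) \<in> B" if "rp x k r c \<noteq> 0" for k r c using 1[of "(k,r,c)"] that by (auto simp: rp_def)
    then show "supp_rep E (rp x) \<and> (\<forall>k r c. cmod (rp x k r c) \<le> R)" using 2 by (simp add: supp_rep_def B_def rp_def)
  next
    assume x: "supp_rep E (rp x) \<and> (\<forall>k r c. cmod (rp x k r c) \<le> R)"
    show "x \<in> C" unfolding C_def
    proof (intro CollectI allI)
      fix j :: "nat \<times> ('v \<times> nat) \<times> ('v \<times> nat)"
      obtain k r c where j: "j = (k,r,c)" by (metis prod.collapse)
      show "x j \<in> (if j \<in> B then cball 0 R else {0})"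
      proof (cases "j \<in> B")
        case True
        have "cmod (rp x k r c) \<le> R" using x by blast
        then show ?thesis using True by (simp add: j rp_def)
      next
        case False
        then have "rp x k r c = 0" using x unfolding supp_rep_def B_def j by blast
        then show ?thesis using False by (simp add: j rp_def)
      qed
    qed
  qed
  show ?thesis
  proof (intro exI[of _ "rp x"] conjI allI impI)
    show "supp_rep E (rp x)" using x(1) C_iff by blast
    show "cmod (rp x k r c) \<le> R" for k r c using x(1) C_iff by blast
    fix g assume g: "supp_rep E g" "\<forall>k r c. cmod (g k r c) \<le> R"
    define y where "y = (\<lambda>(k,r,c). g k r c)"
    have "rp y = g" by (simp add: rp_def y_def fun_eq_iff)
    then show "JJ E a (rp x) + d * nn E (rp x) \<le> JJ E a g + d * nn E g" using x(2)[of y] C_iff[of y] g by simp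
  qed
qed

lemma supp_rep_zero: "supp_rep E (\<lambda>_ _ _. 0)" by (simp add: supp_rep_def)

text \<open>Outside the box of radius \<open>R\<close> the penalty alone exceeds \<open>J0\<close>,
  the value at the zero representation, so the minimum over the box is global. The summand 1 in
  \<open>R\<close> ensures \<open>R \<le> R\<^sup>2\<close>, as the penalty is quadratic.\<close>

lemma penalised_minimiser:
  assumes E: "finite E" and d: "d > 0"
  shows "\<exists>f. minimiser E a d f"
proof -
  define J0 where "J0 = JJ E a (\<lambda>_ _ _. 0)"
  define R where "R = J0 / d + 1"
  have J0: "J0 \<ge> 0" unfolding J0_def by (rule JJ_nonneg)
  have R: "R \<ge> 1" using J0 d by (simp add: R_def)
  obtain f where f: "supp_rep E f" "\<And>g. supp_rep E g \<Longrightarrow> (\<forall>k r c. cmod (g k r c) \<le> R) \<Longrightarrow> JJ E a f + d * nn E f \<le> JJ E a g + d * nn E g"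
    using minimum_on_box[OF E, of R a d] R by auto
  have n0: "nn E (\<lambda>_ _ _. 0) = 0" by (simp add: nn_def mip_def)
  have f0: "JJ E a f + d * nn E f \<le> J0" using f(2)[OF supp_rep_zero] R n0 by (simp add: J0_def)
  have "JJ E a f + d * nn E f \<le> JJ E a g + d * nn E g" if g: "supp_rep E g" for g
  proof (cases "\<forall>k r c. cmod (g k r c) \<le> R")
    case False
    then obtain k r c where krc: "cmod (g k r c) > R" unfolding not_all not_le by blast
    then have "g k r c \<noteq> 0" using R by auto
    then have h: "k \<in> arrows" "r \<in> E" "c \<in> E" using g unfolding supp_rep_def by blast+
    have "R \<le> R * R" using R by simp
    also have "\<dots> \<le> (cmod (g k r c))\<^sup>2" unfolding power2_eq_square using krc R by (intro mult_mono) auto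
    also have "\<dots> \<le> nn E g" by (rule nn_entry[OF E h])
    finally have "d * R \<le> d * nn E g" using d by simp
    moreover have "d * R = J0 + d" using d by (simp add: R_def field_simps)
    ultimately show ?thesis using f0 JJ_nonneg[of E a g] d by linarith
  qed (use f(2) g in blast)
  then show ?thesis unfolding minimiser_def using f(1) by blast
qed

text \<open>For a penalised minimiser the matrix \<open>\<mu>(f) - diag a\<close> grades the representation, so that \<open>f\<close> is
  nilpotent and its size is controlled by \<open>\<mu>(f)\<close>.\<close>

lemma penalised_minimiser_bound:
  assumes E: "finite E"
  shows "\<exists>R\<ge>0. \<forall>d>0. \<forall>f. minimiser E a d f \<longrightarrow> (\<forall>k r c. cmod (f k r c) \<le> R)"
proof -
  define J0 where "J0 = JJ E a (\<lambda>_ _ _. 0)"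
  define n where "n = real (card E)"
  \<comment> \<open>\<open>C\<close> bounds the diagonal of \<mu> in the eigenbasis of
    \<open>X\<close>, \<open>C2\<close> the squared norm of \<open>f\<close> there, and
    \<open>R\<close> the entries after undoing the change of basis. None of them depends on
    \<open>d\<close>.\<close>
  define C where "C = n * n * (sqrt J0 + (\<Sum>r\<in>E. \<bar>a r\<bar>))"
  define C2 where "C2 = n * (n * C)"
  define R where "R = n * n * sqrt C2"
  have J0: "J0 \<ge> 0" unfolding J0_def by (rule JJ_nonneg)
  have C0: "C \<ge> 0" "C2 \<ge> 0" using J0 by (auto simp: C_def C2_def n_def intro!: mult_nonneg_nonneg add_nonneg_nonneg sum_nonneg)
  have "cmod (f k r c) \<le> R" if d: "d > 0" and m: "minimiser E a d f" for d f k r c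
  proof -
    have f: "supp_rep E f" using m by (simp add: minimiser_def)
    define X where "X = XX E a f"
    have "JJ E a f + d * nn E f \<le> J0"
    proof -
      have "nn E (\<lambda>_ _ _. 0) = 0" by (simp add: nn_def mip_def)
      then show ?thesis using m supp_rep_zero unfolding minimiser_def J0_def by fastforce
    qed
    moreover have "d * nn E f \<ge> 0" using d nn_nonneg[of E f] by simp
    ultimately have JJ: "JJ E a f \<le> J0" by linarith
    have Xle: "cmod (X r c) \<le> sqrt J0" if rc: "r \<in> E" "c \<in> E" for r c
    proof -
      have "(cmod (X r c))\<^sup>2 \<le> (\<Sum>c\<in>E. (cmod (X r c))\<^sup>2)" using rc E by (intro member_le_sum) auto
      also have "\<dots> \<le> (\<Sum>r\<in>E. \<Sum>c\<in>E. (cmod (X r c))\<^sup>2)" using rc E by (intro member_le_sum[of r E "\<lambda>r. \<Sum>c\<in>E. (cmod (X r c))\<^sup>2"]) (auto intro: sum_nonneg)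
      also have "\<dots> \<le> J0" using JJ unfolding JJ_def mip_self X_def .
      finally show ?thesis using J0 by (simp add: real_le_rsqrt)
    qed
    have mule: "cmod (mu E f r c) \<le> sqrt J0 + (\<Sum>r\<in>E. \<bar>a r\<bar>)" if rc: "r \<in> E" "c \<in> E" for r c
    proof -
      have "cmod (dg a r c) \<le> (\<Sum>r\<in>E. \<bar>a r\<bar>)"
      proof (cases "r = c")
        case True
        then have "cmod (dg a r c) = \<bar>a r\<bar>" by (simp add: dg_def)
        also have "\<dots> \<le> (\<Sum>r\<in>E. \<bar>a r\<bar>)" using rc E by (intro member_le_sum) auto
        finally show ?thesis .
      qed (simp add: dg_def sum_nonneg)
      moreover have "mu E f r c = X r c + dg a r c" by (simp add: X_def XX_def)
      ultimately show ?thesis using Xle[OF rc] norm_triangle_ineq[of "X r c" "dg a r c"] by simp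
    qed
    have "\<exists>u x. uni E u \<and> (\<forall>r c. u r c \<noteq> 0 \<longrightarrow> r \<in> E \<and> c \<in> E \<and> fst r = fst c) \<and>
       (\<forall>r\<in>E. \<forall>c\<in>E. cu E u X r c = (if r = c then of_real (x r) else 0)) \<and>
       (\<forall>r\<in>E. \<forall>c\<in>E. fst r = fst c \<longrightarrow> r \<preceq> c \<longrightarrow> x r \<le> x c)"
    proof (rule diagonalising_unitary[OF E])
      show "adj X = X" unfolding X_def by (rule adj_XX)
      show "fst r = fst c" if "X r c \<noteq> 0" for r c using XX_graded[OF supp_rep_rep[OF f]] that unfolding X_def .
    qed
    then obtain u x where u: "uni E u" "\<forall>r c. u r c \<noteq> 0 \<longrightarrow> r \<in> E \<and> c \<in> E \<and> fst r = fst c"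
      "\<forall>r\<in>E. \<forall>c\<in>E. cu E u X r c = (if r = c then of_real (x r) else 0)"
      by (elim exE conjE) rule
    define f' where "f' k = cu E u (f k)" for k
    have f': "supp_rep E f'" using supp_rep_cu[OF f, of u] u(2) unfolding f'_def[abs_def] by blast
    \<comment> \<open>In the eigenbasis the critical equation says that \<open>f\<close> lowers
      eigenvalues of \<open>X\<close> by exactly \<open>d / 2\<close>.\<close>
    have step: "x c = x r + d / 2" if h: "k \<in> arrows" "r \<in> E" "c \<in> E" "f' k r c \<noteq> 0" for k r c
    proof -
      have "(\<lambda>r c. 2 * act E X (f k) r c + of_real d * f k r c) m n = 0" if "m \<in> E" "n \<in> E" for m n
        using minimiser_conditions(2)[OF E m h(1) that] unfolding X_def .
      then have "cu E u (\<lambda>r c. 2 * act E X (f k) r c + of_real d * f k r c) r c = 0" by (simp add: cu_def mm_def)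
      then have "2 * act E (cu E u X) (f' k) r c + of_real d * f' k r c = 0"
        unfolding cu_scale_add[OF E u(1)] cu_act[OF E u(1)] f'_def .
      moreover have "act E (cu E u X) (f' k) r c = of_real (x r - x c) * f' k r c"
      proof -
        have "mm E (cu E u X) (f' k) r c = (\<Sum>m\<in>E. if m = r then of_real (x r) * f' k r c else 0)"
          unfolding mm_def using u(3) h by (intro sum.cong) auto
        moreover have "mm E (f' k) (cu E u X) r c = (\<Sum>m\<in>E. if m = c then f' k r c * of_real (x c) else 0)"
          unfolding mm_def using u(3) h by (intro sum.cong) auto
        ultimately show ?thesis using h E by (simp add: act_def algebra_simps)
      qed
      ultimately have "(of_real (2 * (x r - x c) + d)) * f' k r c = 0" by (simp add: algebra_simps)
      then have "2 * (x r - x c) + d = 0" using h(4) of_real_eq_0_iff by (metis mult_eq_0_iff)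
      then show ?thesis by simp
    qed
    have mu': "cmod (mu E f' c c) \<le> C" if c: "c \<in> E" for c
    proof -
      have "mu E f' c c = (\<Sum>m\<in>E. adj u c m * (\<Sum>n\<in>E. mu E f m n * u n c))"
        unfolding f'_def[abs_def] cu_mu[OF E u(1)] by (simp add: cu_def mm_def)
      moreover have "cmod (u m c) \<le> 1" "cmod (adj u c m) \<le> 1" if "m \<in> E" for m
        using uni_entry_le[OF E u(1) that c] by (auto simp: adj_def)
      ultimately show ?thesis unfolding C_def n_def
        using unitary_sandwich_le[OF E u(1), of "\<lambda>m. adj u c m" "\<lambda>n. u n c" "mu E f"] mule by simp
    qed
    \<comment> \<open>The rank of an eigenvalue within its coset modulo multiples of
      \<open>d / 2\<close>. The rank, unlike the eigenvalue divided by \<open>d / 2\<close>, stays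
      bounded by the size of \<open>E\<close> when \<open>d\<close> tends to 0.\<close>
    define G where "G c = card {v \<in> x ` E. v < x c \<and> (\<exists>j::int. x c - v = of_int j * (d / 2))}" for c
    have Gle: "real (G c) \<le> n" for c
    proof -
      have "G c \<le> card (x ` E)" unfolding G_def using E by (intro card_mono) auto
      also have "\<dots> \<le> card E" using E by (rule card_image_le)
      finally show ?thesis by (simp add: n_def)
    qed
    have Gstep: "real (G c) = real (G r) + 1" if rc: "r \<in> E" "x c = x r + d / 2" for r c
    proof -
      have "{v \<in> x ` E. v < x c \<and> (\<exists>j::int. x c - v = of_int j * (d / 2))} =
          insert (x r) {v \<in> x ` E. v < x r \<and> (\<exists>j::int. x r - v = of_int j * (d / 2))}" (is "?L = insert _ ?R")
      proof (intro equalityI subsetI)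
        fix v assume "v \<in> ?L"
        then obtain j :: int where v: "v \<in> x ` E" "v < x c" "x c - v = of_int j * (d / 2)" by blast
        have eq: "x r - v = of_int (j - 1) * (d / 2)" using v(3) rc(2) by (simp add: algebra_simps)
        have "0 < of_int j * (d / 2)" using v(2,3) by linarith
        then have "j \<ge> 1" using d by (simp add: zero_less_mult_iff)
        then have "x r - v \<ge> 0" unfolding eq using d by (intro mult_nonneg_nonneg) auto
        then show "v \<in> insert (x r) ?R" using v(1) eq by fastforce
      next
        fix v assume v: "v \<in> insert (x r) ?R"
        show "v \<in> ?L"
        proof (cases "v = x r")
          case True
          have "x c - v = of_int 1 * (d / 2)" using rc(2) True by simp
          then have "\<exists>j::int. x c - v = of_int j * (d / 2)" by blast
          moreover have "v < x c" using True rc(2) d by simp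
          ultimately show ?thesis using True rc(1) by blast
        next
          case False
          then obtain j :: int where j: "v \<in> x ` E" "v < x r" "x r - v = of_int j * (d / 2)" using v by blast
          have "x c - v = of_int (j + 1) * (d / 2)" using j(3) rc(2) by (simp add: algebra_simps)
          then have "\<exists>j::int. x c - v = of_int j * (d / 2)" by blast
          moreover have "v < x c" using j(2) rc(2) d by simp
          ultimately show ?thesis using j(1) by blast
        qed
      qed
      moreover have "x r \<notin> ?R" by simp
      moreover have "finite ?R" using E by simp
      ultimately show ?thesis unfolding G_def by simp
    qed
    \<comment> \<open>Each nonzero entry of \<open>f'\<close> changes \<open>G\<close> by one, so
      pairing \<open>G\<close> with the diagonal of \<mu> gives minus the squared norm.\<close>
    have nn': "nn E f' \<le> C2"
    proof -
      have mucc: "Re (mu E f' c c) = (\<Sum>k\<in>arrows. \<Sum>m\<in>E. (cmod (f' k c m))\<^sup>2) - (\<Sum>k\<in>arrows. \<Sum>m\<in>E. (cmod (f' k m c))\<^sup>2)" for c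
        unfolding mu_def by (simp add: complex_norm_square[symmetric] mult.commute[of "cnj _"] del: of_real_power)
      have "(\<Sum>c\<in>E. real (G c) * Re (mu E f' c c)) = (\<Sum>k\<in>arrows. \<Sum>c\<in>E. \<Sum>m\<in>E. real (G c) * (cmod (f' k c m))\<^sup>2) - (\<Sum>k\<in>arrows. \<Sum>c\<in>E. \<Sum>m\<in>E. real (G c) * (cmod (f' k m c))\<^sup>2)"
        unfolding mucc right_diff_distrib sum_subtractf sum_distrib_left
        by (intro arg_cong2[of _ _ _ _ "(-)"] sum.swap)
      also have "(\<Sum>k\<in>arrows. \<Sum>c\<in>E. \<Sum>m\<in>E. real (G c) * (cmod (f' k m c))\<^sup>2) = (\<Sum>k\<in>arrows. \<Sum>c\<in>E. \<Sum>m\<in>E. real (G m) * (cmod (f' k c m))\<^sup>2)"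
        by (rule sum.cong[OF refl]) (rule sum.swap)
      also have "(\<Sum>k\<in>arrows. \<Sum>c\<in>E. \<Sum>m\<in>E. real (G c) * (cmod (f' k c m))\<^sup>2) - \<dots> = (\<Sum>k\<in>arrows. \<Sum>c\<in>E. \<Sum>m\<in>E. - ((cmod (f' k c m))\<^sup>2))"
        unfolding sum_subtractf[symmetric]
      proof (intro sum.cong refl)
        fix k c m assume h: "k \<in> arrows" "c \<in> E" "m \<in> E"
        show "real (G c) * (cmod (f' k c m))\<^sup>2 - real (G m) * (cmod (f' k c m))\<^sup>2 = - ((cmod (f' k c m))\<^sup>2)"
        proof (cases "f' k c m = 0")
          case False
          then have "real (G m) = real (G c) + 1" using Gstep[OF h(2)] step[OF h] by blast
          then show ?thesis by (simp add: algebra_simps)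
        qed simp
      qed
      also have "\<dots> = - nn E f'" by (simp add: nn_def mip_self sum_negf)
      finally have "nn E f' = - (\<Sum>c\<in>E. real (G c) * Re (mu E f' c c))" by simp
      also have "\<dots> \<le> (\<Sum>c\<in>E. n * C)"
        unfolding sum_negf[symmetric]
      proof (rule sum_mono)
        fix c assume c: "c \<in> E"
        have "- Re (mu E f' c c) \<le> C" using mu'[OF c] abs_Re_le_cmod[of "mu E f' c c"] by linarith
        then have "real (G c) * (- Re (mu E f' c c)) \<le> real (G c) * C" by (intro mult_left_mono) auto
        also have "\<dots> \<le> n * C" using Gle C0 by (intro mult_right_mono) auto
        finally show "- (real (G c) * Re (mu E f' c c)) \<le> n * C" by simp
      qed
      finally show ?thesis by (simp add: C2_def n_def)
    qed
    show "cmod (f k r c) \<le> R"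
    proof (cases "f k r c = 0")
      case True
      then show ?thesis using C0 by (simp add: R_def n_def)
    next
      case False
      then have h: "k \<in> arrows" "r \<in> E" "c \<in> E" using f unfolding supp_rep_def by blast+
      have ent: "cmod (f' k m n) \<le> sqrt C2" if "m \<in> E" "n \<in> E" for m n
        using nn_entry[OF E h(1) that, of f'] nn' by (intro real_le_rsqrt) simp
      have "f k r c = (\<Sum>m\<in>E. u r m * (\<Sum>n\<in>E. f' k m n * adj u n c))"
        using cu_undo[OF E u(1) h(2,3), of "f k"] by (simp add: f'_def mm_def)
      moreover have "cmod (u r m) \<le> 1" "cmod (adj u m c) \<le> 1" if "m \<in> E" for m
        using uni_entry_le[OF E u(1) h(2) that] uni_entry_le[OF E u(1) h(3) that] by (auto simp: adj_def)
      ultimately show ?thesis unfolding R_def n_def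
        using unitary_sandwich_le[OF E u(1), of "\<lambda>m. u r m" "\<lambda>n. adj u n c" "f' k"] ent by simp
    qed
  qed
  moreover have "R \<ge> 0" using C0 by (simp add: R_def n_def)
  ultimately show ?thesis by blast
qed

text \<open>All penalised minimisers lie in one box, so a minimiser over that box is at least as
  good as each of them. For a fixed competitor \<open>g\<close> the weight \<open>d\<close> is
  chosen so that the penalty of \<open>g\<close> is at most \<open>e\<close>.\<close>

lemma minimiser_exists:
  assumes E: "finite E"
  shows "\<exists>f. minimiser E a 0 f"
proof -
  obtain R where R: "R \<ge> 0" "\<And>d f k r c. d > 0 \<Longrightarrow> minimiser E a d f \<Longrightarrow> cmod (f k r c) \<le> R"
    using penalised_minimiser_bound[OF E, of a] by blast
  obtain f where f: "supp_rep E f" "\<And>g. supp_rep E g \<Longrightarrow> (\<forall>k r c. cmod (g k r c) \<le> R) \<Longrightarrow> JJ E a f + 0 * nn E f \<le> JJ E a g + 0 * nn E g"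
    using minimum_on_box[OF E R(1), of a 0] by blast
  have "JJ E a f \<le> JJ E a g" if g: "supp_rep E g" for g
  proof (rule field_le_epsilon)
    fix e :: real assume e: "e > 0"
    define d where "d = e / (nn E g + 1)"
    have d: "d > 0" using e nn_nonneg[of E g] by (simp add: d_def add_nonneg_pos)
    obtain h where h: "minimiser E a d h" using penalised_minimiser[OF E d] by blast
    have "JJ E a f \<le> JJ E a h" using f(2)[of h] h R(2)[OF d h] by (simp add: minimiser_def)
    also have "\<dots> \<le> JJ E a h + d * nn E h" using d nn_nonneg[of E h] by simp
    also have "\<dots> \<le> JJ E a g + d * nn E g" using h g by (simp add: minimiser_def)
    also have "d * nn E g \<le> d * (nn E g + 1)" using d by simp
    also have "d * (nn E g + 1) = e" using nn_nonneg[of E g] by (simp add: d_def)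
    finally show "JJ E a f \<le> JJ E a g + e" by simp
  qed
  then show ?thesis unfolding minimiser_def using f(1) by auto
qed

end

section \<open>Sufficiency of the inequalities\<close>

context quiver
begin

text \<open>The Hermitian completion of a matrix supported in an off-diagonal block.\<close>

definition hm :: "('v \<times> nat) cmat \<Rightarrow> ('v \<times> nat) cmat" where "hm A r c = A r c + cnj (A c r)"

lemma mip_hm:
  assumes A: "\<And>r c. r \<in> E \<Longrightarrow> c \<in> E \<Longrightarrow> A r c \<noteq> 0 \<Longrightarrow> r \<in> W \<and> c \<in> K"
    and B: "\<And>r c. r \<in> E \<Longrightarrow> c \<in> E \<Longrightarrow> B r c \<noteq> 0 \<Longrightarrow> r \<in> W \<and> c \<in> K" and WK: "W \<inter> K = {}"
  shows "mip E (hm A) (hm B) = 2 * mip E A B"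
proof -
  have h: "hm C = (\<lambda>r c. C r c + adj C r c)" for C by (simp add: hm_def adj_def fun_eq_iff)
  have z: "A r c * cnj (adj B r c) = 0" "adj A r c * cnj (B r c) = 0" if rc: "r \<in> E" "c \<in> E" for r c
  proof -
    have "A r c = 0 \<or> B c r = 0" "A c r = 0 \<or> B r c = 0" using A[OF rc] A[OF rc(2,1)] B[OF rc] B[OF rc(2,1)] WK by blast+
    then show "A r c * cnj (adj B r c) = 0" "adj A r c * cnj (B r c) = 0" by (auto simp: adj_def)
  qed
  have c1: "mip E A (adj B) = 0" unfolding mip_def by (intro sum.neutral ballI) (simp only: z(1) zero_complex.sel)
  have c2: "mip E (adj A) B = 0" unfolding mip_def by (intro sum.neutral ballI) (simp only: z(2) zero_complex.sel)
  show ?thesis unfolding h mip_add_left mip_add_right c1 c2 mip_adj by simp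
qed

text \<open>When \<open>f\<close> preserves both \<open>K\<close> and its complement, the two sums
  in \<mu> run over the same entries: a trace of commutators.\<close>

lemma trace_mu:
  assumes K: "finite K" and f: "\<And>k r m. k \<in> arrows \<Longrightarrow> r \<in> K \<Longrightarrow> m \<in> E - K \<Longrightarrow> f k r m = 0 \<and> f k m r = 0"
    and KE: "K \<subseteq> E" "finite E"
  shows "(\<Sum>c\<in>K. mu E f c c) = 0"
proof -
  have 1: "(\<Sum>m\<in>E. f k c m * cnj (f k c m)) = (\<Sum>m\<in>K. f k c m * cnj (f k c m))" if "k \<in> arrows" "c \<in> K" for k c
    using f that KE by (intro sum.mono_neutral_right) auto
  have 2: "(\<Sum>m\<in>E. cnj (f k m c) * f k m c) = (\<Sum>m\<in>K. cnj (f k m c) * f k m c)" if "k \<in> arrows" "c \<in> K" for k c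
    using f that KE by (intro sum.mono_neutral_right) auto
  have "(\<Sum>c\<in>K. mu E f c c) = (\<Sum>c\<in>K. \<Sum>k\<in>arrows. \<Sum>m\<in>K. f k c m * cnj (f k c m)) - (\<Sum>c\<in>K. \<Sum>k\<in>arrows. \<Sum>m\<in>K. cnj (f k m c) * f k m c)"
    unfolding mu_def sum_subtractf using 1 2 by simp
  also have "(\<Sum>c\<in>K. \<Sum>k\<in>arrows. \<Sum>m\<in>K. f k c m * cnj (f k c m)) = (\<Sum>k\<in>arrows. \<Sum>c\<in>K. \<Sum>m\<in>K. f k c m * cnj (f k c m))" by (rule sum.swap)
  also have "(\<Sum>c\<in>K. \<Sum>k\<in>arrows. \<Sum>m\<in>K. cnj (f k m c) * f k m c) = (\<Sum>k\<in>arrows. \<Sum>c\<in>K. \<Sum>m\<in>K. cnj (f k m c) * f k m c)" by (rule sum.swap)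
  also have "\<dots> = (\<Sum>k\<in>arrows. \<Sum>c\<in>K. \<Sum>m\<in>K. f k c m * cnj (f k c m))"
  proof (rule sum.cong[OF refl])
    fix k
    have "(\<Sum>c\<in>K. \<Sum>m\<in>K. cnj (f k m c) * f k m c) = (\<Sum>m\<in>K. \<Sum>c\<in>K. cnj (f k m c) * f k m c)" by (rule sum.swap)
    then show "(\<Sum>c\<in>K. \<Sum>m\<in>K. cnj (f k m c) * f k m c) = (\<Sum>c\<in>K. \<Sum>m\<in>K. f k c m * cnj (f k c m))" by (simp add: mult.commute)
  qed
  finally show ?thesis by simp
qed

text \<open>Infinitesimal equivariance: along the unitary orbit generated by the skew-Hermitian
  \<open>\<kappa>\<close>, \<mu> moves by its commutator with \<open>\<kappa>\<close>.\<close>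

lemma dmu_act:
  assumes \<kappa>: "\<And>r c. adj \<kappa> r c = - \<kappa> r c"
  shows "dmu E f (\<lambda>k. act E \<kappa> (f k)) r c = mm E \<kappa> (mu E f) r c - mm E (mu E f) \<kappa> r c"
proof -
  have ak: "adj \<kappa> = (\<lambda>r c. - \<kappa> r c)" using \<kappa> by (simp add: fun_eq_iff)
  have aq: "adj (act E \<kappa> A) = (\<lambda>r c. mm E \<kappa> (adj A) r c + - mm E (adj A) \<kappa> r c)" for A
  proof (intro ext)
    fix r c
    have "adj (act E \<kappa> A) r c = adj (mm E \<kappa> A) r c - adj (mm E A \<kappa>) r c" by (simp add: adj_def act_def)
    then show "adj (act E \<kappa> A) r c = mm E \<kappa> (adj A) r c + - mm E (adj A) \<kappa> r c"
      unfolding adj_mm ak mm_uminus_left mm_uminus_right by simp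
  qed
  have acf: "act E \<kappa> A = (\<lambda>r c. mm E \<kappa> A r c + - mm E A \<kappa> r c)" for A by (simp add: act_def fun_eq_iff)
  have 1: "mm E A (adj (act E \<kappa> A)) r c + mm E (act E \<kappa> A) (adj A) r c = mm E \<kappa> (mm E A (adj A)) r c - mm E (mm E A (adj A)) \<kappa> r c" for A
    unfolding aq unfolding acf mm_lin_left mm_lin_right mm_uminus_left mm_uminus_right by (simp add: mm_assoc)
  have 2: "mm E (adj A) (act E \<kappa> A) r c + mm E (adj (act E \<kappa> A)) A r c = mm E \<kappa> (mm E (adj A) A) r c - mm E (mm E (adj A) A) \<kappa> r c" for A
    unfolding aq unfolding acf mm_lin_left mm_lin_right mm_uminus_left mm_uminus_right by (simp add: mm_assoc)
  have muf: "mu E f = (\<lambda>r c. (\<Sum>k\<in>arrows. mm E (f k) (adj (f k)) r c) - (\<Sum>k\<in>arrows. mm E (adj (f k)) (f k) r c))"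
    by (intro ext) (rule mu_eq)
  have ls: "mm E \<kappa> (\<lambda>r c. (\<Sum>k\<in>arrows. A k r c) - (\<Sum>k\<in>arrows. B k r c)) r c = (\<Sum>k\<in>arrows. mm E \<kappa> (A k) r c) - (\<Sum>k\<in>arrows. mm E \<kappa> (B k) r c)" for A B
  proof -
    have "mm E \<kappa> (\<lambda>r c. (\<Sum>k\<in>arrows. A k r c) - (\<Sum>k\<in>arrows. B k r c)) r c = (\<Sum>m\<in>E. \<Sum>k\<in>arrows. \<kappa> r m * A k m c) - (\<Sum>m\<in>E. \<Sum>k\<in>arrows. \<kappa> r m * B k m c)"
      by (simp add: mm_def right_diff_distrib sum_subtractf sum_distrib_left)
    also have "\<dots> = (\<Sum>k\<in>arrows. \<Sum>m\<in>E. \<kappa> r m * A k m c) - (\<Sum>k\<in>arrows. \<Sum>m\<in>E. \<kappa> r m * B k m c)"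
      by (intro arg_cong2[of _ _ _ _ "(-)"] sum.swap)
    finally show ?thesis by (simp add: mm_def)
  qed
  have rs: "mm E (\<lambda>r c. (\<Sum>k\<in>arrows. A k r c) - (\<Sum>k\<in>arrows. B k r c)) \<kappa> r c = (\<Sum>k\<in>arrows. mm E (A k) \<kappa> r c) - (\<Sum>k\<in>arrows. mm E (B k) \<kappa> r c)" for A B
  proof -
    have "mm E (\<lambda>r c. (\<Sum>k\<in>arrows. A k r c) - (\<Sum>k\<in>arrows. B k r c)) \<kappa> r c = (\<Sum>m\<in>E. \<Sum>k\<in>arrows. A k r m * \<kappa> m c) - (\<Sum>m\<in>E. \<Sum>k\<in>arrows. B k r m * \<kappa> m c)"
      by (simp add: mm_def left_diff_distrib sum_subtractf sum_distrib_right)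
    also have "\<dots> = (\<Sum>k\<in>arrows. \<Sum>m\<in>E. A k r m * \<kappa> m c) - (\<Sum>k\<in>arrows. \<Sum>m\<in>E. B k r m * \<kappa> m c)"
      by (intro arg_cong2[of _ _ _ _ "(-)"] sum.swap)
    finally show ?thesis by (simp add: mm_def)
  qed
  show ?thesis unfolding dmu_def 1 2 muf ls rs by (simp add: sum_subtractf)
qed

text \<open>The direction \<open>p\<close> joins the dual Ext class \<open>h\<close> and an
  infinitesimal rotation \<open>q\<close> of \<open>f\<close>. The class alone changes \<mu> by
  \<open>hm N\<close> in first order; the rotation absorbs the part of this change that is measured
  by gaps of \<open>a\<close>. The remaining terms of the second variation are products of gaps of
  opposite sign, and the term of \<open>h\<close> is strictly negative because \<open>h\<close> maps
  the top eigenspace to lower ones.\<close>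

lemma minimiser_diagonal_imp_zero:
  assumes E: "finite E" and mono: "\<And>r c. r \<in> E \<Longrightarrow> c \<in> E \<Longrightarrow> r \<preceq> c \<Longrightarrow> a r \<le> a c"
    and sum0: "(\<Sum>r\<in>E. a r) = 0" and ineq: "\<And>K. Sh E K \<Longrightarrow> (\<Sum>c\<in>K. a c) \<ge> 0"
    and m: "minimiser E a 0 f"
    and X: "\<And>r c. r \<in> E \<Longrightarrow> c \<in> E \<Longrightarrow> XX E a f r c = (if r = c then of_real (x r) else 0)"
    and tie: "\<And>r c. r \<in> E \<Longrightarrow> c \<in> E \<Longrightarrow> r \<preceq> c \<Longrightarrow> a r = a c \<Longrightarrow> x r \<le> x c"
  shows "\<forall>r\<in>E. x r = 0"
proof (rule ccontr)
  assume nz: "\<not> ?thesis"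
  have f: "supp_rep E f" using m by (simp add: minimiser_def)
  have actX: "act E (XX E a f) A r c = of_real (x r - x c) * A r c" if rc: "r \<in> E" "c \<in> E" for A r c
  proof -
    have "mm E (XX E a f) A r c = (\<Sum>m\<in>E. if m = r then of_real (x r) * A r c else 0)"
      unfolding mm_def using X rc by (intro sum.cong) auto
    moreover have "mm E A (XX E a f) r c = (\<Sum>m\<in>E. if m = c then A r c * of_real (x c) else 0)"
      unfolding mm_def using X rc by (intro sum.cong) auto
    ultimately show ?thesis using rc E by (simp add: act_def algebra_simps)
  qed
  have blk: "x r = x c" if h: "k \<in> arrows" "r \<in> E" "c \<in> E" "f k r c \<noteq> 0" for k r c
  proof -
    have "2 * (of_real (x r - x c) * f k r c) = 0"
      using minimiser_conditions(2)[OF E m h(1-3)] unfolding actX[OF h(2,3)] by simp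
    then show ?thesis using h(4) by simp
  qed
  have mux: "mu E f r c = (if r = c then of_real (a r + x r) else 0)" if "r \<in> E" "c \<in> E" for r c
    using X[OF that] by (auto simp: XX_def dg_def algebra_simps split: if_splits)
  have sumx: "(\<Sum>r\<in>E. x r) = 0"
  proof -
    have "complex_of_real (\<Sum>r\<in>E. a r + x r) = (\<Sum>r\<in>E. mu E f r r)" using mux by simp
    also have "\<dots> = 0" by (rule trace_mu) (use E in auto)
    finally have "(\<Sum>r\<in>E. a r + x r) = 0" using of_real_eq_0_iff by blast
    then show ?thesis using sum0 by (simp add: sum.distrib)
  qed
  obtain r0 where r0: "r0 \<in> E" "x r0 \<noteq> 0" using nz by blast
  define l where "l = Max (x ` E)"
  have xl: "x r \<le> l" if "r \<in> E" for r using E that by (simp add: l_def)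
  have "l \<in> x ` E" unfolding l_def using E r0 by (intro Max_in) auto
  then obtain c0 where c0: "c0 \<in> E" "x c0 = l" by blast
  have l0: "l > 0"
  proof (rule ccontr)
    assume "\<not> l > 0"
    then have "- x r \<ge> 0" if "r \<in> E" for r using xl[OF that] by linarith
    moreover have "(\<Sum>r\<in>E. - x r) = 0" using sumx by (simp add: sum_negf)
    ultimately have "\<forall>r\<in>E. - x r = 0" using E sum_nonneg_eq_0_iff[of E "\<lambda>r. - x r"] by blast
    then show False using r0 by auto
  qed
  define K W where "K = {c\<in>E. x c = l}" and "W = E - K"
  have KE: "K \<subseteq> E" "finite K" "finite W" "W \<inter> K = {}" "W \<subseteq> E" using E by (auto simp: K_def W_def)
  have xK: "x c = l" if "c \<in> K" for c using that by (simp add: K_def)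
  have xW: "x r < l" if "r \<in> W" for r using that xl[of r] by (auto simp: W_def K_def)
  \<comment> \<open>The trace of \<mu> over the eigenspace vanishes, so the sum of \<open>a\<close>
    is minus the positive number \<open>card K * l\<close>.\<close>
  have "(\<Sum>c\<in>K. a c) < 0"
  proof -
    have "(\<Sum>c\<in>K. mu E f c c) = 0"
    proof (rule trace_mu[OF KE(2) _ KE(1) E])
      fix k r m assume h: "k \<in> arrows" "r \<in> K" "m \<in> E - K"
      then have "x r \<noteq> x m" "r \<in> E" using xK[OF h(2)] by (auto simp: K_def)
      then show "f k r m = 0 \<and> f k m r = 0" using blk[OF h(1), of r m] blk[OF h(1), of m r] h(3) by auto
    qed
    moreover have "(\<Sum>c\<in>K. mu E f c c) = complex_of_real (\<Sum>c\<in>K. a c + x c)" using mux KE(1) by (auto simp: subset_iff)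
    ultimately have "(\<Sum>c\<in>K. a c + x c) = 0" using of_real_eq_0_iff by metis
    moreover have "(\<Sum>c\<in>K. x c) = real (card K) * l" using xK by simp
    moreover have "card K > 0" using c0 KE(2) by (auto simp: card_gt_0_iff K_def)
    ultimately show ?thesis using l0 by (simp add: sum.distrib) (smt (verit) mult_pos_pos of_nat_0_less_iff)
  qed
  then have "\<not> Sh E K" using ineq by force
  then have nT: "\<not> Tsurj K f W f"
    unfolding W_def
  proof (rule contrapos_nn)
    assume "Tsurj K f (E - K) f"
    then show "Sh E K" by (rule Tsurj_imp_Sh[OF _ supp_rep_rep[OF f] E KE(1) Sh_imp_univ[OF KE(2)]])
  qed
  define Y where "Y = {(k,r,c). k \<in> arrows \<and> r \<in> W \<and> c \<in> K \<and> fst r = tgt k \<and> fst c = src k}"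
  have finY: "finite Y" unfolding Y_def by (rule finite_ar[OF KE(2,3)])
  obtain h0 where h0: "\<exists>y\<in>Y. h0 y \<noteq> 0" "\<And>\<phi>. supp_in {(r,c). r \<in> W \<and> c \<in> K \<and> r \<preceq> c} \<phi> \<Longrightarrow> (\<Sum>y\<in>Y. h0 y * Top K f W f \<phi> y) = 0"
    using linop_not_surjective_imp_annihilator[OF linop_Top finite_cnt[OF KE(2,3)] finite_ar[OF KE(2,3)], of K f W f] nT
    unfolding Tsurj_iff_Top Y_def by blast
  \<comment> \<open>Conjugation turns the annihilating functional into a vector for the Hermitian
    pairing.\<close>
  define h where "h k r c = (if (k,r,c) \<in> Y then cnj (h0 (k,r,c)) else 0)" for k r c
  have hY: "k \<in> arrows \<and> r \<in> W \<and> c \<in> K \<and> fst r = tgt k \<and> fst c = src k" if "h k r c \<noteq> 0" for k r c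
    using that by (auto simp: h_def Y_def split: if_splits)
  have h: "supp_rep E h" unfolding supp_rep_def using hY KE by blast
  define N where "N r c = (\<Sum>k\<in>arrows. mm E (h k) (adj (f k)) r c - mm E (adj (f k)) (h k) r c)" for r c
  \<comment> \<open>The annihilation property is tested on matrix units at flagged
    positions.\<close>
  have N0: "N r c = 0" if rc: "r \<in> W" "c \<in> K" "r \<preceq> c" for r c
  proof -
    define \<phi> where "\<phi> = unit_fun (r,c)"
    have "supp_in {(r,c). r \<in> W \<and> c \<in> K \<and> r \<preceq> c} \<phi>" using rc by (auto simp: supp_in_def \<phi>_def unit_fun_def split: if_splits)
    from h0(2)[OF this] have z: "(\<Sum>y\<in>Y. h0 y * Top K f W f \<phi> y) = 0" .
    have top: "Top K f W f \<phi> (k,r',c') = (if r' = r then f k c c' else 0) - (if c' = c then f k r' r else 0)" for k r' c'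
    proof -
      have "mm K (curry \<phi>) (f k) r' c' = (\<Sum>m\<in>K. if m = c then (if r' = r then f k c c' else 0) else 0)"
        unfolding mm_def by (intro sum.cong) (auto simp: \<phi>_def unit_fun_def)
      moreover have "mm W (f k) (curry \<phi>) r' c' = (\<Sum>m\<in>W. if m = r then (if c' = c then f k r' r else 0) else 0)"
        unfolding mm_def by (intro sum.cong) (auto simp: \<phi>_def unit_fun_def)
      ultimately show ?thesis using rc KE by (simp add: Top_def)
    qed
    have "(\<Sum>y\<in>Y. h0 y * Top K f W f \<phi> y) = (\<Sum>y\<in>arrows \<times> E \<times> E. (\<lambda>(k,r',c'). cnj (h k r' c')) y * Top K f W f \<phi> y)"
      using finY E KE by (intro sum.mono_neutral_cong_left) (auto simp: Y_def h_def)
    also have "\<dots> = (\<Sum>k\<in>arrows. \<Sum>r'\<in>E. \<Sum>c'\<in>E. cnj (h k r' c') * Top K f W f \<phi> (k,r',c'))"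
      by (simp add: sum.cartesian_product case_prod_beta)
    also have "\<dots> = (\<Sum>k\<in>arrows. (\<Sum>m\<in>E. cnj (h k r m) * f k c m) - (\<Sum>m\<in>E. cnj (h k m c) * f k m r))"
    proof (rule sum.cong[OF refl])
      fix k
      have "(\<Sum>r'\<in>E. \<Sum>c'\<in>E. cnj (h k r' c') * Top K f W f \<phi> (k,r',c')) =
          (\<Sum>r'\<in>E. \<Sum>c'\<in>E. if r' = r then cnj (h k r c') * f k c c' else 0) - (\<Sum>r'\<in>E. \<Sum>c'\<in>E. if c' = c then cnj (h k r' c) * f k r' r else 0)"
        unfolding top sum_subtractf[symmetric] by (intro sum.cong refl) (simp add: algebra_simps)
      also have "(\<Sum>r'\<in>E. \<Sum>c'\<in>E. if r' = r then cnj (h k r c') * f k c c' else 0) = (\<Sum>r'\<in>E. if r' = r then (\<Sum>c'\<in>E. cnj (h k r c') * f k c c') else 0)"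
        by (intro sum.cong refl) simp
      also have "\<dots> = (\<Sum>m\<in>E. cnj (h k r m) * f k c m)" using E rc KE by (simp add: subset_iff)
      also have "(\<Sum>r'\<in>E. \<Sum>c'\<in>E. if c' = c then cnj (h k r' c) * f k r' r else 0) = (\<Sum>m\<in>E. cnj (h k m c) * f k m r)"
        using E rc KE by (simp add: subset_iff)
      finally show "(\<Sum>r'\<in>E. \<Sum>c'\<in>E. cnj (h k r' c') * Top K f W f \<phi> (k,r',c')) = (\<Sum>m\<in>E. cnj (h k r m) * f k c m) - (\<Sum>m\<in>E. cnj (h k m c) * f k m r)" .
    qed
    also have "\<dots> = cnj (N r c)" unfolding N_def mm_def adj_def by (simp add: mult.commute)
    finally show ?thesis using z by simp
  qed
  have NWK: "r \<in> W \<and> c \<in> K \<and> fst r = fst c" if rc: "r \<in> E" "c \<in> E" "N r c \<noteq> 0" for r c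
  proof -
    obtain k where k: "k \<in> arrows" "mm E (h k) (adj (f k)) r c - mm E (adj (f k)) (h k) r c \<noteq> 0"
      using rc(3) unfolding N_def by (meson sum.not_neutral_contains_not_neutral)
    then have "mm E (h k) (adj (f k)) r c \<noteq> 0 \<or> mm E (adj (f k)) (h k) r c \<noteq> 0" by auto
    then show ?thesis
    proof
      assume "mm E (h k) (adj (f k)) r c \<noteq> 0"
      from mm_nonzero[OF this] obtain n where n: "n \<in> E" "h k r n \<noteq> 0" "f k c n \<noteq> 0" by (auto simp: adj_def)
      have "x c = x n" by (rule blk[OF k(1) rc(2) n(1,3)])
      moreover have "x n = l" using hY[OF n(2)] xK by blast
      ultimately have "c \<in> K" using rc(2) by (simp add: K_def)
      moreover have "fst c = tgt k" using f n(3) unfolding supp_rep_def by blast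
      ultimately show ?thesis using hY[OF n(2)] by simp
    next
      assume "mm E (adj (f k)) (h k) r c \<noteq> 0"
      from mm_nonzero[OF this] obtain n where n: "n \<in> E" "f k n r \<noteq> 0" "h k n c \<noteq> 0" by (auto simp: adj_def)
      have "x n = x r" by (rule blk[OF k(1) n(1) rc(1) n(2)])
      then have "r \<in> W" using hY[OF n(3)] xW[of n] rc(1) by (auto simp: W_def K_def)
      moreover have "fst r = src k" using f n(2) unfolding supp_rep_def by blast
      ultimately show ?thesis using hY[OF n(3)] by simp
    qed
  qed
  \<comment> \<open>Division by gaps of \<open>a\<close>: \<open>N\<close> lives at positions with
    \<open>c \<preceq> r\<close>, where \<open>a c \<le> a r\<close>, and equality would by
    \<open>tie\<close> contradict \<open>x r < x c\<close>.\<close>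
  define z where "z r c = (if r \<in> W \<and> c \<in> K then N r c / of_real (a r - a c) else 0)" for r c
  have zWK: "r \<in> W \<and> c \<in> K \<and> a c < a r \<and> fst r = fst c" if zn: "z r c \<noteq> 0" for r c
  proof -
    have rc: "r \<in> W" "c \<in> K" "N r c \<noteq> 0" using zn by (auto simp: z_def split: if_splits)
    have rE: "r \<in> E" "c \<in> E" using rc KE by auto
    have fs: "fst r = fst c" using NWK[OF rE rc(3)] by blast
    have "\<not> r \<preceq> c" using N0[OF rc(1,2)] rc(3) by blast
    then have cr: "c \<preceq> r" using fle_total[OF fs] by blast
    have "a c \<noteq> a r" using tie[OF rE(2,1) cr] xK[OF rc(2)] xW[OF rc(1)] by auto
    then show ?thesis using mono[OF rE(2,1) cr] rc fs by simp
  qed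
  have Nz: "N r c = z r c * of_real (a r - a c)" if rE: "r \<in> E" "c \<in> E" for r c
  proof (cases "N r c = 0")
    case False
    then have rc: "r \<in> W" "c \<in> K" "fst r = fst c" using NWK[OF rE] by auto
    have "\<not> r \<preceq> c" using N0[OF rc(1,2)] False by blast
    then have cr: "c \<preceq> r" using fle_total[OF rc(3)] by blast
    have "a c \<noteq> a r" using tie[OF rE(2,1) cr] xK[OF rc(2)] xW[OF rc(1)] by auto
    then have "complex_of_real (a r - a c) \<noteq> 0" unfolding of_real_eq_0_iff by simp
    then show ?thesis using rc by (simp add: z_def del: of_real_diff)
  qed (simp add: z_def)
  define \<kappa> where "\<kappa> r c = z r c - cnj (z c r)" for r c
  have \<kappa>skew: "adj \<kappa> r c = - \<kappa> r c" for r c by (simp add: adj_def \<kappa>_def)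
  define q where "q k = act E \<kappa> (f k)" for k
  have \<kappa>E: "r \<in> E \<and> c \<in> E \<and> fst r = fst c" if "\<kappa> r c \<noteq> 0" for r c
  proof -
    have "z r c \<noteq> 0 \<or> z c r \<noteq> 0" using that by (auto simp: \<kappa>_def)
    then show ?thesis using zWK[of r c] zWK[of c r] KE by auto
  qed
  have q: "supp_rep E q" unfolding supp_rep_def
  proof (intro allI impI)
    fix k r c assume "q k r c \<noteq> 0"
    then have "mm E \<kappa> (f k) r c \<noteq> 0 \<or> mm E (f k) \<kappa> r c \<noteq> 0" by (auto simp: q_def act_def)
    then show "k \<in> arrows \<and> r \<in> E \<and> c \<in> E \<and> fst r = tgt k \<and> fst c = src k"
    proof
      assume "mm E \<kappa> (f k) r c \<noteq> 0"
      from mm_nonzero[OF this] obtain n where n: "\<kappa> r n \<noteq> 0" "f k n c \<noteq> 0" by blast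
      then show ?thesis using \<kappa>E[OF n(1)] f unfolding supp_rep_def by metis
    next
      assume "mm E (f k) \<kappa> r c \<noteq> 0"
      from mm_nonzero[OF this] obtain n where n: "f k r n \<noteq> 0" "\<kappa> n c \<noteq> 0" by blast
      then show ?thesis using \<kappa>E[OF n(2)] f unfolding supp_rep_def by metis
    qed
  qed
  define p where "p k r c = h k r c + q k r c" for k r c
  have p: "supp_rep E p" using supp_rep_lin[OF h q, of 1] unfolding p_def[abs_def] by simp
  \<comment> \<open>\<open>\<eta>\<close> is the commutator contribution of the rotation. As
    \<open>N\<close> is \<open>z\<close> times a gap of \<open>a\<close> and \<mu> is diagonal with
    entries a + x, the sum of \<open>N\<close> and \<open>\<eta>\<close> retains only a gap of
    \<open>x\<close>; it is \<open>\<rho>\<close>.\<close>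
  define \<rho> where "\<rho> r c = of_real (x c - x r) * z r c" for r c
  define \<zeta> where "\<zeta> r c = of_real (x r - x c) * z r c" for r c
  define \<eta> where "\<eta> r c = of_real ((a c + x c) - (a r + x r)) * z r c" for r c
  have d1: "dmu E f h r c = hm N r c" for r c
    unfolding dmu_def hm_def N_def
    by (simp add: sum_subtractf sum.distrib mm_def adj_def algebra_simps)
  have d2: "dmu E f q r c = hm \<eta> r c" if rc: "r \<in> E" "c \<in> E" for r c
  proof -
    have "mm E \<kappa> (mu E f) r c = (\<Sum>m\<in>E. if m = c then \<kappa> r c * of_real (a c + x c) else 0)"
      unfolding mm_def using mux rc by (intro sum.cong) auto
    moreover have "mm E (mu E f) \<kappa> r c = (\<Sum>m\<in>E. if m = r then of_real (a r + x r) * \<kappa> r c else 0)"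
      unfolding mm_def using mux rc by (intro sum.cong) auto
    ultimately show ?thesis unfolding q_def[abs_def] dmu_act[OF \<kappa>skew] using rc E
      by (simp add: hm_def \<eta>_def \<kappa>_def algebra_simps)
  qed
  have d3: "dmu E f p r c = hm \<rho> r c" if rc: "r \<in> E" "c \<in> E" for r c
    unfolding p_def[abs_def] dmu_add d1 d2[OF rc] unfolding hm_def Nz[OF rc] Nz[OF rc(2,1)]
    by (simp add: \<rho>_def \<eta>_def algebra_simps)
  have Z: "adj (hm \<zeta>) = hm \<zeta>" by (simp add: adj_def hm_def fun_eq_iff add.commute)
  have hz: "hm \<zeta> r c = of_real (x r - x c) * \<kappa> r c" for r c by (simp add: hm_def \<zeta>_def \<kappa>_def algebra_simps)
  \<comment> \<open>\<open>f\<close> has entries only between equal eigenvalues of \<open>X\<close>,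
    so the action of \<open>X\<close> on the rotation can be moved onto the generator.\<close>
  have act2: "act E (XX E a f) (q k) r c = act E (hm \<zeta>) (f k) r c" if k: "k \<in> arrows" and rc: "r \<in> E" "c \<in> E" for k r c
  proof -
    have "of_real (x r - x c) * mm E \<kappa> (f k) r c = mm E (hm \<zeta>) (f k) r c"
      unfolding mm_def sum_distrib_left hz
    proof (intro sum.cong refl)
      fix n assume n: "n \<in> E"
      show "of_real (x r - x c) * (\<kappa> r n * f k n c) = of_real (x r - x n) * \<kappa> r n * f k n c"
        using blk[OF k n rc(2)] by (cases "f k n c = 0") auto
    qed
    moreover have "of_real (x r - x c) * mm E (f k) \<kappa> r c = mm E (f k) (hm \<zeta>) r c"
      unfolding mm_def sum_distrib_left hz
    proof (intro sum.cong refl)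
      fix n assume n: "n \<in> E"
      show "of_real (x r - x c) * (f k r n * \<kappa> n c) = f k r n * (of_real (x n - x c) * \<kappa> n c)"
        using blk[OF k rc(1) n] by (cases "f k r n = 0") auto
    qed
    ultimately show ?thesis unfolding actX[OF rc] unfolding q_def act_def by (simp add: right_diff_distrib)
  qed
  have zs: "r \<in> W \<and> c \<in> K" if "of_real t * z r c \<noteq> 0" for r c t using that zWK[of r c] by auto
  have s\<rho>: "r \<in> W \<and> c \<in> K" if "\<rho> r c \<noteq> 0" for r c using that zs unfolding \<rho>_def by blast
  have s\<zeta>: "r \<in> W \<and> c \<in> K" if "\<zeta> r c \<noteq> 0" for r c using that zs unfolding \<zeta>_def by blast
  have s\<eta>: "r \<in> W \<and> c \<in> K" if "\<eta> r c \<noteq> 0" for r c using that zs unfolding \<eta>_def by blast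
  have H1: "mip E (dmu E f p) (dmu E f p) = 2 * mip E \<rho> \<rho>"
  proof -
    have "mip E (dmu E f p) (dmu E f p) = mip E (hm \<rho>) (hm \<rho>)" by (rule mip_cong) (use d3 in auto)
    also have "\<dots> = 2 * mip E \<rho> \<rho>" by (rule mip_hm[OF _ _ KE(4)]) (use s\<rho> in auto)
    finally show ?thesis .
  qed
  have H2: "mip E (XX E a f) (mu E h) = (\<Sum>k\<in>arrows. \<Sum>r\<in>E. \<Sum>c\<in>E. (x r - x c) * (cmod (h k r c))\<^sup>2)"
    unfolding mu_pairing[OF adj_XX] unfolding mip_def
  proof (intro sum.cong refl)
    fix k r c assume rc: "r \<in> E" "c \<in> E"
    have "act E (XX E a f) (h k) r c * cnj (h k r c) = of_real ((x r - x c) * (cmod (h k r c))\<^sup>2)"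
      unfolding actX[OF rc] of_real_mult complex_norm_square by (simp only: mult.assoc)
    then show "Re (act E (XX E a f) (h k) r c * cnj (h k r c)) = (x r - x c) * (cmod (h k r c))\<^sup>2" by (simp only: Re_complex_of_real)
  qed
  have H3: "mip E (XX E a f) (dmu E h q) = 2 * mip E \<zeta> N"
  proof -
    have "mip E (XX E a f) (dmu E h q) = 2 * (\<Sum>k\<in>arrows. mip E (act E (XX E a f) (q k)) (h k))"
      unfolding dmu_commute[of E h q] by (rule dmu_pairing[OF adj_XX])
    also have "\<dots> = 2 * (\<Sum>k\<in>arrows. mip E (act E (hm \<zeta>) (f k)) (h k))"
      using act2 by (intro arg_cong[of _ _ "\<lambda>t. 2 * t"] sum.cong refl mip_cong) auto
    also have "\<dots> = mip E (hm \<zeta>) (dmu E f h)" by (rule dmu_pairing[OF Z, symmetric])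
    also have "\<dots> = mip E (hm \<zeta>) (hm N)" by (rule mip_cong) (use d1 in auto)
    also have "\<dots> = 2 * mip E \<zeta> N" by (rule mip_hm[OF _ _ KE(4)]) (use s\<zeta> NWK in auto)
    finally show ?thesis .
  qed
  have H4: "mip E (XX E a f) (mu E q) = mip E \<zeta> \<eta>"
  proof -
    have "2 * mip E (XX E a f) (mu E q) = 2 * (\<Sum>k\<in>arrows. mip E (act E (XX E a f) (q k)) (q k))"
      unfolding mu_pairing[OF adj_XX] ..
    also have "\<dots> = 2 * (\<Sum>k\<in>arrows. mip E (act E (hm \<zeta>) (f k)) (q k))"
      using act2 by (intro arg_cong[of _ _ "\<lambda>t. 2 * t"] sum.cong refl mip_cong) auto
    also have "\<dots> = mip E (hm \<zeta>) (dmu E f q)" by (rule dmu_pairing[OF Z, symmetric])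
    also have "\<dots> = mip E (hm \<zeta>) (hm \<eta>)" by (rule mip_cong) (use d2 in auto)
    also have "\<dots> = 2 * mip E \<zeta> \<eta>" by (rule mip_hm[OF _ _ KE(4)]) (use s\<zeta> s\<eta> in auto)
    finally show ?thesis by simp
  qed
  have H5: "mip E (XX E a f) (mu E p) = mip E (XX E a f) (mu E h) + mip E (XX E a f) (dmu E h q) + mip E (XX E a f) (mu E q)"
  proof -
    have "mu E p = (\<lambda>r c. mu E h r c + dmu E h q r c + mu E q r c)" unfolding p_def[abs_def] by (intro ext mu_add)
    then show ?thesis by (simp only: mip_add_right)
  qed
  \<comment> \<open>The squared gaps of \<open>x\<close> cancel, and one copy of the mixed product
    survives.\<close>
  have H6: "mip E \<rho> \<rho> + 2 * mip E \<zeta> N + mip E \<zeta> \<eta> = (\<Sum>r\<in>E. \<Sum>c\<in>E. (x r - x c) * (a r - a c) * (cmod (z r c))\<^sup>2)"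
  proof -
    have sc: "Re (of_real s * w * cnj (of_real t * w)) = s * t * (cmod w)\<^sup>2" for s t w
      unfolding cmod_power2 by (simp add: power2_eq_square algebra_simps)
    have m1: "mip E \<rho> \<rho> = (\<Sum>r\<in>E. \<Sum>c\<in>E. (x c - x r) * (x c - x r) * (cmod (z r c))\<^sup>2)"
      unfolding mip_def \<rho>_def sc ..
    have m2: "mip E \<zeta> N = (\<Sum>r\<in>E. \<Sum>c\<in>E. (x r - x c) * (a r - a c) * (cmod (z r c))\<^sup>2)"
      unfolding mip_def \<zeta>_def
    proof (intro sum.cong refl)
      fix r c assume rc: "r \<in> E" "c \<in> E"
      show "Re (of_real (x r - x c) * z r c * cnj (N r c)) = (x r - x c) * (a r - a c) * (cmod (z r c))\<^sup>2"
        unfolding Nz[OF rc] mult.commute[of "z r c" "of_real (a r - a c)"] by (rule sc)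
    qed
    have m3: "mip E \<zeta> \<eta> = (\<Sum>r\<in>E. \<Sum>c\<in>E. (x r - x c) * ((a c + x c) - (a r + x r)) * (cmod (z r c))\<^sup>2)"
      unfolding mip_def \<zeta>_def \<eta>_def sc ..
    show ?thesis unfolding m1 m2 m3 sum_distrib_left sum.distrib[symmetric]
      by (intro sum.cong refl) (simp add: algebra_simps)
  qed
  have "mip E (dmu E f p) (dmu E f p) + 2 * mip E (XX E a f) (mu E p) + 0 * nn E p \<ge> 0"
    by (rule minimiser_conditions(1)[OF E m p])
  then have ge: "mip E (XX E a f) (mu E h) + (mip E \<rho> \<rho> + 2 * mip E \<zeta> N + mip E \<zeta> \<eta>) \<ge> 0"
    unfolding H1 H5 H3 H4 by simp
  have le1: "mip E \<rho> \<rho> + 2 * mip E \<zeta> N + mip E \<zeta> \<eta> \<le> 0" unfolding H6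
  proof (intro sum_nonpos)
    fix r c
    show "(x r - x c) * (a r - a c) * (cmod (z r c))\<^sup>2 \<le> 0"
    proof (cases "z r c = 0")
      case False
      then have "r \<in> W" "c \<in> K" "a c < a r" using zWK by auto
      then have "x r - x c \<le> 0" "a r - a c \<ge> 0" using xW[of r] xK[of c] by auto
      then show ?thesis by (intro mult_nonpos_nonneg) auto
    qed simp
  qed
  have "mip E (XX E a f) (mu E h) < 0"
  proof -
    have nonpos: "(x r - x c) * (cmod (h k r c))\<^sup>2 \<le> 0" for k r c
    proof (cases "h k r c = 0")
      case False
      then have "x r < x c" using hY[OF False] xW[of r] xK[of c] by auto
      then show ?thesis by (intro mult_nonpos_nonneg) auto
    qed simp
    obtain y where y: "y \<in> Y" "h0 y \<noteq> 0" using h0(1) by blast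
    obtain k r c where krc: "y = (k,r,c)" by (cases y)
    have hn: "h k r c \<noteq> 0" using y krc by (simp add: h_def)
    have hk: "k \<in> arrows" "r \<in> W" "c \<in> K" using hY[OF hn] by auto
    have rE: "r \<in> E" "c \<in> E" using hk KE by auto
    have "x r < x c" using xW[OF hk(2)] xK[OF hk(3)] by simp
    then have neg: "(x r - x c) * (cmod (h k r c))\<^sup>2 < 0" using hn by (simp add: mult_neg_pos)
    have "(\<Sum>k\<in>arrows. \<Sum>r\<in>E. \<Sum>c\<in>E. - ((x r - x c) * (cmod (h k r c))\<^sup>2)) \<ge> - ((x r - x c) * (cmod (h k r c))\<^sup>2)"
    proof -
      have "- ((x r - x c) * (cmod (h k r c))\<^sup>2) \<le> (\<Sum>c\<in>E. - ((x r - x c) * (cmod (h k r c))\<^sup>2))"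
        using E rE nonpos by (intro member_le_sum[of c E "\<lambda>c. - ((x r - x c) * (cmod (h k r c))\<^sup>2)"]) auto
      also have "\<dots> \<le> (\<Sum>r\<in>E. \<Sum>c\<in>E. - ((x r - x c) * (cmod (h k r c))\<^sup>2))"
        using E rE nonpos by (intro member_le_sum[of r E "\<lambda>r. \<Sum>c\<in>E. - ((x r - x c) * (cmod (h k r c))\<^sup>2)"] sum_nonneg) auto
      also have "\<dots> \<le> (\<Sum>k\<in>arrows. \<Sum>r\<in>E. \<Sum>c\<in>E. - ((x r - x c) * (cmod (h k r c))\<^sup>2))"
        using hk nonpos by (intro member_le_sum[of k arrows "\<lambda>k. \<Sum>r\<in>E. \<Sum>c\<in>E. - ((x r - x c) * (cmod (h k r c))\<^sup>2)"] sum_nonneg) auto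
      finally show ?thesis .
    qed
    then show ?thesis unfolding H2 using neg by (simp add: sum_negf)
  qed
  then show False using ge le1 by linarith
qed

text \<open>Commuting with \<open>f0\<close> and its adjoint, \<open>X\<close> commutes with \<mu>
  and hence with diag a. It is therefore diagonalised inside classes of equal vertex and equal
  \<open>a\<close>, which fixes diag a and sorts the eigenvalues within ties of
  \<open>a\<close>.\<close>

theorem sufficiency:
  assumes E: "finite E" and mono: "\<And>r c. r \<in> E \<Longrightarrow> c \<in> E \<Longrightarrow> r \<preceq> c \<Longrightarrow> a r \<le> a c"
    and sum0: "(\<Sum>r\<in>E. a r) = 0" and ineq: "\<And>K. Sh E K \<Longrightarrow> (\<Sum>c\<in>K. a c) \<ge> 0"
  shows "\<exists>f. supp_rep E f \<and> (\<forall>r\<in>E. \<forall>c\<in>E. mu E f r c = dg a r c)"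
proof -
  obtain f0 where m0: "minimiser E a 0 f0" using minimiser_exists[OF E] by blast
  have f0: "supp_rep E f0" using m0 by (simp add: minimiser_def)
  define X where "X = XX E a f0"
  have aX: "adj X = X" unfolding X_def by (rule adj_XX)
  have Xf: "mm E X (f0 k) r c = mm E (f0 k) X r c" if "k \<in> arrows" "r \<in> E" "c \<in> E" for k r c
    using minimiser_conditions(2)[OF E m0 that] unfolding X_def act_def by simp
  have Xf': "mm E X (adj (f0 k)) r c = mm E (adj (f0 k)) X r c" if h: "k \<in> arrows" "r \<in> E" "c \<in> E" for k r c
  proof -
    have "mm E X (adj (f0 k)) = adj (mm E (f0 k) X)" "mm E (adj (f0 k)) X = adj (mm E X (f0 k))" by (simp_all add: adj_mm aX)
    then show ?thesis using Xf[OF h(1) h(3,2)] by (simp add: adj_def)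
  qed
  have swap: "mm E X (mm E A B) r c = mm E (mm E A B) X r c"
    if A: "\<And>r c. r \<in> E \<Longrightarrow> c \<in> E \<Longrightarrow> mm E X A r c = mm E A X r c" and B: "\<And>r c. r \<in> E \<Longrightarrow> c \<in> E \<Longrightarrow> mm E X B r c = mm E B X r c"
      and rc: "r \<in> E" "c \<in> E" for A B r c
  proof -
    have "mm E X (mm E A B) r c = mm E (mm E X A) B r c" by (simp add: mm_assoc)
    also have "\<dots> = mm E (mm E A X) B r c" by (rule mm_cong) (use A rc in auto)
    also have "\<dots> = mm E A (mm E X B) r c" by (simp add: mm_assoc)
    also have "\<dots> = mm E A (mm E B X) r c" by (rule mm_cong) (use B rc in auto)
    finally show ?thesis by (simp add: mm_assoc)
  qed
  have Xmu: "mm E X (mu E f0) r c = mm E (mu E f0) X r c" if rc: "r \<in> E" "c \<in> E" for r c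
  proof -
    have muf: "mu E f0 = (\<lambda>r c. (\<Sum>k\<in>arrows. mm E (f0 k) (adj (f0 k)) r c - mm E (adj (f0 k)) (f0 k) r c))"
      by (intro ext) (simp add: mu_eq sum_subtractf)
    have "mm E X (mu E f0) r c = (\<Sum>k\<in>arrows. mm E X (mm E (f0 k) (adj (f0 k))) r c - mm E X (mm E (adj (f0 k)) (f0 k)) r c)"
    proof -
      have "mm E X (mu E f0) r c = (\<Sum>m\<in>E. \<Sum>k\<in>arrows. X r m * (mm E (f0 k) (adj (f0 k)) m c - mm E (adj (f0 k)) (f0 k) m c))"
        unfolding muf mm_def[of E X] sum_distrib_left ..
      also have "\<dots> = (\<Sum>k\<in>arrows. \<Sum>m\<in>E. X r m * (mm E (f0 k) (adj (f0 k)) m c - mm E (adj (f0 k)) (f0 k) m c))" by (rule sum.swap)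
      finally show ?thesis unfolding mm_def[of E X] right_diff_distrib sum_subtractf .
    qed
    also have "\<dots> = (\<Sum>k\<in>arrows. mm E (mm E (f0 k) (adj (f0 k))) X r c - mm E (mm E (adj (f0 k)) (f0 k)) X r c)"
      using swap[OF Xf Xf' rc] swap[OF Xf' Xf rc] by (intro sum.cong refl) simp
    also have "\<dots> = mm E (mu E f0) X r c"
    proof -
      have "mm E (mu E f0) X r c = (\<Sum>m\<in>E. \<Sum>k\<in>arrows. (mm E (f0 k) (adj (f0 k)) r m - mm E (adj (f0 k)) (f0 k) r m) * X m c)"
        unfolding muf mm_def[of E _ X] sum_distrib_right ..
      also have "\<dots> = (\<Sum>k\<in>arrows. \<Sum>m\<in>E. (mm E (f0 k) (adj (f0 k)) r m - mm E (adj (f0 k)) (f0 k) r m) * X m c)" by (rule sum.swap)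
      finally show ?thesis unfolding mm_def[of E _ X] left_diff_distrib sum_subtractf by simp
    qed
    finally show ?thesis .
  qed
  have Xa: "a r = a c" if rc: "r \<in> E" "c \<in> E" and n: "X r c \<noteq> 0" for r c
  proof -
    have "mu E f0 = (\<lambda>r c. X r c + dg a r c)" by (intro ext) (simp add: X_def XX_def)
    then have "mm E X (dg a) r c = mm E (dg a) X r c" using Xmu[OF rc] by (simp add: mm_lin_left mm_lin_right)
    moreover have "mm E X (dg a) r c = (\<Sum>m\<in>E. if m = c then X r c * of_real (a c) else 0)"
      unfolding mm_def dg_def by (intro sum.cong) auto
    moreover have "mm E (dg a) X r c = (\<Sum>m\<in>E. if m = r then of_real (a r) * X r c else 0)"
      unfolding mm_def dg_def by (intro sum.cong) auto
    ultimately show ?thesis using rc E n by simp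
  qed
  obtain u x where u: "uni E u" "\<forall>r c. u r c \<noteq> 0 \<longrightarrow> r \<in> E \<and> c \<in> E \<and> (fst r, a r) = (fst c, a c)"
     "\<forall>r\<in>E. \<forall>c\<in>E. cu E u X r c = (if r = c then of_real (x r) else 0)"
     "\<forall>r\<in>E. \<forall>c\<in>E. (fst r, a r) = (fst c, a c) \<longrightarrow> r \<preceq> c \<longrightarrow> x r \<le> x c"
  proof -
    have "\<exists>u x. uni E u \<and> (\<forall>r c. u r c \<noteq> 0 \<longrightarrow> r \<in> E \<and> c \<in> E \<and> (\<lambda>r. (fst r, a r)) r = (\<lambda>r. (fst r, a r)) c) \<and>
     (\<forall>r\<in>E. \<forall>c\<in>E. cu E u X r c = (if r = c then of_real (x r) else 0)) \<and>
     (\<forall>r\<in>E. \<forall>c\<in>E. (\<lambda>r. (fst r, a r)) r = (\<lambda>r. (fst r, a r)) c \<longrightarrow> r \<preceq> c \<longrightarrow> x r \<le> x c)"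
    proof (rule diagonalising_unitary[OF E aX])
      fix r c assume rc: "r \<in> E" "c \<in> E" "X r c \<noteq> 0"
      then show "(\<lambda>r. (fst r, a r)) r = (\<lambda>r. (fst r, a r)) c"
        using Xa XX_graded[OF supp_rep_rep[OF f0], of E a r c] unfolding X_def by simp
    next
      fix r c :: "'v \<times> nat" assume "(fst r, a r) = (fst c, a c)"
      then show "fst r = fst c" by simp
    qed
    then show ?thesis using that by blast
  qed
  define f where "f k = cu E u (f0 k)" for k
  have f: "supp_rep E f" using supp_rep_cu[OF f0, of u] u(2) unfolding f_def[abs_def] by simp
  have Xf1: "XX E a f r c = cu E u X r c" if rc: "r \<in> E" "c \<in> E" for r c
  proof -
    have "cu E u X r c = cu E u (mu E f0) r c - cu E u (dg a) r c" unfolding X_def XX_def[abs_def] by (rule cu_diff[OF E u(1)])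
    also have "cu E u (dg a) r c = dg a r c" by (rule cu_dg[OF E u(1) _ rc]) (use u(2) in simp)
    also have "cu E u (mu E f0) r c = mu E f r c" unfolding f_def[abs_def] by (rule cu_mu[OF E u(1), symmetric])
    finally show ?thesis by (simp add: XX_def)
  qed
  have "JJ E a f = JJ E a f0"
  proof -
    have "JJ E a f = mip E (cu E u X) (cu E u X)" unfolding JJ_def by (rule mip_cong) (use Xf1 in auto)
    then show ?thesis unfolding mip_cu[OF E u(1)] JJ_def X_def .
  qed
  then have m: "minimiser E a 0 f" using m0 f unfolding minimiser_def by simp
  have "\<forall>r\<in>E. x r = 0"
  proof (rule minimiser_diagonal_imp_zero[OF E mono sum0 ineq m])
    fix r c assume rc: "r \<in> E" "c \<in> E"
    then show "XX E a f r c = (if r = c then of_real (x r) else 0)" using Xf1 u(3) by simp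
    assume "r \<preceq> c" "a r = a c"
    then show "x r \<le> x c" using u(4) rc fle_fst[of r c] by simp
  qed
  then have "XX E a f r c = 0" if "r \<in> E" "c \<in> E" for r c
    using Xf1[OF that] u(3) that by (cases "r = c") simp_all
  then have "\<forall>r\<in>E. \<forall>c\<in>E. mu E f r c = dg a r c" by (simp add: XX_def)
  then show ?thesis using f by blast
qed

end

section \<open>The recursive sets of index tuples\<close>

text \<open>\<open>\<nu> i\<close> lists the indices of \<open>E\<close> at vertex \<open>i\<close>
  increasingly and translates positions in a box into actual indices.\<close>

definition enum :: "('v \<times> nat) set \<Rightarrow> ('v \<Rightarrow> nat) \<Rightarrow> ('v \<Rightarrow> nat \<Rightarrow> nat) \<Rightarrow> bool" where
  "enum E e \<nu> \<longleftrightarrow> (\<forall>i. strict_mono_on {1..e i} (\<nu> i) \<and> \<nu> i ` {1..e i} = {k. (i,k) \<in> E})"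

definition pts :: "('v \<Rightarrow> nat \<Rightarrow> nat) \<Rightarrow> ('v \<Rightarrow> nat set) \<Rightarrow> ('v \<times> nat) set" where
  "pts \<nu> L = Sigma UNIV (\<lambda>i. \<nu> i ` L i)"

lemma mem_pts: "(i,k) \<in> pts \<nu> L \<longleftrightarrow> k \<in> \<nu> i ` L i" by (simp add: pts_def)

lemma card_Pair_image: "card (Pair i ` A) = card A" by (simp add: card_image inj_on_def)

context
  fixes E :: "('v \<times> nat) set" and e \<nu>
  assumes en: "enum E e \<nu>"
begin

lemma enum_image: "\<nu> i ` {1..e i} = {k. (i,k) \<in> E}" using en by (simp add: enum_def)

lemma enum_le_iff:
  assumes "j \<in> {1..e i}" "l \<in> {1..e i}"
  shows "\<nu> i j \<le> \<nu> i l \<longleftrightarrow> j \<le> l"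
proof -
  have s: "strict_mono_on {1..e i} (\<nu> i)" using en by (simp add: enum_def)
  show ?thesis using strict_mono_onD[OF s assms] strict_mono_onD[OF s assms(2,1)]
    by (cases j l rule: linorder_cases) (auto simp: not_le)
qed

lemma enum_inj: "inj_on (\<nu> i) {1..e i}"
  by (intro inj_onI) (metis enum_le_iff order_antisym order_refl)

lemma pts_box: "pts \<nu> (Defs.box e) = E"
proof (rule Set.set_eqI)
  fix p :: "'v \<times> nat"
  obtain i k where p: "p = (i,k)" by (cases p)
  show "p \<in> pts \<nu> (Defs.box e) \<longleftrightarrow> p \<in> E" using enum_image[of i] by (simp add: p mem_pts Defs.box_def)
qed

lemma pts_subset:
  assumes "sub_box L e"
  shows "pts \<nu> L \<subseteq> E"
proof
  fix p assume h: "p \<in> pts \<nu> L"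
  obtain i k where p: "p = (i,k)" by (cases p)
  have "k \<in> \<nu> i ` L i" using h by (simp add: p mem_pts)
  then have "k \<in> \<nu> i ` {1..e i}" using assms unfolding sub_box_def by blast
  then show "p \<in> E" using enum_image[of i] by (simp add: p)
qed

lemma card_fibre:
  assumes "sub_box L e"
  shows "card {r \<in> pts \<nu> L. fst r = i} = card (L i)"
proof -
  have "{r \<in> pts \<nu> L. fst r = i} = Pair i ` (\<nu> i ` L i)" by (auto simp: pts_def)
  moreover have "inj_on (\<nu> i) (L i)" by (rule inj_on_subset[OF enum_inj]) (use assms in \<open>simp add: sub_box_def\<close>)
  ultimately show ?thesis by (simp only: card_Pair_image card_image card_atLeastAtMost diff_Suc_1)
qed

lemma card_fibre_full: "card {r \<in> E. fst r = i} = e i"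
proof -
  have "sub_box (Defs.box e) e" by (simp add: sub_box_def Defs.box_def)
  from card_fibre[OF this, of i] show ?thesis unfolding pts_box by (simp add: Defs.box_def)
qed

lemma card_initial:
  assumes "l \<in> {1..e i}"
  shows "card {r \<in> E. r \<preceq> (i, \<nu> i l)} = l"
proof -
  have "{r \<in> E. r \<preceq> (i, \<nu> i l)} = Pair i ` (\<nu> i ` {1..l})"
  proof (intro equalityI subsetI)
    fix r assume r: "r \<in> {r \<in> E. r \<preceq> (i, \<nu> i l)}"
    then have f: "fst r = i" "snd r \<le> \<nu> i l" "(i, snd r) \<in> E" by (auto simp: fle_def)
    then have "snd r \<in> \<nu> i ` {1..e i}" unfolding enum_image by simp
    then obtain j where j: "j \<in> {1..e i}" "snd r = \<nu> i j" by blast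
    then have "j \<le> l" using enum_le_iff[OF j(1) assms] f(2) by simp
    then have "snd r \<in> \<nu> i ` {1..l}" using j by auto
    then show "r \<in> Pair i ` (\<nu> i ` {1..l})" using f(1) by (metis image_eqI prod.collapse)
  next
    fix r assume "r \<in> Pair i ` (\<nu> i ` {1..l})"
    then obtain j where j: "j \<in> {1..l}" "r = (i, \<nu> i j)" by blast
    then have je: "j \<in> {1..e i}" using assms by simp
    then have "\<nu> i j \<in> {k. (i,k) \<in> E}" unfolding enum_image[symmetric] by blast
    then show "r \<in> {r \<in> E. r \<preceq> (i, \<nu> i l)}" using j enum_le_iff[OF je assms] by (simp add: fle_def)
  qed
  moreover have "inj_on (\<nu> i) {1..l}" by (rule inj_on_subset[OF enum_inj]) (use assms in auto)
  ultimately show ?thesis by (simp only: card_Pair_image card_image card_atLeastAtMost diff_Suc_1)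
qed

end

lemma sorted_list_of_set_nth_enum:
  fixes A :: "nat set"
  assumes "finite A"
  shows "strict_mono_on {1..card A} (\<lambda>j. sorted_list_of_set A ! (j - 1))"
    and "(\<lambda>j. sorted_list_of_set A ! (j - 1)) ` {1..card A} = A"
proof -
  have len: "length (sorted_list_of_set A) = card A" by simp
  show "strict_mono_on {1..card A} (\<lambda>j. sorted_list_of_set A ! (j - 1))"
  proof (rule strict_mono_onI)
    fix r s :: nat assume "r \<in> {1..card A}" "s \<in> {1..card A}" "r < s"
    then have "r - 1 < s - 1" "s - 1 < length (sorted_list_of_set A)" using len by auto
    then show "sorted_list_of_set A ! (r - 1) < sorted_list_of_set A ! (s - 1)"
      by (rule sorted_wrt_nth_less[OF strict_sorted_list_of_set])
  qed
  have "(\<lambda>j. sorted_list_of_set A ! (j - 1)) ` {1..card A} = (\<lambda>j. sorted_list_of_set A ! j) ` {..<card A}"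
  proof -
    have "{1..card A} = Suc ` {..<card A}" by (simp add: image_Suc_lessThan)
    then show ?thesis by (simp add: image_image)
  qed
  also have "\<dots> = set (sorted_list_of_set A)" unfolding set_conv_nth len by auto
  finally show "(\<lambda>j. sorted_list_of_set A ! (j - 1)) ` {1..card A} = A" using assms by simp
qed

lemma enum_sub:
  assumes en: "enum E e \<nu>" and L: "sub_box L e"
  shows "enum (pts \<nu> L) (weight L) (\<lambda>i j. \<nu> i (sorted_list_of_set (L i) ! (j - 1)))"
  unfolding enum_def
proof (intro allI conjI)
  fix i
  have Le: "L i \<subseteq> {1..e i}" using L by (simp add: sub_box_def)
  then have fin: "finite (L i)" by (rule finite_subset) simp
  define s where "s j = sorted_list_of_set (L i) ! (j - 1)" for j
  have s: "strict_mono_on {1..card (L i)} s" "s ` {1..card (L i)} = L i"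
    using sorted_list_of_set_nth_enum[OF fin] unfolding s_def by auto
  show "strict_mono_on {1..weight L i} (\<lambda>j. \<nu> i (sorted_list_of_set (L i) ! (j - 1)))"
    unfolding s_def[symmetric] weight_def
  proof (rule strict_mono_onI)
    fix p q :: nat assume pq: "p \<in> {1..card (L i)}" "q \<in> {1..card (L i)}" "p < q"
    have "s p < s q" by (rule strict_mono_onD[OF s(1) pq])
    moreover have "s p \<in> {1..e i}" "s q \<in> {1..e i}" using s(2) Le pq by blast+
    ultimately show "\<nu> i (s p) < \<nu> i (s q)" using en strict_mono_onD unfolding enum_def by blast
  qed
  have "(\<lambda>j. \<nu> i (s j)) ` {1..card (L i)} = \<nu> i ` (s ` {1..card (L i)})" by (simp only: image_image)
  also have "\<dots> = \<nu> i ` L i" unfolding s(2) ..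
  finally show "(\<lambda>j. \<nu> i (sorted_list_of_set (L i) ! (j - 1))) ` {1..weight L i} = {k. (i,k) \<in> pts \<nu> L}"
    by (simp add: s_def weight_def mem_pts)
qed

context
  fixes Q :: "'v::finite quiver" and E :: "('v \<times> nat) set" and e \<nu> L L' \<nu>' K P
  assumes E: "finite E" and en: "enum E e \<nu>" and L: "sub_box L e" and L': "sub_box L' (weight L)"
  defines "\<nu>' \<equiv> \<lambda>i j. \<nu> i (sorted_list_of_set (L i) ! (j - 1))"
    and "K \<equiv> pts \<nu> L" and "P \<equiv> pts \<nu>' L'"
begin

lemma sub_enum: "enum K (weight L) \<nu>'" unfolding K_def \<nu>'_def by (rule enum_sub[OF en L])

lemma finite_sub: "K \<subseteq> E" "finite K" "P \<subseteq> K" "finite P"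
proof -
  show KE: "K \<subseteq> E" unfolding K_def by (rule pts_subset[OF en L])
  then show fK: "finite K" using E by (rule finite_subset)
  show PK: "P \<subseteq> K" unfolding P_def by (rule pts_subset[OF sub_enum L'])
  then show "finite P" using fK by (rule finite_subset)
qed

lemma ar_eq_arrow_rhs: "int (quiver.ar Q P (E - K)) = arrow_rhs Q e L L'"
proof -
  have eq: "{(k,r,c). k \<in> {..<length Q} \<and> r \<in> E - K \<and> c \<in> P \<and> fst r = snd (Q ! k) \<and> fst c = fst (Q ! k)} =
      (SIGMA k:{..<length Q}. {r \<in> E - K. fst r = snd (Q ! k)} \<times> {c \<in> P. fst c = fst (Q ! k)})" by auto
  have fW: "card {r \<in> E - K. fst r = i} = e i - card (L i)" for i
  proof -
    have "{r \<in> E - K. fst r = i} = {r \<in> E. fst r = i} - {r \<in> K. fst r = i}" by auto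
    moreover have "card ({r \<in> E. fst r = i} - {r \<in> K. fst r = i}) = card {r \<in> E. fst r = i} - card {r \<in> K. fst r = i}"
      using finite_sub E by (intro card_Diff_subset) auto
    ultimately show ?thesis using card_fibre_full[OF en, of i] card_fibre[OF en L, of i] by (simp add: K_def)
  qed
  have fP: "card {c \<in> P. fst c = i} = card (L' i)" for i
    unfolding P_def by (rule card_fibre[OF sub_enum L'])
  have "quiver.ar Q P (E - K) = (\<Sum>k<length Q. (e (snd (Q ! k)) - card (L (snd (Q ! k)))) * card (L' (fst (Q ! k))))"
  proof -
    have "quiver.ar Q P (E - K) = (\<Sum>k<length Q. card ({r \<in> E - K. fst r = snd (Q ! k)} \<times> {c \<in> P. fst c = fst (Q ! k)}))"
      unfolding quiver.ar_def eq using finite_sub E by (intro card_SigmaI) auto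
    then show ?thesis by (simp only: card_cartesian_product fW fP)
  qed
  then show ?thesis unfolding arrow_rhs_def
    using sub_box_card_le[OF L] by (simp add: of_nat_diff mult.commute)
qed

text \<open>Up to the \<open>j\<close>-th element of \<open>K\<close> at a vertex, \<open>E\<close>
  has as many indices as the rank of that element, and \<open>j\<close> of them lie in
  \<open>K\<close>; the summand of the height counts the others.\<close>

lemma cnt_eq_ht: "int (cnt P (E - K)) = ht L L'"
proof -
  have sum_P: "(\<Sum>c\<in>P. g c) = (\<Sum>i\<in>UNIV. \<Sum>j\<in>L' i. g (i, \<nu>' i j))" for g :: "'v \<times> nat \<Rightarrow> int"
  proof -
    have fin: "finite (L' i)" for i by (rule finite_subset[of _ "{1..weight L i}"]) (use L' in \<open>auto simp: sub_box_def\<close>)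
    have inj: "inj_on (\<nu>' i) (L' i)" for i
      by (rule inj_on_subset[OF enum_inj[OF sub_enum]]) (use L' in \<open>simp add: sub_box_def\<close>)
    have "(\<Sum>c\<in>P. g c) = (\<Sum>i\<in>UNIV. \<Sum>k\<in>\<nu>' i ` L' i. g (i, k))"
      unfolding P_def pts_def using fin by (subst sum.Sigma) (auto simp: case_prod_beta)
    also have "\<dots> = (\<Sum>i\<in>UNIV. \<Sum>j\<in>L' i. g (i, \<nu>' i j))"
      by (rule sum.cong[OF refl]) (simp add: sum.reindex[OF inj])
    finally show ?thesis .
  qed
  have "cnt P (E - K) = card (SIGMA c:P. {r \<in> E - K. r \<preceq> c})"
  proof -
    have "{(r,c). r \<in> E - K \<and> c \<in> P \<and> r \<preceq> c} = prod.swap ` (SIGMA c:P. {r \<in> E - K. r \<preceq> c})" by (auto simp: image_iff)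
    then show ?thesis unfolding cnt_def by (simp only: card_image inj_swap)
  qed
  also have "\<dots> = (\<Sum>c\<in>P. card {r \<in> E - K. r \<preceq> c})" using finite_sub E by (intro card_SigmaI) auto
  finally have "int (cnt P (E - K)) = (\<Sum>c\<in>P. int (card {r \<in> E - K. r \<preceq> c}))" by simp
  also have "\<dots> = (\<Sum>i\<in>UNIV. \<Sum>j\<in>L' i. int (card {r \<in> E - K. r \<preceq> (i, \<nu>' i j)}))" by (rule sum_P)
  also have "\<dots> = ht L L'" unfolding ht_def
  proof (intro sum.cong refl)
    fix i j assume "j \<in> L' i"
    then have j: "j \<in> {1..weight L i}" using L' unfolding sub_box_def by blast
    define l where "l = sorted_list_of_set (L i) ! (j - 1)"
    have "finite (L i)" by (rule finite_subset[of _ "{1..e i}"]) (use L in \<open>auto simp: sub_box_def\<close>)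
    from sorted_list_of_set_nth_enum(2)[OF this] have "l \<in> L i" using j unfolding l_def weight_def by blast
    then have l: "l \<in> {1..e i}" using L unfolding sub_box_def by blast
    have cE: "card {r \<in> E. r \<preceq> (i, \<nu>' i j)} = l" using card_initial[OF en l] by (simp add: \<nu>'_def l_def)
    have cK: "card {r \<in> K. r \<preceq> (i, \<nu>' i j)} = j" by (rule card_initial[OF sub_enum j])
    have "{r \<in> E - K. r \<preceq> (i, \<nu>' i j)} = {r \<in> E. r \<preceq> (i, \<nu>' i j)} - {r \<in> K. r \<preceq> (i, \<nu>' i j)}" by auto
    moreover have "card ({r \<in> E. r \<preceq> (i, \<nu>' i j)} - {r \<in> K. r \<preceq> (i, \<nu>' i j)}) =
        card {r \<in> E. r \<preceq> (i, \<nu>' i j)} - card {r \<in> K. r \<preceq> (i, \<nu>' i j)}"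
      using finite_sub E by (intro card_Diff_subset) auto
    moreover have "j \<le> l"
    proof -
      have "card {r \<in> K. r \<preceq> (i, \<nu>' i j)} \<le> card {r \<in> E. r \<preceq> (i, \<nu>' i j)}"
        using finite_sub E by (intro card_mono) auto
      then show ?thesis by (simp add: cE cK)
    qed
    ultimately show "int (card {r \<in> E - K. r \<preceq> (i, \<nu>' i j)}) = int (sorted_list_of_set (L i) ! (j - 1)) - int j"
      unfolding l_def[symmetric] by (simp only: cE cK of_nat_diff)
  qed
  finally show ?thesis .
qed

end

lemma in_Shat_sub_box: "in_Shat Q e K \<Longrightarrow> sub_box K e"
  by (subst (asm) in_Shat.simps) (auto simp: sub_box_def Defs.box_def split: if_splits)

text \<open>Stated for arbitrary index sets, since the recursion replaces \<open>E\<close> by a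
  subset that need not be an initial segment at each vertex.\<close>

lemma in_Shat_iff_Sh:
  fixes Q :: "'v::finite quiver"
  assumes "finite E" "enum E e \<nu>" "sub_box L e"
  shows "in_Shat Q e L \<longleftrightarrow> quiver.Sh Q E (pts \<nu> L)"
  using assms
proof (induction "\<Sum>i\<in>UNIV. e i" arbitrary: E e \<nu> L rule: less_induct)
  case less
  note E = less.prems(1) and en = less.prems(2) and L = less.prems(3)
  show ?case
  proof (cases "L = Defs.box e")
    case True
    have "in_Shat Q e L" by (subst in_Shat.simps) (simp add: True)
    moreover have "quiver.Sh Q E (pts \<nu> L)" unfolding True pts_box[OF en] by (rule quiver.Sh_full[OF E])
    ultimately show ?thesis by simp
  next
    case False
    define K where "K = pts \<nu> L"
    define \<nu>' where "\<nu>' = (\<lambda>i j. \<nu> i (sorted_list_of_set (L i) ! (j - 1)))"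
    have KE: "K \<subseteq> E" unfolding K_def by (rule pts_subset[OF en L])
    have fK: "finite K" using KE E by (rule finite_subset)
    have en': "enum K (weight L) \<nu>'" unfolding K_def \<nu>'_def by (rule enum_sub[OF en L])
    have lt: "(\<Sum>i\<in>UNIV. weight L i) < (\<Sum>i\<in>UNIV. e i)" unfolding weight_def by (rule sub_box_neq_lt[OF L False])
    have "K \<noteq> E"
    proof
      assume "K = E"
      then have "card (L i) = e i" for i using card_fibre[OF en L, of i] card_fibre_full[OF en, of i] by (simp add: K_def)
      then show False using lt by (simp add: weight_def)
    qed
    then have "quiver.Sh Q E K \<longleftrightarrow> (\<forall>P. quiver.Sh Q K P \<longrightarrow> quiver.ar Q P (E - K) \<le> cnt P (E - K))"
      using KE by (simp add: quiver.Sh_iff[OF E])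
    also have "\<dots> \<longleftrightarrow> (\<forall>L'. in_Shat Q (weight L) L' \<longrightarrow> arrow_rhs Q e L L' \<le> ht L L')"
    proof (intro iffI allI impI)
      fix L' assume h: "\<forall>P. quiver.Sh Q K P \<longrightarrow> quiver.ar Q P (E - K) \<le> cnt P (E - K)" and S: "in_Shat Q (weight L) L'"
      have L': "sub_box L' (weight L)" by (rule in_Shat_sub_box[OF S])
      have "quiver.Sh Q K (pts \<nu>' L')" using less.hyps[OF lt fK en' L'] S by simp
      then have "quiver.ar Q (pts \<nu>' L') (E - K) \<le> cnt (pts \<nu>' L') (E - K)" using h by blast
      then show "arrow_rhs Q e L L' \<le> ht L L'"
        unfolding ar_eq_arrow_rhs[OF E en L L', symmetric] cnt_eq_ht[OF E en L L', symmetric] K_def \<nu>'_def by simp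
    next
      fix P assume h: "\<forall>L'. in_Shat Q (weight L) L' \<longrightarrow> arrow_rhs Q e L L' \<le> ht L L'" and S: "quiver.Sh Q K P"
      define L' where "L' i = {j \<in> {1..weight L i}. (i, \<nu>' i j) \<in> P}" for i
      have L': "sub_box L' (weight L)" by (auto simp: sub_box_def L'_def)
      have PK: "P \<subseteq> K" by (rule quiver.Sh_subset[OF S])
      have P: "P = pts \<nu>' L'"
      proof (rule Set.set_eqI)
        fix p :: "'v \<times> nat"
        obtain i k where p: "p = (i,k)" by (cases p)
        have "k \<in> \<nu>' i ` L' i" if "(i,k) \<in> P"
        proof -
          have "k \<in> {k. (i,k) \<in> K}" using that PK by blast
          then have "k \<in> \<nu>' i ` {1..weight L i}" unfolding enum_image[OF en'] .
          then show ?thesis using that by (auto simp: L'_def)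
        qed
        moreover have "(i,k) \<in> P" if "k \<in> \<nu>' i ` L' i" using that by (auto simp: L'_def)
        ultimately show "p \<in> P \<longleftrightarrow> p \<in> pts \<nu>' L'" unfolding p mem_pts by blast
      qed
      have "in_Shat Q (weight L) L'" using less.hyps[OF lt fK en' L'] S P by simp
      then have "arrow_rhs Q e L L' \<le> ht L L'" using h by blast
      then show "quiver.ar Q P (E - K) \<le> cnt P (E - K)"
        unfolding ar_eq_arrow_rhs[OF E en L L', symmetric] cnt_eq_ht[OF E en L L', symmetric] P K_def \<nu>'_def by simp
    qed
    also have "\<dots> \<longleftrightarrow> in_Shat Q e L" by (subst (2) in_Shat.simps) (use L False in simp)
    finally show ?thesis by (simp add: K_def)
  qed
qed

section \<open>Translation to matrices\<close>

lemma mat_adjoint_carrier: "A \<in> carrier_mat n m \<Longrightarrow> mat_adjoint A \<in> carrier_mat m n"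
  by (auto simp: mat_adjoint_def)

lemma mat_adjoint_index: "A \<in> carrier_mat n m \<Longrightarrow> r < m \<Longrightarrow> c < n \<Longrightarrow> mat_adjoint (A :: complex mat) $$ (r,c) = cnj (A $$ (c,r))"
  by (auto simp: mat_adjoint_def mat_of_rows_def conjugate_complex_def)

lemma mult_mat_index:
  assumes "A \<in> carrier_mat n m" "B \<in> carrier_mat m p" "r < n" "c < p"
  shows "(A * B) $$ (r,c) = (\<Sum>j<m. (A :: complex mat) $$ (r,j) * B $$ (j,c))"
  using assms by (auto simp: scalar_prod_def atLeast0LessThan)

text \<open>Indices start at 1 as in the tuples of the recursion, whereas matrix rows and columns
  start at 0; hence the shifts by \<open>Suc\<close> and \<open>- 1\<close>.\<close>

definition idx :: "('v \<Rightarrow> nat) \<Rightarrow> ('v \<times> nat) set" where "idx d = Sigma UNIV (\<lambda>i. {1..d i})"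

lemma mem_idx: "r \<in> idx d \<longleftrightarrow> snd r \<in> {1..d (fst r)}" by (cases r) (simp add: idx_def)

lemma finite_idx: "finite (idx (d :: 'v::finite \<Rightarrow> nat))" by (auto simp: idx_def)

lemma idx_shift: "r \<in> idx d \<Longrightarrow> snd r - 1 < d (fst r) \<and> r = (fst r, Suc (snd r - 1))"
  by (cases r) (auto simp: idx_def)

lemma sum_idx_fibre:
  fixes d :: "'v::finite \<Rightarrow> nat" and g :: "'v \<times> nat \<Rightarrow> 'a::comm_monoid_add"
  assumes "\<And>m. m \<in> idx d \<Longrightarrow> fst m \<noteq> s \<Longrightarrow> g m = 0"
  shows "(\<Sum>m\<in>idx d. g m) = (\<Sum>j<d s. g (s, Suc j))"
proof -
  have "(\<Sum>m\<in>idx d. g m) = (\<Sum>m\<in>(\<lambda>j. (s, Suc j)) ` {..<d s}. g m)"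
  proof (rule sum.mono_neutral_right[OF finite_idx])
    show "(\<lambda>j. (s, Suc j)) ` {..<d s} \<subseteq> idx d" by (auto simp: idx_def)
    show "\<forall>m\<in>idx d - (\<lambda>j. (s, Suc j)) ` {..<d s}. g m = 0"
    proof
      fix m assume m: "m \<in> idx d - (\<lambda>j. (s, Suc j)) ` {..<d s}"
      have "fst m \<noteq> s"
      proof
        assume "fst m = s"
        then have "m = (\<lambda>j. (s, Suc j)) (snd m - 1)" "snd m - 1 \<in> {..<d s}" using idx_shift[of m d] m by auto
        then show False using m by blast
      qed
      then show "g m = 0" using assms m by blast
    qed
  qed
  also have "\<dots> = (\<Sum>j<d s. g (s, Suc j))" by (subst sum.reindex) (auto simp: inj_on_def)
  finally show ?thesis .
qed

definition fun_of_mats :: "('v \<Rightarrow> nat) \<Rightarrow> ('v \<Rightarrow> complex mat) \<Rightarrow> ('v \<times> nat) cmat" where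
  "fun_of_mats d B r c = (if r \<in> idx d \<and> c \<in> idx d \<and> fst r = fst c then B (fst r) $$ (snd r - 1, snd c - 1) else 0)"

definition fun_of_rep :: "'v quiver \<Rightarrow> ('v \<Rightarrow> nat) \<Rightarrow> (nat \<Rightarrow> complex mat) \<Rightarrow> nat \<Rightarrow> ('v \<times> nat) cmat" where
  "fun_of_rep Q d f k r c = (if k < length Q \<and> r \<in> idx d \<and> c \<in> idx d \<and> fst r = snd (Q ! k) \<and> fst c = fst (Q ! k)
     then f k $$ (snd r - 1, snd c - 1) else 0)"

lemma supp_rep_fun_of_rep: "quiver.supp_rep Q (idx d) (fun_of_rep Q d f)"
  unfolding quiver.supp_rep_def fun_of_rep_def by simp

lemma mu_fun_of_rep:
  fixes Q :: "'v::finite quiver"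
  assumes f: "is_rep Q d f" and rc: "r < d i" "c < d i"
  shows "quiver.mu Q (idx d) (fun_of_rep Q d f) (i, Suc r) (i, Suc c) = momentum Q d f i $$ (r,c)"
proof -
  have fk: "f k \<in> carrier_mat (d (snd (Q ! k))) (d (fst (Q ! k)))" if "k < length Q" for k
    using f that by (simp add: is_rep_def)
  have 1: "(\<Sum>m\<in>idx d. fun_of_rep Q d f k (i, Suc r) m * cnj (fun_of_rep Q d f k (i, Suc c) m)) =
      (if snd (Q ! k) = i then (f k * mat_adjoint (f k)) $$ (r,c) else 0)" if k: "k < length Q" for k
  proof (cases "snd (Q ! k) = i")
    case True
    have "(\<Sum>m\<in>idx d. fun_of_rep Q d f k (i, Suc r) m * cnj (fun_of_rep Q d f k (i, Suc c) m)) =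
        (\<Sum>j<d (fst (Q ! k)). fun_of_rep Q d f k (i, Suc r) (fst (Q ! k), Suc j) * cnj (fun_of_rep Q d f k (i, Suc c) (fst (Q ! k), Suc j)))"
      by (rule sum_idx_fibre) (simp add: fun_of_rep_def)
    also have "\<dots> = (\<Sum>j<d (fst (Q ! k)). f k $$ (r,j) * mat_adjoint (f k) $$ (j,c))"
      using k True rc mat_adjoint_index[OF fk[OF k]] by (intro sum.cong refl) (simp add: fun_of_rep_def mem_idx)
    also have "\<dots> = (f k * mat_adjoint (f k)) $$ (r,c)"
      using mult_mat_index[OF fk[OF k] mat_adjoint_carrier[OF fk[OF k]]] True rc by simp
    finally show ?thesis using True by simp
  qed (auto simp: fun_of_rep_def)
  have 2: "(\<Sum>m\<in>idx d. cnj (fun_of_rep Q d f k m (i, Suc r)) * fun_of_rep Q d f k m (i, Suc c)) =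
      (if fst (Q ! k) = i then (mat_adjoint (f k) * f k) $$ (r,c) else 0)" if k: "k < length Q" for k
  proof (cases "fst (Q ! k) = i")
    case True
    have "(\<Sum>m\<in>idx d. cnj (fun_of_rep Q d f k m (i, Suc r)) * fun_of_rep Q d f k m (i, Suc c)) =
        (\<Sum>j<d (snd (Q ! k)). cnj (fun_of_rep Q d f k (snd (Q ! k), Suc j) (i, Suc r)) * fun_of_rep Q d f k (snd (Q ! k), Suc j) (i, Suc c))"
      by (rule sum_idx_fibre) (simp add: fun_of_rep_def)
    also have "\<dots> = (\<Sum>j<d (snd (Q ! k)). mat_adjoint (f k) $$ (r,j) * f k $$ (j,c))"
      using k True rc mat_adjoint_index[OF fk[OF k]] by (intro sum.cong refl) (simp add: fun_of_rep_def mem_idx)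
    also have "\<dots> = (mat_adjoint (f k) * f k) $$ (r,c)"
      using mult_mat_index[OF mat_adjoint_carrier[OF fk[OF k]] fk[OF k]] True rc by simp
    finally show ?thesis using True by simp
  qed (auto simp: fun_of_rep_def)
  have s: "(\<Sum>k<length Q. if P k then g k else 0) = (\<Sum>k\<in>{k. k < length Q \<and> P k}. g k)" for P and g :: "nat \<Rightarrow> complex"
    by (simp add: sum.If_cases lessThan_def Collect_conj_eq)
  have "quiver.mu Q (idx d) (fun_of_rep Q d f) (i, Suc r) (i, Suc c) =
      (\<Sum>k<length Q. if snd (Q ! k) = i then (f k * mat_adjoint (f k)) $$ (r,c) else 0) -
      (\<Sum>k<length Q. if fst (Q ! k) = i then (mat_adjoint (f k) * f k) $$ (r,c) else 0)"
    unfolding quiver.mu_def using 1 2 by simp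
  then show ?thesis unfolding s using rc by (simp add: momentum_def)
qed

lemma in_momentum_image_iff:
  fixes Q :: "'v::finite quiver"
  assumes B: "\<And>i. B i \<in> carrier_mat (d i) (d i)"
  shows "(\<exists>f. is_rep Q d f \<and> (\<forall>i. momentum Q d f i = B i)) \<longleftrightarrow>
    (\<exists>f. quiver.supp_rep Q (idx d) f \<and> (\<forall>r\<in>idx d. \<forall>c\<in>idx d. quiver.mu Q (idx d) f r c = fun_of_mats d B r c))"
proof
  assume "\<exists>f. is_rep Q d f \<and> (\<forall>i. momentum Q d f i = B i)"
  then obtain f where f: "is_rep Q d f" "\<And>i. momentum Q d f i = B i" by blast
  have "quiver.mu Q (idx d) (fun_of_rep Q d f) r c = fun_of_mats d B r c" if rc: "r \<in> idx d" "c \<in> idx d" for r c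
  proof (cases "fst r = fst c")
    case True
    have r: "r = (fst r, Suc (snd r - 1))" "snd r - 1 < d (fst r)" and c: "c = (fst r, Suc (snd c - 1))" "snd c - 1 < d (fst r)"
      using idx_shift[OF rc(1)] idx_shift[OF rc(2)] True by auto
    have "quiver.mu Q (idx d) (fun_of_rep Q d f) r c = momentum Q d f (fst r) $$ (snd r - 1, snd c - 1)"
      using mu_fun_of_rep[OF f(1) r(2) c(2)] r(1)[symmetric] c(1)[symmetric] by simp
    then show ?thesis using True rc f(2) by (simp add: fun_of_mats_def)
  next
    case False
    have rp: "quiver.rep Q (fun_of_rep Q d f)" by (rule quiver.supp_rep_rep[OF supp_rep_fun_of_rep])
    have "quiver.mu Q (idx d) (fun_of_rep Q d f) r c = 0" using quiver.mu_graded[OF rp] False by blast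
    then show ?thesis using False by (simp add: fun_of_mats_def)
  qed
  then show "\<exists>f. quiver.supp_rep Q (idx d) f \<and> (\<forall>r\<in>idx d. \<forall>c\<in>idx d. quiver.mu Q (idx d) f r c = fun_of_mats d B r c)"
    using supp_rep_fun_of_rep by (intro exI[of _ "fun_of_rep Q d f"]) simp
next
  assume "\<exists>f. quiver.supp_rep Q (idx d) f \<and> (\<forall>r\<in>idx d. \<forall>c\<in>idx d. quiver.mu Q (idx d) f r c = fun_of_mats d B r c)"
  then obtain g where g: "quiver.supp_rep Q (idx d) g" "\<And>r c. r \<in> idx d \<Longrightarrow> c \<in> idx d \<Longrightarrow> quiver.mu Q (idx d) g r c = fun_of_mats d B r c" by blast
  define f where "f k = Matrix.mat (d (snd (Q ! k))) (d (fst (Q ! k))) (\<lambda>(r,c). g k (snd (Q ! k), Suc r) (fst (Q ! k), Suc c))" for k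
  have f: "is_rep Q d f" by (simp add: is_rep_def f_def)
  have "fun_of_rep Q d f k r c = g k r c" for k r c
  proof (cases "k < length Q \<and> r \<in> idx d \<and> c \<in> idx d \<and> fst r = snd (Q ! k) \<and> fst c = fst (Q ! k)")
    case True
    have r: "r = (snd (Q ! k), Suc (snd r - 1))" "snd r - 1 < d (snd (Q ! k))" and c: "c = (fst (Q ! k), Suc (snd c - 1))" "snd c - 1 < d (fst (Q ! k))"
      using idx_shift[of r d] idx_shift[of c d] True by auto
    have "fun_of_rep Q d f k r c = g k (snd (Q ! k), Suc (snd r - 1)) (fst (Q ! k), Suc (snd c - 1))"
      using True r(2) c(2) by (simp only: fun_of_rep_def f_def index_mat if_True) simp
    then show ?thesis using r(1)[symmetric] c(1)[symmetric] by simp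
  next
    case False
    then have "g k r c = 0" using g(1) unfolding quiver.supp_rep_def by blast
    moreover have "fun_of_rep Q d f k r c = 0" unfolding fun_of_rep_def using False by (rule if_not_P)
    ultimately show ?thesis by simp
  qed
  then have fg: "fun_of_rep Q d f = g" by (intro ext)
  have "momentum Q d f i = B i" for i
  proof (rule eq_matI)
    fix r c assume "r < dim_row (B i)" "c < dim_col (B i)"
    then have rc: "r < d i" "c < d i" using B[of i] by auto
    have "momentum Q d f i $$ (r,c) = quiver.mu Q (idx d) g (i, Suc r) (i, Suc c)"
      using mu_fun_of_rep[OF f rc] fg by simp
    also have "\<dots> = fun_of_mats d B (i, Suc r) (i, Suc c)" by (rule g(2)) (use rc in \<open>simp_all add: mem_idx\<close>)
    also have "\<dots> = B i $$ (r,c)" using rc by (simp add: fun_of_mats_def mem_idx)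
    finally show "momentum Q d f i $$ (r,c) = B i $$ (r,c)" .
  qed (use B[of i] in \<open>auto simp: momentum_def\<close>)
  then show "\<exists>f. is_rep Q d f \<and> (\<forall>i. momentum Q d f i = B i)" using f by blast
qed

text \<open>Unique factorisation fixes the multiset of roots, and sorting fixes their order; this
  identifies eigenvalues read off a diagonal form with the given ones.\<close>

lemma sorted_roots_unique:
  fixes a b :: "nat \<Rightarrow> real"
  assumes eq: "(\<Prod>k = 1..n. [:- complex_of_real (a k), 1:]) = (\<Prod>k = 1..n. [:- complex_of_real (b k), 1:])"
    and a: "\<And>k l. 1 \<le> k \<Longrightarrow> k \<le> l \<Longrightarrow> l \<le> n \<Longrightarrow> a k \<le> a l"
    and b: "\<And>k l. 1 \<le> k \<Longrightarrow> k \<le> l \<Longrightarrow> l \<le> n \<Longrightarrow> b k \<le> b l"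
    and k: "k \<in> {1..n}"
  shows "a k = b k"
proof -
  have s: "(\<Sum>k\<in>A. {#f k#}) = image_mset f (mset_set A)" if "finite A" for A :: "nat set" and f :: "nat \<Rightarrow> complex"
    using that by (induction A rule: finite_induct) auto
  have r: "proots (\<Prod>k = 1..n. [:- complex_of_real (f k), 1:]) = image_mset (\<lambda>k. complex_of_real (f k)) (mset_set {1..n})" for f
    by (subst proots_prod) (auto simp: s)
  have "image_mset Re (image_mset (\<lambda>k. complex_of_real (a k)) (mset_set {1..n})) = image_mset Re (image_mset (\<lambda>k. complex_of_real (b k)) (mset_set {1..n}))"
    using eq r[of a] r[of b] by simp
  then have "image_mset a (mset_set {1..n}) = image_mset b (mset_set {1..n})" by (simp add: multiset.map_comp o_def)
  moreover have m: "mset (map f [1..<Suc n]) = image_mset f (mset_set {1..n})" for f :: "nat \<Rightarrow> real"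
    by (simp only: mset_map mset_upt atLeastLessThanSuc_atLeastAtMost)
  ultimately have me: "mset (map a [1..<Suc n]) = mset (map b [1..<Suc n])" by simp
  have srt: "sorted (map f [1..<Suc n])" if "\<And>k l. 1 \<le> k \<Longrightarrow> k \<le> l \<Longrightarrow> l \<le> n \<Longrightarrow> f k \<le> f l" for f :: "nat \<Rightarrow> real"
    unfolding sorted_iff_nth_mono using that by (auto simp del: upt_Suc)
  have "map a [1..<Suc n] = map b [1..<Suc n]"
    using properties_for_sort[OF me srt[OF a]] properties_for_sort[OF refl srt[OF b]] by simp
  then have "\<forall>k\<in>{1..<Suc n}. a k = b k" by (simp only: map_eq_conv set_upt)
  then show ?thesis using k by simp
qed

text \<open>Restricting to the indices at vertex \<open>i\<close> turns products of graded matrices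
  into products of blocks, so \<open>B i\<close> is similar to a diagonal matrix.\<close>

lemma (in quiver) eigenvalues_of_diagonal_form:
  assumes fin: "finite (idx d)" and B: "B i \<in> carrier_mat (d i) (d i)"
    and u: "uni (idx d) u" "\<And>r c. u r c \<noteq> 0 \<Longrightarrow> r \<in> idx d \<and> c \<in> idx d \<and> fst r = fst c"
    and D: "\<And>r c. r \<in> idx d \<Longrightarrow> c \<in> idx d \<Longrightarrow> cu (idx d) u (fun_of_mats d B) r c = (if r = c then of_real (x r) else 0)"
  shows "char_poly (B i) = (\<Prod>k = 1..d i. [:- complex_of_real (x (i,k)), 1:])"
proof -
  define mt where "mt A = Matrix.mat (d i) (d i) (\<lambda>(r,c). A (i, Suc r) (i, Suc c))" for A :: "('v \<times> nat) cmat"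
  have car: "mt A \<in> carrier_mat (d i) (d i)" for A by (simp add: mt_def)
  have I: "(i, Suc r) \<in> idx d" if "r < d i" for r using that by (simp add: mem_idx)
  have mul: "mt (mm (idx d) A C) = mt A * mt C"
    if A: "\<And>r c. r \<in> idx d \<Longrightarrow> c \<in> idx d \<Longrightarrow> A r c \<noteq> 0 \<Longrightarrow> fst r = fst c" for A C
  proof (rule eq_matI)
    fix r c assume "r < dim_row (mt A * mt C)" "c < dim_col (mt A * mt C)"
    then have rc: "r < d i" "c < d i" by (auto simp: mt_def)
    have "mm (idx d) A C (i, Suc r) (i, Suc c) = (\<Sum>j<d i. A (i, Suc r) (i, Suc j) * C (i, Suc j) (i, Suc c))"
      unfolding mm_def
    proof -
      have z: "A (i, Suc r) m * C m (i, Suc c) = 0" if "m \<in> idx d" "fst m \<noteq> i" for m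
        using A[OF I[OF rc(1)] that(1)] that(2) by auto
      have "(\<Sum>m\<in>idx d. A (i, Suc r) m * C m (i, Suc c)) = (\<Sum>m\<in>(\<lambda>j. (i, Suc j)) ` {..<d i}. A (i, Suc r) m * C m (i, Suc c))"
      proof (rule sum.mono_neutral_right[OF fin])
        show "(\<lambda>j. (i, Suc j)) ` {..<d i} \<subseteq> idx d" using I by auto
        show "\<forall>m\<in>idx d - (\<lambda>j. (i, Suc j)) ` {..<d i}. A (i, Suc r) m * C m (i, Suc c) = 0"
        proof
          fix m assume m: "m \<in> idx d - (\<lambda>j. (i, Suc j)) ` {..<d i}"
          have "fst m \<noteq> i"
          proof
            assume "fst m = i"
            then have "m = (\<lambda>j. (i, Suc j)) (snd m - 1)" "snd m - 1 \<in> {..<d i}" using idx_shift[of m d] m by auto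
            then show False using m by blast
          qed
          then show "A (i, Suc r) m * C m (i, Suc c) = 0" using z m by blast
        qed
      qed
      also have "\<dots> = (\<Sum>j<d i. A (i, Suc r) (i, Suc j) * C (i, Suc j) (i, Suc c))" by (subst sum.reindex) (auto simp: inj_on_def)
      finally show "(\<Sum>m\<in>idx d. A (i, Suc r) m * C m (i, Suc c)) = (\<Sum>j<d i. A (i, Suc r) (i, Suc j) * C (i, Suc j) (i, Suc c))" .
    qed
    then show "mt (mm (idx d) A C) $$ (r,c) = (mt A * mt C) $$ (r,c)"
      using mult_mat_index[OF car[of A] car[of C] rc] rc by (simp add: mt_def)
  qed (auto simp: mt_def)
  have gu: "fst r = fst c" if "u r c \<noteq> 0" for r c using u(2)[OF that] by blast
  have ga: "fst r = fst c" if "adj u r c \<noteq> 0" for r c using gu[of c r] that by (simp add: adj_def)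
  have gB: "fst r = fst c" if "fun_of_mats d B r c \<noteq> 0" for r c using that by (auto simp: fun_of_mats_def split: if_splits)
  have mB: "mt (fun_of_mats d B) = B i"
    by (rule eq_matI) (use B in \<open>auto simp: mt_def fun_of_mats_def mem_idx\<close>)
  define Dg where "Dg = mt (cu (idx d) u (fun_of_mats d B))"
  have Dg: "Dg = mt (adj u) * (B i * mt u)"
    unfolding Dg_def cu_def using mul[of "adj u"] mul[of "fun_of_mats d B"] ga gB mB by simp
  have one: "mt A = 1\<^sub>m (d i)" if "\<And>r c. r \<in> idx d \<Longrightarrow> c \<in> idx d \<Longrightarrow> A r c = unit_fun c r" for A
    by (rule eq_matI) (use that I in \<open>auto simp: mt_def unit_fun_def\<close>)
  have 1: "mt u * mt (adj u) = 1\<^sub>m (d i)" using mul[of u "adj u"] gu one[OF uni2[OF fin u(1)]] by simp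
  have 2: "mt (adj u) * mt u = 1\<^sub>m (d i)" using mul[of "adj u" u] ga one[OF uni1[OF fin u(1)]] by simp
  have "mt u * Dg * mt (adj u) = (mt u * mt (adj u)) * B i * (mt u * mt (adj u))"
    unfolding Dg using car[of u] car[of "adj u"] B by (simp add: assoc_mult_mat[of _ "d i" "d i" _ "d i" _ "d i"])
  also have "\<dots> = B i" unfolding 1 using B by simp
  finally have "similar_mat_wit (B i) Dg (mt u) (mt (adj u))"
    using 1 2 B car by (intro similar_mat_witI[of _ _ "d i"]) (auto simp: Dg_def)
  then have "char_poly (B i) = char_poly Dg" by (intro char_poly_similar) (auto simp: similar_mat_def)
  also have "\<dots> = (\<Prod>a\<leftarrow>diag_mat Dg. [:- a, 1:])"
  proof (rule char_poly_upper_triangular)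
    show "Dg \<in> carrier_mat (d i) (d i)" unfolding Dg_def by (rule car)
    show "upper_triangular Dg" unfolding upper_triangular_def using D I by (auto simp: Dg_def mt_def)
  qed
  also have "diag_mat Dg = map (\<lambda>k. of_real (x (i, Suc k))) [0..<d i]"
    unfolding diag_mat_def using D I by (auto simp: Dg_def mt_def)
  also have "(\<Prod>a\<leftarrow>map (\<lambda>k. complex_of_real (x (i, Suc k))) [0..<d i]. [:- a, 1:]) = (\<Prod>k\<in>{0..<d i}. [:- complex_of_real (x (i, Suc k)), 1:])"
    using prod.distinct_set_conv_list[of "[0..<d i]" "\<lambda>k. [:- complex_of_real (x (i, Suc k)), 1:]"] by (simp add: o_def)
  also have "\<dots> = (\<Prod>k = 1..d i. [:- complex_of_real (x (i,k)), 1:])"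
    by (rule prod.reindex_bij_witness[of _ "\<lambda>k. k - 1" Suc]) auto
  finally show ?thesis .
qed

lemma (in quiver) mu_conjugation:
  assumes E: "finite E" and u: "uni E u" "\<And>r c. u r c \<noteq> 0 \<Longrightarrow> r \<in> E \<and> c \<in> E \<and> fst r = fst c"
    and D: "\<And>r c. r \<in> E \<Longrightarrow> c \<in> E \<Longrightarrow> cu E u X r c = D r c"
  shows "(\<exists>f. supp_rep E f \<and> (\<forall>r\<in>E. \<forall>c\<in>E. mu E f r c = X r c)) \<longleftrightarrow>
    (\<exists>f. supp_rep E f \<and> (\<forall>r\<in>E. \<forall>c\<in>E. mu E f r c = D r c))"
proof
  assume "\<exists>f. supp_rep E f \<and> (\<forall>r\<in>E. \<forall>c\<in>E. mu E f r c = X r c)"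
  then obtain f where f: "supp_rep E f" "\<And>r c. r \<in> E \<Longrightarrow> c \<in> E \<Longrightarrow> mu E f r c = X r c" by blast
  have "mu E (\<lambda>k. cu E u (f k)) r c = D r c" if rc: "r \<in> E" "c \<in> E" for r c
  proof -
    have "cu E u (mu E f) r c = cu E u X r c" using f(2) by (simp add: cu_def mm_def)
    then show ?thesis using cu_mu[OF E u(1), of f r c] D[OF rc] by simp
  qed
  moreover have "supp_rep E (\<lambda>k. cu E u (f k))" by (rule supp_rep_cu[OF f(1) u(2)])
  ultimately show "\<exists>f. supp_rep E f \<and> (\<forall>r\<in>E. \<forall>c\<in>E. mu E f r c = D r c)" by blast
next
  assume "\<exists>f. supp_rep E f \<and> (\<forall>r\<in>E. \<forall>c\<in>E. mu E f r c = D r c)"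
  then obtain f where f: "supp_rep E f" "\<And>r c. r \<in> E \<Longrightarrow> c \<in> E \<Longrightarrow> mu E f r c = D r c" by blast
  have v: "uni E (adj u)" using u(1) by (simp add: uni_def)
  have vs: "r \<in> E \<and> c \<in> E \<and> fst r = fst c" if "adj u r c \<noteq> 0" for r c using u(2)[of c r] that by (simp add: adj_def)
  have "mu E (\<lambda>k. cu E (adj u) (f k)) r c = X r c" if rc: "r \<in> E" "c \<in> E" for r c
  proof -
    have "mu E (\<lambda>k. cu E (adj u) (f k)) r c = cu E (adj u) (mu E f) r c" by (rule cu_mu[OF E v])
    also have "\<dots> = cu E (adj u) (cu E u X) r c"
    proof -
      have "mm E (mu E f) (adj u) m c = mm E (cu E u X) (adj u) m c" if "m \<in> E" for m
        unfolding mm_def using f(2) D that by (intro sum.cong refl) simp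
      then show ?thesis unfolding cu_def[of E "adj u"] mm_def[of E "adj (adj u)"] by (intro sum.cong refl) (simp only:)
    qed
    also have "\<dots> = mm E u (mm E (cu E u X) (adj u)) r c" by (simp add: cu_def[of E "adj u"])
    also have "\<dots> = X r c" by (rule cu_undo[OF E u(1) rc])
    finally show ?thesis .
  qed
  moreover have "supp_rep E (\<lambda>k. cu E (adj u) (f k))" by (rule supp_rep_cu[OF f(1) vs])
  ultimately show "\<exists>f. supp_rep E f \<and> (\<forall>r\<in>E. \<forall>c\<in>E. mu E f r c = X r c)" by blast
qed

lemma sum_tuple:
  fixes K :: "'v::finite \<Rightarrow> nat set" and a :: "'v \<Rightarrow> nat \<Rightarrow> real"
  assumes "\<And>i. finite (K i)"
  shows "(\<Sum>i\<in>UNIV. \<Sum>k\<in>K i. a i k) = (\<Sum>r\<in>Sigma UNIV K. a (fst r) (snd r))"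
  using assms by (subst sum.Sigma) (auto simp: case_prod_beta)

lemma Shat_idx_iff:
  fixes Q :: "'v::finite quiver"
  shows "K \<in> Shat Q d \<longleftrightarrow> sub_box K d \<and> quiver.Sh Q (idx d) (Sigma UNIV K)"
proof -
  have en: "enum (idx d) d (\<lambda>_ j. j)" by (auto simp: enum_def idx_def strict_mono_on_ident)
  have "in_Shat Q d K \<longleftrightarrow> quiver.Sh Q (idx d) (Sigma UNIV K)" if "sub_box K d"
    using in_Shat_iff_Sh[OF finite_idx en that, of Q] by (simp add: pts_def)
  then show ?thesis using in_Shat_sub_box[of Q d K] unfolding Shat_def mem_Collect_eq by blast
qed

theorem theorem2p1:
  fixes Q :: "'v::finite quiver" and d :: "'v \<Rightarrow> nat"
    and B :: "'v \<Rightarrow> complex mat" and a :: "'v \<Rightarrow> nat \<Rightarrow> real"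
  assumes herm: "\<And>i. hermitian_mat (d i) (B i)"
    and sorted: "\<And>i k l. 1 \<le> k \<Longrightarrow> k \<le> l \<Longrightarrow> l \<le> d i \<Longrightarrow> a i k \<le> a i l"
    and eig: "\<And>i. char_poly (B i) = (\<Prod>k = 1..d i. [:- complex_of_real (a i k), 1:])"
  shows "(\<exists>f. is_rep Q d f \<and> (\<forall>i. momentum Q d f i = B i)) \<longleftrightarrow>
         ((\<Sum>i\<in>UNIV. \<Sum>k = 1..d i. a i k) = 0 \<and>
          (\<forall>K \<in> Shat Q d. (\<Sum>i\<in>UNIV. \<Sum>k\<in>K i. a i k) \<ge> 0))"
proof -
  interpret quiver Q .
  define E where "E = idx d"
  have E: "finite E" unfolding E_def by (rule finite_idx)
  have car: "B i \<in> carrier_mat (d i) (d i)" for i using herm[of i] by (simp add: hermitian_mat_def)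
  define X where "X = fun_of_mats d B"
  have aX: "adj X = X"
  proof (intro ext)
    fix r c
    show "adj X r c = X r c"
    proof (cases "r \<in> idx d \<and> c \<in> idx d \<and> fst r = fst c")
      case True
      then have rc: "snd r - 1 < d (fst r)" "snd c - 1 < d (fst r)" using idx_shift[of r d] idx_shift[of c d] by auto
      have "X r c = mat_adjoint (B (fst r)) $$ (snd r - 1, snd c - 1)"
        using True herm[of "fst r"] by (simp add: X_def fun_of_mats_def hermitian_mat_def)
      also have "\<dots> = cnj (B (fst r) $$ (snd c - 1, snd r - 1))" by (rule mat_adjoint_index[OF car rc])
      also have "\<dots> = adj X r c" using True by (simp add: X_def fun_of_mats_def adj_def)
      finally show ?thesis by simp
    next
      case False
      then show ?thesis by (auto simp: adj_def X_def fun_of_mats_def)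
    qed
  qed
  have gX: "fst r = fst c" if "X r c \<noteq> 0" for r c using that by (auto simp: X_def fun_of_mats_def split: if_splits)
  have "\<exists>u x. uni E u \<and> (\<forall>r c. u r c \<noteq> 0 \<longrightarrow> r \<in> E \<and> c \<in> E \<and> fst r = fst c) \<and>
     (\<forall>r\<in>E. \<forall>c\<in>E. cu E u X r c = (if r = c then of_real (x r) else 0)) \<and>
     (\<forall>r\<in>E. \<forall>c\<in>E. fst r = fst c \<longrightarrow> r \<preceq> c \<longrightarrow> x r \<le> x c)"
  proof (rule diagonalising_unitary[OF E aX])
    show "fst r = fst c" if "X r c \<noteq> 0" for r c using gX[OF that] .
  qed
  then obtain u x where u: "uni E u" "\<forall>r c. u r c \<noteq> 0 \<longrightarrow> r \<in> E \<and> c \<in> E \<and> fst r = fst c"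
     "\<forall>r\<in>E. \<forall>c\<in>E. cu E u X r c = (if r = c then of_real (x r) else 0)"
     "\<forall>r\<in>E. \<forall>c\<in>E. fst r = fst c \<longrightarrow> r \<preceq> c \<longrightarrow> x r \<le> x c"
    by (elim exE conjE) rule
  have us: "r \<in> E \<and> c \<in> E \<and> fst r = fst c" if "u r c \<noteq> 0" for r c using u(2) that by blast
  have x: "x (i,k) = a i k" if k: "k \<in> {1..d i}" for i k
  proof (rule sorted_roots_unique[OF _ _ _ k])
    have "char_poly (B i) = (\<Prod>k = 1..d i. [:- complex_of_real (x (i,k)), 1:])"
    proof (rule eigenvalues_of_diagonal_form)
      show "finite (idx d)" by (rule finite_idx)
      show "uni (idx d) u" using u(1) by (simp add: E_def)
      show "r \<in> idx d \<and> c \<in> idx d \<and> fst r = fst c" if "u r c \<noteq> 0" for r c using us[OF that] by (simp add: E_def)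
      show "cu (idx d) u (fun_of_mats d B) r c = (if r = c then of_real (x r) else 0)" if "r \<in> idx d" "c \<in> idx d" for r c
        using u(3) that by (simp add: E_def X_def)
    qed (rule car)
    then show "(\<Prod>k = 1..d i. [:- complex_of_real (x (i,k)), 1:]) = (\<Prod>k = 1..d i. [:- complex_of_real (a i k), 1:])"
      using eig[of i] by simp
    show "x (i,k) \<le> x (i,l)" if kl: "1 \<le> k" "k \<le> l" "l \<le> d i" for k l
    proof -
      have "(i,k) \<in> E" "(i,l) \<in> E" "(i,k) \<preceq> (i,l)" using kl by (simp_all add: E_def mem_idx fle_def)
      then show ?thesis using u(4) by simp
    qed
    show "a i k \<le> a i l" if "1 \<le> k" "k \<le> l" "l \<le> d i" for k l by (rule sorted[OF that])
  qed
  define b where "b r = a (fst r) (snd r)" for r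
  have D: "cu E u X r c = dg b r c" if rc: "r \<in> E" "c \<in> E" for r c
  proof -
    have "x r = b r" using x[of "snd r" "fst r"] rc(1) by (simp add: b_def E_def mem_idx)
    then show ?thesis using u(3) rc by (cases "r = c") (simp_all add: dg_def)
  qed
  have mono: "b r \<le> b c" if rc: "r \<in> E" "c \<in> E" "r \<preceq> c" for r c
    using rc sorted[of "snd r" "snd c" "fst r"] by (simp add: b_def E_def mem_idx fle_def)
  have sumb: "(\<Sum>i\<in>UNIV. \<Sum>k\<in>K i. a i k) = (\<Sum>r\<in>Sigma UNIV K. b r)" if "sub_box K d" for K
  proof -
    have "finite (K i)" for i using that unfolding sub_box_def by (meson finite_atLeastAtMost finite_subset)
    then show ?thesis unfolding b_def by (rule sum_tuple)
  qed
  have sum_all: "(\<Sum>i\<in>UNIV. \<Sum>k = 1..d i. a i k) = (\<Sum>r\<in>E. b r)"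
    unfolding b_def E_def idx_def by (rule sum_tuple) simp
  have "(\<exists>f. is_rep Q d f \<and> (\<forall>i. momentum Q d f i = B i)) \<longleftrightarrow>
      (\<exists>f. supp_rep E f \<and> (\<forall>r\<in>E. \<forall>c\<in>E. mu E f r c = X r c))"
    unfolding E_def X_def by (rule in_momentum_image_iff[OF car])
  also have "\<dots> \<longleftrightarrow> (\<exists>f. supp_rep E f \<and> (\<forall>r\<in>E. \<forall>c\<in>E. mu E f r c = dg b r c))"
    by (rule mu_conjugation[OF E u(1) us D])
  also have "\<dots> \<longleftrightarrow> ((\<Sum>i\<in>UNIV. \<Sum>k = 1..d i. a i k) = 0 \<and> (\<forall>K \<in> Shat Q d. (\<Sum>i\<in>UNIV. \<Sum>k\<in>K i. a i k) \<ge> 0))"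
  proof
    assume "\<exists>f. supp_rep E f \<and> (\<forall>r\<in>E. \<forall>c\<in>E. mu E f r c = dg b r c)"
    then obtain f where f: "supp_rep E f" "\<And>r c. r \<in> E \<Longrightarrow> c \<in> E \<Longrightarrow> mu E f r c = dg b r c" by blast
    show "(\<Sum>i\<in>UNIV. \<Sum>k = 1..d i. a i k) = 0 \<and> (\<forall>K \<in> Shat Q d. (\<Sum>i\<in>UNIV. \<Sum>k\<in>K i. a i k) \<ge> 0)"
    proof (intro conjI ballI)
      have "complex_of_real (\<Sum>r\<in>E. b r) = (\<Sum>r\<in>E. mu E f r r)" using f(2) by (simp add: dg_def)
      also have "\<dots> = 0" by (rule trace_mu) (use E in auto)
      finally show "(\<Sum>i\<in>UNIV. \<Sum>k = 1..d i. a i k) = 0" unfolding sum_all using of_real_eq_0_iff by blast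
    next
      fix K assume "K \<in> Shat Q d"
      then have K: "sub_box K d" "Sh E (Sigma UNIV K)" unfolding Shat_idx_iff E_def by auto
      show "(\<Sum>i\<in>UNIV. \<Sum>k\<in>K i. a i k) \<ge> 0" unfolding sumb[OF K(1)]
        by (rule necessity[OF E supp_rep_rep[OF f(1)] _ mono K(2)]) (simp add: f(2) dg_def)
    qed
  next
    assume h: "(\<Sum>i\<in>UNIV. \<Sum>k = 1..d i. a i k) = 0 \<and> (\<forall>K \<in> Shat Q d. (\<Sum>i\<in>UNIV. \<Sum>k\<in>K i. a i k) \<ge> 0)"
    show "\<exists>f. supp_rep E f \<and> (\<forall>r\<in>E. \<forall>c\<in>E. mu E f r c = dg b r c)"
    proof (rule sufficiency[OF E mono])
      show "(\<Sum>r\<in>E. b r) = 0" using h unfolding sum_all by blast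
      fix K assume S: "Sh E K"
      define L where "L i = {k. (i,k) \<in> K}" for i
      have KL: "Sigma UNIV L = K" by (auto simp: L_def)
      have "K \<subseteq> idx d" using Sh_subset[OF S] by (simp add: E_def)
      then have L: "sub_box L d" by (auto simp: sub_box_def L_def idx_def)
      then have "L \<in> Shat Q d" unfolding Shat_idx_iff KL using S by (simp add: E_def)
      then have "(\<Sum>i\<in>UNIV. \<Sum>k\<in>L i. a i k) \<ge> 0" using h by blast
      then show "(\<Sum>r\<in>K. b r) \<ge> 0" unfolding sumb[OF L] KL .
    qed
  qed
  finally show ?thesis .
qed

end
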